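(* Let $G_k$ ($k\in\mathbb N$) be finitely generated groups with non-trivial actions on simplicial trees $S_k$, and let $(\phi_k,f_k)$ be epimorphisms from the action of $G_k$ on $S_k$ to the action of $G_{k+1}$ on $S_{k+1}$. Assume that $(\phi_k,f_k)$ does not increase edge stabilizers in the following sense: for all $k$, $$\forall e\in E(S_k),\ \forall e'\in E(S_{k+1}),\quad e'\subset f_k(e)\ \Rightarrow\ G_{k+1}(e')=\phi_k(G_k(e)).$$ Then the direct limit $\varinjlim G_k$ has a non-trivial splitting over the image of an edge stabilizer of some $S_k$.
   Context: Actions on simplicial trees are simplicial and without inversion; an action is trivial if the group has a global fixed point. $E(S)$ is the set of edges of $S$ and $G(e)$ is the stabilizer of the edge $e$ in $G$. An epimorphism $(\phi_k,f_k)$ consists of a surjective group morphism $\phi_k:G_k\to G_{k+1}$ and a surjective continuous $\phi_k$-equivariant map $f_k:S_k\to S_{k+1}$ sending each edge to a (maybe degenerate) edge path. The direct limit is taken along the maps $\phi_k$. A group $G$ has a non-trivial splitting over $C$ if $G$ is a non-trivial amalgam $A*_CB$ ($A\neq C\neq B$) or an HNN extension $A*_C$. The image of a subgroup of $G_k$ means its image under the natural map $G_k\to\varinjlim G_k$. *)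

theory Defs
  imports "HOL-Analysis.Analysis" "HOL-Algebra.Group_Action" "HOL-Algebra.Generated_Groups"
begin

section \<open>Simplicial trees\<close>

text \<open>Edges are unoriented, i.e. two-element sets of vertices; a tree has neither loops nor
  multiple edges, so nothing is lost.\<close>

record 'v graph =
  verts :: "'v set"
  edges :: "'v set set"

definition walk :: "'v graph \<Rightarrow> 'v list \<Rightarrow> bool" where
  "walk T ws \<longleftrightarrow> ws \<noteq> [] \<and> set ws \<subseteq> verts T \<and> successively (\<lambda>u v. {u, v} \<in> edges T) ws"

definition circuit :: "'v graph \<Rightarrow> 'v list \<Rightarrow> bool" where
  "circuit T ws \<longleftrightarrow> walk T ws \<and> 3 \<le> length ws \<and> distinct ws \<and> {last ws, hd ws} \<in> edges T"

definition simplicial_tree :: "'v graph \<Rightarrow> bool" where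
  "simplicial_tree T \<longleftrightarrow>
     verts T \<noteq> {} \<and>
     edges T \<subseteq> {{u, v} | u v. u \<in> verts T \<and> v \<in> verts T \<and> u \<noteq> v} \<and>
     (\<forall>u\<in>verts T. \<forall>v\<in>verts T. \<exists>ws. walk T ws \<and> hd ws = u \<and> last ws = v) \<and>
     (\<nexists>ws. circuit T ws)"

section \<open>Geometric realization\<close>

text \<open>Points are given by their barycentric coordinates.\<close>

definition closed_simplex :: "'v set \<Rightarrow> ('v \<Rightarrow> real) set" where
  "closed_simplex \<sigma> = {x. (\<forall>w. 0 \<le> x w) \<and> (\<forall>w. w \<notin> \<sigma> \<longrightarrow> x w = 0) \<and> sum x \<sigma> = 1}"

definition simplices :: "'v graph \<Rightarrow> 'v set set" where
  "simplices T = (\<lambda>v. {v}) ` verts T \<union> edges T"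

definition realization :: "'v graph \<Rightarrow> ('v \<Rightarrow> real) set" where
  "realization T = \<Union> (closed_simplex ` simplices T)"

text \<open>The usual (weak) topology of a simplicial complex. Each closed simplex carries the subspace
  topology of the product topology on functions, which is its Euclidean topology. For maps
  sending edges to edge paths, continuity for the path metrics implies continuity for the weak
  topologies.\<close>

definition weak_open :: "'v graph \<Rightarrow> ('v \<Rightarrow> real) set \<Rightarrow> bool" where
  "weak_open T U \<longleftrightarrow> U \<subseteq> realization T \<and>
     (\<forall>\<sigma>\<in>simplices T. openin (top_of_set (closed_simplex \<sigma>)) (U \<inter> closed_simplex \<sigma>))"

definition tree_topology :: "'v graph \<Rightarrow> ('v \<Rightarrow> real) topology" where
  "tree_topology T = topology (weak_open T)"

lemma istopology_weak_open: "istopology (weak_open T)"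
  unfolding istopology_def
proof (intro conjI allI impI)
  fix U V assume "weak_open T U" "weak_open T V"
  moreover have "U \<inter> V \<inter> X = (U \<inter> X) \<inter> (V \<inter> X)" for X by blast
  ultimately show "weak_open T (U \<inter> V)"
    unfolding weak_open_def by (metis inf.coboundedI1 openin_Int)
next
  fix K assume K: "\<forall>U\<in>K. weak_open T U"
  have "openin (top_of_set (closed_simplex \<sigma>)) (\<Union>K \<inter> closed_simplex \<sigma>)"
    if "\<sigma> \<in> simplices T" for \<sigma>
  proof -
    have "\<Union>K \<inter> closed_simplex \<sigma> = \<Union> ((\<lambda>U. U \<inter> closed_simplex \<sigma>) ` K)" by blast
    moreover have "openin (top_of_set (closed_simplex \<sigma>)) (\<Union> ((\<lambda>U. U \<inter> closed_simplex \<sigma>) ` K))"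
      using K that by (intro openin_Union) (auto simp: weak_open_def)
    ultimately show ?thesis by simp
  qed
  then show "weak_open T (\<Union>K)" using K by (auto simp: weak_open_def)
qed

lemma openin_tree_topology: "openin (tree_topology T) = weak_open T"
  by (simp add: tree_topology_def istopology_weak_open topology_inverse')

text \<open>The point at parameter \<open>t\<close> of the segment from \<open>u\<close> to \<open>v\<close>, and the point at parameter \<open>s\<close>
  (\<open>0 \<le> s \<le> length ws - 1\<close>) of the path running through \<open>ws\<close> with unit speed. At the right end
  \<open>s = length ws - 1\<close> the out-of-range entry of \<open>ws\<close> has coefficient \<open>0\<close>.\<close>

definition edge_point :: "'v \<Rightarrow> 'v \<Rightarrow> real \<Rightarrow> 'v \<Rightarrow> real" where
  "edge_point u v t = (\<lambda>w. (1 - t) * of_bool (w = u) + t * of_bool (w = v))"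

definition walk_point :: "'v list \<Rightarrow> real \<Rightarrow> 'v \<Rightarrow> real" where
  "walk_point ws s = edge_point (ws ! nat \<lfloor>s\<rfloor>) (ws ! Suc (nat \<lfloor>s\<rfloor>)) (frac s)"

text \<open>\<open>f\<close> restricted to the edge \<open>e\<close> is, up to reparametrization, an edge path of \<open>T'\<close>. The path is
  degenerate (constant at a vertex) if \<open>length ws = 1\<close>; it may backtrack.\<close>

definition sends_to_edge_path ::
    "'w graph \<Rightarrow> (('v \<Rightarrow> real) \<Rightarrow> ('w \<Rightarrow> real)) \<Rightarrow> 'v set \<Rightarrow> bool" where
  "sends_to_edge_path T' f e \<longleftrightarrow>
     (\<exists>u v ws h. e = {u, v} \<and> walk T' ws \<and>
        continuous_on {0..1} h \<and> mono_on {0..1} h \<and> h 0 = 0 \<and> h 1 = real (length ws - 1) \<and>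
        (\<forall>t\<in>{0..1}. f (edge_point u v t) = walk_point ws (h t)))"

section \<open>Actions on trees\<close>

definition finitely_generated :: "('a, 'b) monoid_scheme \<Rightarrow> bool" where
  "finitely_generated G \<longleftrightarrow> (\<exists>X. finite X \<and> X \<subseteq> carrier G \<and> generate G X = carrier G)"

definition tree_action ::
    "('a, 'b) monoid_scheme \<Rightarrow> 'v graph \<Rightarrow> ('a \<Rightarrow> 'v \<Rightarrow> 'v) \<Rightarrow> bool" where
  "tree_action G T \<alpha> \<longleftrightarrow>
     simplicial_tree T \<and>
     group_action G (verts T) \<alpha> \<and>
     (\<forall>g\<in>carrier G. \<forall>e\<in>edges T. \<alpha> g ` e \<in> edges T) \<and>
     (\<forall>g\<in>carrier G. \<forall>u v. {u, v} \<in> edges T \<longrightarrow> \<not> (\<alpha> g u = v \<and> \<alpha> g v = u))"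

definition edge_stabilizer ::
    "('a, 'b) monoid_scheme \<Rightarrow> ('a \<Rightarrow> 'v \<Rightarrow> 'v) \<Rightarrow> 'v set \<Rightarrow> 'a set" where
  "edge_stabilizer G \<alpha> e = stabilizer G (\<lambda>g. (`) (\<alpha> g)) e"

text \<open>The induced action on the realization, \<open>(g x)(w) = x(g\<^sup>-\<^sup>1 w)\<close>.\<close>

definition point_action ::
    "('a, 'b) monoid_scheme \<Rightarrow> 'v graph \<Rightarrow> ('a \<Rightarrow> 'v \<Rightarrow> 'v) \<Rightarrow> 'a \<Rightarrow> ('v \<Rightarrow> real) \<Rightarrow> ('v \<Rightarrow> real)" where
  "point_action G T \<alpha> g x = (\<lambda>w. if w \<in> verts T then x (\<alpha> (inv\<^bsub>G\<^esub> g) w) else 0)"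

definition trivial_action ::
    "('a, 'b) monoid_scheme \<Rightarrow> 'v graph \<Rightarrow> ('a \<Rightarrow> 'v \<Rightarrow> 'v) \<Rightarrow> bool" where
  "trivial_action G T \<alpha> \<longleftrightarrow>
     (\<exists>x\<in>realization T. \<forall>g\<in>carrier G. point_action G T \<alpha> g x = x)"

definition action_epimorphism ::
    "('a, 'c) monoid_scheme \<Rightarrow> 'v graph \<Rightarrow> ('a \<Rightarrow> 'v \<Rightarrow> 'v) \<Rightarrow>
     ('b, 'd) monoid_scheme \<Rightarrow> 'w graph \<Rightarrow> ('b \<Rightarrow> 'w \<Rightarrow> 'w) \<Rightarrow>
     ('a \<Rightarrow> 'b) \<Rightarrow> (('v \<Rightarrow> real) \<Rightarrow> ('w \<Rightarrow> real)) \<Rightarrow> bool" where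
  "action_epimorphism G T \<alpha> G' T' \<alpha>' \<phi> f \<longleftrightarrow>
     \<phi> \<in> epi G G' \<and>
     continuous_map (tree_topology T) (tree_topology T') f \<and>
     f ` realization T = realization T' \<and>
     (\<forall>g\<in>carrier G. \<forall>x\<in>realization T.
        f (point_action G T \<alpha> g x) = point_action G' T' \<alpha>' (\<phi> g) (f x)) \<and>
     (\<forall>e\<in>edges T. sends_to_edge_path T' f e)"

section \<open>Direct limit of a sequence of groups\<close>

text \<open>\<open>transition \<phi> k m\<close> is the composite \<open>G k \<rightarrow> G m\<close>, used for \<open>k \<le> m\<close>.\<close>

primrec iterated_map :: "(nat \<Rightarrow> 'a \<Rightarrow> 'a) \<Rightarrow> nat \<Rightarrow> nat \<Rightarrow> 'a \<Rightarrow> 'a" where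
  "iterated_map \<phi> k 0 = id"
| "iterated_map \<phi> k (Suc n) = \<phi> (k + n) \<circ> iterated_map \<phi> k n"

definition transition :: "(nat \<Rightarrow> 'a \<Rightarrow> 'a) \<Rightarrow> nat \<Rightarrow> nat \<Rightarrow> 'a \<Rightarrow> 'a" where
  "transition \<phi> k m = iterated_map \<phi> k (m - k)"

definition limit_rel ::
    "(nat \<Rightarrow> ('a, 'b) monoid_scheme) \<Rightarrow> (nat \<Rightarrow> 'a \<Rightarrow> 'a) \<Rightarrow> ((nat \<times> 'a) \<times> (nat \<times> 'a)) set" where
  "limit_rel G \<phi> = {((k, g), (l, h)). g \<in> carrier (G k) \<and> h \<in> carrier (G l) \<and>
     (\<exists>m. k \<le> m \<and> l \<le> m \<and> transition \<phi> k m g = transition \<phi> l m h)}"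

definition limit_map ::
    "(nat \<Rightarrow> ('a, 'b) monoid_scheme) \<Rightarrow> (nat \<Rightarrow> 'a \<Rightarrow> 'a) \<Rightarrow> nat \<Rightarrow> 'a \<Rightarrow> (nat \<times> 'a) set" where
  "limit_map G \<phi> k g = limit_rel G \<phi> `` {(k, g)}"

definition direct_limit ::
    "(nat \<Rightarrow> ('a, 'b) monoid_scheme) \<Rightarrow> (nat \<Rightarrow> 'a \<Rightarrow> 'a) \<Rightarrow> (nat \<times> 'a) set monoid" where
  "direct_limit G \<phi> =
     \<lparr>carrier = (SIGMA k:UNIV. carrier (G k)) // limit_rel G \<phi>,
      monoid.mult = (\<lambda>X Y. \<Union>(k, g)\<in>X. \<Union>(l, h)\<in>Y.
        limit_map G \<phi> (max k l)
          (transition \<phi> k (max k l) g \<otimes>\<^bsub>G (max k l)\<^esub> transition \<phi> l (max k l) h)),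
      one = limit_map G \<phi> 0 \<one>\<^bsub>G 0\<^esub>\<rparr>"

section \<open>Amalgams and HNN extensions\<close>

text \<open>Words over the alphabet \<open>X\<close> modulo the congruence generated by the relations \<open>R\<close>. This is the
  group presented by \<open>\<langle>X | R\<rangle>\<close> as soon as \<open>R\<close> makes every letter invertible, as it does below.\<close>

definition word_step :: "('x list \<Rightarrow> 'x list \<Rightarrow> bool) \<Rightarrow> 'x list \<Rightarrow> 'x list \<Rightarrow> bool" where
  "word_step R x y \<longleftrightarrow> (\<exists>p s u v. R u v \<and> x = p @ u @ s \<and> y = p @ v @ s)"

definition word_rel :: "'x set \<Rightarrow> ('x list \<Rightarrow> 'x list \<Rightarrow> bool) \<Rightarrow> ('x list \<times> 'x list) set" where
  "word_rel X R = {(x, y). x \<in> lists X \<and> y \<in> lists X \<and> equivclp (word_step R) x y}"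

definition word_class :: "'x set \<Rightarrow> ('x list \<Rightarrow> 'x list \<Rightarrow> bool) \<Rightarrow> 'x list \<Rightarrow> 'x list set" where
  "word_class X R x = word_rel X R `` {x}"

definition word_group :: "'x set \<Rightarrow> ('x list \<Rightarrow> 'x list \<Rightarrow> bool) \<Rightarrow> 'x list set monoid" where
  "word_group X R =
     \<lparr>carrier = lists X // word_rel X R,
      monoid.mult = (\<lambda>U V. \<Union>u\<in>U. \<Union>v\<in>V. word_class X R (u @ v)),
      one = word_class X R []\<rparr>"

text \<open>The amalgam \<open>A *\<^sub>C B\<close> of two groups with a common subgroup \<open>C\<close>.\<close>

inductive amalgam_relator ::
    "('a, 'c) monoid_scheme \<Rightarrow> ('a, 'd) monoid_scheme \<Rightarrow> 'a set \<Rightarrow>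
     ('a + 'a) list \<Rightarrow> ('a + 'a) list \<Rightarrow> bool"
  for A :: "('a, 'c) monoid_scheme" and B :: "('a, 'd) monoid_scheme" and C :: "'a set" where
  one_left: "amalgam_relator A B C [Inl \<one>\<^bsub>A\<^esub>] []"
| one_right: "amalgam_relator A B C [Inr \<one>\<^bsub>B\<^esub>] []"
| mult_left: "a \<in> carrier A \<Longrightarrow> a' \<in> carrier A \<Longrightarrow>
    amalgam_relator A B C [Inl a, Inl a'] [Inl (a \<otimes>\<^bsub>A\<^esub> a')]"
| mult_right: "b \<in> carrier B \<Longrightarrow> b' \<in> carrier B \<Longrightarrow>
    amalgam_relator A B C [Inr b, Inr b'] [Inr (b \<otimes>\<^bsub>B\<^esub> b')]"
| glue: "c \<in> C \<Longrightarrow> amalgam_relator A B C [Inl c] [Inr c]"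

definition amalgam_letters ::
    "('a, 'c) monoid_scheme \<Rightarrow> ('a, 'd) monoid_scheme \<Rightarrow> ('a + 'a) set" where
  "amalgam_letters A B = carrier A <+> carrier B"

definition amalgam ::
    "('a, 'c) monoid_scheme \<Rightarrow> ('a, 'd) monoid_scheme \<Rightarrow> 'a set \<Rightarrow> ('a + 'a) list set monoid" where
  "amalgam A B C = word_group (amalgam_letters A B) (amalgam_relator A B C)"

definition amalgam_class ::
    "('a, 'c) monoid_scheme \<Rightarrow> ('a, 'd) monoid_scheme \<Rightarrow> 'a set \<Rightarrow>
     ('a + 'a) list \<Rightarrow> ('a + 'a) list set" where
  "amalgam_class A B C = word_class (amalgam_letters A B) (amalgam_relator A B C)"

text \<open>The HNN extension \<open>A *\<^sub>C = \<langle>A, t | t c t\<^sup>-\<^sup>1 = \<theta> c (c \<in> C)\<rangle>\<close> for a monomorphism \<open>\<theta> : C \<rightarrow> A\<close>.\<close>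

datatype 'a hnn_letter = Base 'a | Stable | StableInv

inductive hnn_relator ::
    "('a, 'c) monoid_scheme \<Rightarrow> 'a set \<Rightarrow> ('a \<Rightarrow> 'a) \<Rightarrow>
     'a hnn_letter list \<Rightarrow> 'a hnn_letter list \<Rightarrow> bool"
  for A :: "('a, 'c) monoid_scheme" and C :: "'a set" and \<theta> :: "'a \<Rightarrow> 'a" where
  one_base: "hnn_relator A C \<theta> [Base \<one>\<^bsub>A\<^esub>] []"
| mult_base: "a \<in> carrier A \<Longrightarrow> a' \<in> carrier A \<Longrightarrow>
    hnn_relator A C \<theta> [Base a, Base a'] [Base (a \<otimes>\<^bsub>A\<^esub> a')]"
| stable_right: "hnn_relator A C \<theta> [Stable, StableInv] []"
| stable_left: "hnn_relator A C \<theta> [StableInv, Stable] []"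
| conjugate: "c \<in> C \<Longrightarrow> hnn_relator A C \<theta> [Stable, Base c, StableInv] [Base (\<theta> c)]"

definition hnn_letters :: "('a, 'c) monoid_scheme \<Rightarrow> 'a hnn_letter set" where
  "hnn_letters A = Base ` carrier A \<union> {Stable, StableInv}"

definition hnn_extension ::
    "('a, 'c) monoid_scheme \<Rightarrow> 'a set \<Rightarrow> ('a \<Rightarrow> 'a) \<Rightarrow> 'a hnn_letter list set monoid" where
  "hnn_extension A C \<theta> = word_group (hnn_letters A) (hnn_relator A C \<theta>)"

definition hnn_class ::
    "('a, 'c) monoid_scheme \<Rightarrow> 'a set \<Rightarrow> ('a \<Rightarrow> 'a) \<Rightarrow>
     'a hnn_letter list \<Rightarrow> 'a hnn_letter list set" where
  "hnn_class A C \<theta> = word_class (hnn_letters A) (hnn_relator A C \<theta>)"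

text \<open>The factors embed in an amalgam and the base group embeds in an HNN extension, so they can be
  taken to be subgroups of \<open>G\<close>. The isomorphisms are required to be the identity on these subgroups,
  so that the edge group is the given subgroup \<open>C\<close> of \<open>G\<close> itself, not just an isomorphic copy.\<close>

definition splits_as_amalgam :: "('a, 'b) monoid_scheme \<Rightarrow> 'a set \<Rightarrow> 'a set \<Rightarrow> 'a set \<Rightarrow> bool" where
  "splits_as_amalgam G A B C \<longleftrightarrow>
     subgroup A G \<and> subgroup B G \<and> subgroup C G \<and> C \<subseteq> A \<and> C \<subseteq> B \<and>
     (let A' = G\<lparr>carrier := A\<rparr>; B' = G\<lparr>carrier := B\<rparr> in
      \<exists>h\<in>iso (amalgam A' B' C) G.
        (\<forall>a\<in>A. h (amalgam_class A' B' C [Inl a]) = a) \<and>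
        (\<forall>b\<in>B. h (amalgam_class A' B' C [Inr b]) = b))"

definition splits_as_hnn :: "('a, 'b) monoid_scheme \<Rightarrow> 'a set \<Rightarrow> 'a set \<Rightarrow> ('a \<Rightarrow> 'a) \<Rightarrow> bool" where
  "splits_as_hnn G A C \<theta> \<longleftrightarrow>
     subgroup A G \<and> subgroup C G \<and> C \<subseteq> A \<and>
     (let A' = G\<lparr>carrier := A\<rparr>; C' = G\<lparr>carrier := C\<rparr> in
      \<theta> \<in> mon C' A' \<and>
      (\<exists>h\<in>iso (hnn_extension A' C \<theta>) G. \<forall>a\<in>A. h (hnn_class A' C \<theta> [Base a]) = a))"

definition nontrivial_splitting_over :: "('a, 'b) monoid_scheme \<Rightarrow> 'a set \<Rightarrow> bool" where
  "nontrivial_splitting_over G C \<longleftrightarrow>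
     (\<exists>A B. splits_as_amalgam G A B C \<and> A \<noteq> C \<and> C \<noteq> B) \<or>
     (\<exists>A \<theta>. splits_as_hnn G A C \<theta>)"

end

theory Submission
  imports Defs
begin

text \<open>
  The idea is to find a tree on which the direct limit acts without a fixed vertex, and whose edge
  stabilizers are the images of edge stabilizers of one \<open>S k\<close>. Bass-Serre theory for one orbit of edges then
  gives the splitting. The tree is a quotient of an invariant subtree \<open>Y\<close> of \<open>S k\<close> by the kernel of
  the map from \<open>G k\<close> to the limit. In general such a quotient is not a tree. What makes it
  one is the choice of \<open>Y\<close> by means of a complexity. Quotients of graphs are understood without multiple
  edges, and loops are dropped.

  As \<open>G k\<close> is finitely generated, \<open>S k\<close> contains invariant subtrees with finitely many orbits of edges
  (\<open>cofinite_subtree_exists\<close>). The complexity of \<open>Y\<close> is the pair, ordered lexicographically, of the defect,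
  which is minus twice the Euler characteristic of the graph of orbits, and the number of orbits of
  big vertices, that is of vertices whose stabilizer moves an incident edge. The defect is at least
  \<open>-2\<close>, as the graph of orbits is connected. Hence there is a pair \<open>(k, Y)\<close> of minimal complexity among all
  levels \<open>k\<close> and all cofinite subtrees.

  For \<open>m \<ge> k\<close> let \<open>N\<close> be the kernel of the map from \<open>G k\<close> to \<open>G m\<close>. The composite map from \<open>Y\<close> to \<open>S m\<close>
  becomes simplicial after subdividing \<open>Y\<close>, and the induced map of the quotient by \<open>N\<close> is a sequence of
  folds of \<open>G m\<close>-graphs, ending in the hull of the image. The hypothesis on edge stabilizers passes
  to all stages of the sequence. It rules out that two edges of one orbit are folded, since such a fold
  would increase the stabilizer of this edge. So every fold loses an edge orbit, and it loses at most one
  vertex orbit: the defect does not increase. If it is constant, two vertex orbits are merged. If both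
  are big, the number of big orbits decreases. If one of them is small, the fold can be controlled well enough to
  see that the graph before the fold is a tree if the graph after the fold is one. At the end of the
  sequence there is a tree. Consequently (\<open>folding\<close>, \<open>complexity_compare\<close>) the image of \<open>Y\<close> in \<open>S m\<close> has at most
  the complexity of \<open>Y\<close>, and if it has the same complexity, the quotient of \<open>Y\<close> by \<open>N\<close> is a
  tree. By minimality this is the case for all \<open>m\<close>. The quotient by the increasing union of the
  kernels is then a tree as well (\<open>quotient_tree\<close>), with the expected edge stabilizers
  (\<open>quotient_stabilizer\<close>). There is no fixed vertex, because by finite generation
  there would already be one at a finite level (\<open>no_fix_limit\<close>).

  All trees, apart from the given ones, are described by cuts: a connected graph is a tree if for each edge there
  is a function to \<open>bool\<close> that changes its value across this edge only. Such functions can be transported through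
  quotients, folds and limits without any discussion of paths and circuits.
\<close>

section \<open>Counting orbits\<close>

text \<open>The counting device of all comparisons below: a map onto \<open>B\<close> that respects the relations
  induces a surjection of the classes. The relations may live on larger sets \<open>D\<close> and \<open>D'\<close>.\<close>

lemma quotient_card_surj:
  assumes "finite (A // r)" "equiv D r" "A \<subseteq> D" "equiv D' s" "B \<subseteq> D'" "B \<subseteq> f ` A"
    and resp: "\<And>x y. x \<in> A \<Longrightarrow> y \<in> A \<Longrightarrow> (x, y) \<in> r \<Longrightarrow> f x \<in> B \<Longrightarrow> f y \<in> B \<Longrightarrow> (f x, f y) \<in> s"
  shows "finite (B // s)" "card (B // s) \<le> card (A // r)"
proof -
  let ?g = "\<lambda>C. s `` {f (SOME x. x \<in> C \<and> x \<in> A \<and> f x \<in> B)}"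
  have sub: "B // s \<subseteq> ?g ` (A // r)"
  proof
    fix Z assume "Z \<in> B // s"
    then obtain b where b: "b \<in> B" "Z = s `` {b}" by (auto simp: quotient_def)
    then obtain a where a: "a \<in> A" "b = f a" using assms(6) by auto
    have "a \<in> r `` {a}" using a assms(2,3) by (meson equiv_class_self subset_iff)
    hence ex: "\<exists>x. x \<in> r `` {a} \<and> x \<in> A \<and> f x \<in> B" using a b by auto
    define x where "x = (SOME x. x \<in> r `` {a} \<and> x \<in> A \<and> f x \<in> B)"
    have x: "x \<in> r `` {a}" "x \<in> A" "f x \<in> B" using someI_ex[OF ex] unfolding x_def by auto
    have "(f a, f x) \<in> s" using resp x a b by auto
    hence "Z = ?g (r `` {a})"
      using b a equiv_class_eq[OF assms(4)] unfolding x_def by auto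
    moreover have "r `` {a} \<in> A // r" using a by (auto intro: quotientI)
    ultimately show "Z \<in> ?g ` (A // r)" by blast
  qed
  show "finite (B // s)" using sub assms(1) finite_surj by blast
  show "card (B // s) \<le> card (A // r)" using sub assms(1) by (rule surj_card_le[rotated])
qed

lemma quotient_Un: "(A \<union> B) // r = A // r \<union> B // r"
  by (auto simp: quotient_def)

lemma quotient_disjoint:
  assumes "equiv D r" "A \<subseteq> D" "B \<subseteq> D" "\<And>x y. x \<in> A \<Longrightarrow> y \<in> B \<Longrightarrow> (x, y) \<notin> r"
  shows "A // r \<inter> B // r = {}"
proof (rule ccontr)
  assume "A // r \<inter> B // r \<noteq> {}"
  then obtain a b where "a \<in> A" "b \<in> B" "r `` {a} = r `` {b}" by (auto simp: quotient_def)
  thus False using assms eq_equiv_class_iff[OF assms(1)] by blast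
qed

text \<open>Unlike \<open>group_action\<close>, this asks nothing of \<open>act\<close> outside of \<open>V\<close>, so that one function acts on
  all invariant subsets.\<close>

locale gact = group \<Gamma> for \<Gamma> :: "'g monoid" (structure) +
  fixes V :: "'x set" and act :: "'g \<Rightarrow> 'x \<Rightarrow> 'x"
  assumes act_closed: "g \<in> carrier \<Gamma> \<Longrightarrow> x \<in> V \<Longrightarrow> act g x \<in> V"
    and act_one: "x \<in> V \<Longrightarrow> act \<one> x = x"
    and act_mult: "g \<in> carrier \<Gamma> \<Longrightarrow> h \<in> carrier \<Gamma> \<Longrightarrow> x \<in> V \<Longrightarrow> act (g \<otimes> h) x = act g (act h x)"
begin

lemma act_inv1: "g \<in> carrier \<Gamma> \<Longrightarrow> x \<in> V \<Longrightarrow> act (inv g) (act g x) = x"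
  by (metis act_mult act_one inv_closed l_inv)

lemma act_inv2: "g \<in> carrier \<Gamma> \<Longrightarrow> x \<in> V \<Longrightarrow> act g (act (inv g) x) = x"
  by (metis act_mult act_one inv_closed r_inv)

lemma act_inj: "g \<in> carrier \<Gamma> \<Longrightarrow> x \<in> V \<Longrightarrow> y \<in> V \<Longrightarrow> act g x = act g y \<longleftrightarrow> x = y"
  by (metis act_inv1)

lemma gact_subset: "U \<subseteq> V \<Longrightarrow> (\<And>g x. g \<in> carrier \<Gamma> \<Longrightarrow> x \<in> U \<Longrightarrow> act g x \<in> U) \<Longrightarrow> gact \<Gamma> U act"
  by unfold_locales (auto simp: act_one act_mult subset_iff)

end

text \<open>For counting and folding, a graph is not divided by an invariant equivalence relation \<open>R\<close>.
  Instead all notions take \<open>R\<close> as a parameter and refer to the quotient; this one describes the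
  orbits of \<open>\<Gamma>\<close> on \<open>V/R\<close>.\<close>

definition orb_rel :: "'g monoid \<Rightarrow> ('g \<Rightarrow> 'x \<Rightarrow> 'x) \<Rightarrow> 'x set \<Rightarrow> ('x \<times> 'x) set \<Rightarrow> ('x \<times> 'x) set" where
  "orb_rel \<Gamma> act V R = {(x, y). x \<in> V \<and> y \<in> V \<and> (\<exists>g\<in>carrier \<Gamma>. (act g x, y) \<in> R)}"

definition invariant_rel :: "'g monoid \<Rightarrow> ('g \<Rightarrow> 'x \<Rightarrow> 'x) \<Rightarrow> ('x \<times> 'x) set \<Rightarrow> bool" where
  "invariant_rel \<Gamma> act R \<longleftrightarrow> (\<forall>g\<in>carrier \<Gamma>. \<forall>(x, y)\<in>R. (act g x, act g y) \<in> R)"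

lemma invariant_relD: "invariant_rel \<Gamma> act R \<Longrightarrow> g \<in> carrier \<Gamma> \<Longrightarrow> (x, y) \<in> R \<Longrightarrow> (act g x, act g y) \<in> R"
  by (auto simp: invariant_rel_def)

lemma (in gact) equiv_orb_rel:
  assumes R: "equiv V R" and inv: "invariant_rel \<Gamma> act R"
  shows "equiv V (orb_rel \<Gamma> act V R)"
proof (rule equivI)
  show "refl_on V (orb_rel \<Gamma> act V R)"
    using R act_one by (auto simp: refl_on_def orb_rel_def equiv_def intro!: bexI[of _ \<one>])
  show "orb_rel \<Gamma> act V R \<subseteq> V \<times> V" by (auto simp: orb_rel_def)
  have symR: "(x, y) \<in> R \<Longrightarrow> (y, x) \<in> R" for x y using R by (auto simp: equiv_def sym_def)
  have trR: "(x, y) \<in> R \<Longrightarrow> (y, z) \<in> R \<Longrightarrow> (x, z) \<in> R" for x y z using R by (auto simp: equiv_def dest: transD)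
  show "sym (orb_rel \<Gamma> act V R)"
  proof (rule symI)
    fix x y assume "(x, y) \<in> orb_rel \<Gamma> act V R"
    then obtain g where g: "x \<in> V" "y \<in> V" "g \<in> carrier \<Gamma>" "(act g x, y) \<in> R" by (auto simp: orb_rel_def)
    hence "(act (inv g) (act g x), act (inv g) y) \<in> R" using invariant_relD[OF inv] by auto
    hence "(act (inv g) y, x) \<in> R" using g symR by (simp add: act_inv1)
    thus "(y, x) \<in> orb_rel \<Gamma> act V R" using g by (auto simp: orb_rel_def)
  qed
  show "trans (orb_rel \<Gamma> act V R)"
  proof (rule transI)
    fix x y z assume "(x, y) \<in> orb_rel \<Gamma> act V R" "(y, z) \<in> orb_rel \<Gamma> act V R"
    then obtain g h where g: "x \<in> V" "y \<in> V" "z \<in> V" "g \<in> carrier \<Gamma>" "(act g x, y) \<in> R" "h \<in> carrier \<Gamma>" "(act h y, z) \<in> R"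
      by (auto simp: orb_rel_def)
    hence "(act h (act g x), z) \<in> R" using invariant_relD[OF inv, of h] trR by blast
    thus "(x, z) \<in> orb_rel \<Gamma> act V R" using g act_mult
      by (auto simp: orb_rel_def intro!: bexI[of _ "h \<otimes> g"])
  qed
qed

definition pair_act :: "('g \<Rightarrow> 'x \<Rightarrow> 'x) \<Rightarrow> 'g \<Rightarrow> 'x \<times> 'x \<Rightarrow> 'x \<times> 'x" where
  "pair_act act g = map_prod (act g) (act g)"

definition pair_rel :: "('x \<times> 'x) set \<Rightarrow> (('x \<times> 'x) \<times> ('x \<times> 'x)) set" where
  "pair_rel R = {((a, b), (c, d)). (a, c) \<in> R \<and> (b, d) \<in> R}"

lemma pair_act_simp [simp]: "pair_act act g (a, b) = (act g a, act g b)"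
  by (simp add: pair_act_def)

lemma pair_rel_iff [simp]: "((a, b), (c, d)) \<in> pair_rel R \<longleftrightarrow> (a, c) \<in> R \<and> (b, d) \<in> R"
  by (simp add: pair_rel_def)

text \<open>Orbits of oriented edges of the quotient graph. Two edges are identified if their ends are, so
  the quotient has no multiple edges.\<close>

definition edge_orb_rel :: "'g monoid \<Rightarrow> ('g \<Rightarrow> 'x \<Rightarrow> 'x) \<Rightarrow> ('x \<times> 'x) set \<Rightarrow> ('x \<times> 'x) set \<Rightarrow> (('x \<times> 'x) \<times> ('x \<times> 'x)) set" where
  "edge_orb_rel \<Gamma> act E R = orb_rel \<Gamma> (pair_act act) E (pair_rel R \<inter> E \<times> E)"

lemma (in gact) gact_edges:
  assumes "E \<subseteq> V \<times> V" "invariant_rel \<Gamma> act E"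
  shows "gact \<Gamma> E (pair_act act)"
  using assms by unfold_locales (auto simp: act_one act_mult subset_iff dest: invariant_relD)

lemma (in gact) equiv_edge_orb_rel:
  assumes "equiv V R" "invariant_rel \<Gamma> act R" "E \<subseteq> V \<times> V" "invariant_rel \<Gamma> act E"
  shows "equiv E (edge_orb_rel \<Gamma> act E R)"
  unfolding edge_orb_rel_def
proof (rule gact.equiv_orb_rel[OF gact_edges[OF assms(3,4)]])
  have r: "\<And>x. x \<in> V \<Longrightarrow> (x, x) \<in> R" "\<And>x y. (x, y) \<in> R \<Longrightarrow> (y, x) \<in> R"
    "\<And>x y z. (x, y) \<in> R \<Longrightarrow> (y, z) \<in> R \<Longrightarrow> (x, z) \<in> R"
    using assms(1) unfolding equiv_def refl_on_def sym_def trans_def by blast+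
  show "equiv E (pair_rel R \<inter> E \<times> E)"
  proof (rule equivI)
    show "refl_on E (pair_rel R \<inter> E \<times> E)" using r(1) assms(3) by (auto simp: refl_on_def)
    show "sym (pair_rel R \<inter> E \<times> E)" using r(2) by (auto simp: sym_def)
    show "trans (pair_rel R \<inter> E \<times> E)" by (rule transI) (auto intro: r(3))
  qed auto
  show "invariant_rel \<Gamma> (pair_act act) (pair_rel R \<inter> E \<times> E)"
    using invariant_relD[OF assms(2)] invariant_relD[OF assms(4)]
    unfolding invariant_rel_def[of _ _ "pair_rel R \<inter> E \<times> E"] by auto
qed

lemma edge_orb_rel_iff:
  "((a, b), (c, d)) \<in> edge_orb_rel \<Gamma> act E R \<longleftrightarrow>
   (a, b) \<in> E \<and> (c, d) \<in> E \<and> (\<exists>g\<in>carrier \<Gamma>. (act g a, act g b) \<in> E \<and> (act g a, c) \<in> R \<and> (act g b, d) \<in> R)"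
  by (auto simp: edge_orb_rel_def orb_rel_def)

text \<open>A vertex of the quotient is big if its stabilizer moves some incident edge. Folding at a small
  vertex involves no group elements other than those that fix the edges in question; this is what
  makes such folds reversible.\<close>

definition big_verts :: "'g monoid \<Rightarrow> ('g \<Rightarrow> 'x \<Rightarrow> 'x) \<Rightarrow> 'x set \<Rightarrow> ('x \<times> 'x) set \<Rightarrow> ('x \<times> 'x) set \<Rightarrow> 'x set" where
  "big_verts \<Gamma> act V E R =
     {x\<in>V. \<exists>a b. \<exists>g\<in>carrier \<Gamma>. (a, b) \<in> E \<and> (a, x) \<in> R \<and> (act g x, x) \<in> R \<and> (act g b, b) \<notin> R}"

definition num_vert :: "'g monoid \<Rightarrow> ('g \<Rightarrow> 'x \<Rightarrow> 'x) \<Rightarrow> 'x set \<Rightarrow> ('x \<times> 'x) set \<Rightarrow> nat" where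
  "num_vert \<Gamma> act V R = card (V // orb_rel \<Gamma> act V R)"

definition num_edge :: "'g monoid \<Rightarrow> ('g \<Rightarrow> 'x \<Rightarrow> 'x) \<Rightarrow> ('x \<times> 'x) set \<Rightarrow> ('x \<times> 'x) set \<Rightarrow> nat" where
  "num_edge \<Gamma> act E R = card (E // edge_orb_rel \<Gamma> act E R)"

definition num_big :: "'g monoid \<Rightarrow> ('g \<Rightarrow> 'x \<Rightarrow> 'x) \<Rightarrow> 'x set \<Rightarrow> ('x \<times> 'x) set \<Rightarrow> ('x \<times> 'x) set \<Rightarrow> nat" where
  "num_big \<Gamma> act V E R = card (big_verts \<Gamma> act V E R // orb_rel \<Gamma> act V R)"

text \<open>Minus twice the Euler characteristic of the graph of orbits: oriented edges are counted, each
  geometric edge twice.\<close>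

definition defect :: "'g monoid \<Rightarrow> ('g \<Rightarrow> 'x \<Rightarrow> 'x) \<Rightarrow> 'x set \<Rightarrow> ('x \<times> 'x) set \<Rightarrow> ('x \<times> 'x) set \<Rightarrow> int" where
  "defect \<Gamma> act V E R = int (num_edge \<Gamma> act E R) - 2 * int (num_vert \<Gamma> act V R)"

text \<open>The indicator function of one side of the edge from \<open>x\<close> to \<open>y\<close> in the quotient by \<open>R\<close>. A
  connected graph is a tree if and only if there is such a function for each of its edges.\<close>

definition is_cut :: "('x \<times> 'x) set \<Rightarrow> ('x \<times> 'x) set \<Rightarrow> 'x \<Rightarrow> 'x \<Rightarrow> ('x \<Rightarrow> bool) \<Rightarrow> bool" where
  "is_cut E R x y c \<longleftrightarrow> (\<forall>(a, b)\<in>R. c a = c b) \<and>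
     (\<forall>(a, b)\<in>E. c a \<noteq> c b \<longleftrightarrow> (a, x) \<in> R \<and> (b, y) \<in> R \<or> (a, y) \<in> R \<and> (b, x) \<in> R)"

section \<open>Folding a graph onto a tree\<close>

text \<open>To be applied to the classes of the two folded edges and of their reversals.\<close>

lemma two_collisions:
  assumes "finite A" "a \<in> A" "b \<in> A" "c \<in> A" "d \<in> A" "distinct [a, b, c, d]" "f a = f b" "f c = f d"
  shows "card (f ` A) + 2 \<le> card A" "card (f ` A) + 2 = card A \<Longrightarrow> inj_on f (A - {b, d})"
proof -
  have "f x \<in> f ` (A - {b, d})" if "x \<in> A" for x
  proof (cases "x \<in> {b, d}")
    case True
    hence "f x = f a \<or> f x = f c" using assms(7,8) by auto
    moreover have "a \<in> A - {b, d}" "c \<in> A - {b, d}" using assms(2,4,6) by auto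
    ultimately show ?thesis by blast
  qed (use that in blast)
  hence eq: "f ` A = f ` (A - {b, d})" by blast
  have c2: "card (A - {b, d}) + 2 = card A"
    using assms card_Diff_subset[of "{b, d}" A] card_mono[of A "{b, d}"] by simp
  have "card (f ` A) \<le> card (A - {b, d})" unfolding eq using assms(1) by (simp add: card_image_le)
  thus "card (f ` A) + 2 \<le> card A" using c2 by simp
  show "inj_on f (A - {b, d})" if "card (f ` A) + 2 = card A"
    using that c2 eq assms(1) by (intro eq_card_imp_inj_on) auto
qed

lemma image_of_coarser_quotient:
  assumes "equiv D r" "equiv D s" "r \<subseteq> s" "A \<subseteq> D"
  shows "A // s = (\<lambda>C. s `` C) ` (A // r)" "\<And>x. x \<in> A \<Longrightarrow> s `` (r `` {x}) = s `` {x}"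
proof -
  show *: "s `` (r `` {x}) = s `` {x}" if "x \<in> A" for x
  proof
    show "s `` (r `` {x}) \<subseteq> s `` {x}" using assms(2,3) unfolding equiv_def trans_def by blast
    show "s `` {x} \<subseteq> s `` (r `` {x})" using assms(1,4) that unfolding equiv_def refl_on_def by blast
  qed
  show "A // s = (\<lambda>C. s `` C) ` (A // r)" using * by (auto simp: quotient_def image_UN) 
qed

text \<open>A connected graph with an equivariant map to a tree, encoded by its fibre relation \<open>Rm\<close>:
  \<open>cutm\<close> says that the quotient by \<open>Rm\<close> is a tree. The map is factored into folds starting from the
  quotient by \<open>R0\<close>. The assumption \<open>stab\<close> says that the quotient map from \<open>V/R0\<close> to \<open>V/Rm\<close> does not
  increase edge stabilizers.\<close>

locale graph_over_tree = gact \<Gamma> V act for \<Gamma> :: "'g monoid" (structure) and V :: "'x set" and act +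
  fixes E :: "('x \<times> 'x) set" and R0 Rm :: "('x \<times> 'x) set"
  assumes EV: "E \<subseteq> V \<times> V" and symE: "(x, y) \<in> E \<Longrightarrow> (y, x) \<in> E"
    and invE: "invariant_rel \<Gamma> act E"
    and connE: "x \<in> V \<Longrightarrow> y \<in> V \<Longrightarrow> (x, y) \<in> E\<^sup>*"
    and eqR0: "equiv V R0" and invR0: "invariant_rel \<Gamma> act R0"
    and eqRm: "equiv V Rm" and invRm: "invariant_rel \<Gamma> act Rm"
    and R0m: "R0 \<subseteq> Rm"
    and finV: "finite (V // orb_rel \<Gamma> act V R0)" and finE: "finite (E // edge_orb_rel \<Gamma> act E R0)"
    and noloop: "(x, y) \<in> E \<Longrightarrow> (x, y) \<notin> Rm"
    and noinv: "(x, y) \<in> E \<Longrightarrow> g \<in> carrier \<Gamma> \<Longrightarrow> (act g x, y) \<in> Rm \<Longrightarrow> (act g y, x) \<notin> Rm"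
    and stab: "(x, y) \<in> E \<Longrightarrow> g \<in> carrier \<Gamma> \<Longrightarrow> (act g x, x) \<in> Rm \<Longrightarrow> (act g y, y) \<in> Rm \<Longrightarrow>
                 (act g x, x) \<in> R0 \<and> (act g y, y) \<in> R0"
    and cutm: "(x, y) \<in> E \<Longrightarrow> \<exists>c. is_cut E Rm x y c"
begin

text \<open>The stages of a folding sequence.\<close>

definition adm :: "('x \<times> 'x) set \<Rightarrow> bool" where
  "adm R \<longleftrightarrow> equiv V R \<and> invariant_rel \<Gamma> act R \<and> R0 \<subseteq> R \<and> R \<subseteq> Rm"

abbreviation vE where "vE R \<equiv> orb_rel \<Gamma> act V R"
abbreviation eE where "eE R \<equiv> edge_orb_rel \<Gamma> act E R"

lemma EVD: "(x, y) \<in> E \<Longrightarrow> x \<in> V" "(x, y) \<in> E \<Longrightarrow> y \<in> V"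
  using EV by auto

lemma E_act: "(x, y) \<in> E \<Longrightarrow> g \<in> carrier \<Gamma> \<Longrightarrow> (act g x, act g y) \<in> E"
  using invariant_relD[OF invE] by blast

lemma adm_refl: "adm R \<Longrightarrow> x \<in> V \<Longrightarrow> (x, x) \<in> R"
  and adm_sym: "adm R \<Longrightarrow> (x, y) \<in> R \<Longrightarrow> (y, x) \<in> R"
  and adm_trans: "adm R \<Longrightarrow> (x, y) \<in> R \<Longrightarrow> (y, z) \<in> R \<Longrightarrow> (x, z) \<in> R"
  and adm_act: "adm R \<Longrightarrow> g \<in> carrier \<Gamma> \<Longrightarrow> (x, y) \<in> R \<Longrightarrow> (act g x, act g y) \<in> R"
  and adm_V: "adm R \<Longrightarrow> (x, y) \<in> R \<Longrightarrow> x \<in> V \<and> y \<in> V"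
  and adm_m: "adm R \<Longrightarrow> (x, y) \<in> R \<Longrightarrow> (x, y) \<in> Rm"
  and adm_0: "adm R \<Longrightarrow> (x, y) \<in> R0 \<Longrightarrow> (x, y) \<in> R"
proof -
  assume "adm R"
  hence *: "refl_on V R" "sym R" "trans R" "R \<subseteq> V \<times> V" "invariant_rel \<Gamma> act R" "R0 \<subseteq> R" "R \<subseteq> Rm"
    by (auto simp: adm_def equiv_def)
  show "x \<in> V \<Longrightarrow> (x, x) \<in> R" using *(1) by (rule refl_onD)
  show "(x, y) \<in> R \<Longrightarrow> (y, x) \<in> R" using *(2) by (rule symD)
  show "(x, y) \<in> R \<Longrightarrow> (y, z) \<in> R \<Longrightarrow> (x, z) \<in> R" using *(3) by (rule transD)
  show "g \<in> carrier \<Gamma> \<Longrightarrow> (x, y) \<in> R \<Longrightarrow> (act g x, act g y) \<in> R" using *(5) by (rule invariant_relD)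
  show "(x, y) \<in> R \<Longrightarrow> x \<in> V \<and> y \<in> V" using *(4) by blast
  show "(x, y) \<in> R \<Longrightarrow> (x, y) \<in> Rm" using *(7) by blast
  show "(x, y) \<in> R0 \<Longrightarrow> (x, y) \<in> R" using *(6) by blast
qed

lemma adm_R0: "adm R0" and adm_Rm: "adm Rm"
  using eqR0 eqRm invR0 invRm R0m by (auto simp: adm_def)

lemmas Rm_rules = adm_refl[OF adm_Rm] adm_sym[OF adm_Rm] adm_trans[OF adm_Rm] adm_act[OF adm_Rm]

lemma adm_act_eq:
  assumes "adm R" "g \<in> carrier \<Gamma>" "x \<in> V" "y \<in> V"
  shows "(act g x, act g y) \<in> R \<longleftrightarrow> (x, y) \<in> R"
  using adm_act[OF assms(1), of "inv g" "act g x" "act g y"] adm_act[OF assms(1), of g x y] assms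
  by (auto simp: act_inv1)

lemma adm_act_diff:
  assumes "adm R" "g \<in> carrier \<Gamma>" "h \<in> carrier \<Gamma>" "x \<in> V" "y \<in> V"
  shows "(act (inv g \<otimes> h) x, y) \<in> R \<longleftrightarrow> (act h x, act g y) \<in> R"
  using adm_act_eq[OF assms(1,2), of "act (inv g \<otimes> h) x" y] assms
  by (simp add: act_mult act_inv2 act_closed)

lemma equiv_vE: "adm R \<Longrightarrow> equiv V (vE R)"
  by (rule equiv_orb_rel) (auto simp: adm_def)

lemma equiv_eE: "adm R \<Longrightarrow> equiv E (eE R)"
  by (rule equiv_edge_orb_rel) (auto simp: adm_def EV invE)

lemma eE_iff: "((a, b), (c, d)) \<in> eE R \<longleftrightarrow> (a, b) \<in> E \<and> (c, d) \<in> E \<and> (\<exists>g\<in>carrier \<Gamma>. (act g a, c) \<in> R \<and> (act g b, d) \<in> R)"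
  using E_act by (auto simp: edge_orb_rel_iff)

lemma vE_mono: "R \<subseteq> R' \<Longrightarrow> vE R \<subseteq> vE R'"
  and eE_mono: "R \<subseteq> R' \<Longrightarrow> eE R \<subseteq> eE R'"
  by (auto simp: orb_rel_def eE_iff) blast+

lemma finV': assumes "adm R" shows "finite (V // vE R)"
  using quotient_card_surj(1)[OF finV equiv_vE[OF adm_R0] subset_refl equiv_vE[OF assms] subset_refl, of id] vE_mono[of R0 R] assms
  by (auto simp: adm_def)

lemma finE': assumes "adm R" shows "finite (E // eE R)"
  using quotient_card_surj(1)[OF finE equiv_eE[OF adm_R0] subset_refl equiv_eE[OF assms] subset_refl, of id] eE_mono[of R0 R] assms
  by (auto simp: adm_def)

text \<open>If no fold is possible, the map to the tree is locally injective, and a locally injective map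
  from a connected graph to a tree is injective: a path with equal ends in the tree crosses its
  first edge back at some time, the loop in between is shorter, and induction closes it up, so that
  the two crossings could be folded.\<close>

lemma immersion_imp_eq:
  assumes R: "adm R"
    and linj: "\<And>u v1 u' v2. (u, v1) \<in> E \<Longrightarrow> (u', v2) \<in> E \<Longrightarrow> (u, u') \<in> R \<Longrightarrow> (v1, v2) \<in> Rm \<Longrightarrow> (v1, v2) \<in> R"
  shows "R = Rm"
proof
  show "R \<subseteq> Rm" using R by (auto simp: adm_def)
  have key: "(\<forall>i<n. (p i, p (Suc i)) \<in> E) \<Longrightarrow> (p 0, p n) \<in> Rm \<Longrightarrow> (p 0, p n) \<in> R" for n p
  proof (induction n arbitrary: p rule: less_induct)
    case (less n)
    show ?case
    proof (cases "n = 0")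
      case True thus ?thesis using less.prems adm_V[OF adm_Rm] adm_refl[OF R] by auto
    next
      case False
      hence e: "(p 0, p 1) \<in> E" using less.prems(1) by auto
      then obtain c where c: "is_cut E Rm (p 0) (p 1) c" using cutm by blast
      have c1: "c (p 0) \<noteq> c (p 1)"
        using c e EVD[OF e] Rm_rules(1) unfolding is_cut_def by blast
      have cR: "(a, b) \<in> Rm \<Longrightarrow> c a = c b" for a b using c by (auto simp: is_cut_def)
      \<comment> \<open>The first return across the first edge.\<close>
      define j where "j = (LEAST j. 1 \<le> j \<and> c (p j) \<noteq> c (p 1))"
      have ex: "1 \<le> n \<and> c (p n) \<noteq> c (p 1)" using False cR[OF less.prems(2)] c1 by auto
      have j: "1 \<le> j" "c (p j) \<noteq> c (p 1)" and jn: "j \<le> n"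
        using LeastI[of "\<lambda>j. 1 \<le> j \<and> c (p j) \<noteq> c (p 1)", OF ex] Least_le[of "\<lambda>j. 1 \<le> j \<and> c (p j) \<noteq> c (p 1)", OF ex]
        unfolding j_def by auto
      have "j \<noteq> 1" using j by auto
      then obtain i where i: "j = Suc i" "1 \<le> i" using j(1) by (cases j) auto
      have ci: "c (p i) = c (p 1)" using not_less_Least[of i "\<lambda>j. 1 \<le> j \<and> c (p j) \<noteq> c (p 1)"] i by (auto simp: j_def)
      have eij: "(p i, p j) \<in> E" using less.prems(1) i jn by auto
      have "(p i, p 0) \<in> Rm \<and> (p j, p 1) \<in> Rm \<or> (p i, p 1) \<in> Rm \<and> (p j, p 0) \<in> Rm"
        using c eij ci j by (auto simp: is_cut_def)
      hence m: "(p i, p 1) \<in> Rm" "(p j, p 0) \<in> Rm" using cR ci c1 by blast+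
      have "(p 1, p i) \<in> R"
        using less.IH[of "i - 1" "\<lambda>k. p (Suc k)"] less.prems(1) i jn m Rm_rules(2) by auto
      hence j0: "(p 0, p j) \<in> R" using linj[OF symE[OF e] eij] m Rm_rules(2) by auto
      have "(p j, p n) \<in> R"
        using less.IH[of "n - j" "\<lambda>k. p (j + k)"] less.prems jn j(1) False m(2) Rm_rules(3) by auto
      thus ?thesis using j0 adm_trans[OF R] by blast
    qed
  qed
  show "Rm \<subseteq> R"
  proof (rule subrelI)
    fix x y assume xy: "(x, y) \<in> Rm"
    hence "(x, y) \<in> E\<^sup>*" using connE adm_V[OF adm_Rm] by blast
    then obtain n where "(x, y) \<in> E ^^ n" using rtrancl_imp_relpow by blast
    then obtain p where "p 0 = x" "p n = y" "\<forall>i<n. (p i, p (Suc i)) \<in> E" using relpow_fun_conv[of x y n E] by auto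
    thus "(x, y) \<in> R" using key[of n p] xy by auto
  qed
qed

text \<open>The finest invariant equivalence relation above \<open>R\<close> that identifies \<open>v1\<close> and \<open>v2\<close>.\<close>

definition fold_rel :: "('x \<times> 'x) set \<Rightarrow> 'x \<Rightarrow> 'x \<Rightarrow> ('x \<times> 'x) set" where
  "fold_rel R v1 v2 = (R \<union> {(act h v1, act h v2) |h. h \<in> carrier \<Gamma>} \<union> {(act h v2, act h v1) |h. h \<in> carrier \<Gamma>})\<^sup>+"

lemma fold_rel_commute: "fold_rel R v1 v2 = fold_rel R v2 v1"
  by (simp add: fold_rel_def Un_commute Un_left_commute)

lemma fold_rel_minimal:
  assumes "equiv V S" "R \<subseteq> S" "\<And>h. h \<in> carrier \<Gamma> \<Longrightarrow> (act h v1, act h v2) \<in> S"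
  shows "fold_rel R v1 v2 \<subseteq> S"
proof -
  have "R \<union> {(act h v1, act h v2) |h. h \<in> carrier \<Gamma>} \<union> {(act h v2, act h v1) |h. h \<in> carrier \<Gamma>} \<subseteq> S"
    using assms by (auto simp: equiv_def sym_def)
  hence "fold_rel R v1 v2 \<subseteq> S\<^sup>+" unfolding fold_rel_def by (rule trancl_mono_subset)
  thus ?thesis using assms(1) by (simp add: equiv_def trancl_id)
qed

lemma fold_rel_contains: "R \<subseteq> fold_rel R v1 v2" "h \<in> carrier \<Gamma> \<Longrightarrow> (act h v1, act h v2) \<in> fold_rel R v1 v2"
  by (auto simp: fold_rel_def)

lemma adm_fold_rel:
  assumes R: "adm R" and v: "(v1, v2) \<in> Rm"
  shows "adm (fold_rel R v1 v2)"
proof -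
  let ?B = "R \<union> {(act h v1, act h v2) |h. h \<in> carrier \<Gamma>} \<union> {(act h v2, act h v1) |h. h \<in> carrier \<Gamma>}"
  have V: "v1 \<in> V" "v2 \<in> V" using v adm_V[OF adm_Rm] by auto
  have "?B \<subseteq> V \<times> V" using V adm_V[OF R] by (auto simp: act_closed)
  hence sub: "fold_rel R v1 v2 \<subseteq> V \<times> V" unfolding fold_rel_def by (rule trancl_subset_Sigma)
  have "sym ?B" using adm_sym[OF R] by (auto simp: sym_def)
  hence "sym (fold_rel R v1 v2)" unfolding fold_rel_def by (rule sym_trancl)
  moreover have "refl_on V (fold_rel R v1 v2)"
    by (rule refl_onI) (use adm_refl[OF R] fold_rel_contains(1) in blast)
  ultimately have eq: "equiv V (fold_rel R v1 v2)" using sub by (auto simp: equiv_def fold_rel_def)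
  define B where "B = ?B"
  have B: "(act g x, act g y) \<in> B" if "(x, y) \<in> B" "g \<in> carrier \<Gamma>" for g x y
    using that adm_act[OF R] V unfolding B_def by (auto simp: act_mult[symmetric] intro: m_closed)
  have "(act g x, act g y) \<in> B\<^sup>+" if "(x, y) \<in> B\<^sup>+" "g \<in> carrier \<Gamma>" for g x y
    using that(1)
  proof (induction rule: trancl_induct)
    case (base y) thus ?case using B that(2) by (meson r_into_trancl)
  next
    case (step y z)
    have "(act g y, act g z) \<in> B" using B step(2) that(2) by blast
    thus ?case using step(3) by (rule trancl_into_trancl[rotated])
  qed
  hence "invariant_rel \<Gamma> act (B\<^sup>+)" by (auto simp: invariant_rel_def)
  hence "invariant_rel \<Gamma> act (fold_rel R v1 v2)" by (simp add: B_def fold_rel_def)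
  moreover have "fold_rel R v1 v2 \<subseteq> Rm"
  proof (rule fold_rel_minimal[OF eqRm])
    show "R \<subseteq> Rm" using R by (simp add: adm_def)
  qed (use v Rm_rules(4) in blast)
  moreover have "R0 \<subseteq> fold_rel R v1 v2" using R fold_rel_contains(1) unfolding adm_def by (meson subset_trans)
  ultimately show ?thesis using eq by (simp add: adm_def)
qed

end

section \<open>A single fold\<close>

text \<open>Two edges with a common origin in the quotient by \<open>R\<close> are folded. The common origin is the
  class of both \<open>u\<close> and \<open>u'\<close>; the edges end in different classes with the same image in the tree.
  \<open>R1\<close> is the relation after the fold, and \<open>K\<close> is the set of vertices over the orbits of the two
  ends.\<close>

locale fold_step = graph_over_tree +
  fixes R u u' v1 v2
  assumes R: "adm R" and e1: "(u, v1) \<in> E" and e2: "(u', v2) \<in> E" and uu': "(u, u') \<in> R"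
    and vm: "(v1, v2) \<in> Rm" and vR: "(v1, v2) \<notin> R"
begin

definition R1 where "R1 = fold_rel R v1 v2"
definition K where "K = vE R `` {v1, v2}"

lemma R1: "adm R1" unfolding R1_def using R vm by (rule adm_fold_rel)

lemma RR1: "(x, y) \<in> R \<Longrightarrow> (x, y) \<in> R1" using fold_rel_contains(1) by (auto simp: R1_def)

lemma v_R1: "h \<in> carrier \<Gamma> \<Longrightarrow> (act h v1, act h v2) \<in> R1"
  using fold_rel_contains(2) by (auto simp: R1_def)

lemma v12_R1: "(v1, v2) \<in> R1"
  using v_R1[OF one_closed] EVD(2)[OF e1] EVD(2)[OF e2] by (simp add: act_one)

lemma uVs: "u \<in> V" "u' \<in> V" "v1 \<in> V" "v2 \<in> V" using e1 e2 EVD by auto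

lemmas R_rules = adm_refl[OF R] adm_sym[OF R] adm_trans[OF R] adm_act[OF R] adm_m[OF R] adm_0[OF R]
lemmas rR = R_rules(1) and sR = R_rules(2) and tR = R_rules(3) and aR = R_rules(4) and mR = R_rules(5) and zR = R_rules(6)
lemmas sM = Rm_rules(2) and tM = Rm_rules(3) and aM = Rm_rules(4)
lemmas R1_rules = adm_refl[OF R1] adm_sym[OF R1] adm_trans[OF R1] adm_act[OF R1] adm_m[OF R1]

lemma mutual: "fold_step \<Gamma> V act E R0 Rm R u' u v2 v1"
proof unfold_locales
  show "(v2, v1) \<notin> R" using vR sR by auto
qed (use R e1 e2 sR[OF uu'] sM[OF vm] in auto)

text \<open>The element \<open>inv h \<otimes> h'\<close> stabilizes the common image of the two folded edges in the tree.
  Since stabilizers do not increase, it already stabilizes both edges.\<close>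

lemma match:
  assumes h: "h \<in> carrier \<Gamma>" and h': "h' \<in> carrier \<Gamma>"
    and m: "(act h u', act h' u) \<in> Rm" "(act h v2, act h' v1) \<in> Rm"
  shows "(act h u, act h' u) \<in> R" "(act h v1, act h' v1) \<in> R" "(act h v2, act h' v2) \<in> R"
proof -
  let ?g = "inv h \<otimes> h'"
  have g: "?g \<in> carrier \<Gamma>" using h h' by simp
  have "(act h' u, act h u) \<in> Rm" by (rule tM[OF sM[OF m(1)] sM[OF aM[OF h mR[OF uu']]]])
  hence 1: "(act ?g u, u) \<in> Rm" using adm_act_diff[OF adm_Rm h h'] uVs by blast
  have "(act h' v1, act h v1) \<in> Rm" by (rule tM[OF sM[OF m(2)] sM[OF aM[OF h vm]]])
  hence 2: "(act ?g v1, v1) \<in> Rm" using adm_act_diff[OF adm_Rm h h'] uVs by blast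
  have s1: "(act ?g u, u) \<in> R" "(act ?g v1, v1) \<in> R" using stab[OF e1 g 1 2] R_rules(6) by auto
  have 3: "(act ?g u', u') \<in> Rm" by (rule tM[OF sM[OF aM[OF g mR[OF uu']]] tM[OF 1 mR[OF uu']]])
  have 4: "(act ?g v2, v2) \<in> Rm" by (rule tM[OF sM[OF aM[OF g vm]] tM[OF 2 vm]])
  have s2: "(act ?g v2, v2) \<in> R" using stab[OF e2 g 3 4] R_rules(6) by auto
  show "(act h u, act h' u) \<in> R" "(act h v1, act h' v1) \<in> R" "(act h v2, act h' v2) \<in> R"
    using s1 s2 adm_act_diff[OF R h h'] uVs by (auto intro: sR)
qed

text \<open>Folding two edges of one orbit would increase the stabilizer of this edge.\<close>

lemma not_orbit_equiv: "((u, v1), (u', v2)) \<notin> eE R"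
proof
  assume "((u, v1), (u', v2)) \<in> eE R"
  then obtain g where g: "g \<in> carrier \<Gamma>" "(act g u, u') \<in> R" "(act g v1, v2) \<in> R" by (auto simp: eE_iff)
  hence "(act \<one> u', act g u) \<in> Rm" "(act \<one> v2, act g v1) \<in> Rm" 
    using sR mR uVs by (auto simp: act_one)
  from match(2)[OF one_closed g(1) this] have "(v1, act g v1) \<in> R" using uVs by (simp add: act_one)
  thus False using tR[OF _ g(3)] vR by blast
qed

lemma eE_rev: "((a, b), (c, d)) \<in> eE S \<Longrightarrow> ((b, a), (d, c)) \<in> eE S"
  using symE by (auto simp: eE_iff)

lemma no_flip:
  assumes "(a, b) \<in> E" "((a, b), (c, d)) \<in> eE Rm" shows "((a, b), (d, c)) \<notin> eE Rm"
proof
  assume "((a, b), (d, c)) \<in> eE Rm"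
  then obtain g h where gh: "g \<in> carrier \<Gamma>" "(act g a, c) \<in> Rm" "(act g b, d) \<in> Rm"
    "h \<in> carrier \<Gamma>" "(act h a, d) \<in> Rm" "(act h b, c) \<in> Rm" using assms(2) by (auto simp: eE_iff)
  hence g: "g \<in> carrier \<Gamma>" "h \<in> carrier \<Gamma>" "(act g a, act h b) \<in> Rm" "(act g b, act h a) \<in> Rm"
    using gh(1,4) tM[OF gh(2) sM[OF gh(6)]] tM[OF gh(3) sM[OF gh(5)]] by auto
  have "(act (inv h \<otimes> g) a, b) \<in> Rm" "(act (inv h \<otimes> g) b, a) \<in> Rm"
    using adm_act_diff[OF adm_Rm g(2,1), of a b] adm_act_diff[OF adm_Rm g(2,1), of b a] g(3,4) EVD[OF assms(1)] by auto
  thus False using noinv[OF assms(1) m_closed[OF inv_closed[OF g(2)] g(1)]] by blast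
qed

lemma eE_Rm: "S \<subseteq> Rm \<Longrightarrow> (p, q) \<in> eE S \<Longrightarrow> (p, q) \<in> eE Rm"
  using eE_mono by blast

lemma R_sub: "R \<subseteq> Rm" "R1 \<subseteq> Rm" "R \<subseteq> R1" using R R1 RR1 by (auto simp: adm_def)

lemma folded_edges: "((u, v1), (u', v2)) \<in> eE R1"
  using e1 e2 RR1[OF uu'] v12_R1 uVs by (auto simp: eE_iff act_one intro!: bexI[of _ \<one>])

lemma distinct_edge_classes:
  "distinct [eE R `` {(u, v1)}, eE R `` {(u', v2)}, eE R `` {(v1, u)}, eE R `` {(v2, u')}]"
proof -
  note eq = eq_equiv_class_iff[OF equiv_eE[OF R]]
  note E = e1 e2 symE[OF e1] symE[OF e2]
  have s: "(p, q) \<in> eE R \<Longrightarrow> (q, p) \<in> eE R" for p q using equiv_eE[OF R] by (meson equivE symD)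
  have refl: "p \<in> E \<Longrightarrow> (p, p) \<in> eE Rm" for p using equiv_eE[OF adm_Rm] by (meson equivE refl_onD)
  have m: "((u, v1), (u', v2)) \<in> eE Rm" "((u', v2), (u, v1)) \<in> eE Rm"
    using eE_Rm[OF R_sub(2) folded_edges] equiv_eE[OF adm_Rm] by (meson equivE symD)+
  have "((u, v1), (v1, u)) \<notin> eE R" "((u, v1), (v2, u')) \<notin> eE R" "((u', v2), (v2, u')) \<notin> eE R" "((u', v2), (v1, u)) \<notin> eE R"
    using no_flip[OF e1 refl[OF e1]] no_flip[OF e1 m(1)] no_flip[OF e2 refl[OF e2]] no_flip[OF e2 m(2)] by (auto dest: eE_Rm[OF R_sub(1)])
  moreover have "((v1, u), (v2, u')) \<notin> eE R" using eE_rev not_orbit_equiv by blast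
  ultimately show ?thesis using not_orbit_equiv E eq by (auto dest: s)
qed

text \<open>Two edge orbits become one, and likewise for the reversed edges. As edges are not inverted,
  these four orbits are different.\<close>

lemma num_edge_R1:
  "num_edge \<Gamma> act E R1 + 2 \<le> num_edge \<Gamma> act E R"
  "num_edge \<Gamma> act E R1 + 2 = num_edge \<Gamma> act E R \<Longrightarrow>
     inj_on (\<lambda>C. eE R1 `` C) (E // eE R - {eE R `` {(u', v2)}, eE R `` {(v2, u')}})"
proof -
  let ?f = "\<lambda>C. eE R1 `` C"
  note im = image_of_coarser_quotient[OF equiv_eE[OF R] equiv_eE[OF R1] eE_mono[OF R_sub(3)] subset_refl]
  note E = e1 e2 symE[OF e1] symE[OF e2]
  have mem: "p \<in> E \<Longrightarrow> eE R `` {p} \<in> E // eE R" for p by (rule quotientI)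
  have f: "?f (eE R `` {(u, v1)}) = ?f (eE R `` {(u', v2)})" "?f (eE R `` {(v1, u)}) = ?f (eE R `` {(v2, u')})"
    using im(2)[OF E(1)] im(2)[OF E(2)] im(2)[OF E(3)] im(2)[OF E(4)] folded_edges eE_rev[OF folded_edges]
      equiv_class_eq[OF equiv_eE[OF R1]] by auto
  note tc = two_collisions[OF finE'[OF R] mem[OF e1] mem[OF e2] mem[OF E(3)] mem[OF E(4)] distinct_edge_classes f]
  show "num_edge \<Gamma> act E R1 + 2 \<le> num_edge \<Gamma> act E R"
    using tc(1) unfolding num_edge_def im(1) by simp
  show "inj_on ?f (E // eE R - {eE R `` {(u', v2)}, eE R `` {(v2, u')}})"
    if "num_edge \<Gamma> act E R1 + 2 = num_edge \<Gamma> act E R"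
    using tc(2) that unfolding num_edge_def im(1) by simp
qed

definition tight where "tight \<longleftrightarrow> num_edge \<Gamma> act E R1 + 2 = num_edge \<Gamma> act E R"

lemma identified_aux:
  assumes "((u', v2), (a, b)) \<in> eE R" "((u, v1), (c, d)) \<in> eE R" "(a, c) \<in> Rm" "(b, d) \<in> Rm"
  shows "\<exists>h\<in>carrier \<Gamma>. (act h u, a) \<in> R \<and> (act h u, c) \<in> R \<and> (act h v2, b) \<in> R \<and> (act h v1, d) \<in> R"
proof -
  obtain h where h: "h \<in> carrier \<Gamma>" "(act h u', a) \<in> R" "(act h v2, b) \<in> R" using assms by (auto simp: eE_iff)
  obtain h' where h': "h' \<in> carrier \<Gamma>" "(act h' u, c) \<in> R" "(act h' v1, d) \<in> R" using assms by (auto simp: eE_iff)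
  have "(act h u', act h' u) \<in> Rm" "(act h v2, act h' v1) \<in> Rm"
    using tM[OF mR[OF h(2)] tM[OF assms(3) sM[OF mR[OF h'(2)]]]] tM[OF mR[OF h(3)] tM[OF assms(4) sM[OF mR[OF h'(3)]]]] by auto
  note m = match[OF h(1) h'(1) this]
  have "(act h u, a) \<in> R" by (rule tR[OF aR[OF h(1) uu'] h(2)])
  moreover have "(act h u, c) \<in> R" "(act h v1, d) \<in> R" using tR[OF m(1) h'(2)] tR[OF m(2) h'(3)] by auto
  ultimately show ?thesis using h by blast
qed

text \<open>If the fold merges only one pair of edge orbits, then it identifies no edges apart from
  translates of the two folded ones: two other identified edges lie in one orbit by injectivity on
  orbits, and the element that moves one to the other stabilizes their image in the tree, hence the
  edge itself.\<close>

lemma identified: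
  assumes t: tight and ab: "(a, b) \<in> E" and cd: "(c, d) \<in> E" and ac: "(a, c) \<in> R1" and bd: "(b, d) \<in> R1"
  obtains "(a, c) \<in> R" "(b, d) \<in> R"
  | h w w' where "h \<in> carrier \<Gamma>" "(act h u, a) \<in> R" "(act h u, c) \<in> R" "{w, w'} = {v1, v2}" "(act h w, b) \<in> R" "(act h w', d) \<in> R"
  | h w w' where "h \<in> carrier \<Gamma>" "(act h u, b) \<in> R" "(act h u, d) \<in> R" "{w, w'} = {v1, v2}" "(act h w, a) \<in> R" "(act h w', c) \<in> R"
proof -
  let ?f = "\<lambda>C. eE R1 `` C"
  let ?c = "\<lambda>p. eE R `` {p}"
  note im = image_of_coarser_quotient(2)[OF equiv_eE[OF R] equiv_eE[OF R1] eE_mono[OF R_sub(3)] subset_refl]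
  note E = e1 e2 symE[OF e1] symE[OF e2]
  have inj: "inj_on ?f (E // eE R - {?c (u', v2), ?c (v2, u')})" using num_edge_R1(2) t by (simp add: tight_def)
  have cls: "?c p = ?c q \<longleftrightarrow> (p, q) \<in> eE R" if "p \<in> E" "q \<in> E" for p q
    using eq_equiv_class_iff[OF equiv_eE[OF R]] that by blast
  have mem: "p \<in> E \<Longrightarrow> ?c p \<in> E // eE R" for p by (rule quotientI)
  have "((a, b), (c, d)) \<in> eE R1"
    using ab cd ac bd EVD[OF ab] by (auto simp: eE_iff act_one intro!: bexI[of _ \<one>])
  hence feq: "?f (?c (a, b)) = ?f (?c (c, d))" using im[OF ab] im[OF cd] equiv_class_eq[OF equiv_eE[OF R1]] by auto
  have f12: "?f (?c (u, v1)) = ?f (?c (u', v2))" "?f (?c (v1, u)) = ?f (?c (v2, u'))"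
    using im[OF E(1)] im[OF E(2)] im[OF E(3)] im[OF E(4)] folded_edges eE_rev[OF folded_edges]
      equiv_class_eq[OF equiv_eE[OF R1]] by auto
  have m: "(a, c) \<in> Rm" "(b, d) \<in> Rm" "(c, a) \<in> Rm" "(d, b) \<in> Rm" using ac bd R1_rules(5) Rm_rules(2) by auto
  note dist = distinct_edge_classes
  let ?P = "E // eE R - {?c (u', v2), ?c (v2, u')}"
  have inP: "?c (u, v1) \<in> ?P" "?c (v1, u) \<in> ?P" using dist mem E by auto
  have fne: "?f (?c (u, v1)) \<noteq> ?f (?c (v1, u))"
    using inj_onD[OF inj _ inP] dist by auto
  consider (eq) "?c (a, b) = ?c (c, d)" 
    | (1) "?c (a, b) = ?c (u', v2)" "?c (c, d) = ?c (u, v1)"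
    | (2) "?c (a, b) = ?c (u, v1)" "?c (c, d) = ?c (u', v2)"
    | (3) "?c (a, b) = ?c (v2, u')" "?c (c, d) = ?c (v1, u)"
    | (4) "?c (a, b) = ?c (v1, u)" "?c (c, d) = ?c (v2, u')"
  proof -
    have *: "?c (c', d') = ?c (u, v1)"
      if "?c (a', b') = ?c (u', v2)" "?f (?c (a', b')) = ?f (?c (c', d'))" "?c (a', b') \<noteq> ?c (c', d')" "(c', d') \<in> E" for a' b' c' d'
    proof -
      have f: "?f (?c (u, v1)) = ?f (?c (c', d'))" using that f12 by simp
      hence "?c (c', d') \<noteq> ?c (v2, u')" using f12 fne by auto
      hence "?c (c', d') \<in> ?P" using that mem by auto
      thus ?thesis using inj_onD[OF inj f inP(1)] by auto
    qed
    have **: "?c (c', d') = ?c (v1, u)"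
      if "?c (a', b') = ?c (v2, u')" "?f (?c (a', b')) = ?f (?c (c', d'))" "?c (a', b') \<noteq> ?c (c', d')" "(c', d') \<in> E" for a' b' c' d'
    proof -
      have f: "?f (?c (v1, u)) = ?f (?c (c', d'))" using that f12 by simp
      hence "?c (c', d') \<noteq> ?c (u', v2)" using f12 fne by auto
      hence "?c (c', d') \<in> ?P" using that mem by auto
      thus ?thesis using inj_onD[OF inj f inP(2)] by auto
    qed
    show ?thesis
    proof (cases "?c (a, b) = ?c (c, d)")
      case False
      show ?thesis
      proof (cases "?c (a, b) \<in> ?P \<and> ?c (c, d) \<in> ?P")
        case True thus ?thesis using inj_onD[OF inj feq] False by auto
      next
        case F: False
        hence "?c (a, b) \<in> {?c (u', v2), ?c (v2, u')} \<or> ?c (c, d) \<in> {?c (u', v2), ?c (v2, u')}"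
          using mem ab cd by auto
        then consider "?c (a, b) = ?c (u', v2)" | "?c (a, b) = ?c (v2, u')" | "?c (c, d) = ?c (u', v2)" | "?c (c, d) = ?c (v2, u')"
          by blast
        thus ?thesis
        proof cases
          case 1 from that(2)[OF 1 *[OF 1 feq False cd]] show ?thesis .
        next
          case 2 from that(4)[OF 2 **[OF 2 feq False cd]] show ?thesis .
        next
          case 3 from that(3)[OF *[OF 3 feq[symmetric] False[symmetric] ab] 3] show ?thesis .
        next
          case 4 from that(5)[OF **[OF 4 feq[symmetric] False[symmetric] ab] 4] show ?thesis .
        qed
      qed
    qed (rule that(1))
  qed
  thus ?thesis
  proof cases
    case eq
    then obtain g where g: "g \<in> carrier \<Gamma>" "(act g a, c) \<in> R" "(act g b, d) \<in> R" using cls[OF ab cd] by (auto simp: eE_iff)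
    hence "(act g a, a) \<in> Rm" "(act g b, b) \<in> Rm" using tM[OF mR[OF g(2)] m(3)] tM[OF mR[OF g(3)] m(4)] by auto
    hence "(act g a, a) \<in> R" "(act g b, b) \<in> R" using stab[OF ab g(1)] R_rules(6) by auto
    thus ?thesis using that(1) tR[OF sR g(2)] tR[OF sR g(3)] by blast
  next
    case 1
    have "((u', v2), (a, b)) \<in> eE R" "((u, v1), (c, d)) \<in> eE R"
      using cls[OF E(2) ab] cls[OF E(1) cd] 1 by auto
    from identified_aux[OF this m(1,2)] obtain h where h: "h \<in> carrier \<Gamma>" "(act h u, a) \<in> R" "(act h u, c) \<in> R"
      "(act h v2, b) \<in> R" "(act h v1, d) \<in> R" by blast
    show ?thesis by (rule that(2)[OF h(1-3) _ h(4,5)]) auto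
  next
    case 2
    have "((u', v2), (c, d)) \<in> eE R" "((u, v1), (a, b)) \<in> eE R"
      using cls[OF E(2) cd] cls[OF E(1) ab] 2 by auto
    from identified_aux[OF this m(3,4)] obtain h where h: "h \<in> carrier \<Gamma>" "(act h u, c) \<in> R" "(act h u, a) \<in> R"
      "(act h v2, d) \<in> R" "(act h v1, b) \<in> R" by blast
    show ?thesis by (rule that(2)[OF h(1,3,2) _ h(5,4)]) auto
  next
    case 3
    have "((v2, u'), (a, b)) \<in> eE R" "((v1, u), (c, d)) \<in> eE R"
      using cls[OF E(4) ab] cls[OF E(3) cd] 3 by auto
    from identified_aux[OF eE_rev[OF this(1)] eE_rev[OF this(2)] m(2,1)]
    obtain h where h: "h \<in> carrier \<Gamma>" "(act h u, b) \<in> R" "(act h u, d) \<in> R"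
      "(act h v2, a) \<in> R" "(act h v1, c) \<in> R" by blast
    show ?thesis by (rule that(3)[OF h(1-3) _ h(4,5)]) auto
  next
    case 4
    have "((v2, u'), (c, d)) \<in> eE R" "((v1, u), (a, b)) \<in> eE R"
      using cls[OF E(4) cd] cls[OF E(3) ab] 4 by auto
    from identified_aux[OF eE_rev[OF this(1)] eE_rev[OF this(2)] m(4,3)]
    obtain h where h: "h \<in> carrier \<Gamma>" "(act h u, d) \<in> R" "(act h u, b) \<in> R"
      "(act h v2, c) \<in> R" "(act h v1, a) \<in> R" by blast
    show ?thesis by (rule that(3)[OF h(1,3,2) _ h(5,4)]) auto
  qed
qed

end

context fold_step
begin

lemma vE_iff: "(x, y) \<in> vE S \<longleftrightarrow> x \<in> V \<and> y \<in> V \<and> (\<exists>g\<in>carrier \<Gamma>. (act g x, y) \<in> S)"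
  by (auto simp: orb_rel_def)

lemma vE_rules:
  assumes "adm S"
  shows "x \<in> V \<Longrightarrow> (x, x) \<in> vE S" "(x, y) \<in> vE S \<Longrightarrow> (y, x) \<in> vE S"
    "(x, y) \<in> vE S \<Longrightarrow> (y, z) \<in> vE S \<Longrightarrow> (x, z) \<in> vE S" "(x, y) \<in> S \<Longrightarrow> (x, y) \<in> vE S"
    "g \<in> carrier \<Gamma> \<Longrightarrow> x \<in> V \<Longrightarrow> (x, act g x) \<in> vE S"
proof -
  have "refl_on V (vE S)" "sym (vE S)" "trans (vE S)" using equiv_vE[OF assms] by (auto simp: equiv_def)
  thus "x \<in> V \<Longrightarrow> (x, x) \<in> vE S" "(x, y) \<in> vE S \<Longrightarrow> (y, x) \<in> vE S"
    "(x, y) \<in> vE S \<Longrightarrow> (y, z) \<in> vE S \<Longrightarrow> (x, z) \<in> vE S" by (auto dest: refl_onD symD transD)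
  show "(x, y) \<in> S \<Longrightarrow> (x, y) \<in> vE S" using adm_V[OF assms] by (force simp: vE_iff act_one intro: bexI[of _ \<one>])
  show "g \<in> carrier \<Gamma> \<Longrightarrow> x \<in> V \<Longrightarrow> (x, act g x) \<in> vE S"
    using adm_refl[OF assms] act_closed by (auto simp: vE_iff)
qed

lemmas vr = vE_rules(1)[OF R] and vs = vE_rules(2)[OF R] and vt = vE_rules(3)[OF R]
  and vi = vE_rules(4)[OF R] and vg = vE_rules(5)[OF R]

lemma K_V: "K \<subseteq> V" by (auto simp: K_def vE_iff)

lemma K_vE: "x \<in> K \<Longrightarrow> (x, y) \<in> vE R \<Longrightarrow> y \<in> K"
  using vE_rules(3)[OF R] by (auto simp: K_def)

lemma K_mem: "v1 \<in> K" "v2 \<in> K" "x \<in> K \<Longrightarrow> g \<in> carrier \<Gamma> \<Longrightarrow> act g x \<in> K"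
proof -
  show *: "v1 \<in> K" "v2 \<in> K" using vr uVs by (auto simp: K_def)
  show "x \<in> K \<Longrightarrow> g \<in> carrier \<Gamma> \<Longrightarrow> act g x \<in> K" using K_vE[OF _ vg] K_V by blast
qed

lemma K_R: "x \<in> K \<Longrightarrow> (x, y) \<in> R \<Longrightarrow> y \<in> K"
  using K_vE vE_rules(4)[OF R] by blast

text \<open>The relation \<open>R \<union> K \<times> K\<close> is an equivalence relation that identifies what the fold identifies.\<close>

lemma R1_outside: assumes "(x, y) \<in> R1" "x \<notin> K" shows "(x, y) \<in> R"
proof -
  let ?S = "R \<union> K \<times> K"
  have "equiv V ?S"
  proof (rule equivI)
    show "refl_on V ?S" using R_rules(1) by (auto intro: refl_onI)
    show "sym ?S" using R_rules(2) by (auto simp: sym_def)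
    show "trans ?S"
    proof (rule transI)
      fix x y z assume xy: "(x, y) \<in> ?S" and yz: "(y, z) \<in> ?S"
      show "(x, z) \<in> ?S"
      proof (cases "(x, y) \<in> R \<and> (y, z) \<in> R")
        case True thus ?thesis using tR by blast
      next
        case False
        hence "y \<in> K" using xy yz by auto
        hence "x \<in> K" "z \<in> K" using xy yz K_R sR by blast+
        thus ?thesis by blast
      qed
    qed
    show "?S \<subseteq> V \<times> V" using adm_V[OF R] K_V by auto
  qed
  hence "R1 \<subseteq> ?S" unfolding R1_def using K_mem by (intro fold_rel_minimal) auto
  thus ?thesis using assms by auto
qed

lemma vE_R1_outside:
  assumes "x \<in> V" "x \<notin> K" shows "(x, y) \<in> vE R1 \<longleftrightarrow> (x, y) \<in> vE R"
proof
  show "(x, y) \<in> vE R \<Longrightarrow> (x, y) \<in> vE R1" using vE_mono[OF R_sub(3)] by auto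
  assume "(x, y) \<in> vE R1"
  then obtain g where g: "g \<in> carrier \<Gamma>" "(act g x, y) \<in> R1" "y \<in> V" by (auto simp: vE_iff)
  have "act g x \<notin> K" using K_mem(3)[of "act g x" "inv g"] g(1) assms by (auto simp: act_inv1)
  thus "(x, y) \<in> vE R" using R1_outside[OF g(2)] g assms by (auto simp: vE_iff)
qed

lemma vE_R1_K: "x \<in> K \<Longrightarrow> (v1, x) \<in> vE R1"
proof -
  assume "x \<in> K"
  hence "(v1, x) \<in> vE R1 \<or> (v2, x) \<in> vE R1" using vE_mono[OF R_sub(3)] by (auto simp: K_def)
  thus "(v1, x) \<in> vE R1" using vE_rules(3)[OF R1 vE_rules(4)[OF R1 v12_R1]] by blast
qed

text \<open>The fold merges at most the orbits of \<open>v1\<close> and \<open>v2\<close>. As it loses two oriented edge orbits, the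
  defect does not increase, and it is constant only if exactly these vertex orbits are merged.\<close>

lemma num_vert_R1:
  "num_vert \<Gamma> act V R \<le> num_vert \<Gamma> act V R1 + 1"
  "(v1, v2) \<in> vE R \<Longrightarrow> num_vert \<Gamma> act V R \<le> num_vert \<Gamma> act V R1"
proof -
  let ?f = "\<lambda>C. vE R1 `` C"
  let ?c = "\<lambda>x. vE R `` {x}"
  note im = image_of_coarser_quotient[OF equiv_vE[OF R] equiv_vE[OF R1] vE_mono[OF R_sub(3)] subset_refl]
  note cls = eq_equiv_class_iff[OF equiv_vE[OF R]]
  have inj: "inj_on ?f (V // vE R - {?c v2})"
  proof (rule inj_onI)
    fix C D assume C: "C \<in> V // vE R - {?c v2}" and D: "D \<in> V // vE R - {?c v2}" and eq: "?f C = ?f D"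
    from C obtain x where x: "x \<in> V" "C = ?c x" by (auto simp: quotient_def)
    from D obtain y where y: "y \<in> V" "D = ?c y" by (auto simp: quotient_def)
    have xy: "(x, y) \<in> vE R1" "(y, x) \<in> vE R1"
      using eq x y im(2) eq_equiv_class_iff[OF equiv_vE[OF R1]] vE_rules(2)[OF R1] by auto
    show "C = D"
    proof (cases "x \<in> K \<and> y \<in> K")
      case True
      have cK: "?c z = ?c v1" if z: "z \<in> K" "?c z \<noteq> ?c v2" for z
      proof -
        have "(v1, z) \<in> vE R \<or> (v2, z) \<in> vE R" using z(1) by (auto simp: K_def)
        thus ?thesis using equiv_class_eq[OF equiv_vE[OF R], of v1 z] equiv_class_eq[OF equiv_vE[OF R], of v2 z] z(2) by auto
      qed
      have "?c x = ?c v1" "?c y = ?c v1" using cK[of x] cK[of y] True C D x(2) y(2) by blast+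
      thus ?thesis using x y by simp
    next
      case False
      hence "(x, y) \<in> vE R" using vE_R1_outside[of x y] vE_R1_outside[of y x] xy x y vs[of y x] by auto
      thus ?thesis using x y cls by auto
    qed
  qed
  have fin: "finite (V // vE R)" using finV'[OF R] .
  have mem: "?c v2 \<in> V // vE R" using uVs by (intro quotientI)
  have "card (V // vE R - {?c v2}) \<le> card (?f ` (V // vE R))"
    using card_image[OF inj] fin by (metis card_mono finite_imageI image_mono Diff_subset)
  thus "num_vert \<Gamma> act V R \<le> num_vert \<Gamma> act V R1 + 1"
    using fin mem unfolding num_vert_def im(1) by simp
  assume s: "(v1, v2) \<in> vE R"
  have "inj_on ?f (V // vE R)"
  proof (rule inj_onI)
    fix C D assume C: "C \<in> V // vE R" and D: "D \<in> V // vE R" and eq: "?f C = ?f D"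
    from C obtain x where x: "x \<in> V" "C = ?c x" by (auto simp: quotient_def)
    from D obtain y where y: "y \<in> V" "D = ?c y" by (auto simp: quotient_def)
    have xy: "(x, y) \<in> vE R1" "(y, x) \<in> vE R1"
      using eq x y im(2) eq_equiv_class_iff[OF equiv_vE[OF R1]] vE_rules(2)[OF R1] by auto
    have Kv: "z \<in> K \<Longrightarrow> (v1, z) \<in> vE R" for z using vt[OF s] by (auto simp: K_def)
    show "C = D"
    proof (cases "x \<in> K \<and> y \<in> K")
      case True
      hence "(x, y) \<in> vE R" using vt[OF vs[OF Kv] Kv] by blast
      thus ?thesis using x y cls by auto
    next
      case False
      hence "(x, y) \<in> vE R" using vE_R1_outside[of x y] vE_R1_outside[of y x] xy x y vs[of y x] by auto
      thus ?thesis using x y cls by auto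
    qed
  qed
  hence "card (V // vE R) = card (?f ` (V // vE R))" by (simp add: card_image)
  thus "num_vert \<Gamma> act V R \<le> num_vert \<Gamma> act V R1" unfolding num_vert_def im(1) by simp
qed

abbreviation bigR where "bigR S \<equiv> big_verts \<Gamma> act V E S"

lemma big_iff: "x \<in> bigR S \<longleftrightarrow> x \<in> V \<and> (\<exists>a b. \<exists>g\<in>carrier \<Gamma>. (a, b) \<in> E \<and> (a, x) \<in> S \<and> (act g x, x) \<in> S \<and> (act g b, b) \<notin> S)"
  by (auto simp: big_verts_def)

lemma big_outside: assumes "x \<in> bigR R1" "x \<notin> K" shows "x \<in> bigR R"
proof -
  obtain a b g where *: "x \<in> V" "g \<in> carrier \<Gamma>" "(a, b) \<in> E" "(a, x) \<in> R1" "(act g x, x) \<in> R1" "(act g b, b) \<notin> R1"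
    using assms by (auto simp: big_iff)
  have "(a, x) \<in> R" "(act g x, x) \<in> R"
    using sR[OF R1_outside[OF R1_rules(2)[OF *(4)] assms(2)]] sR[OF R1_outside[OF R1_rules(2)[OF *(5)] assms(2)]] by auto
  moreover have "(act g b, b) \<notin> R" using * RR1 by blast
  ultimately show ?thesis using * by (auto simp: big_iff)
qed

text \<open>Outside of \<open>K\<close> the fold creates no big vertices, and \<open>K\<close> contributes at most one big orbit
  after the fold. Two big orbits in \<open>K\<close> before the fold are therefore a loss.\<close>

lemma num_big_R1:
  assumes diff: "(v1, v2) \<notin> vE R"
  shows "v1 \<in> bigR R \<Longrightarrow> v2 \<in> bigR R \<Longrightarrow> num_big \<Gamma> act V E R1 < num_big \<Gamma> act V E R"
    and "v1 \<in> bigR R \<or> bigR R1 \<inter> K = {} \<Longrightarrow> num_big \<Gamma> act V E R1 \<le> num_big \<Gamma> act V E R"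
proof -
  let ?O = "(bigR R - K) // vE R"
  let ?c = "\<lambda>x. vE R `` {x}"
  let ?Z = "if bigR R1 \<inter> K = {} then {} else {vE R1 `` {v1}}"
  have bV: "bigR R \<subseteq> V" by (auto simp: big_verts_def)
  have fin: "finite (bigR R // vE R)" by (rule finite_subset[OF _ finV'[OF R]]) (use bV in \<open>auto simp: quotient_def\<close>)
  have finO: "finite ?O" using fin by (rule finite_subset[rotated]) (auto simp: quotient_def)
  have sub: "bigR R1 // vE R1 \<subseteq> ?O \<union> ?Z"
  proof
    fix C assume "C \<in> bigR R1 // vE R1"
    then obtain x where x: "x \<in> bigR R1" "C = vE R1 `` {x}" by (auto simp: quotient_def)
    have xV: "x \<in> V" using x by (auto simp: big_iff)
    show "C \<in> ?O \<union> ?Z"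
    proof (cases "x \<in> K")
      case True
      hence "vE R1 `` {x} = vE R1 `` {v1}" using vE_R1_K[OF True] equiv_class_eq[OF equiv_vE[OF R1]] by auto
      thus ?thesis using True x by auto
    next
      case False
      have "vE R1 `` {x} = vE R `` {x}" using vE_R1_outside[OF xV False] by auto
      thus ?thesis using False big_outside[OF x(1) False] x by (auto intro: quotientI)
    qed
  qed
  have le: "num_big \<Gamma> act V E R1 \<le> card ?O + card ?Z"
    unfolding num_big_def using card_mono[OF _ sub] card_Un_le[of ?O ?Z] finO by (simp split: if_splits)
  have nO: "?c x \<notin> ?O" if "x \<in> K" for x
  proof
    assume "?c x \<in> ?O"
    then obtain y where y: "y \<in> bigR R - K" "?c x = ?c y" by (auto simp: quotient_def)
    hence "(x, y) \<in> vE R" using eq_equiv_class_iff[OF equiv_vE[OF R]] that K_V bV by blast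
    thus False using K_vE[OF that] y by blast
  qed
  show "num_big \<Gamma> act V E R1 < num_big \<Gamma> act V E R" if b: "v1 \<in> bigR R" "v2 \<in> bigR R"
  proof -
    have "?c v1 \<noteq> ?c v2" using diff eq_equiv_class_iff[OF equiv_vE[OF R]] uVs by blast
    hence "card (insert (?c v1) (insert (?c v2) ?O)) = card ?O + 2"
      using nO K_mem finO by simp
    moreover have "insert (?c v1) (insert (?c v2) ?O) \<subseteq> bigR R // vE R"
      using b by (auto simp: quotient_def)
    ultimately have "card ?O + 2 \<le> num_big \<Gamma> act V E R" unfolding num_big_def using card_mono[OF fin] by metis
    thus ?thesis using le by (simp split: if_splits)
  qed
  show "num_big \<Gamma> act V E R1 \<le> num_big \<Gamma> act V E R" if b: "v1 \<in> bigR R \<or> bigR R1 \<inter> K = {}"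
  proof (cases "bigR R1 \<inter> K = {}")
    case True
    have "card ?O \<le> num_big \<Gamma> act V E R" unfolding num_big_def by (rule card_mono[OF fin]) (auto simp: quotient_def)
    thus ?thesis using le True by simp
  next
    case False
    hence "insert (?c v1) ?O \<subseteq> bigR R // vE R" using b by (auto simp: quotient_def)
    hence "card ?O + 1 \<le> num_big \<Gamma> act V E R" unfolding num_big_def
      using card_mono[OF fin] nO[OF K_mem(1)] finO by (metis Suc_eq_plus1 card_insert_disjoint)
    thus ?thesis using le by (simp split: if_splits)
  qed
qed

text \<open>If \<open>v2\<close> is small, its stabilizer also fixes the two folded edges, so that the classes of the
  folded graph arise by attaching translates of \<open>v2\<close> to translates of \<open>v1\<close>.\<close>

lemma small_stab:
  assumes s: "v2 \<notin> bigR R" and h: "h \<in> carrier \<Gamma>" "(act h v2, v2) \<in> R"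
  shows "(act h u, u) \<in> R" "(act h v1, v1) \<in> R"
proof -
  have "(act h u', u') \<in> R" using s h symE[OF e2] uVs R_rules(1) by (auto simp: big_iff)
  thus *: "(act h u, u) \<in> R" by (rule tR[OF aR[OF h(1) uu'] tR[OF _ sR[OF uu']]])
  have "(act h v1, v1) \<in> Rm" by (rule tM[OF aM[OF h(1) vm] tM[OF mR[OF h(2)] sM[OF vm]]])
  thus "(act h v1, v1) \<in> R" using stab[OF e1 h(1) mR[OF *]] zR by blast
qed

text \<open>The relation \<open>ret\<close> of the proof is the retraction that moves translates of \<open>v2\<close> to the
  corresponding translates of \<open>v1\<close>; it is single-valued on classes by \<open>small_stab\<close>.\<close>

lemma small_R1:
  assumes s: "v2 \<notin> bigR R" and d: "(v1, v2) \<notin> vE R"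
    and xy: "(x, y) \<in> R1" and y: "(v1, y) \<in> vE R"
  shows "(x, y) \<in> R \<or> (\<exists>h\<in>carrier \<Gamma>. (act h v2, x) \<in> R \<and> (act h v1, y) \<in> R)"
proof -
  define ret where "ret x z \<longleftrightarrow> (x, z) \<in> R \<and> (v2, x) \<notin> vE R \<or> (\<exists>h\<in>carrier \<Gamma>. (act h v2, x) \<in> R \<and> (act h v1, z) \<in> R)" for x z
  define S where "S = {(x, y). x \<in> V \<and> y \<in> V \<and> (\<exists>z. ret x z \<and> ret y z)}"
  have orb: "(act h v2, x) \<in> R \<Longrightarrow> h \<in> carrier \<Gamma> \<Longrightarrow> (v2, x) \<in> vE R" for h x
    using adm_V[OF R] uVs by (auto simp: vE_iff)
  have v1orb: "(v2, act h v1) \<notin> vE R" if "h \<in> carrier \<Gamma>" for h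
    using d vs[OF vt[OF _ vs[OF vg[OF that uVs(3)]]]] by blast
  have retR: "ret x z \<Longrightarrow> (z, z') \<in> R \<Longrightarrow> ret x z'" for x z z' 
    unfolding ret_def by (meson tR)
  have retu: "(z, z') \<in> R" if r: "ret y z" "ret y z'" for y z z'
  proof (cases "(v2, y) \<in> vE R")
    case False
    hence "(y, z) \<in> R" "(y, z') \<in> R" using r orb unfolding ret_def by blast+
    thus ?thesis using tR sR by blast
  next
    case True
    then obtain h h' where h: "h \<in> carrier \<Gamma>" "(act h v2, y) \<in> R" "(act h v1, z) \<in> R"
      "h' \<in> carrier \<Gamma>" "(act h' v2, y) \<in> R" "(act h' v1, z') \<in> R" using r unfolding ret_def by blast
    have "(act h' v2, act h v2) \<in> R" by (rule tR[OF h(5) sR[OF h(2)]])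
    hence "(act (inv h \<otimes> h') v2, v2) \<in> R" using adm_act_diff[OF R h(1,4)] uVs by blast
    hence "(act (inv h \<otimes> h') v1, v1) \<in> R" using small_stab(2)[OF s] h by simp
    hence "(act h' v1, act h v1) \<in> R" using adm_act_diff[OF R h(1,4)] uVs by blast
    thus ?thesis by (rule tR[OF sR[OF h(3)] tR[OF sR h(6)]])
  qed
  have retex: "\<exists>z. ret x z" if "x \<in> V" for x
  proof (cases "(v2, x) \<in> vE R")
    case True
    then obtain g where g: "g \<in> carrier \<Gamma>" "(act g v2, x) \<in> R" by (auto simp: vE_iff)
    have "(act g v1, act g v1) \<in> R" using rR act_closed[OF g(1) uVs(3)] by blast
    thus ?thesis using g unfolding ret_def by blast
  next
    case False thus ?thesis using R_rules(1)[OF that] unfolding ret_def by blast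
  qed
  have retRR: "ret x z" if r: "(x, y) \<in> R" "ret y z" for x y z
  proof (cases "(v2, y) \<in> vE R")
    case True
    then obtain h where h: "h \<in> carrier \<Gamma>" "(act h v2, y) \<in> R" "(act h v1, z) \<in> R" using r(2) unfolding ret_def by blast
    have "(act h v2, x) \<in> R" by (rule tR[OF h(2) sR[OF that(1)]])
    thus ?thesis using h unfolding ret_def by blast
  next
    case False 
    hence x: "(v2, x) \<notin> vE R" using vt[OF _ vi[OF that(1)]] by blast
    have "(y, z) \<in> R" using that(2) False orb unfolding ret_def by blast
    thus ?thesis using tR[OF that(1)] x unfolding ret_def by blast
  qed
  have "equiv V S"
  proof (rule equivI)
    show "refl_on V S" using retex by (auto simp: refl_on_def S_def)
    show "sym S" by (auto simp: S_def sym_def)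
    show "trans S" 
    proof (rule transI)
      fix x y z assume "(x, y) \<in> S" "(y, z) \<in> S"
      then obtain w w' where w: "x \<in> V" "z \<in> V" "ret x w" "ret y w" "ret y w'" "ret z w'" by (auto simp: S_def)
      hence "ret z w" using retu retR by blast
      thus "(x, z) \<in> S" using w by (auto simp: S_def)
    qed
  qed (auto simp: S_def)
  moreover have "R \<subseteq> S" 
  proof (rule subrelI)
    fix x y assume xy: "(x, y) \<in> R"
    then obtain z where "ret y z" using retex adm_V[OF R] by blast
    thus "(x, y) \<in> S" using xy retRR adm_V[OF R] by (auto simp: S_def)
  qed
  moreover have "(act h v1, act h v2) \<in> S" if h: "h \<in> carrier \<Gamma>" for h
  proof -
    have "ret (act h v2) (act h v1)" using h rR[OF act_closed[OF h uVs(4)]] rR[OF act_closed[OF h uVs(3)]] unfolding ret_def by blast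
    moreover have "ret (act h v1) (act h v1)" using h R_rules(1) uVs act_closed v1orb by (auto simp: ret_def)
    ultimately show ?thesis using h uVs act_closed by (auto simp: S_def)
  qed
  ultimately have "R1 \<subseteq> S" unfolding R1_def by (rule fold_rel_minimal)
  then obtain z where z: "ret x z" "ret y z" using xy by (auto simp: S_def)
  have "(v2, y) \<notin> vE R" using d vt[OF y vs] by blast
  hence "(y, z) \<in> R" using z(2) orb unfolding ret_def by blast
  hence yz: "(z, y) \<in> R" by (rule sR)
  hence "ret x y" using z(1) retR by blast
  thus ?thesis unfolding ret_def by blast
qed

text \<open>If neither end is big, then an element that stabilizes the merged vertex stabilizes both
  folded edges, and with them all edges at either end.\<close>

lemma small_both:
  assumes s2: "v2 \<notin> bigR R" and s1: "v1 \<notin> bigR R" and d: "(v1, v2) \<notin> vE R"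
  shows "bigR R1 \<inter> K = {}"
proof (rule ccontr)
  assume "bigR R1 \<inter> K \<noteq> {}"
  then obtain x where x: "x \<in> K" "x \<in> bigR R1" by auto
  then obtain a b g where *: "x \<in> V" "g \<in> carrier \<Gamma>" "(a, b) \<in> E" "(a, x) \<in> R1" "(act g x, x) \<in> R1" "(act g b, b) \<notin> R1"
    by (auto simp: big_iff)
  obtain k where k: "k \<in> carrier \<Gamma>" "(act k v1, x) \<in> R1" using vE_R1_K[OF x(1)] by (auto simp: vE_iff)
  define a' b' g' where "a' = act (inv k) a" and "b' = act (inv k) b" and "g' = inv k \<otimes> g \<otimes> k"
  have V: "a \<in> V" "b \<in> V" using EVD[OF *(3)] by auto
  have g': "g' \<in> carrier \<Gamma>" using k * by (simp add: g'_def)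
  have e': "(a', b') \<in> E" using E_act[OF *(3)] k by (simp add: a'_def b'_def)
  have iv: "(act (inv k) x, v1) \<in> R1" 
    using R1_rules(4)[OF inv_closed[OF k(1)] R1_rules(2)[OF k(2)]] uVs k by (simp add: act_inv1)
  have a'v: "(a', v1) \<in> R1" using R1_rules(4)[OF inv_closed[OF k(1)] *(4)] R1_rules(3)[OF _ iv] by (simp add: a'_def)
  have "(act g (act k v1), act k v1) \<in> R1"
    by (rule R1_rules(3)[OF R1_rules(4)[OF *(2) k(2)] R1_rules(3)[OF *(5) R1_rules(2)[OF k(2)]]])
  hence g'v: "(act g' v1, v1) \<in> R1"
    using R1_rules(4)[OF inv_closed[OF k(1)], of "act g (act k v1)" "act k v1"] k *(2) uVs 
    by (simp add: g'_def act_mult act_inv1 act_closed)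
  have nb: "(act g' b', b') \<notin> R1"
  proof
    assume "(act g' b', b') \<in> R1"
    hence "(act k (act g' b'), act k b') \<in> R1" using R1_rules(4) k by blast
    moreover have "act k (act g' b') = act g b" using V k * by (simp add: g'_def b'_def act_mult act_inv2 act_closed)
    moreover have "act k b' = b" using V k by (simp add: b'_def act_inv2)
    ultimately show False using * by simp
  qed
  have v1v1: "(v1, v1) \<in> vE R" by (rule vr[OF uVs(3)])
  have st1: "(act g' v1, v1) \<in> R"
  proof -
    have "(v2, act g' v1) \<notin> vE R" using d vs[OF vt[OF _ vs[OF vg[OF g' uVs(3)]]]] by blast
    hence "\<not> (\<exists>h\<in>carrier \<Gamma>. (act h v2, act g' v1) \<in> R \<and> (act h v1, v1) \<in> R)"
      using adm_V[OF R] uVs by (auto simp: vE_iff)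
    thus ?thesis using small_R1[OF s2 d g'v v1v1] by blast
  qed
  have sm1: "(act h y, y) \<in> R" if "h \<in> carrier \<Gamma>" "(act h v1, v1) \<in> R" "(w, y) \<in> E" "(w, v1) \<in> R" for h w y
    using that s1 uVs by (auto simp: big_iff)
  have sm2: "(act h y, y) \<in> R" if "h \<in> carrier \<Gamma>" "(act h v2, v2) \<in> R" "(w, y) \<in> E" "(w, v2) \<in> R" for h w y
    using that s2 uVs by (auto simp: big_iff)
  have st12: "(act h v2, v2) \<in> R" if h: "h \<in> carrier \<Gamma>" "(act h v1, v1) \<in> R" for h
  proof -
    have "(act h u, u) \<in> R" by (rule sm1[OF h symE[OF e1] rR[OF uVs(3)]])
    hence "(act h u', u') \<in> R" by (rule tR[OF sR[OF aR[OF h(1) uu']] tR[OF _ uu']])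
    moreover have "(act h v2, v2) \<in> Rm" by (rule tM[OF sM[OF aM[OF h(1) vm]] tM[OF mR[OF h(2)] vm]])
    ultimately show ?thesis using stab[OF e2 h(1) mR] zR by blast
  qed
  show False
    using small_R1[OF s2 d a'v v1v1]
  proof
    assume "(a', v1) \<in> R"
    thus False using sm1[OF g' st1 e'] nb RR1 by blast
  next
    assume "\<exists>h\<in>carrier \<Gamma>. (act h v2, a') \<in> R \<and> (act h v1, v1) \<in> R"
    then obtain h where h: "h \<in> carrier \<Gamma>" "(act h v2, a') \<in> R" "(act h v1, v1) \<in> R" by blast
    have "(a', v2) \<in> R" by (rule tR[OF sR[OF h(2)] st12[OF h(1,3)]])
    thus False using sm2[OF g' st12[OF g' st1] e'] nb RR1 by blast
  qed
qed

end

section \<open>Pulling cuts back along a fold\<close>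

context fold_step
begin

text \<open>Cuts of the folded graph pull back. A cut at the edge \<open>{u, v1}\<close> of the folded graph also cuts
  the edge \<open>{u, v2}\<close>, so a cut is needed that separates \<open>v2\<close> from \<open>u\<close> only. The side of \<open>v2\<close>
  consists of \<open>v2\<close> and of everything beyond the other edges at \<open>v2\<close>.\<close>

lemma isolating_cut:
  assumes t: tight and s: "v2 \<notin> bigR R" and d: "(v1, v2) \<notin> vE R"
    and cuts: "\<And>x y. (x, y) \<in> E \<Longrightarrow> \<exists>c. is_cut E R1 x y c"
  shows "\<exists>c. is_cut E R u v2 c"
proof -
  define c where "c \<epsilon> = (SOME c. is_cut E R1 (fst \<epsilon>) (snd \<epsilon>) c)" for \<epsilon>
  have c: "is_cut E R1 x y (c (x, y))" if "(x, y) \<in> E" for x y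
    unfolding c_def using someI_ex[OF cuts[OF that]] by simp
  have cinv: "c (x, y) a = c (x, y) b" if "(a, b) \<in> R" "(x, y) \<in> E" for x y a b
    using c[OF that(2)] RR1[OF that(1)] by (auto simp: is_cut_def)
  define D where "D x \<longleftrightarrow> (x, v2) \<in> R \<or> (\<exists>l z. (l, z) \<in> E \<and> (l, v2) \<in> R \<and> (z, u) \<notin> R \<and> c (l, z) x \<noteq> c (l, z) v2)" for x
  have v12: "(act h v1, v2) \<notin> R" if "h \<in> carrier \<Gamma>" for h
    using d that uVs by (auto simp: vE_iff)
  have hu: "(act h u, u) \<in> R" if "h \<in> carrier \<Gamma>" "(act h v2, v2) \<in> R" for h
    using small_stab(1)[OF s that] .
  have Dinv: "D a = D b" if ab: "(a, b) \<in> R" for a b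
    using cinv[OF ab] tR[OF ab] tR[OF sR[OF ab]] unfolding D_def by metis
  have crossing: "(x, l) \<in> R1 \<and> (y, z) \<in> R1 \<or> (x, z) \<in> R1 \<and> (y, l) \<in> R1"
    if "(x, y) \<in> E" "(l, z) \<in> E" "c (l, z) x \<noteq> c (l, z) y" for x y l z
    using c[OF that(2)] that(1,3) by (auto simp: is_cut_def)
  \<comment> \<open>An edge at \<open>v2\<close> other than the folded one is identified with no other edge,
    unless both have a common endpoint in the class of \<open>v2\<close>.\<close>
  have ident: "(x, v2) \<in> R"
    if e: "(x, y) \<in> E" "(l, z) \<in> E" "(x, l) \<in> R1" "(y, z) \<in> R1" "(l, v2) \<in> R" "(z, u) \<notin> R" for x y l z
    using t e(1-4)
  proof (cases rule: identified)
    case 1 thus ?thesis using tR e(5) by blast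
  next
    case (2 h w w')
    thus ?thesis using tR[OF sR[OF 2(2)] tR[OF 2(3) e(5)]] by blast
  next
    case (3 h w w')
    have "(act h w', v2) \<in> R" using tR[OF 3(6) e(5)] .
    moreover have "w' = v1 \<or> w' = v2" using 3(4) by auto
    ultimately have "(act h v2, v2) \<in> R" using v12[OF 3(1)] by auto
    hence "(z, u) \<in> R" using tR[OF sR[OF 3(3)] hu[OF 3(1)]] by blast
    thus ?thesis using e(6) by simp
  qed
  have flat1: "D y" if xy: "(x, y) \<in> E" and n: "\<not> ((x, u) \<in> R \<and> (y, v2) \<in> R)" "\<not> ((x, v2) \<in> R \<and> (y, u) \<in> R)" and Dx: "D x" for x y
  proof (rule ccontr)
    assume nD: "\<not> D y"
    from Dx show False unfolding D_def
    proof
      assume x: "(x, v2) \<in> R"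
      have "c (x, y) y \<noteq> c (x, y) x" using c[OF xy] xy R1_rules(1) EVD[OF xy] by (auto simp: is_cut_def)
      hence "c (x, y) y \<noteq> c (x, y) v2" using cinv[OF x xy] by simp
      thus False using nD xy x n(2) unfolding D_def by blast
    next
      assume "\<exists>l z. (l, z) \<in> E \<and> (l, v2) \<in> R \<and> (z, u) \<notin> R \<and> c (l, z) x \<noteq> c (l, z) v2"
      then obtain l z where lz: "(l, z) \<in> E" "(l, v2) \<in> R" "(z, u) \<notin> R" "c (l, z) x \<noteq> c (l, z) v2" by blast
      have y: "c (l, z) y = c (l, z) v2" using nD lz unfolding D_def by blast
      have nx: "(x, v2) \<notin> R" using cinv[OF _ lz(1)] lz(4) by blast
      have ny: "(y, v2) \<notin> R" using nD by (auto simp: D_def)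
      have "c (l, z) x \<noteq> c (l, z) y" using lz y by simp
      from crossing[OF xy lz(1) this] show False
      proof
        assume "(x, l) \<in> R1 \<and> (y, z) \<in> R1"
        thus False using ident[OF xy lz(1) _ _ lz(2,3)] nx by blast
      next
        assume "(x, z) \<in> R1 \<and> (y, l) \<in> R1"
        thus False using ident[OF symE[OF xy] lz(1) _ _ lz(2,3)] ny by blast
      qed
    qed
  qed
  have flat: "D x = D y" if "(x, y) \<in> E" "\<not> ((x, u) \<in> R \<and> (y, v2) \<in> R)" "\<not> ((x, v2) \<in> R \<and> (y, u) \<in> R)" for x y
    using flat1[OF that] flat1[OF symE[OF that(1)]] that(2,3) by blast
  have Dv: "D v2" using rR[OF uVs(4)] by (auto simp: D_def)
  have e2u: "(u, v2) \<notin> R" 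
  proof
    assume "(u, v2) \<in> R"
    hence "(u', v2) \<in> R" using tR[OF sR[OF uu']] by blast
    thus False using noloop[OF e2] mR by blast
  qed
  have nDu: "\<not> D u"
  proof
    assume "D u"
    then obtain l z where lz: "(l, z) \<in> E" "(l, v2) \<in> R" "(z, u) \<notin> R" "c (l, z) u \<noteq> c (l, z) v2"
      using e2u unfolding D_def by blast
    have "c (l, z) u' \<noteq> c (l, z) v2" using lz(4) cinv[OF uu' lz(1)] by simp
    from crossing[OF e2 lz(1) this] show False
    proof
      assume "(u', l) \<in> R1 \<and> (v2, z) \<in> R1"
      hence "(u', v2) \<in> R" using ident[OF e2 lz(1) _ _ lz(2,3)] by blast
      thus False using noloop[OF e2] mR by blast
    next
      assume a: "(u', z) \<in> R1 \<and> (v2, l) \<in> R1"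
      show False using t symE[OF e2] lz(1) a[THEN conjunct2] a[THEN conjunct1]
      proof (cases rule: identified)
        case 1 thus False using lz(3) tR[OF uu'] sR by blast
      next
        case (2 h w w')
        have "w = v1 \<or> w = v2" using 2(4) by auto
        hence w: "(act h w, act h v1) \<in> Rm" "(v2, w) \<in> Rm"
          using 2(1) vm Rm_rules(1)[OF uVs(4)] Rm_rules(1)[OF act_closed[OF 2(1) uVs(3)]] sM[OF aM[OF 2(1) vm]] sM[OF vm] by auto
        have "(act h u, v1) \<in> Rm" by (rule tM[OF mR[OF 2(2)] sM[OF vm]])
        moreover have "(act h v1, u) \<in> Rm" by (rule tM[OF sM[OF w(1)] tM[OF mR[OF 2(5)] sM[OF mR[OF uu']]]])
        ultimately show False using noinv[OF e1 2(1)] by blast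
      next
        case (3 h w w')
        have "(act h w', v2) \<in> R" using tR[OF 3(6) lz(2)] .
        moreover have "w' = v1 \<or> w' = v2" using 3(4) by auto
        ultimately have "(act h v2, v2) \<in> R" using v12[OF 3(1)] by auto
        hence "(z, u) \<in> R" using tR[OF sR[OF 3(3)] hu[OF 3(1)]] by blast
        thus False using lz(3) by simp
      qed
    qed
  qed
  have "is_cut E R u v2 D"
    unfolding is_cut_def
  proof (intro conjI ballI; clarify)
    fix a b assume "(a, b) \<in> R" thus "D a = D b" using Dinv by blast
  next
    fix a b assume ab: "(a, b) \<in> E"
    have "D a \<noteq> D b" if "(a, u) \<in> R \<and> (b, v2) \<in> R \<or> (a, v2) \<in> R \<and> (b, u) \<in> R"
      using that Dinv Dv nDu by metis
    thus "(D a \<noteq> D b) = ((a, u) \<in> R \<and> (b, v2) \<in> R \<or> (a, v2) \<in> R \<and> (b, u) \<in> R)"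
      using flat[OF ab] by blast
  qed
  thus ?thesis by blast
qed

end

context graph_over_tree
begin

lemma is_cut_translate:
  assumes R: "adm R" and g: "g \<in> carrier \<Gamma>" and xy: "x \<in> V" "y \<in> V" and c: "is_cut E R x y c"
  shows "is_cut E R (act g x) (act g y) (\<lambda>z. c (act (inv g) z))"
proof -
  have ig: "inv g \<in> carrier \<Gamma>" using g by simp
  have eq: "(act (inv g) a, z) \<in> R \<longleftrightarrow> (a, act g z) \<in> R" if "a \<in> V" "z \<in> V" for a z
    using adm_act_eq[OF R g act_closed[OF ig that(1)] that(2)] that g by (simp add: act_inv2)
  show ?thesis unfolding is_cut_def
  proof (intro conjI ballI; clarify)
    fix a b assume "(a, b) \<in> R"
    thus "c (act (inv g) a) = c (act (inv g) b)" using c adm_act[OF R ig] by (fastforce simp: is_cut_def)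
  next
    fix a b assume ab: "(a, b) \<in> E"
    have "(act (inv g) a, act (inv g) b) \<in> E" using E_act[OF ab ig] .
    thus "(c (act (inv g) a) \<noteq> c (act (inv g) b)) = ((a, act g x) \<in> R \<and> (b, act g y) \<in> R \<or> (a, act g y) \<in> R \<and> (b, act g x) \<in> R)"
      using c EVD[OF ab] xy eq by (auto simp: is_cut_def)
  qed
qed

lemma is_cut_sym: "is_cut E R x y c \<Longrightarrow> is_cut E R y x c"
  by (auto simp: is_cut_def)

lemma is_cut_equiv:
  assumes R: "adm R" and xy: "(x, x') \<in> R" "(y, y') \<in> R" and c: "is_cut E R x y c"
  shows "is_cut E R x' y' c"
proof -
  have "(a, x) \<in> R \<longleftrightarrow> (a, x') \<in> R" "(a, y) \<in> R \<longleftrightarrow> (a, y') \<in> R" for a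
    using xy adm_trans[OF R] adm_sym[OF R] by meson+
  thus ?thesis using c by (simp add: is_cut_def)
qed

end

context fold_step
begin

text \<open>At all edges other than the folded ones a cut of the folded graph is a cut of the original
  graph. At the edge \<open>{u, v1}\<close> it is corrected by the isolating cut at \<open>{u, v2}\<close>.\<close>

lemma cuts_pull_back:
  assumes t: tight and s: "v2 \<notin> bigR R" and d: "(v1, v2) \<notin> vE R"
    and cuts: "\<And>x y. (x, y) \<in> E \<Longrightarrow> \<exists>c. is_cut E R1 x y c" and xy: "(x, y) \<in> E"
  shows "\<exists>c. is_cut E R x y c"
proof -
  obtain D where D: "is_cut E R u v2 D" using isolating_cut[OF t s d cuts] by blast
  have vne: "(act h v1, v2) \<notin> R" if "h \<in> carrier \<Gamma>" for h using d that uVs by (auto simp: vE_iff)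
  have e2c: "\<exists>c. is_cut E R x y c" if "h \<in> carrier \<Gamma>" "(act h u, x) \<in> R" "(act h v2, y) \<in> R" for x y h
    using is_cut_equiv[OF R that(2,3) is_cut_translate[OF R that(1) uVs(1) uVs(4) D]] by blast
  have e1c: "\<exists>c. is_cut E R u v1 c"
  proof -
    obtain c where c: "is_cut E R1 u v1 c" using cuts e1 by blast
    \<comment> \<open>The exclusive or removes the crossing at \<open>{u, v2}\<close>.\<close>
    have "is_cut E R u v1 (\<lambda>z. c z \<noteq> D z)"
      unfolding is_cut_def
    proof (intro conjI ballI; clarify)
      fix a b assume ab: "(a, b) \<in> R"
      have "c a = c b" "D a = D b" using c D ab RR1[OF ab] by (auto simp: is_cut_def)
      thus "(c a \<noteq> D a) = (c b \<noteq> D b)" by simp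
    next
      fix a b assume ab: "(a, b) \<in> E"
      have cc: "(c a \<noteq> c b) = ((a, u) \<in> R1 \<and> (b, v1) \<in> R1 \<or> (a, v1) \<in> R1 \<and> (b, u) \<in> R1)"
        using c ab by (auto simp: is_cut_def)
      have DD: "(D a \<noteq> D b) = ((a, u) \<in> R \<and> (b, v2) \<in> R \<or> (a, v2) \<in> R \<and> (b, u) \<in> R)"
        using D ab by (auto simp: is_cut_def)
      have up: "(p, u) \<in> R1 \<and> (q, v1) \<in> R1 \<longleftrightarrow> (p, u) \<in> R \<and> ((q, v1) \<in> R \<or> (q, v2) \<in> R)" if pq: "(p, q) \<in> E" for p q
      proof
        assume "(p, u) \<in> R \<and> ((q, v1) \<in> R \<or> (q, v2) \<in> R)"
        thus "(p, u) \<in> R1 \<and> (q, v1) \<in> R1" using RR1 R1_rules(3)[OF _ R1_rules(2)[OF v12_R1]] by blast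
      next
        assume a: "(p, u) \<in> R1 \<and> (q, v1) \<in> R1"
        show "(p, u) \<in> R \<and> ((q, v1) \<in> R \<or> (q, v2) \<in> R)"
          using t pq e1 a[THEN conjunct1] a[THEN conjunct2]
        proof (cases rule: identified)
          case 1 thus ?thesis by blast
        next
          case (2 h w w')
          have pu: "(p, u) \<in> R" by (rule tR[OF sR[OF 2(2)] 2(3)])
          have w: "w \<in> {v1, v2}" "w' \<in> {v1, v2}" using 2(4) by auto
          have w'1: "w' = v1" 
          proof (rule ccontr)
            assume "w' \<noteq> v1"
            hence "(act h v2, v1) \<in> R" using 2(6) w by auto
            hence "(v2, v1) \<in> vE R" using 2(1) uVs by (auto simp: vE_iff)
            thus False using d vs by blast
          qed
          hence hv1: "(act h v1, v1) \<in> R" using 2(6) by simp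
          have "(act h v2, v2) \<in> R"
          proof -
            have "(act h u', u') \<in> Rm" by (rule tM[OF sM[OF aM[OF 2(1) mR[OF uu']]] tM[OF mR[OF 2(3)] mR[OF uu']]])
            moreover have "(act h v2, v2) \<in> Rm" by (rule tM[OF sM[OF aM[OF 2(1) vm]] tM[OF mR[OF hv1] vm]])
            ultimately show ?thesis using stab[OF e2 2(1)] zR by blast
          qed
          hence "(act h w, w) \<in> R" using w hv1 by auto
          hence "(q, w) \<in> R" using tR[OF sR[OF 2(5)]] by blast
          thus ?thesis using w pu by auto
        next
          case (3 h w w')
          have w: "w' = v1 \<or> w' = v2" using 3(4) by auto
          have "(act h w', act h v1) \<in> Rm"
            using w Rm_rules(1)[OF act_closed[OF 3(1) uVs(3)]] sM[OF aM[OF 3(1) vm]] by auto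
          hence "(act h v1, u) \<in> Rm" using tM[OF sM _] mR[OF 3(6)] by blast
          thus ?thesis using noinv[OF e1 3(1) mR[OF 3(3)]] by blast
        qed
      qed
      have n12: "\<not> ((q, v1) \<in> R \<and> (q, v2) \<in> R)" for q using vR tR[OF sR] by blast
      have nuv: "\<not> ((q, u) \<in> R \<and> (q, v1) \<in> R)" for q
        using noloop[OF e1] mR tR[OF sR] by blast
      have nuv2: "\<not> ((q, u) \<in> R \<and> (q, v2) \<in> R)" for q
        using noloop[OF e2] mR tR[OF sR] tR[OF uu'] tR[OF sR[OF uu']] by meson
      show "((c a \<noteq> D a) \<noteq> (c b \<noteq> D b)) = ((a, u) \<in> R \<and> (b, v1) \<in> R \<or> (a, v1) \<in> R \<and> (b, u) \<in> R)"
        using cc DD up[OF ab] up[OF symE[OF ab]] n12[of a] n12[of b] nuv[of a] nuv[of b] nuv2[of a] nuv2[of b] by argo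
    qed
    thus ?thesis by blast
  qed
  have e1c': "\<exists>c. is_cut E R x y c" if "h \<in> carrier \<Gamma>" "(act h u, x) \<in> R" "(act h v1, y) \<in> R" for x y h
    using e1c is_cut_equiv[OF R that(2,3) is_cut_translate[OF R that(1) uVs(1) uVs(3)]] by blast
  have one: "\<exists>c. is_cut E R x y c" if "h \<in> carrier \<Gamma>" "(act h u, x) \<in> R" "(act h w, y) \<in> R" "{w, w'} = {v1, v2}" for x y h w w'
  proof -
    have "w = v1 \<or> w = v2" using that(4) by auto
    thus ?thesis using e1c'[OF that(1,2)] e2c[OF that(1,2)] that(3) by auto
  qed
  show ?thesis
  proof (rule ccontr)
    assume no: "\<nexists>c. is_cut E R x y c"
    obtain c where c: "is_cut E R1 x y c" using cuts xy by blast
    have "(a, x) \<in> R \<and> (b, y) \<in> R" if ab: "(a, b) \<in> E" and r1: "(a, x) \<in> R1" "(b, y) \<in> R1" for a b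
      using t ab xy r1
    proof (cases rule: identified)
      case (2 h w w')
      thus ?thesis using one[OF 2(1,3,6), of w] no by (auto simp: insert_commute)
    next
      case (3 h w w')
      have "\<exists>c. is_cut E R y x c" using one[OF 3(1,3,6), of w] 3(4) by (auto simp: insert_commute)
      thus ?thesis using no is_cut_sym by blast
    qed auto
    hence eq: "(a, x) \<in> R1 \<and> (b, y) \<in> R1 \<longleftrightarrow> (a, x) \<in> R \<and> (b, y) \<in> R" if "(a, b) \<in> E" for a b
      using that RR1 by blast
    have "is_cut E R x y c"
      unfolding is_cut_def
    proof (intro conjI ballI; clarify)
      fix a b assume "(a, b) \<in> R"
      hence "(a, b) \<in> R1" by (rule RR1)
      thus "c a = c b" using c by (auto simp: is_cut_def)
    next
      fix a b assume ab: "(a, b) \<in> E"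
      have "(c a \<noteq> c b) = ((a, x) \<in> R1 \<and> (b, y) \<in> R1 \<or> (a, y) \<in> R1 \<and> (b, x) \<in> R1)"
        using c ab by (auto simp: is_cut_def)
      thus "(c a \<noteq> c b) = ((a, x) \<in> R \<and> (b, y) \<in> R \<or> (a, y) \<in> R \<and> (b, x) \<in> R)"
        using eq[OF ab] eq[OF symE[OF ab]] by argo
    qed
    thus False using no by blast
  qed
qed

end

context graph_over_tree
begin

text \<open>Induction on the number of edge orbits, which every fold lowers. A fold within one vertex
  orbit lowers the defect. A fold that merges two big orbits lowers the number of big orbits. Any
  other fold has an end \<open>v2\<close> (or \<open>v1\<close>, by symmetry) that is small, and cuts pull back along it, so
  that nothing but folds of a tree onto a tree can leave both quantities constant.\<close>

theorem folding:
  assumes "adm R"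
  shows "defect \<Gamma> act V E Rm \<le> defect \<Gamma> act V E R \<and>
    (defect \<Gamma> act V E Rm = defect \<Gamma> act V E R \<longrightarrow>
      num_big \<Gamma> act V E Rm \<le> num_big \<Gamma> act V E R \<and>
      (num_big \<Gamma> act V E Rm = num_big \<Gamma> act V E R \<longrightarrow> (\<forall>(x, y)\<in>E. \<exists>c. is_cut E R x y c)))"
    (is "?P R")
  using assms
proof (induction "num_edge \<Gamma> act E R" arbitrary: R rule: less_induct)
  case less
  show ?case
  proof (cases "\<exists>u v1 u' v2. (u, v1) \<in> E \<and> (u', v2) \<in> E \<and> (u, u') \<in> R \<and> (v1, v2) \<in> Rm \<and> (v1, v2) \<notin> R")
    case False
    hence "R = Rm" using immersion_imp_eq[OF less.prems] by blast
    thus ?thesis using cutm by auto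
  next
    case True
    then obtain u v1 u' v2 where f: "(u, v1) \<in> E" "(u', v2) \<in> E" "(u, u') \<in> R" "(v1, v2) \<in> Rm" "(v1, v2) \<notin> R" by blast
    interpret F: fold_step \<Gamma> V act E R0 Rm R u u' v1 v2 by unfold_locales (use f less.prems in auto)
    interpret F': fold_step \<Gamma> V act E R0 Rm R u' u v2 v1 by (rule F.mutual)
    have R1': "F'.R1 = F.R1" by (simp add: F.R1_def F'.R1_def fold_rel_commute)
    have K': "F'.K = F.K" by (simp add: F.K_def F'.K_def insert_commute)
    have "num_edge \<Gamma> act E F.R1 < num_edge \<Gamma> act E R" using F.num_edge_R1(1) by simp
    note IH = less.hyps[OF this F.R1]
    have le: "defect \<Gamma> act V E F.R1 \<le> defect \<Gamma> act V E R"
      using F.num_edge_R1(1) F.num_vert_R1(1) by (simp add: defect_def)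
    show ?thesis
    proof (cases "defect \<Gamma> act V E Rm = defect \<Gamma> act V E R")
      case False thus ?thesis using IH le by auto
    next
      case True
      hence eq: "defect \<Gamma> act V E Rm = defect \<Gamma> act V E F.R1" "defect \<Gamma> act V E F.R1 = defect \<Gamma> act V E R"
        using IH le by auto
      have t: "F.tight" using F.num_edge_R1(1) F.num_vert_R1(1) eq(2) by (simp add: defect_def F.tight_def)
      hence t': "F'.tight" by (simp add: F.tight_def F'.tight_def R1')
      have d: "(v1, v2) \<notin> vE R"
        using F.num_edge_R1(1) F.num_vert_R1(2) eq(2) by (auto simp: defect_def)
      hence d': "(v2, v1) \<notin> vE R" using F.vs by blast
      have IHb: "num_big \<Gamma> act V E Rm \<le> num_big \<Gamma> act V E F.R1" using IH eq by auto
      show ?thesis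
      proof (cases "v1 \<in> F.bigR R \<and> v2 \<in> F.bigR R")
        case True
        thus ?thesis using IHb F.num_big_R1(1)[OF d] le eq by auto
      next
        case False
        have b: "num_big \<Gamma> act V E F.R1 \<le> num_big \<Gamma> act V E R"
        proof (cases "v1 \<in> F.bigR R \<or> v2 \<in> F.bigR R")
          case True
          thus ?thesis using F.num_big_R1(2)[OF d] F'.num_big_R1(2)[OF d'] R1' by auto
        next
          case F: False
          thus ?thesis using F.num_big_R1(2)[OF d] F.small_both[OF _ _ d] by auto
        qed
        have "\<exists>c. is_cut E R x y c" if nb: "num_big \<Gamma> act V E Rm = num_big \<Gamma> act V E R" and xy: "(x, y) \<in> E" for x y
        proof -
          have cuts: "\<And>x y. (x, y) \<in> E \<Longrightarrow> \<exists>c. is_cut E F.R1 x y c" using IH eq IHb b nb by auto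
          show ?thesis
          proof (cases "v2 \<in> F.bigR R")
            case True
            hence "v1 \<notin> F.bigR R" using False by blast
            thus ?thesis using F'.cuts_pull_back[OF t' _ d' _ xy] cuts R1' by auto
          next
            case False thus ?thesis using F.cuts_pull_back[OF t _ d _ xy] cuts by auto
          qed
        qed
        thus ?thesis using IHb b eq le by auto
      qed
    qed
  qed
qed

end

section \<open>Trees\<close>

text \<open>Trees are described by cuts, which can be restricted to connected subgraphs and, being
  functions, can be taken to quotients and limits.\<close>

locale ctree =
  fixes V :: "'x set" and E :: "('x \<times> 'x) set"
  assumes EV: "E \<subseteq> V \<times> V" and symE: "(x, y) \<in> E \<Longrightarrow> (y, x) \<in> E" and irreflE: "(x, x) \<notin> E"
    and connE: "x \<in> V \<Longrightarrow> y \<in> V \<Longrightarrow> (x, y) \<in> E\<^sup>*"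
    and cutE: "(x, y) \<in> E \<Longrightarrow> \<exists>c. is_cut E Id x y c"
begin

lemma EVD: "(x, y) \<in> E \<Longrightarrow> x \<in> V" "(x, y) \<in> E \<Longrightarrow> y \<in> V"
  using EV by auto

lemma is_cut_IdD: "is_cut E Id x y c \<Longrightarrow> (a, b) \<in> E \<Longrightarrow> (c a \<noteq> c b) = (a = x \<and> b = y \<or> a = y \<and> b = x)"
  by (auto simp: is_cut_def)

lemma is_cut_IdI: "(\<And>a b. (a, b) \<in> E \<Longrightarrow> (c a \<noteq> c b) = (a = x \<and> b = y \<or> a = y \<and> b = x)) \<Longrightarrow> is_cut E Id x y c"
  by (auto simp: is_cut_def)

text \<open>\<open>beyond x y\<close> is the half-tree that the edge from \<open>x\<close> to \<open>y\<close> points to.\<close>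

definition beyond :: "'x \<Rightarrow> 'x \<Rightarrow> 'x \<Rightarrow> bool" where
  "beyond x y = (SOME c. is_cut E Id x y c \<and> c y)"

lemma beyond_cut: assumes "(x, y) \<in> E" shows "is_cut E Id x y (beyond x y)" "beyond x y y"
proof -
  obtain c where c: "is_cut E Id x y c" using cutE[OF assms] by blast
  have "is_cut E Id x y (\<lambda>z. \<not> c z)" by (rule is_cut_IdI) (use is_cut_IdD[OF c] in blast)
  hence "\<exists>c. is_cut E Id x y c \<and> c y" using c by (cases "c y") auto
  from someI_ex[OF this] show "is_cut E Id x y (beyond x y)" "beyond x y y"
    unfolding beyond_def by blast+
qed

lemma beyond_edge:
  assumes "(x, y) \<in> E" "(a, b) \<in> E"
  shows "beyond x y a \<noteq> beyond x y b \<longleftrightarrow> a = x \<and> b = y \<or> a = y \<and> b = x"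
  by (rule is_cut_IdD[OF beyond_cut(1)[OF assms(1)] assms(2)])

lemma not_beyond_start: "(x, y) \<in> E \<Longrightarrow> \<not> beyond x y x"
  using beyond_edge[of x y x y] beyond_cut(2) by auto

lemma beyond_unique:
  assumes "(x, y) \<in> E" "is_cut E Id x y c" "c y" "z \<in> V"
  shows "c z = beyond x y z"
proof -
  have "(y, z) \<in> E\<^sup>*" using connE assms EVD by blast
  thus ?thesis
  proof (induction rule: rtrancl_induct)
    case base thus ?case using assms beyond_cut by auto
  next
    case (step a b)
    have "(c a \<noteq> c b) = (beyond x y a \<noteq> beyond x y b)" 
      using beyond_edge[OF assms(1) step(2)] is_cut_IdD[OF assms(2) step(2)] by argo
    thus ?case using step(3) by auto
  qed
qed

lemma beyond_swap:
  assumes "(x, y) \<in> E" "z \<in> V" shows "beyond y x z = (\<not> beyond x y z)"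
proof -
  have "is_cut E Id y x (\<lambda>z. \<not> beyond x y z)" 
    by (rule is_cut_IdI) (use beyond_edge[OF assms(1)] in blast)
  from beyond_unique[OF symE[OF assms(1)] this _ assms(2)] not_beyond_start[OF assms(1)] show ?thesis by auto
qed

text \<open>Leaving an intersection of two branches at \<open>x\<close> means crossing one of the two edges.\<close>

lemma branches_disjoint:
  assumes "(x, y) \<in> E" "(x, y') \<in> E" "y \<noteq> y'" "z \<in> V"
  shows "\<not> (beyond x y z \<and> beyond x y' z)"
proof
  assume b: "beyond x y z \<and> beyond x y' z"
  have "beyond x y w \<and> beyond x y' w" if "(z, w) \<in> E\<^sup>*" for w
    using that
  proof (induction rule: rtrancl_induct)
    case base thus ?case using b .
  next
    case (step p q)
    have *: "p \<noteq> x" using step(3) not_beyond_start[OF assms(1)] by auto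
    have 1: "beyond x y q"
    proof (rule ccontr)
      assume "\<not> beyond x y q"
      hence "p = y" using beyond_edge[OF assms(1) step(2)] step(3) * by auto
      hence "beyond x y' y" using step(3) by simp
      thus False using beyond_edge[OF assms(2,1)] assms(3) not_beyond_start[OF assms(2)] irreflE assms(1,2) by auto
    qed
    have 2: "beyond x y' q"
    proof (rule ccontr)
      assume "\<not> beyond x y' q"
      hence "p = y'" using beyond_edge[OF assms(2) step(2)] step(3) * by auto
      hence "beyond x y y'" using step(3) by simp
      thus False using beyond_edge[OF assms(1,2)] assms(3) not_beyond_start[OF assms(1)] irreflE assms(1,2) by auto
    qed
    show ?case using 1 2 by blast
  qed
  from this[OF connE[OF assms(4) EVD(1)[OF assms(1)]]] show False using not_beyond_start[OF assms(1)] by auto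
qed

lemma first_edge:
  assumes "z \<in> V" "w \<in> V" "z \<noteq> w" shows "\<exists>z'. (z, z') \<in> E \<and> beyond z z' w"
proof -
  have "(z, w) \<in> E\<^sup>*" using connE assms by blast
  hence "z = w \<or> (\<exists>z'. (z, z') \<in> E \<and> beyond z z' w)"
  proof (induction rule: rtrancl_induct)
    case base thus ?case by simp
  next
    case (step a b)
    show ?case
    proof (cases "z = b \<or> z = a")
      case True thus ?thesis using step(2) beyond_cut(2) by auto
    next
      case False
      then obtain z' where z': "(z, z') \<in> E" "beyond z z' a" using step(3) by auto
      hence "beyond z z' b" using beyond_edge[OF z'(1) step(2)] False by auto
      thus ?thesis using z' by auto
    qed
  qed
  thus ?thesis using assms by blast
qed

text \<open>Induction along the geodesic from \<open>a\<close> to \<open>b\<close>, without mentioning paths.\<close>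

lemma geodesic_induct [consumes 2, case_names refl step]:
  assumes a: "a \<in> V" and b: "b \<in> V" and refl: "P b"
    and step: "\<And>a a'. (a, a') \<in> E \<Longrightarrow> beyond a a' b \<Longrightarrow> P a' \<Longrightarrow> P a"
  shows "P a"
proof -
  have "P a" if "(a, b) \<in> E ^^ n" "a \<in> V" for n a
    using that
  proof (induction n arbitrary: a rule: less_induct)
    case (less n)
    show ?case
    proof (cases "a = b")
      case False
      then obtain a' where a': "(a, a') \<in> E" "beyond a a' b" using first_edge less.prems b by blast
      obtain p where p: "p 0 = a" "p n = b" "\<forall>i<n. (p i, p (Suc i)) \<in> E"
        using less.prems relpow_fun_conv[of a b n E] by auto
      have "\<exists>i<n. \<not> beyond a a' (p i) \<and> beyond a a' (p (Suc i))"
      proof (rule ccontr)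
        assume no: "\<not> ?thesis"
        have "\<not> beyond a a' (p i)" if "i \<le> n" for i
          using that
        proof (induction i)
          case 0 thus ?case using not_beyond_start[OF a'(1)] p(1) by simp
        next
          case (Suc i) thus ?case using no by (auto simp: Suc_le_eq)
        qed
        thus False using p(2) a'(2) by auto
      qed
      then obtain i where i: "i < n" "\<not> beyond a a' (p i)" "beyond a a' (p (Suc i))" by blast
      hence "p (Suc i) = a'" using beyond_edge[OF a'(1), of "p i" "p (Suc i)"] p(3) not_beyond_start[OF a'(1)] by auto
      hence "(a', b) \<in> E ^^ (n - Suc i)"
        unfolding relpow_fun_conv using p i by (intro exI[of _ "\<lambda>k. p (Suc i + k)"]) auto
      hence "P a'" using less.IH[of "n - Suc i" a'] i(1) EVD[OF a'(1)] by auto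
      thus ?thesis using step a' by blast
    qed (use refl in simp)
  qed
  moreover obtain n where "(a, b) \<in> E ^^ n" using connE[OF a b] rtrancl_imp_relpow by blast
  ultimately show ?thesis using a by blast
qed

text \<open>The vertices on the geodesic from \<open>a\<close> to \<open>b\<close>: an intersection of half-trees.\<close>

definition interval :: "'x \<Rightarrow> 'x \<Rightarrow> 'x set" where
  "interval a b = {t\<in>V. \<forall>(x, y)\<in>E. beyond x y a \<and> beyond x y b \<longrightarrow> beyond x y t}"

lemma intervalD: "t \<in> interval a b \<Longrightarrow> (x, y) \<in> E \<Longrightarrow> beyond x y a \<Longrightarrow> beyond x y b \<Longrightarrow> beyond x y t"
  and interval_V: "t \<in> interval a b \<Longrightarrow> t \<in> V"
  by (auto simp: interval_def)

lemma intervalI: "t \<in> V \<Longrightarrow> (\<And>x y. (x, y) \<in> E \<Longrightarrow> beyond x y a \<Longrightarrow> beyond x y b \<Longrightarrow> beyond x y t) \<Longrightarrow> t \<in> interval a b"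
  by (auto simp: interval_def)

lemma interval_ends: "a \<in> V \<Longrightarrow> a \<in> interval a b" "b \<in> V \<Longrightarrow> b \<in> interval a b"
  by (auto simp: interval_def)

lemma interval_commute: "interval a b = interval b a"
  by (auto simp: interval_def)

lemma interval_same: assumes "a \<in> V" shows "interval a a = {a}"
proof -
  have "t = a" if t: "t \<in> interval a a" for t
  proof (rule ccontr)
    assume "t \<noteq> a"
    then obtain t' where "(t, t') \<in> E" "beyond t t' a" using first_edge interval_V[OF t] assms by blast
    thus False using intervalD[OF t] not_beyond_start by blast
  qed
  thus ?thesis using interval_ends[OF assms] by auto
qed

lemma interval_sub: assumes "t \<in> interval a b" shows "interval a t \<subseteq> interval a b"
  using assms by (auto simp: interval_def)

lemma interval_step:
  assumes e: "(a, a') \<in> E" and b: "beyond a a' b" "b \<in> V"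
  shows "interval a b = insert a (interval a' b)"
proof
  have a'I: "a' \<in> interval a b"
  proof (rule intervalI)
    show "a' \<in> V" using EVD[OF e] by simp
    fix x y assume xy: "(x, y) \<in> E" "beyond x y a" "beyond x y b"
    show "beyond x y a'"
    proof (rule ccontr)
      assume "\<not> beyond x y a'"
      hence "x = a' \<and> y = a" using beyond_edge[OF xy(1) e] xy(2) not_beyond_start[OF xy(1)] by auto
      thus False using xy b beyond_swap[OF e b(2)] by auto
    qed
  qed
  show "insert a (interval a' b) \<subseteq> interval a b"
    using interval_ends[of a b] EVD[OF e] interval_sub[of a' b a] a'I by (auto simp: interval_commute)
  show "interval a b \<subseteq> insert a (interval a' b)"
  proof
    fix t assume t: "t \<in> interval a b"
    show "t \<in> insert a (interval a' b)"
    proof (cases "t = a")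
      case False
      then obtain a'' where a'': "(a, a'') \<in> E" "beyond a a'' t" using first_edge interval_V[OF t] EVD[OF e] by blast
      have "a'' = a'"
      proof (rule ccontr)
        assume n: "a'' \<noteq> a'"
        have "\<not> beyond a a'' b" using branches_disjoint[OF e a''(1) _ b(2)] b(1) n by auto
        hence "beyond a'' a b" using beyond_swap[OF a''(1) b(2)] by simp
        hence "beyond a'' a t" using intervalD[OF t symE[OF a''(1)]] beyond_cut(2)[OF symE[OF a''(1)]] by blast
        thus False using a''(2) beyond_swap[OF a''(1) interval_V[OF t]] by simp
      qed
      hence bt: "beyond a a' t" using a'' by simp
      have "beyond x y t" if xy: "(x, y) \<in> E" "beyond x y a'" "beyond x y b" for x y
      proof (cases "beyond x y a")
        case True thus ?thesis using intervalD[OF t xy(1) True xy(3)] by simp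
      next
        case False
        hence "x = a \<and> y = a'" using beyond_edge[OF xy(1) e] xy(2) beyond_cut(2)[OF xy(1)] by auto
        thus ?thesis using bt by simp
      qed
      thus ?thesis using interval_V[OF t] by (auto simp: interval_def)
    qed simp
  qed
qed

lemma finite_interval: assumes "a \<in> V" "b \<in> V" shows "finite (interval a b)"
  using assms
proof (induction rule: geodesic_induct)
  case refl thus ?case using interval_same[OF assms(2)] by simp
next
  case (step a a')
  thus ?case using interval_step assms(2) by simp
qed

text \<open>Geodesics are paths.\<close>

lemma interval_connected:
  assumes "a \<in> V" "b \<in> V" shows "(a, b) \<in> (E \<inter> interval a b \<times> interval a b)\<^sup>*"
  using assms
proof (induction rule: geodesic_induct)
  case refl thus ?case by simp
next
  case (step a a')
  have "interval a b = insert a (interval a' b)" using interval_step step assms(2) by simp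
  moreover have "a' \<in> interval a' b" using interval_ends EVD[OF step(1)] by auto
  ultimately have "(a, a') \<in> E \<inter> interval a b \<times> interval a b"
    "E \<inter> interval a' b \<times> interval a' b \<subseteq> E \<inter> interval a b \<times> interval a b" using step by auto
  thus ?case using step(3) rtrancl_mono by (meson converse_rtrancl_into_rtrancl in_mono)
qed

lemma interval_edge_separates:
  assumes "t \<in> interval a b" "t' \<in> interval a b" "(t, t') \<in> E" "a \<in> V" "b \<in> V"
  shows "beyond t t' a \<noteq> beyond t t' b"
proof
  assume "beyond t t' a = beyond t t' b"
  hence "beyond t t' a \<and> beyond t t' b \<or> beyond t' t a \<and> beyond t' t b"
    using beyond_swap[OF assms(3)] assms(4,5) by auto
  hence "beyond t t' t \<or> beyond t' t t'"
    using intervalD[OF assms(1,3)] intervalD[OF assms(2) symE[OF assms(3)]] by blast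
  thus False using not_beyond_start assms(3) symE by blast
qed

lemma interval_connected_mono:
  assumes "t \<in> interval a b" "a \<in> V" shows "(a, t) \<in> (E \<inter> interval a b \<times> interval a b)\<^sup>*"
proof -
  have "E \<inter> interval a t \<times> interval a t \<subseteq> E \<inter> interval a b \<times> interval a b"
    using interval_sub[OF assms(1)] by auto
  thus ?thesis using interval_connected[OF assms(2) interval_V[OF assms(1)]] rtrancl_mono by blast
qed

lemma subtree:
  assumes "Y \<subseteq> V" "\<And>x y. x \<in> Y \<Longrightarrow> y \<in> Y \<Longrightarrow> (x, y) \<in> (E \<inter> Y \<times> Y)\<^sup>*"
  shows "ctree Y (E \<inter> Y \<times> Y)"
proof
  fix x y assume "(x, y) \<in> E \<inter> Y \<times> Y"
  hence "is_cut E Id x y (beyond x y)" using beyond_cut by blast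
  hence "is_cut (E \<inter> Y \<times> Y) Id x y (beyond x y)" by (auto simp: is_cut_def)
  thus "\<exists>c. is_cut (E \<inter> Y \<times> Y) Id x y c" by blast
qed (use assms symE irreflE in auto)

text \<open>Geodesics do not branch.\<close>

lemma direction_unique:
  assumes "(t, t') \<in> E" "(t, t'') \<in> E" "beyond t t' a" "beyond t t'' a" "a \<in> V"
  shows "t' = t''"
  using branches_disjoint[OF assms(1,2) _ assms(5)] assms(3,4) by blast

end

locale ctree_act = ctree V E + gact \<Gamma> V act for V :: "'x set" and E and \<Gamma> :: "'g monoid" (structure) and act +
  assumes invE: "invariant_rel \<Gamma> act E"
    and noinvE: "(x, y) \<in> E \<Longrightarrow> g \<in> carrier \<Gamma> \<Longrightarrow> act g x = y \<Longrightarrow> act g y \<noteq> x"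
begin

lemma E_act: "(x, y) \<in> E \<Longrightarrow> g \<in> carrier \<Gamma> \<Longrightarrow> (act g x, act g y) \<in> E"
  using invariant_relD[OF invE] by blast

lemma beyond_act:
  assumes "(x, y) \<in> E" "g \<in> carrier \<Gamma>" "z \<in> V"
  shows "beyond (act g x) (act g y) (act g z) = beyond x y z"
proof -
  have "is_cut E Id x y (\<lambda>z. beyond (act g x) (act g y) (act g z))"
  proof (rule is_cut_IdI)
    fix a b assume ab: "(a, b) \<in> E"
    show "(beyond (act g x) (act g y) (act g a) \<noteq> beyond (act g x) (act g y) (act g b)) = (a = x \<and> b = y \<or> a = y \<and> b = x)"
      using beyond_edge[OF E_act[OF assms(1,2)] E_act[OF ab assms(2)]] act_inj[OF assms(2)] EVD[OF ab] EVD[OF assms(1)] by simp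
  qed
  from beyond_unique[OF assms(1) this _ assms(3)] beyond_cut(2)[OF E_act[OF assms(1,2)]] show ?thesis by simp
qed

lemma interval_act:
  assumes "g \<in> carrier \<Gamma>" "a \<in> V" "b \<in> V" "t \<in> interval a b" shows "act g t \<in> interval (act g a) (act g b)"
proof (rule intervalI)
  show "act g t \<in> V" using assms interval_V act_closed by blast
  fix x y assume xy: "(x, y) \<in> E" "beyond x y (act g a)" "beyond x y (act g b)"
  let ?x = "act (inv g) x" and ?y = "act (inv g) y"
  have g: "act g ?x = x" "act g ?y = y" using act_inv2 assms(1) EVD[OF xy(1)] by auto
  have e: "(?x, ?y) \<in> E" using E_act[OF xy(1)] assms(1) by simp
  have "beyond x y (act g z) = beyond ?x ?y z" if "z \<in> V" for z
    using beyond_act[OF e assms(1) that] g by simp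
  thus "beyond x y (act g t)" using intervalD[OF assms(4) e] xy(2,3) assms interval_V by simp
qed

text \<open>An element that fixes \<open>a\<close> and \<open>b\<close> fixes the first edge towards \<open>b\<close> by uniqueness, and so on.\<close>

lemma fixes_interval:
  assumes "g \<in> carrier \<Gamma>" "a \<in> V" "b \<in> V" "act g a = a" "act g b = b" "t \<in> interval a b"
  shows "act g t = t"
  using assms(2,3,4,6)
proof (induction arbitrary: t rule: geodesic_induct)
  case refl thus ?case using interval_same assms by auto
next
  case (step a a')
  have "beyond (act g a) (act g a') (act g b)" using beyond_act[OF step(1) assms(1,3)] step(2) by simp
  hence "beyond a (act g a') b" "(a, act g a') \<in> E" using step assms(5) E_act[OF step(1) assms(1)] by auto
  hence "act g a' = a'" using direction_unique[OF _ step(1) _ step(2) assms(3)] by blast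
  thus ?case using step interval_step[OF step(1,2) assms(3)] by auto
qed

end

text \<open>A connected vertex set is enlarged by one vertex at a time, with an edge that \<open>D\<close> contains in
  both orientations.\<close>

lemma connected_card_edges:
  assumes "finite Q" "Q \<noteq> {}" "D \<subseteq> Q \<times> Q" "sym D" and conn: "\<And>x y. x \<in> Q \<Longrightarrow> y \<in> Q \<Longrightarrow> (x, y) \<in> D\<^sup>*"
  shows "2 * card Q \<le> card D + 2"
proof -
  have finD: "finite D" using assms finite_subset by blast
  have "\<exists>A. A \<subseteq> Q \<and> card A = Suc n \<and> 2 * Suc n \<le> card (D \<inter> A \<times> A) + 2" if "Suc n \<le> card Q" for n
    using that
  proof (induction n)
    case 0
    obtain q where "q \<in> Q" using assms by auto
    thus ?case by (intro exI[of _ "{q}"]) auto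
  next
    case (Suc n)
    then obtain A where A: "A \<subseteq> Q" "card A = Suc n" "2 * Suc n \<le> card (D \<inter> A \<times> A) + 2" by auto
    have "A \<noteq> Q" using A Suc.prems by auto
    then obtain b where b: "b \<in> Q" "b \<notin> A" using A by auto
    obtain a where a: "a \<in> A" using A by fastforce
    have "\<exists>p q. (p, q) \<in> D \<and> p \<in> A \<and> q \<notin> A"
    proof (rule ccontr)
      assume n: "\<not> ?thesis"
      have "(a, b) \<in> D\<^sup>*" using conn a A b by blast
      hence "b \<in> A" by (induction rule: rtrancl_induct) (use a n in auto)
      thus False using b by simp
    qed
    then obtain p q where pq: "(p, q) \<in> D" "p \<in> A" "q \<notin> A" by blast
    have fA: "finite A" using A(2) by (metis card.infinite nat.distinct(1))
    let ?B = "insert q A"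
    have "insert (p, q) (insert (q, p) (D \<inter> A \<times> A)) \<subseteq> D \<inter> ?B \<times> ?B"
      using pq assms(4) by (auto simp: sym_def)
    hence "card (insert (p, q) (insert (q, p) (D \<inter> A \<times> A))) \<le> card (D \<inter> ?B \<times> ?B)"
      using finD by (intro card_mono) auto
    moreover have "card (insert (p, q) (insert (q, p) (D \<inter> A \<times> A))) = card (D \<inter> A \<times> A) + 2"
      using pq finD by (subst card_insert_disjoint; auto)+
    ultimately have "2 * Suc (Suc n) \<le> card (D \<inter> ?B \<times> ?B) + 2" using A(3) by simp
    moreover have "card ?B = Suc (Suc n)" using A(2) fA pq by simp
    moreover have "?B \<subseteq> Q" using A pq assms(3) by auto
    ultimately show ?case by blast
  qed
  from this[of "card Q - 1"] obtain A where A: "A \<subseteq> Q" "card A = card Q" "2 * card Q \<le> card (D \<inter> A \<times> A) + 2"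
    using assms(1,2) by (metis One_nat_def Suc_pred card_gt_0_iff le_refl)
  moreover have "card (D \<inter> A \<times> A) \<le> card D" using finD by (intro card_mono) auto
  ultimately show ?thesis by simp
qed

text \<open>The graph of orbits is connected, so that its Euler characteristic is at most \<open>1\<close>. This makes
  the defect usable as a complexity.\<close>

lemma (in gact) defect_lower_bound:
  assumes ne: "V \<noteq> {}" and EV: "E \<subseteq> V \<times> V" and symE: "\<And>x y. (x, y) \<in> E \<Longrightarrow> (y, x) \<in> E"
    and invE: "invariant_rel \<Gamma> act E" and conn: "\<And>x y. x \<in> V \<Longrightarrow> y \<in> V \<Longrightarrow> (x, y) \<in> E\<^sup>*"
    and R: "equiv V R" "invariant_rel \<Gamma> act R"
    and fin: "finite (V // orb_rel \<Gamma> act V R)" "finite (E // edge_orb_rel \<Gamma> act E R)"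
  shows "- 2 \<le> defect \<Gamma> act V E R"
proof -
  let ?r = "orb_rel \<Gamma> act V R" and ?s = "edge_orb_rel \<Gamma> act E R"
  define cls where "cls x = ?r `` {x}" for x
  define D where "D = (\<lambda>(x, y). (cls x, cls y)) ` E"
  have eqr: "equiv V ?r" by (rule equiv_orb_rel[OF R])
  have eqs: "equiv E ?s" by (rule equiv_edge_orb_rel[OF R EV invE])
  have Q: "V // ?r = cls ` V" by (auto simp: quotient_def cls_def)
  have fsub: "D \<subseteq> (\<lambda>C. (\<lambda>(x, y). (cls x, cls y)) (SOME e. e \<in> C)) ` (E // ?s)"
  proof
    fix d assume "d \<in> D"
    then obtain x y where xy: "(x, y) \<in> E" "d = (cls x, cls y)" by (auto simp: D_def)
    have "(x, y) \<in> ?s `` {(x, y)}" using equiv_class_self[OF eqs xy(1)] .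
    hence "(SOME e. e \<in> ?s `` {(x, y)}) \<in> ?s `` {(x, y)}" by (rule someI)
    then obtain a b where ab: "(SOME e. e \<in> ?s `` {(x, y)}) = (a, b)" "((x, y), (a, b)) \<in> ?s" by (cases "SOME e. e \<in> ?s `` {(x, y)}") auto
    hence "(x, a) \<in> ?r" "(y, b) \<in> ?r" using EV by (auto simp: edge_orb_rel_iff orb_rel_def)
    hence "cls a = cls x" "cls b = cls y" unfolding cls_def using equiv_class_eq[OF eqr] by blast+
    thus "d \<in> (\<lambda>C. (\<lambda>(x, y). (cls x, cls y)) (SOME e. e \<in> C)) ` (E // ?s)"
      using xy ab by (intro image_eqI[of _ _ "?s `` {(x, y)}"]) (auto intro: quotientI)
  qed
  have "card D \<le> num_edge \<Gamma> act E R" unfolding num_edge_def by (rule surj_card_le[OF fin(2) fsub])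
  moreover have "2 * card (V // ?r) \<le> card D + 2"
  proof (rule connected_card_edges)
    show "D \<subseteq> (V // ?r) \<times> (V // ?r)" using EV unfolding Q D_def by auto
    show "sym D" using symE unfolding D_def sym_def by force
    fix X Y assume "X \<in> V // ?r" "Y \<in> V // ?r"
    then obtain x y where xy: "x \<in> V" "y \<in> V" "X = cls x" "Y = cls y" unfolding Q by auto
    have "(x, y) \<in> E\<^sup>*" using conn xy by blast
    hence "(cls x, cls y) \<in> D\<^sup>*"
      by (induction rule: rtrancl_induct) (auto simp: D_def intro: rtrancl_into_rtrancl)
    thus "(X, Y) \<in> D\<^sup>*" using xy by simp
  qed (use fin ne in \<open>auto simp: quotient_def\<close>)
  ultimately show ?thesis by (simp add: defect_def num_vert_def)
qed

section \<open>Subdividing a tree along an equivariant map\<close>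

lemma rtrancl_crossing:
  assumes "(x, y) \<in> r\<^sup>*" "\<not> P x" "P y"
  obtains p q where "(p, q) \<in> r" "\<not> P p" "P q"
  using assms by (induction rule: rtrancl_induct) blast+

text \<open>An equivariant map of vertices, thought of as linear on edges. The assumption \<open>edge_stab\<close> says
  that each edge \<open>(t, t')\<close> on the geodesic from \<open>F u\<close> to \<open>F v\<close> has no larger stabilizer than \<open>(u,
  v)\<close>.\<close>

locale tree_map = S: ctree_act VS ES \<Gamma> aS + T: ctree_act VT ET H aT
  for VS :: "'x set" and ES and \<Gamma> :: "'g monoid" and aS
    and VT :: "'y set" and ET and H :: "'h monoid" and aT +
  fixes \<phi> :: "'g \<Rightarrow> 'h" and F :: "'x \<Rightarrow> 'y"
  assumes hom: "\<phi> \<in> hom \<Gamma> H" and onto: "\<phi> ` carrier \<Gamma> = carrier H"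
    and neS: "VS \<noteq> {}"
    and F_closed: "v \<in> VS \<Longrightarrow> F v \<in> VT"
    and F_equiv: "g \<in> carrier \<Gamma> \<Longrightarrow> v \<in> VS \<Longrightarrow> F (aS g v) = aT (\<phi> g) (F v)"
    and edge_stab: "(u, v) \<in> ES \<Longrightarrow> (t, t') \<in> ET \<Longrightarrow> T.beyond t t' (F u) \<noteq> T.beyond t t' (F v) \<Longrightarrow>
      h \<in> carrier H \<Longrightarrow> aT h t = t \<Longrightarrow> aT h t' = t' \<Longrightarrow> \<exists>g\<in>carrier \<Gamma>. \<phi> g = h \<and> aS g u = u \<and> aS g v = v"
    and finVS: "finite (VS // orb_rel \<Gamma> aS VS (Id_on VS))"
    and finES: "finite (ES // edge_orb_rel \<Gamma> aS ES (Id_on VS))"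
begin

definition base :: "'x \<Rightarrow> 'x set \<times> 'y" where "base v = ({v}, F v)"

text \<open>A vertex of the subdivided tree is a pair of the simplex that carries it and its image in the
  target. An edge with a nondegenerate image is subdivided by the inner vertices of the geodesic
  between the images of its ends. A degenerate edge is not contracted but gets a midpoint, a
  so-called hair: folding its two halves leaves one vertex with one edge attached to the target,
  which does not change the Euler characteristic.\<close>

definition mids :: "('x set \<times> 'y) set" where
  "mids = {p. \<exists>u v. (u, v) \<in> ES \<and> fst p = {u, v} \<and> snd p \<in> T.interval (F u) (F v) \<and>
      (F u = F v \<or> snd p \<noteq> F u \<and> snd p \<noteq> F v)}"

definition pts :: "'x \<Rightarrow> 'x \<Rightarrow> ('x set \<times> 'y) set" where
  "pts u v = {base u, base v} \<union> {p \<in> mids. fst p = {u, v}}"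

definition V0 :: "('x set \<times> 'y) set" where "V0 = base ` VS \<union> mids"

definition adj :: "'x \<Rightarrow> 'x \<Rightarrow> 'x set \<times> 'y \<Rightarrow> 'x set \<times> 'y \<Rightarrow> bool" where
  "adj u v p q \<longleftrightarrow> (snd p, snd q) \<in> ET \<or> F u = F v \<and> (fst p = {u, v}) \<noteq> (fst q = {u, v})"

text \<open>On a degenerate edge exactly the hair is adjacent to the two ends.\<close>

definition E0 :: "(('x set \<times> 'y) \<times> ('x set \<times> 'y)) set" where
  "E0 = {(p, q). \<exists>u v. (u, v) \<in> ES \<and> p \<in> pts u v \<and> q \<in> pts u v \<and> adj u v p q}"

definition act0 :: "'g \<Rightarrow> 'x set \<times> 'y \<Rightarrow> 'x set \<times> 'y" where
  "act0 g p = (aS g ` fst p, aT (\<phi> g) (snd p))"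

definition hair :: "'x set \<times> 'y \<Rightarrow> bool" where
  "hair p \<longleftrightarrow> (\<exists>u v. (u, v) \<in> ES \<and> F u = F v \<and> fst p = {u, v})"

definition N :: "'g set" where "N = {n \<in> carrier \<Gamma>. \<phi> n = \<one>\<^bsub>H\<^esub>}"

text \<open>\<open>R0\<close> divides by the kernel. \<open>Rm\<close> is the fibre relation of the map to the target with hairs
  attached, one for each orbit of degenerate edges under the kernel.\<close>

definition R0 where "R0 = {(p, q). p \<in> V0 \<and> q \<in> V0 \<and> (\<exists>n\<in>N. act0 n p = q)}"

definition Rm where "Rm = {(p, q). p \<in> V0 \<and> q \<in> V0 \<and> snd p = snd q \<and> hair p = hair q \<and>
  (hair p \<longrightarrow> (\<exists>n\<in>N. aS n ` fst p = fst q))}"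

lemma phi_closed: "g \<in> carrier \<Gamma> \<Longrightarrow> \<phi> g \<in> carrier H"
  using hom by (auto simp: hom_def)

lemma phi_mult: "g \<in> carrier \<Gamma> \<Longrightarrow> h \<in> carrier \<Gamma> \<Longrightarrow> \<phi> (g \<otimes>\<^bsub>\<Gamma>\<^esub> h) = \<phi> g \<otimes>\<^bsub>H\<^esub> \<phi> h"
  using hom by (auto simp: hom_def)

interpretation gh: group_hom \<Gamma> H \<phi>
  by unfold_locales (rule hom)

lemma phi_one: "\<phi> \<one>\<^bsub>\<Gamma>\<^esub> = \<one>\<^bsub>H\<^esub>" by simp

lemma N_carrier: "n \<in> N \<Longrightarrow> n \<in> carrier \<Gamma>" and N_phi: "n \<in> N \<Longrightarrow> \<phi> n = \<one>\<^bsub>H\<^esub>"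
  by (auto simp: N_def)

lemma N_one: "\<one>\<^bsub>\<Gamma>\<^esub> \<in> N" and N_inv: "n \<in> N \<Longrightarrow> inv\<^bsub>\<Gamma>\<^esub> n \<in> N"
  and N_mult: "n \<in> N \<Longrightarrow> n' \<in> N \<Longrightarrow> n \<otimes>\<^bsub>\<Gamma>\<^esub> n' \<in> N"
  and N_conj: "n \<in> N \<Longrightarrow> g \<in> carrier \<Gamma> \<Longrightarrow> g \<otimes>\<^bsub>\<Gamma>\<^esub> n \<otimes>\<^bsub>\<Gamma>\<^esub> inv\<^bsub>\<Gamma>\<^esub> g \<in> N"
  by (auto simp: N_def phi_closed)

lemma EV: "(u, v) \<in> ES \<Longrightarrow> u \<in> VS \<and> v \<in> VS \<and> u \<noteq> v"
  using S.EVD S.irreflE by blast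

lemma F_edge: "(u, v) \<in> ES \<Longrightarrow> F u \<in> VT \<and> F v \<in> VT"
  using EV F_closed by blast

lemma mids_iff:
  assumes "(u, v) \<in> ES"
  shows "({u, v}, t) \<in> mids \<longleftrightarrow> t \<in> T.interval (F u) (F v) \<and> (F u = F v \<or> t \<noteq> F u \<and> t \<noteq> F v)"
proof
  assume "({u, v}, t) \<in> mids"
  then obtain u' v' where *: "{u, v} = {u', v'}" "t \<in> T.interval (F u') (F v')" "F u' = F v' \<or> t \<noteq> F u' \<and> t \<noteq> F v'"
    by (auto simp: mids_def)
  from *(1) have "u = u' \<and> v = v' \<or> u = v' \<and> v = u'" by (auto simp: doubleton_eq_iff)
  thus "t \<in> T.interval (F u) (F v) \<and> (F u = F v \<or> t \<noteq> F u \<and> t \<noteq> F v)"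
    using * T.interval_commute by auto
next
  assume "t \<in> T.interval (F u) (F v) \<and> (F u = F v \<or> t \<noteq> F u \<and> t \<noteq> F v)"
  thus "({u, v}, t) \<in> mids" using assms unfolding mids_def by (intro CollectI exI[of _ u] exI[of _ v]) auto
qed

lemma midsE:
  assumes "p \<in> mids"
  obtains u v where "(u, v) \<in> ES" "fst p = {u, v}" "p \<in> pts u v"
  using assms by (auto simp: mids_def pts_def)

lemma pts_commute: "pts u v = pts v u"
  using insert_commute[of u v "{}"] unfolding pts_def by auto

lemma adj_commute: "adj u v p q = adj v u p q"
  using insert_commute[of u v "{}"] unfolding adj_def by metis

lemma pts_V0: "(u, v) \<in> ES \<Longrightarrow> p \<in> pts u v \<Longrightarrow> p \<in> V0"
  using EV by (auto simp: pts_def V0_def)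

lemma pts_fst: "p \<in> pts u v \<Longrightarrow> fst p \<in> {{u}, {v}, {u, v}}"
  by (auto simp: pts_def base_def)

lemma pts_snd: assumes "(u, v) \<in> ES" "p \<in> pts u v" shows "snd p \<in> T.interval (F u) (F v)"
proof (cases "p \<in> {base u, base v}")
  case True thus ?thesis using T.interval_ends[of "F u" "F v"] T.interval_ends[of "F v" "F u"] F_edge[OF assms(1)]
    by (auto simp: base_def T.interval_commute)
next
  case False
  hence "p \<in> mids" "fst p = {u, v}" using assms(2) by (auto simp: pts_def)
  hence "({u, v}, snd p) \<in> mids" by (metis prod.collapse)
  thus ?thesis using mids_iff[OF assms(1)] by blast
qed

lemma pts_cases:
  assumes "(u, v) \<in> ES" "p \<in> pts u v"
  obtains "p = base u" | "p = base v" | "fst p = {u, v}" "p \<in> mids" "F u = F v \<or> snd p \<noteq> F u \<and> snd p \<noteq> F v"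
proof (cases "p \<in> {base u, base v}")
  case True thus ?thesis using that by auto
next
  case False
  hence "p \<in> mids" "fst p = {u, v}" using assms(2) by (auto simp: pts_def)
  moreover have "({u, v}, snd p) \<in> mids" using calculation by (metis prod.collapse)
  ultimately show ?thesis using that(3) mids_iff[OF assms(1)] by blast
qed

lemma pts_inj:
  assumes "(u, v) \<in> ES" "p \<in> pts u v" "q \<in> pts u v" "F u \<noteq> F v" "snd p = snd q" shows "p = q"
  using pts_cases[OF assms(1,2)] pts_cases[OF assms(1,3)] assms(4,5)
  by (smt (verit) base_def prod.collapse snd_conv)

lemma pts_hair:
  assumes "(u, v) \<in> ES" "p \<in> pts u v" shows "hair p \<longleftrightarrow> fst p = {u, v} \<and> F u = F v"
proof
  assume "hair p"
  then obtain a b where ab: "(a, b) \<in> ES" "F a = F b" "fst p = {a, b}" by (auto simp: hair_def)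
  have "a \<noteq> b" "u \<noteq> v" using EV ab assms by auto
  hence "{a, b} = {u, v}" using pts_fst[OF assms(2)] ab by auto
  thus "fst p = {u, v} \<and> F u = F v" using ab by (auto simp: doubleton_eq_iff)
next
  assume "fst p = {u, v} \<and> F u = F v"
  thus "hair p" using assms(1) unfolding hair_def by blast
qed

lemma V0_cases:
  assumes "p \<in> V0"
  obtains v where "v \<in> VS" "p = base v" | u v where "(u, v) \<in> ES" "p \<in> pts u v" "fst p = {u, v}" "p \<in> mids"
proof (cases "p \<in> mids")
  case True
  then obtain u v where "(u, v) \<in> ES" "fst p = {u, v}" "p \<in> pts u v" by (rule midsE)
  thus ?thesis using that(2) True by blast
next
  case False thus ?thesis using that(1) assms unfolding V0_def by blast
qed

lemma V0_fst: "p \<in> V0 \<Longrightarrow> fst p \<subseteq> VS"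
  by (erule V0_cases) (auto simp: base_def dest: EV)

lemma V0_snd: "p \<in> V0 \<Longrightarrow> snd p \<in> VT"
  by (erule V0_cases) (simp_all add: base_def F_closed T.interval_V[OF pts_snd])

lemma base_hair: "\<not> hair (base v)"
  by (auto simp: hair_def base_def dest: EV)

lemma hair_mids: "p \<in> V0 \<Longrightarrow> hair p \<Longrightarrow> p \<in> mids"
  using base_hair by (auto simp: V0_def)

lemma ES_act: "(u, v) \<in> ES \<Longrightarrow> g \<in> carrier \<Gamma> \<Longrightarrow> (aS g u, aS g v) \<in> ES"
  by (rule S.E_act)

lemma pts_act:
  assumes "(u, v) \<in> ES" "g \<in> carrier \<Gamma>" "p \<in> pts u v" shows "act0 g p \<in> pts (aS g u) (aS g v)"
  using assms(1,3)
proof (cases rule: pts_cases)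
  case 3
  have e: "F (aS g u) = aT (\<phi> g) (F u)" "F (aS g v) = aT (\<phi> g) (F v)" using F_equiv assms EV by auto
  note * = F_edge[OF assms(1)] phi_closed[OF assms(2)]
  have V: "snd p \<in> VT" using pts_snd[OF assms(1,3)] T.interval_V by blast
  have "aT (\<phi> g) (snd p) \<in> T.interval (F (aS g u)) (F (aS g v))"
    using T.interval_act[OF *(2) _ _ pts_snd[OF assms(1,3)]] * e by simp
  moreover have "F (aS g u) = F (aS g v) \<or> aT (\<phi> g) (snd p) \<noteq> F (aS g u) \<and> aT (\<phi> g) (snd p) \<noteq> F (aS g v)"
    using 3(3) unfolding e using T.act_inj[OF *(2)] V * by auto
  ultimately have "({aS g u, aS g v}, aT (\<phi> g) (snd p)) \<in> mids"
    using mids_iff[OF ES_act[OF assms(1,2)]] by blast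
  thus ?thesis using 3 by (simp add: pts_def act0_def)
next
  case 1
  have "act0 g (base u) = base (aS g u)" using F_equiv[OF assms(2)] EV[OF assms(1)] by (simp add: base_def act0_def)
  thus ?thesis using 1 by (simp add: pts_def)
next
  case 2
  have "act0 g (base v) = base (aS g v)" using F_equiv[OF assms(2)] EV[OF assms(1)] by (simp add: base_def act0_def)
  thus ?thesis using 2 by (simp add: pts_def)
qed

lemma act0_base: "g \<in> carrier \<Gamma> \<Longrightarrow> v \<in> VS \<Longrightarrow> act0 g (base v) = base (aS g v)"
  by (simp add: act0_def base_def F_equiv)

lemma act0_mids: "g \<in> carrier \<Gamma> \<Longrightarrow> p \<in> mids \<Longrightarrow> act0 g p \<in> mids"
proof -
  assume g: "g \<in> carrier \<Gamma>" and "p \<in> mids"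
  then obtain u v where uv: "(u, v) \<in> ES" "fst p = {u, v}" "p \<in> pts u v" by (metis midsE)
  note e = ES_act[OF uv(1) g]
  have "act0 g p \<in> pts (aS g u) (aS g v)" using pts_act[OF uv(1) g uv(3)] .
  moreover have "fst (act0 g p) = {aS g u, aS g v}" using uv by (simp add: act0_def)
  ultimately show "act0 g p \<in> mids" using EV[OF e] by (auto simp: pts_def base_def)
qed

sublocale X: gact \<Gamma> V0 act0
proof
  fix g p assume g: "g \<in> carrier \<Gamma>" and p: "p \<in> V0"
  show "act0 g p \<in> V0"
  proof (cases "p \<in> mids")
    case True thus ?thesis using act0_mids[OF g] by (simp add: V0_def)
  next
    case False
    then obtain v where "v \<in> VS" "p = base v" using p by (auto simp: V0_def)
    thus ?thesis using act0_base[OF g] S.act_closed[OF g] by (simp add: V0_def)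
  qed
next
  fix p assume p: "p \<in> V0"
  have "aS \<one>\<^bsub>\<Gamma>\<^esub> ` fst p = fst p" using V0_fst[OF p] S.act_one by force
  thus "act0 \<one>\<^bsub>\<Gamma>\<^esub> p = p" using V0_snd[OF p] T.act_one by (simp add: act0_def phi_one)
next
  fix g h p assume g: "g \<in> carrier \<Gamma>" "h \<in> carrier \<Gamma>" and p: "p \<in> V0"
  have "aS (g \<otimes>\<^bsub>\<Gamma>\<^esub> h) ` fst p = aS g ` aS h ` fst p"
    unfolding image_image using V0_fst[OF p] S.act_mult[OF g] by (intro image_cong) auto
  thus "act0 (g \<otimes>\<^bsub>\<Gamma>\<^esub> h) p = act0 g (act0 h p)"
    using V0_snd[OF p] T.act_mult phi_closed g by (simp add: act0_def phi_mult)
qed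

lemma act0_N: "n \<in> N \<Longrightarrow> p \<in> V0 \<Longrightarrow> act0 n p = (aS n ` fst p, snd p)"
  using T.act_one V0_snd by (simp add: act0_def N_phi)

lemma hair_act1: "g \<in> carrier \<Gamma> \<Longrightarrow> hair p \<Longrightarrow> hair (act0 g p)"
proof -
  assume g: "g \<in> carrier \<Gamma>" and "hair p"
  then obtain u v where uv: "(u, v) \<in> ES" "F u = F v" "fst p = {u, v}" by (auto simp: hair_def)
  have "(aS g u, aS g v) \<in> ES" "F (aS g u) = F (aS g v)" "fst (act0 g p) = {aS g u, aS g v}"
    using ES_act[OF uv(1) g] F_equiv[OF g] EV[OF uv(1)] uv by (auto simp: act0_def)
  thus ?thesis unfolding hair_def by blast
qed

lemma hair_act: "g \<in> carrier \<Gamma> \<Longrightarrow> p \<in> V0 \<Longrightarrow> hair (act0 g p) = hair p"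
  using hair_act1[of g p] hair_act1[of "inv\<^bsub>\<Gamma>\<^esub> g" "act0 g p"] X.act_inv1 by auto

lemma E0I: "(u, v) \<in> ES \<Longrightarrow> p \<in> pts u v \<Longrightarrow> q \<in> pts u v \<Longrightarrow> adj u v p q \<Longrightarrow> (p, q) \<in> E0"
  unfolding E0_def by blast

lemma E0_sym: "(p, q) \<in> E0 \<Longrightarrow> (q, p) \<in> E0"
  using T.symE unfolding E0_def adj_def by blast

lemma E0_V: "(p, q) \<in> E0 \<Longrightarrow> p \<in> V0 \<and> q \<in> V0"
  using pts_V0 unfolding E0_def by blast

lemma E0_alt:
  assumes "(u, v) \<in> ES" "p \<in> pts u v" "q \<in> pts u v" "adj u v p q"
  shows "(snd p, snd q) \<in> ET \<and> F u \<noteq> F v \<and> \<not> hair p \<and> \<not> hair q \<or>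
    snd p = snd q \<and> F u = F v \<and> hair p = (fst p = {u, v}) \<and> hair q = (fst q = {u, v}) \<and> hair p \<noteq> hair q"
proof (cases "F u = F v")
  case True
  have "snd r = F u" if "r \<in> pts u v" for r
    using pts_snd[OF assms(1) that] True T.interval_same F_edge[OF assms(1)] by auto
  hence "snd p = snd q" using assms by auto
  thus ?thesis using assms True pts_hair T.irreflE unfolding adj_def by auto
next
  case False thus ?thesis using assms pts_hair unfolding adj_def by auto
qed

lemma E0_types:
  assumes "(p, q) \<in> E0"
  shows "(snd p, snd q) \<in> ET \<and> \<not> hair p \<and> \<not> hair q \<or> snd p = snd q \<and> hair p \<noteq> hair q"
  using assms E0_alt unfolding E0_def by blast

lemma E0_act: assumes "(p, q) \<in> E0" "g \<in> carrier \<Gamma>" shows "(act0 g p, act0 g q) \<in> E0"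
proof -
  obtain u v where uv: "(u, v) \<in> ES" "p \<in> pts u v" "q \<in> pts u v" "adj u v p q" using assms by (auto simp: E0_def)
  note e = ES_act[OF uv(1) assms(2)]
  note P = pts_act[OF uv(1) assms(2) uv(2)] pts_act[OF uv(1) assms(2) uv(3)]
  have eq: "(aS g ` fst r = {aS g u, aS g v}) = (fst r = {u, v})" if "r \<in> pts u v" for r
    using pts_fst[OF that] EV[OF uv(1)] EV[OF e] by auto
  have "adj (aS g u) (aS g v) (act0 g p) (act0 g q)"
  proof (cases "(snd p, snd q) \<in> ET")
    case True
    thus ?thesis using T.E_act[OF True phi_closed[OF assms(2)]] by (simp add: adj_def act0_def)
  next
    case False
    hence "F u = F v" "(fst p = {u, v}) \<noteq> (fst q = {u, v})" using uv(4) by (auto simp: adj_def)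
    moreover have "F (aS g u) = F (aS g v)" using calculation(1) F_equiv[OF assms(2)] EV[OF uv(1)] by simp
    ultimately show ?thesis using eq[OF uv(2)] eq[OF uv(3)] by (simp add: adj_def act0_def)
  qed
  thus ?thesis by (rule E0I[OF e P])
qed

text \<open>Connectedness: the geodesic between the images of the ends of an edge lifts.\<close>

lemma pts_connected_inside:
  assumes uv: "(u, v) \<in> ES" and p: "p \<in> pts u v" shows "(base u, p) \<in> (E0 \<inter> pts u v \<times> pts u v)\<^sup>*"
proof (cases "F u = F v")
  case True
  have "F u \<in> T.interval (F u) (F v)" using T.interval_ends F_edge[OF uv] by blast
  hence m: "({u, v}, F u) \<in> pts u v" using mids_iff[OF uv] True by (auto simp: pts_def)
  have ne: "u \<noteq> v" using EV uv by auto
  have b: "base u \<in> pts u v" "base v \<in> pts u v" by (auto simp: pts_def)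
  have "{u} \<noteq> {u, v}" "{v} \<noteq> {u, v}" using ne by auto
  hence "adj u v (base u) ({u, v}, F u)" "adj u v ({u, v}, F u) (base v)"
    using True by (simp_all add: adj_def base_def)
  hence 1: "(base u, ({u, v}, F u)) \<in> E0 \<inter> pts u v \<times> pts u v" "(({u, v}, F u), base v) \<in> E0 \<inter> pts u v \<times> pts u v"
    using E0I[OF uv] m b by blast+
  from uv p show ?thesis
  proof (cases rule: pts_cases)
    case 2 thus ?thesis using 1 by (meson r_into_rtrancl rtrancl_trans)
  next
    case 3
    have "snd p = F u" using pts_snd[OF uv p] True T.interval_same F_edge[OF uv] by auto
    hence "p = ({u, v}, F u)" using 3 by (metis prod.collapse)
    thus ?thesis using 1 by auto
  qed auto
next
  case False
  let ?I = "T.interval (F u) (F v)"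
  define l where "l t = (if t = F u then base u else if t = F v then base v else ({u, v}, t))" for t
  have l: "l t \<in> pts u v" "snd (l t) = t" if "t \<in> ?I" for t
    using mids_iff[OF uv, of t] that by (auto simp: l_def pts_def base_def)
  have lp: "l (snd p) = p"
    by (rule pts_inj[OF uv l(1) p False l(2)]) (use pts_snd[OF uv p] in auto)
  have "(F u, snd p) \<in> (ET \<inter> ?I \<times> ?I)\<^sup>*"
    using T.interval_connected_mono[OF pts_snd[OF uv p]] F_edge[OF uv] by blast
  hence "(l (F u), l (snd p)) \<in> (E0 \<inter> pts u v \<times> pts u v)\<^sup>*"
  proof (induction rule: rtrancl_induct)
    case (step y z)
    have "(l y, l z) \<in> E0" by (rule E0I[OF uv]) (use step(2) l[of y] l[of z] in \<open>auto simp: adj_def\<close>)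
    hence "(l y, l z) \<in> E0 \<inter> pts u v \<times> pts u v" using l(1)[of y] l(1)[of z] step(2) by blast
    thus ?case using step(3) by (rule rtrancl_into_rtrancl[rotated])
  qed simp
  thus ?thesis using lp by (simp add: l_def)
qed

lemma pts_connected: "(u, v) \<in> ES \<Longrightarrow> p \<in> pts u v \<Longrightarrow> (base u, p) \<in> E0\<^sup>*"
  using pts_connected_inside[of u v p] rtrancl_mono[of "E0 \<inter> pts u v \<times> pts u v" E0] by blast

lemma E0_connected: assumes "p \<in> V0" "q \<in> V0" shows "(p, q) \<in> E0\<^sup>*"
proof -
  have bb: "(base u, base v) \<in> E0\<^sup>*" if uv: "u \<in> VS" "v \<in> VS" for u v
    using S.connE[OF uv]
  proof (induction rule: rtrancl_induct)
    case (step y z)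
    have "base z \<in> pts y z" by (simp add: pts_def)
    hence "(base y, base z) \<in> E0\<^sup>*" by (rule pts_connected[OF step(2)])
    thus ?case using step(3) by (rule rtrancl_trans[rotated])
  qed simp
  have ex: "\<exists>v\<in>VS. (base v, p) \<in> E0\<^sup>*" if "p \<in> V0" for p
    using that
  proof (cases rule: V0_cases)
    case (2 u v) thus ?thesis using pts_connected EV by blast
  qed blast
  obtain u v where uv: "u \<in> VS" "v \<in> VS" "(base u, p) \<in> E0\<^sup>*" "(base v, q) \<in> E0\<^sup>*" using ex assms by blast
  have "sym E0" using E0_sym by (auto simp: sym_def)
  hence "(p, base u) \<in> E0\<^sup>*" using uv(3) sym_rtrancl symD by metis
  thus ?thesis using bb[OF uv(1,2)] uv(4) by (meson rtrancl_trans)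
qed

lemma R0I: "p \<in> V0 \<Longrightarrow> n \<in> N \<Longrightarrow> act0 n p = q \<Longrightarrow> (p, q) \<in> R0"
  using X.act_closed[OF N_carrier] unfolding R0_def by blast

lemma R0E: assumes "(p, q) \<in> R0" obtains n where "p \<in> V0" "q \<in> V0" "n \<in> N" "act0 n p = q"
  using assms unfolding R0_def by blast

lemma RmI: "p \<in> V0 \<Longrightarrow> q \<in> V0 \<Longrightarrow> snd p = snd q \<Longrightarrow> \<not> hair p \<Longrightarrow> \<not> hair q \<Longrightarrow> (p, q) \<in> Rm"
  unfolding Rm_def by blast

lemma RmD: "(p, q) \<in> Rm \<Longrightarrow> p \<in> V0 \<and> q \<in> V0 \<and> snd p = snd q \<and> hair p = hair q"
  and Rm_hairD: "(p, q) \<in> Rm \<Longrightarrow> hair p \<Longrightarrow> \<exists>n\<in>N. aS n ` fst p = fst q"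
  unfolding Rm_def by blast+

lemma equiv_R0: "equiv V0 R0"
proof (rule equivI)
  show "refl_on V0 R0" by (rule refl_onI) (rule R0I[OF _ N_one X.act_one])
  show "sym R0"
  proof (rule symI)
    fix p q assume "(p, q) \<in> R0"
    then obtain n where n: "p \<in> V0" "q \<in> V0" "n \<in> N" "act0 n p = q" by (rule R0E)
    hence "act0 (inv\<^bsub>\<Gamma>\<^esub> n) q = p" using X.act_inv1[OF N_carrier[OF n(3)] n(1)] by simp
    thus "(q, p) \<in> R0" using R0I[OF n(2) N_inv[OF n(3)]] by blast
  qed
  show "trans R0"
  proof (rule transI)
    fix p q r assume pq: "(p, q) \<in> R0" and qr: "(q, r) \<in> R0"
    obtain n where n: "p \<in> V0" "n \<in> N" "act0 n p = q" using R0E[OF pq] by metis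
    obtain n' where n': "n' \<in> N" "act0 n' q = r" using R0E[OF qr] by metis
    have "act0 (n' \<otimes>\<^bsub>\<Gamma>\<^esub> n) p = r" using X.act_mult[OF N_carrier[OF n'(1)] N_carrier[OF n(2)] n(1)] n n' by simp
    thus "(p, r) \<in> R0" using R0I[OF n(1) N_mult[OF n'(1) n(2)]] by blast
  qed
  show "R0 \<subseteq> V0 \<times> V0" unfolding R0_def by blast
qed

lemma inv_R0: "invariant_rel \<Gamma> act0 R0"
proof -
  have "(act0 g p, act0 g q) \<in> R0" if g: "g \<in> carrier \<Gamma>" and pq: "(p, q) \<in> R0" for g p q
  proof -
    obtain n where n: "p \<in> V0" "q \<in> V0" "n \<in> N" "act0 n p = q" using pq by (rule R0E)
    let ?n = "g \<otimes>\<^bsub>\<Gamma>\<^esub> n \<otimes>\<^bsub>\<Gamma>\<^esub> inv\<^bsub>\<Gamma>\<^esub> g"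
    have "act0 ?n (act0 g p) = act0 g q"
      using g n N_carrier[OF n(3)] by (simp add: X.act_mult X.act_closed X.act_inv1)
    thus ?thesis by (rule R0I[OF X.act_closed[OF g n(1)] N_conj[OF n(3) g]])
  qed
  thus ?thesis unfolding invariant_rel_def by blast
qed

lemma RmI_N: assumes "p \<in> V0" "n \<in> N" shows "(p, act0 n p) \<in> Rm"
proof -
  have "act0 n p \<in> V0" "hair (act0 n p) = hair p" "act0 n p = (aS n ` fst p, snd p)"
    using X.act_closed[OF N_carrier] hair_act[OF N_carrier] act0_N assms by auto
  thus ?thesis using assms unfolding Rm_def by auto
qed

lemma Rm_hair: assumes "(p, q) \<in> Rm" "hair p" shows "(p, q) \<in> R0"
proof -
  obtain n where n: "n \<in> N" "aS n ` fst p = fst q" using Rm_hairD[OF assms] by blast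
  have "p \<in> V0" "snd p = snd q" using RmD[OF assms(1)] by auto
  moreover have "act0 n p = (fst q, snd q)" using act0_N[OF n(1)] n(2) calculation by simp
  ultimately show ?thesis using R0I[OF _ n(1)] by simp
qed

lemma R0_sub_Rm: "R0 \<subseteq> Rm"
proof (rule subrelI)
  fix p q assume "(p, q) \<in> R0"
  then obtain n where n: "p \<in> V0" "q \<in> V0" "n \<in> N" "act0 n p = q" by (rule R0E)
  thus "(p, q) \<in> Rm" using RmI_N[OF n(1,3)] by simp
qed

lemma equiv_Rm: "equiv V0 Rm"
proof (rule equivI)
  have s: "(p, q) \<in> R0 \<Longrightarrow> (q, p) \<in> R0" for p q using equiv_R0 by (meson equivE symD)
  have t: "(p, q) \<in> R0 \<Longrightarrow> (q, r) \<in> R0 \<Longrightarrow> (p, r) \<in> R0" for p q r using equiv_R0 by (meson equivE transD)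
  show "refl_on V0 Rm" by (rule refl_onI) (metis RmI_N N_one X.act_one)
  show "sym Rm"
  proof (rule symI)
    fix p q assume pq: "(p, q) \<in> Rm"
    show "(q, p) \<in> Rm"
    proof (cases "hair p")
      case True thus ?thesis using Rm_hair[OF pq] s R0_sub_Rm by blast
    next
      case False thus ?thesis using RmD[OF pq] RmI[of q p] by simp
    qed
  qed
  show "trans Rm"
  proof (rule transI)
    fix p q r assume pq: "(p, q) \<in> Rm" and qr: "(q, r) \<in> Rm"
    show "(p, r) \<in> Rm"
    proof (cases "hair p")
      case True
      hence "hair q" using RmD[OF pq] by simp
      thus ?thesis using t[OF Rm_hair[OF pq True] Rm_hair[OF qr]] R0_sub_Rm by blast
    next
      case False thus ?thesis using RmD[OF pq] RmD[OF qr] RmI[of p r] by simp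
    qed
  qed
  show "Rm \<subseteq> V0 \<times> V0" unfolding Rm_def by blast
qed

lemma inv_Rm: "invariant_rel \<Gamma> act0 Rm"
proof -
  have "(act0 g p, act0 g q) \<in> Rm" if g: "g \<in> carrier \<Gamma>" and pq: "(p, q) \<in> Rm" for g p q
  proof (cases "hair p")
    case True
    thus ?thesis using invariant_relD[OF inv_R0 g Rm_hair[OF pq]] R0_sub_Rm by blast
  next
    case False
    note d = RmD[OF pq]
    have "snd (act0 g p) = snd (act0 g q)" using d by (simp add: act0_def)
    thus ?thesis using RmI[of "act0 g p" "act0 g q"] X.act_closed[OF g] hair_act[OF g] d False by simp
  qed
  thus ?thesis unfolding invariant_rel_def by blast
qed

lemma fix_set: assumes "(u, v) \<in> ES" "g \<in> carrier \<Gamma>" "aS g ` {u, v} = {u, v}" shows "aS g u = u" "aS g v = v"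
proof -
  have "aS g u = u \<and> aS g v = v \<or> aS g u = v \<and> aS g v = u" using assms(3) by (auto simp: doubleton_eq_iff)
  moreover have "\<not> (aS g u = v \<and> aS g v = u)" using S.noinvE[OF assms(1,2)] by simp
  ultimately show "aS g u = u" "aS g v = v" by simp_all
qed

lemma fix_pts: "p \<in> pts u v \<Longrightarrow> aS g u = u \<Longrightarrow> aS g v = v \<Longrightarrow> aS g ` fst p = fst p"
proof -
  assume "p \<in> pts u v" and eq: "aS g u = u" "aS g v = v"
  hence "fst p = {u} \<or> fst p = {v} \<or> fst p = {u, v}" using pts_fst by blast
  thus "aS g ` fst p = fst p" using eq by (elim disjE) simp_all
qed

lemma fix_pts0:
  assumes "(u, v) \<in> ES" "p \<in> pts u v" "g \<in> carrier \<Gamma>" "aS g u = u" "aS g v = v" shows "act0 g p = p"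
proof -
  have "aT (\<phi> g) (F u) = F u" "aT (\<phi> g) (F v) = F v" using F_equiv[OF assms(3)] EV[OF assms(1)] assms(4,5) by metis+
  hence "aT (\<phi> g) (snd p) = snd p"
    using T.fixes_interval[OF phi_closed[OF assms(3)] _ _ _ _ pts_snd[OF assms(1,2)]] F_edge[OF assms(1)] by blast
  thus ?thesis using fix_pts[OF assms(2,4,5)] by (simp add: act0_def)
qed

lemma N_of_fixing:
  assumes uv: "(u, v) \<in> ES" "p \<in> pts u v" and g: "g \<in> carrier \<Gamma>" "n \<in> N"
    and fx: "aS (inv\<^bsub>\<Gamma>\<^esub> n \<otimes>\<^bsub>\<Gamma>\<^esub> g) u = u" "aS (inv\<^bsub>\<Gamma>\<^esub> n \<otimes>\<^bsub>\<Gamma>\<^esub> g) v = v"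
  shows "act0 n p = act0 g p"
proof -
  have p: "p \<in> V0" using pts_V0 uv by blast
  have "act0 (inv\<^bsub>\<Gamma>\<^esub> n \<otimes>\<^bsub>\<Gamma>\<^esub> g) p = p" using fix_pts0[OF uv _ fx] g N_carrier by simp
  hence "act0 (inv\<^bsub>\<Gamma>\<^esub> n) (act0 g p) = p" using X.act_mult p g N_carrier by simp
  hence "act0 n (act0 (inv\<^bsub>\<Gamma>\<^esub> n) (act0 g p)) = act0 n p" by simp
  thus ?thesis using X.act_inv2[OF N_carrier[OF g(2)] X.act_closed[OF g(1) p]] by simp
qed

text \<open>If \<open>g\<close> stabilizes the image of an edge of the subdivided tree, then \<open>\<phi> g\<close> is the image of an
  element \<open>k\<close> that stabilizes the edge itself, as edge stabilizers do not increase. Hence \<open>g\<close>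
  differs from \<open>k\<close>
  by a kernel element, which moves both ends of the edge as \<open>g\<close> does.\<close>

lemma common_kernel_element:
  assumes pq: "(p, q) \<in> E0" and g: "g \<in> carrier \<Gamma>" and p: "(act0 g p, p) \<in> Rm" and q: "(act0 g q, q) \<in> Rm"
  shows "\<exists>n\<in>N. act0 n p = act0 g p \<and> act0 n q = act0 g q"
proof -
  obtain u v where uv: "(u, v) \<in> ES" "p \<in> pts u v" "q \<in> pts u v" "adj u v p q" using assms by (auto simp: E0_def)
  show ?thesis
  proof (cases "(snd p, snd q) \<in> ET")
    case True
    have "T.beyond (snd p) (snd q) (F u) \<noteq> T.beyond (snd p) (snd q) (F v)"
      using T.interval_edge_separates[OF pts_snd[OF uv(1,2)] pts_snd[OF uv(1,3)] True] F_edge[OF uv(1)] by blast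
    moreover have "aT (\<phi> g) (snd p) = snd p" "aT (\<phi> g) (snd q) = snd q" using RmD[OF p] RmD[OF q] by (simp_all add: act0_def)
    ultimately obtain k where k: "k \<in> carrier \<Gamma>" "\<phi> k = \<phi> g" "aS k u = u" "aS k v = v"
      using edge_stab[OF uv(1) True _ phi_closed[OF g]] by blast
    define n where "n = g \<otimes>\<^bsub>\<Gamma>\<^esub> inv\<^bsub>\<Gamma>\<^esub> k"
    have n: "n \<in> N" using k g phi_closed by (simp add: n_def N_def)
    have "inv\<^bsub>\<Gamma>\<^esub> n \<otimes>\<^bsub>\<Gamma>\<^esub> g = k" using k g by (simp add: n_def S.inv_mult_group S.m_assoc)
    hence "act0 n p = act0 g p" "act0 n q = act0 g q"
      using N_of_fixing[OF uv(1,2) g n] N_of_fixing[OF uv(1,3) g n] k by simp_all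
    thus ?thesis using n by blast
  next
    case False
    hence h: "hair p \<or> hair q" and hf: "hair p = (fst p = {u, v})" "hair q = (fst q = {u, v})"
      using E0_alt[OF uv] by auto
    obtain n where n: "n \<in> N" "aS n ` aS g ` {u, v} = {u, v}"
    proof (cases "hair p")
      case True
      hence "hair (act0 g p)" using hair_act1[OF g] by blast
      then obtain n where "n \<in> N" "aS n ` fst (act0 g p) = fst p" using Rm_hairD[OF p] by blast
      thus ?thesis using that True hf by (auto simp: act0_def)
    next
      case False
      hence hq: "hair q" using h by simp
      hence "hair (act0 g q)" using hair_act1[OF g] by blast
      then obtain n where "n \<in> N" "aS n ` fst (act0 g q) = fst q" using Rm_hairD[OF q] by blast
      thus ?thesis using that hq hf by (auto simp: act0_def)
    qed
    have ng: "n \<otimes>\<^bsub>\<Gamma>\<^esub> g \<in> carrier \<Gamma>" using N_carrier[OF n(1)] g by simp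
    have ngs: "aS (n \<otimes>\<^bsub>\<Gamma>\<^esub> g) ` {u, v} = {u, v}" using n(2) S.act_mult[OF N_carrier[OF n(1)] g] EV[OF uv(1)] by simp
    have f: "aS (inv\<^bsub>\<Gamma>\<^esub> (inv\<^bsub>\<Gamma>\<^esub> n) \<otimes>\<^bsub>\<Gamma>\<^esub> g) u = u" "aS (inv\<^bsub>\<Gamma>\<^esub> (inv\<^bsub>\<Gamma>\<^esub> n) \<otimes>\<^bsub>\<Gamma>\<^esub> g) v = v"
      using fix_set[OF uv(1) ng ngs] S.inv_inv[OF N_carrier[OF n(1)]] by simp_all
    show ?thesis using N_of_fixing[OF uv(1,2) g N_inv[OF n(1)] f] N_of_fixing[OF uv(1,3) g N_inv[OF n(1)] f] N_inv[OF n(1)] by blast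
  qed
qed

lemma stab0:
  assumes pq: "(p, q) \<in> E0" and g: "g \<in> carrier \<Gamma>" and p: "(act0 g p, p) \<in> Rm" and q: "(act0 g q, q) \<in> Rm"
  shows "(act0 g p, p) \<in> R0 \<and> (act0 g q, q) \<in> R0"
proof -
  obtain n where n: "n \<in> N" "act0 n p = act0 g p" "act0 n q = act0 g q" using common_kernel_element[OF assms] by blast
  have V: "p \<in> V0" "q \<in> V0" using E0_V[OF pq] by auto
  have "(p, act0 g p) \<in> R0" "(q, act0 g q) \<in> R0" using R0I[OF V(1) n(1,2)] R0I[OF V(2) n(1,3)] by auto
  thus ?thesis using equiv_R0 by (meson equivE symD)
qed

lemma noinv0:
  assumes pq: "(p, q) \<in> E0" and g: "g \<in> carrier \<Gamma>" and r: "(act0 g p, q) \<in> Rm" shows "(act0 g q, p) \<notin> Rm"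
proof
  assume s: "(act0 g q, p) \<in> Rm"
  show False
  proof (cases "(snd p, snd q) \<in> ET")
    case True
    have "aT (\<phi> g) (snd p) = snd q" "aT (\<phi> g) (snd q) = snd p" using RmD[OF r] RmD[OF s] by (simp_all add: act0_def)
    thus False using T.noinvE[OF True phi_closed[OF g]] by blast
  next
    case False
    hence "hair p \<noteq> hair q" using E0_types[OF pq] by blast
    moreover have "hair (act0 g p) = hair q" using RmD[OF r] by blast
    ultimately show False using hair_act[OF g] E0_V[OF pq] by blast
  qed
qed

text \<open>An edge of the target is cut by its half-tree. The edge of a hair is cut by isolating the
  hair.\<close>

lemma cut0: assumes pq: "(p, q) \<in> E0" shows "\<exists>c. is_cut E0 Rm p q c"
proof (cases "(snd p, snd q) \<in> ET")
  case True
  let ?c = "\<lambda>r. T.beyond (snd p) (snd q) (snd r)"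
  have nh: "\<not> hair p" "\<not> hair q" using E0_types[OF pq] True T.irreflE by auto
  have "is_cut E0 Rm p q ?c"
    unfolding is_cut_def
  proof (intro conjI ballI; clarify)
    fix a1 a2 b1 b2 assume "((a1, a2), (b1, b2)) \<in> Rm"
    thus "?c (a1, a2) = ?c (b1, b2)" using RmD by fastforce
  next
    fix a1 a2 b1 b2 assume "((a1, a2), (b1, b2)) \<in> E0"
    then obtain a b where ab: "a = (a1, a2)" "b = (b1, b2)" "(a, b) \<in> E0" by blast
    have "(?c a \<noteq> ?c b) = ((a, p) \<in> Rm \<and> (b, q) \<in> Rm \<or> (a, q) \<in> Rm \<and> (b, p) \<in> Rm)"
    proof (cases "(snd a, snd b) \<in> ET")
      case True': True
      have "\<not> hair a" "\<not> hair b" using E0_types[OF ab(3)] True' T.irreflE by auto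
      hence "(a, p) \<in> Rm \<longleftrightarrow> snd a = snd p" "(a, q) \<in> Rm \<longleftrightarrow> snd a = snd q" "(b, p) \<in> Rm \<longleftrightarrow> snd b = snd p" "(b, q) \<in> Rm \<longleftrightarrow> snd b = snd q"
        using nh E0_V[OF pq] E0_V[OF ab(3)] RmD RmI by metis+
      thus ?thesis using T.beyond_edge[OF True True'] by simp
    next
      case False
      hence "snd a = snd b" using E0_types[OF ab(3)] by blast
      moreover have "snd p \<noteq> snd q" using True T.irreflE by auto
      ultimately show ?thesis using RmD by metis
    qed
    thus "(?c (a1, a2) \<noteq> ?c (b1, b2)) = (((a1, a2), p) \<in> Rm \<and> ((b1, b2), q) \<in> Rm \<or> ((a1, a2), q) \<in> Rm \<and> ((b1, b2), p) \<in> Rm)"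
      unfolding ab .
  qed
  thus ?thesis by blast
next
  case False
  have s: "(x, y) \<in> Rm \<Longrightarrow> (y, x) \<in> Rm" and t: "(x, y) \<in> Rm \<Longrightarrow> (y, z) \<in> Rm \<Longrightarrow> (x, z) \<in> Rm" for x y z
    using equiv_Rm by (meson equivE symD, meson equivE transD)
  have main: "\<exists>c. is_cut E0 Rm p q c" if pq: "(p, q) \<in> E0" "snd p = snd q" "hair p" "\<not> hair q" for p q
  proof -
    let ?c = "\<lambda>r. (r, p) \<in> Rm"
    have one: "(a, p) \<in> Rm \<and> (b, q) \<in> Rm" if "(a, b) \<in> E0" "(a, p) \<in> Rm" "(b, p) \<notin> Rm" for a b
    proof -
      have "hair a" "snd a = snd p" using RmD[OF that(2)] pq(3) by auto
      hence "snd a = snd b" "\<not> hair b" using E0_types[OF that(1)] by auto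
      hence "(b, q) \<in> Rm" using \<open>snd a = snd p\<close> pq E0_V[OF that(1)] E0_V[OF pq(1)] RmI[of b q] by simp
      thus ?thesis using that by blast
    qed
    have npq: "(q, p) \<notin> Rm" using RmD[of q p] pq by blast
    have "is_cut E0 Rm p q ?c"
      unfolding is_cut_def
    proof (intro conjI ballI; clarify)
      fix a1 a2 b1 b2 assume "((a1, a2), (b1, b2)) \<in> Rm"
      thus "?c (a1, a2) = ?c (b1, b2)" using s t by blast
    next
      fix a1 a2 b1 b2 assume ab: "((a1, a2), (b1, b2)) \<in> E0"
      have "(r, q) \<in> Rm \<Longrightarrow> (r, p) \<notin> Rm" for r using npq s t by blast
      thus "(?c (a1, a2) \<noteq> ?c (b1, b2)) = (((a1, a2), p) \<in> Rm \<and> ((b1, b2), q) \<in> Rm \<or> ((a1, a2), q) \<in> Rm \<and> ((b1, b2), p) \<in> Rm)"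
        using one[OF ab] one[OF E0_sym[OF ab]] by blast
    qed
    thus ?thesis by blast
  qed
  have "snd p = snd q" "hair p \<noteq> hair q" using E0_types[OF pq] False by auto
  thus ?thesis
  proof (cases "hair p")
    case True thus ?thesis using main[OF pq] \<open>snd p = snd q\<close> \<open>hair p \<noteq> hair q\<close> by blast
  next
    case False
    then obtain c where "is_cut E0 Rm q p c" using main[OF E0_sym[OF pq]] \<open>snd p = snd q\<close> \<open>hair p \<noteq> hair q\<close> by auto
    hence "is_cut E0 Rm p q c" unfolding is_cut_def by blast
    thus ?thesis by blast
  qed
qed

end

section \<open>The complexity of the subdivided tree\<close>

lemma big_vertsI: "x \<in> V \<Longrightarrow> g \<in> carrier \<Gamma> \<Longrightarrow> (a, b) \<in> E \<Longrightarrow> (a, x) \<in> R \<Longrightarrow> (act g x, x) \<in> R \<Longrightarrow>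
    (act g b, b) \<notin> R \<Longrightarrow> x \<in> big_verts \<Gamma> act V E R"
  unfolding big_verts_def mem_Collect_eq by (intro conjI exI bexI) auto

lemma big_vertsE:
  assumes "x \<in> big_verts \<Gamma> act V E R"
  obtains a b g where "x \<in> V" "g \<in> carrier \<Gamma>" "(a, b) \<in> E" "(a, x) \<in> R" "(act g x, x) \<in> R" "(act g b, b) \<notin> R"
  using assms unfolding big_verts_def mem_Collect_eq by (elim conjE exE bexE) auto

lemma big_verts_sub: "big_verts \<Gamma> act V E R \<subseteq> V"
  by (auto elim: big_vertsE)

context gact
begin

lemma equiv_Id_on: "equiv V (Id_on V)"
  by (rule equivI) (auto simp: refl_on_def sym_def trans_def)

lemma invariant_Id_on: "invariant_rel \<Gamma> act (Id_on V)"
  by (auto simp: invariant_rel_def act_closed)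

lemma orb_rel_Id: "(x, y) \<in> orb_rel \<Gamma> act V (Id_on V) \<longleftrightarrow> x \<in> V \<and> (\<exists>g\<in>carrier \<Gamma>. act g x = y)"
  using act_closed by (auto simp: orb_rel_def)

lemma edge_orb_rel_Id:
  assumes "E \<subseteq> V \<times> V" "invariant_rel \<Gamma> act E"
  shows "((a, b), (c, d)) \<in> edge_orb_rel \<Gamma> act E (Id_on V) \<longleftrightarrow>
    (a, b) \<in> E \<and> (\<exists>g\<in>carrier \<Gamma>. act g a = c \<and> act g b = d)"
proof -
  have "act g a \<in> V \<and> act g b \<in> V \<and> (act g a, act g b) \<in> E" if "(a, b) \<in> E" "g \<in> carrier \<Gamma>" for g
    using that assms act_closed invariant_relD[OF assms(2)] by blast
  thus ?thesis unfolding edge_orb_rel_iff by auto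
qed

lemmas equiv_vert_Id = equiv_orb_rel[OF equiv_Id_on invariant_Id_on]

end

context ctree_act
begin

lemma equiv_edge_Id: "equiv E (edge_orb_rel \<Gamma> act E (Id_on V))"
  by (rule equiv_edge_orb_rel[OF equiv_Id_on invariant_Id_on EV invE])

lemma edge_orb_Id: "((a, b), (c, d)) \<in> edge_orb_rel \<Gamma> act E (Id_on V) \<longleftrightarrow>
    (a, b) \<in> E \<and> (\<exists>g\<in>carrier \<Gamma>. act g a = c \<and> act g b = d)"
  by (rule edge_orb_rel_Id[OF EV invE])

lemma big_iff: "x \<in> big_verts \<Gamma> act V E (Id_on V) \<longleftrightarrow> (\<exists>b. \<exists>g\<in>carrier \<Gamma>. (x, b) \<in> E \<and> act g x = x \<and> act g b \<noteq> b)"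
proof
  assume "x \<in> big_verts \<Gamma> act V E (Id_on V)"
  then obtain a b g where *: "x \<in> V" "g \<in> carrier \<Gamma>" "(a, b) \<in> E" "(a, x) \<in> Id_on V" "(act g x, x) \<in> Id_on V" "(act g b, b) \<notin> Id_on V"
    by (rule big_vertsE)
  hence "a = x" "act g x = x" "act g b \<noteq> b" using EVD(2)[OF *(3)] by (auto simp: Id_on_iff)
  thus "\<exists>b. \<exists>g\<in>carrier \<Gamma>. (x, b) \<in> E \<and> act g x = x \<and> act g b \<noteq> b" using *(2,3) by (intro exI[of _ b] bexI[of _ g]) simp_all
next
  assume "\<exists>b. \<exists>g\<in>carrier \<Gamma>. (x, b) \<in> E \<and> act g x = x \<and> act g b \<noteq> b"
  then obtain b g where *: "g \<in> carrier \<Gamma>" "(x, b) \<in> E" "act g x = x" "act g b \<noteq> b" by blast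
  have "x \<in> V" using EVD(1)[OF *(2)] .
  moreover have "(act g x, x) \<in> Id_on V" "(x, x) \<in> Id_on V" "(act g b, b) \<notin> Id_on V" using *(3,4) calculation by (simp_all add: Id_on_iff)
  ultimately show "x \<in> big_verts \<Gamma> act V E (Id_on V)" using *(1,2) by (intro big_vertsI)
qed

end

context tree_map
begin

abbreviation "r0 \<equiv> orb_rel \<Gamma> act0 V0 R0"
abbreviation "s0 \<equiv> edge_orb_rel \<Gamma> act0 E0 R0"
abbreviation "rm \<equiv> orb_rel \<Gamma> act0 V0 Rm"
abbreviation "sm \<equiv> edge_orb_rel \<Gamma> act0 E0 Rm"
abbreviation "rS \<equiv> orb_rel \<Gamma> aS VS (Id_on VS)"
abbreviation "sS \<equiv> edge_orb_rel \<Gamma> aS ES (Id_on VS)"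

lemma inv_E0: "invariant_rel \<Gamma> act0 E0"
  unfolding invariant_rel_def using E0_act by blast

lemma E0_sub: "E0 \<subseteq> V0 \<times> V0"
  using E0_V by (auto intro!: subrelI)

lemma equiv_r0: "equiv V0 r0" and equiv_rm: "equiv V0 rm"
  by (rule X.equiv_orb_rel[OF equiv_R0 inv_R0] X.equiv_orb_rel[OF equiv_Rm inv_Rm])+

lemma equiv_s0: "equiv E0 s0" and equiv_sm: "equiv E0 sm"
  by (rule X.equiv_edge_orb_rel[OF equiv_R0 inv_R0 E0_sub inv_E0] X.equiv_edge_orb_rel[OF equiv_Rm inv_Rm E0_sub inv_E0])+

lemma R0_refl: "p \<in> V0 \<Longrightarrow> (p, p) \<in> R0" and R0_sym: "(p, q) \<in> R0 \<Longrightarrow> (q, p) \<in> R0"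
  and R0_trans: "(p, q) \<in> R0 \<Longrightarrow> (q, r) \<in> R0 \<Longrightarrow> (p, r) \<in> R0"
  using equiv_R0 by (meson equivE refl_onD, meson equivE symD, meson equivE transD)

lemma R0_act: "(p, q) \<in> R0 \<Longrightarrow> g \<in> carrier \<Gamma> \<Longrightarrow> (act0 g p, act0 g q) \<in> R0"
  using invariant_relD[OF inv_R0] by blast

lemma r0I: "p \<in> V0 \<Longrightarrow> g \<in> carrier \<Gamma> \<Longrightarrow> act0 g p = q \<Longrightarrow> (p, q) \<in> r0"
  unfolding orb_rel_def using X.act_closed R0_refl by blast

lemma r0D: assumes "(p, q) \<in> r0" shows "\<exists>g\<in>carrier \<Gamma>. act0 g p = q"
proof -
  obtain g where g: "p \<in> V0" "g \<in> carrier \<Gamma>" "(act0 g p, q) \<in> R0" using assms unfolding orb_rel_def by blast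
  obtain n where n: "n \<in> N" "act0 n (act0 g p) = q" using R0E[OF g(3)] by metis
  have "act0 (n \<otimes>\<^bsub>\<Gamma>\<^esub> g) p = q" using X.act_mult[OF N_carrier[OF n(1)] g(2,1)] n(2) by simp
  thus ?thesis using N_carrier[OF n(1)] g(2) by blast
qed

lemma s0I: "(p, q) \<in> E0 \<Longrightarrow> g \<in> carrier \<Gamma> \<Longrightarrow> act0 g p = p' \<Longrightarrow> act0 g q = q' \<Longrightarrow> ((p, q), (p', q')) \<in> s0"
  using E0_act[of p q g] E0_V[of p' q'] R0_refl unfolding edge_orb_rel_iff by blast

lemma E0E:
  assumes "(p, q) \<in> E0" obtains u v where "(u, v) \<in> ES" "p \<in> pts u v" "q \<in> pts u v" "adj u v p q"
  using assms unfolding E0_def mem_Collect_eq case_prod_conv by (elim exE conjE)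

lemma adj_ET: "adj u v p q \<Longrightarrow> F u \<noteq> F v \<Longrightarrow> (snd p, snd q) \<in> ET"
  by (simp add: adj_def)

lemma mids_fst:
  assumes "p \<in> mids" "(u, v) \<in> ES" "p \<in> pts u v" shows "fst p = {u, v}"
proof -
  obtain a b where ab: "(a, b) \<in> ES" "fst p = {a, b}" using assms(1) by (rule midsE)
  have "a \<noteq> b" using EV[OF ab(1)] by blast
  hence "fst p \<noteq> {u}" "fst p \<noteq> {v}" using ab(2) by auto
  thus ?thesis using pts_fst[OF assms(3)] by blast
qed

lemma mids_fix:
  assumes p: "p \<in> mids" and g: "g \<in> carrier \<Gamma>" "act0 g p = p" and e: "(p, q) \<in> E0" shows "act0 g q = q"
proof -
  obtain u v where uv: "(u, v) \<in> ES" "p \<in> pts u v" "q \<in> pts u v" using e by (rule E0E)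
  have "fst p = {u, v}" using mids_fst[OF p uv(1,2)] .
  hence "aS g ` {u, v} = {u, v}" using g(2) by (metis act0_def fst_conv)
  from fix_set[OF uv(1) g(1) this] fix_pts0[OF uv(1,3) g(1)] show ?thesis by blast
qed

text \<open>Subdivision points have valence two, so that subdividing leaves the Euler characteristic
  unchanged and, as edges are not inverted, creates no big vertices.\<close>

lemma mids_neighbours:
  assumes p: "p \<in> mids" shows "\<exists>q1 q2. \<forall>q. (p, q) \<in> E0 \<longrightarrow> q = q1 \<or> q = q2"
proof -
  obtain u v where uv: "(u, v) \<in> ES" "fst p = {u, v}" "p \<in> pts u v" using p by (rule midsE)
  have nb: "q \<in> pts u v \<and> adj u v p q" if pq: "(p, q) \<in> E0" for q
  proof -
    obtain u' v' where *: "(u', v') \<in> ES" "p \<in> pts u' v'" "q \<in> pts u' v'" "adj u' v' p q" using pq by (rule E0E)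
    have "{u, v} = {u', v'}" using mids_fst[OF p *(1,2)] uv(2) by simp
    hence "u = u' \<and> v = v' \<or> u = v' \<and> v = u'" by (auto simp: doubleton_eq_iff)
    thus ?thesis using *(2-4) pts_commute[of u v] adj_commute[of u v] by (elim disjE conjE) simp_all
  qed
  show ?thesis
  proof (cases "F u = F v")
    case True
    have "q = base u \<or> q = base v" if "(p, q) \<in> E0" for q
    proof -
      note n = nb[OF that]
      have "fst q \<noteq> {u, v}" using E0_alt[OF uv(1,3) n[THEN conjunct1] n[THEN conjunct2]] True uv(2) by auto
      thus ?thesis using pts_cases[OF uv(1), of q] n by blast
    qed
    thus ?thesis by blast
  next
    case False
    let ?d = "\<lambda>w q. (p, q) \<in> E0 \<and> T.beyond (snd p) (snd q) w"
    have uniq: "q = q'" if "?d w q" "?d w q'" "w \<in> VT" for w q q'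
    proof -
      note n = nb[of q] nb[of q']
      have e: "(snd p, snd q) \<in> ET" "(snd p, snd q') \<in> ET" using n that(1,2) adj_ET[OF _ False] by blast+
      have "snd q = snd q'" using T.direction_unique[OF e _ _ that(3)] that(1,2) by blast
      thus ?thesis using pts_inj[OF uv(1) _ _ False, of q q'] n that by blast
    qed
    have dir: "?d (F u) q \<or> ?d (F v) q" if "(p, q) \<in> E0" for q
    proof -
      note n = nb[OF that]
      have "(snd p, snd q) \<in> ET" using n adj_ET[OF _ False] by blast
      thus ?thesis using T.interval_edge_separates[OF pts_snd[OF uv(1,3)] pts_snd[OF uv(1)]] n F_edge[OF uv(1)] that by blast
    qed
    have ex: "\<exists>q1. \<forall>q. ?d w q \<longrightarrow> q = q1" if "w \<in> VT" for w
    proof (cases "\<exists>q. ?d w q")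
      case True
      then obtain q1 where "?d w q1" by blast
      thus ?thesis using uniq[OF _ _ that] by blast
    qed blast
    obtain q1 where q1: "\<forall>q. ?d (F u) q \<longrightarrow> q = q1" using ex F_edge[OF uv(1)] by blast
    obtain q2 where q2: "\<forall>q. ?d (F v) q \<longrightarrow> q = q2" using ex F_edge[OF uv(1)] by blast
    show ?thesis using dir q1 q2 by blast
  qed
qed

text \<open>Edges of the subdivided tree that start at an original vertex correspond to the oriented edges
  of the original tree.\<close>

lemma first_neighbour:
  assumes uv: "(u, v) \<in> ES" shows "\<exists>!q. q \<in> pts u v \<and> adj u v (base u) q"
proof (cases "F u = F v")
  case True
  have ne: "u \<noteq> v" using EV[OF uv] by blast
  have "F u \<in> T.interval (F u) (F v)" using T.interval_ends F_edge[OF uv] by blast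
  hence m: "({u, v}, F u) \<in> pts u v" using mids_iff[OF uv] True by (auto simp: pts_def)
  have a: "{u} \<noteq> {u, v}" using ne by auto
  have b: "adj u v (base u) ({u, v}, F u)" using True a by (simp add: adj_def base_def)
  have "q = ({u, v}, F u)" if q: "q \<in> pts u v" "adj u v (base u) q" for q
  proof -
    have "snd q = F u" using pts_snd[OF uv q(1)] True T.interval_same F_edge[OF uv] by auto
    moreover have "fst q = {u, v}" using q(2) True a calculation T.irreflE by (auto simp: adj_def base_def)
    ultimately show ?thesis by (metis prod.collapse)
  qed
  thus ?thesis using m b by blast
next
  case False
  note FV = F_edge[OF uv]
  obtain t' where t': "(F u, t') \<in> ET" "T.beyond (F u) t' (F v)" using T.first_edge[of "F u" "F v"] False FV by blast
  have "t' \<in> T.interval (F u) (F v)"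
    using T.interval_step[OF t'] FV T.interval_ends(1)[OF T.EVD(2)[OF t'(1)]] by blast
  hence ex: "\<exists>q\<in>pts u v. snd q = t'"
  proof (cases "t' = F v")
    case True thus ?thesis by (auto simp: pts_def base_def)
  next
    case F: False
    moreover have "t' \<noteq> F u" using t' T.irreflE by auto
    ultimately show ?thesis using mids_iff[OF uv, of t'] \<open>t' \<in> T.interval (F u) (F v)\<close>
      by (intro bexI[of _ "({u, v}, t')"]) (auto simp: pts_def)
  qed
  then obtain q where q: "q \<in> pts u v" "snd q = t'" by blast
  have "q' = q" if "q' \<in> pts u v" "adj u v (base u) q'" for q'
  proof -
    have e: "(F u, snd q') \<in> ET" using that False by (auto simp: adj_def base_def)
    have "T.beyond (F u) (snd q') (F v)"
      using T.interval_edge_separates[OF _ pts_snd[OF uv that(1)] e] T.interval_ends FV T.not_beyond_start[OF e] by blast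
    hence "snd q' = t'" using T.direction_unique[OF e t'(1) _ t'(2)] FV by blast
    thus ?thesis using pts_inj[OF uv that(1) q(1) False] q by simp
  qed
  moreover have "adj u v (base u) q" using q t' by (simp add: adj_def base_def)
  ultimately show ?thesis using q by blast
qed

definition nb :: "'x \<Rightarrow> 'x \<Rightarrow> 'x set \<times> 'y" where
  "nb u v = (THE q. q \<in> pts u v \<and> adj u v (base u) q)"

lemma nb: assumes "(u, v) \<in> ES" shows "nb u v \<in> pts u v" "adj u v (base u) (nb u v)" "(base u, nb u v) \<in> E0"
proof -
  show *: "nb u v \<in> pts u v" "adj u v (base u) (nb u v)"
    using theI'[OF first_neighbour[OF assms]] unfolding nb_def by blast+
  have "base u \<in> pts u v" by (simp add: pts_def)
  thus "(base u, nb u v) \<in> E0" using E0I[OF assms _ *] by blast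
qed

lemma nb_unique: "(u, v) \<in> ES \<Longrightarrow> q \<in> pts u v \<Longrightarrow> adj u v (base u) q \<Longrightarrow> nb u v = q"
  unfolding nb_def using first_neighbour by (intro the1_equality) auto

lemma base_inj: "base u = base v \<longleftrightarrow> u = v"
  by (auto simp: base_def)

lemma base_edge:
  assumes "(base w, q) \<in> E0" shows "\<exists>v. (w, v) \<in> ES \<and> q = nb w v"
proof -
  obtain u v where uv: "(u, v) \<in> ES" "base w \<in> pts u v" "q \<in> pts u v" "adj u v (base w) q" using assms by (rule E0E)
  have "base w = base u \<or> base w = base v" using pts_fst[OF uv(2)] EV[OF uv(1)] by (auto simp: base_def)
  thus ?thesis
  proof
    assume "base w = base u"
    hence "w = u" by (simp add: base_inj)
    thus ?thesis using uv nb_unique by blast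
  next
    assume "base w = base v"
    hence w: "w = v" by (simp add: base_inj)
    have "nb v u = q" using nb_unique[OF S.symE[OF uv(1)]] uv w pts_commute adj_commute by metis
    thus ?thesis using w S.symE[OF uv(1)] by blast
  qed
qed

lemma nb_act:
  assumes "(u, v) \<in> ES" "g \<in> carrier \<Gamma>" shows "act0 g (nb u v) = nb (aS g u) (aS g v)"
proof -
  note e = ES_act[OF assms]
  have "(base (aS g u), act0 g (nb u v)) \<in> E0"
    using E0_act[OF nb(3)[OF assms(1)] assms(2)] act0_base[OF assms(2)] EV[OF assms(1)] by simp
  moreover have p: "act0 g (nb u v) \<in> pts (aS g u) (aS g v)" using pts_act[OF assms nb(1)[OF assms(1)]] .
  moreover have "adj (aS g u) (aS g v) (base (aS g u)) (act0 g (nb u v))"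
  proof (cases "F u = F v")
    case True
    have "F (aS g u) = F (aS g v)" using True F_equiv[OF assms(2)] EV[OF assms(1)] by simp
    moreover have f: "fst (nb u v) = {u, v}"
    proof -
      have "{u} \<noteq> {u, v}" using EV[OF assms(1)] by auto
      moreover have "(snd (base u), snd (nb u v)) \<notin> ET"
        using pts_snd[OF assms(1) nb(1)[OF assms(1)]] True T.interval_same F_edge[OF assms(1)] T.irreflE by (auto simp: base_def)
      ultimately show ?thesis using nb(2)[OF assms(1)] by (simp add: adj_def base_def)
    qed
    moreover have "{aS g u} \<noteq> {aS g u, aS g v}" using EV[OF e] by auto
    ultimately show ?thesis by (simp add: adj_def base_def act0_def)
  next
    case False
    hence "(F u, snd (nb u v)) \<in> ET" using nb(2)[OF assms(1)] by (simp add: adj_def base_def)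
    from T.E_act[OF this phi_closed[OF assms(2)]] show ?thesis
      using F_equiv[OF assms(2)] EV[OF assms(1)] by (simp add: adj_def base_def act0_def)
  qed
  ultimately show ?thesis using nb_unique[OF e] by metis
qed

lemma fin_mids: "finite (mids // r0)"
proof -
  let ?e = "\<lambda>C. SOME e. e \<in> C \<and> e \<in> ES"
  let ?P = "\<lambda>C. (\<lambda>t. r0 `` {({fst (?e C), snd (?e C)}, t)}) ` T.interval (F (fst (?e C))) (F (snd (?e C)))"
  have e: "?e C \<in> C \<and> ?e C \<in> ES" if C: "C \<in> ES // sS" for C
  proof -
    obtain p where "p \<in> ES" "C = sS `` {p}" using quotientE[OF C] by metis
    hence "p \<in> C \<and> p \<in> ES" using equiv_class_self[OF S.equiv_edge_Id] by blast
    thus ?thesis by (rule someI)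
  qed
  have "mids // r0 \<subseteq> (\<Union>C\<in>ES // sS. ?P C)"
  proof
    fix Z assume "Z \<in> mids // r0"
    then obtain p where p: "p \<in> mids" "Z = r0 `` {p}" by (meson quotientE)
    obtain u v where uv: "(u, v) \<in> ES" "fst p = {u, v}" "p \<in> pts u v" using p(1) by (rule midsE)
    let ?C = "sS `` {(u, v)}"
    have C: "?C \<in> ES // sS" by (rule quotientI[OF uv(1)])
    obtain a b where ab: "?e ?C = (a, b)" by (cases "?e ?C")
    hence "((u, v), (a, b)) \<in> sS" using e[OF C] by auto
    then obtain g where g: "g \<in> carrier \<Gamma>" "aS g u = a" "aS g v = b" unfolding S.edge_orb_Id by blast
    have pV: "p \<in> V0" using pts_V0 uv by blast
    have q: "act0 g p \<in> pts a b" using pts_act[OF uv(1) g(1) uv(3)] g by simp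
    have abE: "(a, b) \<in> ES" using ES_act[OF uv(1) g(1)] g by simp
    have "fst (act0 g p) = {a, b}" using uv(2) g by (simp add: act0_def)
    hence qe: "act0 g p = ({a, b}, snd (act0 g p))" by (metis prod.collapse)
    have "Z = r0 `` {act0 g p}" using p(2) equiv_class_eq[OF equiv_r0 r0I[OF pV g(1) refl]] by simp
    moreover have "snd (act0 g p) \<in> T.interval (F a) (F b)" using pts_snd[OF abE q] .
    ultimately have "Z \<in> ?P ?C" using ab qe by (intro image_eqI[of _ _ "snd (act0 g p)"]) auto
    thus "Z \<in> (\<Union>C\<in>ES // sS. ?P C)" using C by blast
  qed
  moreover have "finite (\<Union>C\<in>ES // sS. ?P C)"
  proof (intro finite_UN_I[OF finES] finite_imageI T.finite_interval)
    fix C assume C: "C \<in> ES // sS"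
    have "(fst (?e C), snd (?e C)) \<in> ES" using e[OF C] by simp
    from F_edge[OF this] show "F (fst (?e C)) \<in> VT" "F (snd (?e C)) \<in> VT" by blast+
  qed
  ultimately show ?thesis by (rule finite_subset)
qed

lemma base_sub: "base ` VS \<subseteq> V0" and mids_sub: "mids \<subseteq> V0"
  by (auto simp: V0_def)

lemma base_not_mids: "base v \<notin> mids"
  by (auto simp: base_def mids_def dest: EV)

lemma fin_base: "finite (base ` VS // r0)"
  and card_base: "card (base ` VS // r0) = card (VS // rS)"
proof -
  have resp: "(base x, base y) \<in> r0" if xy: "x \<in> VS" "(x, y) \<in> rS" for x y
  proof -
    obtain g where g: "g \<in> carrier \<Gamma>" "aS g x = y" using xy(2) unfolding S.orb_rel_Id by blast
    have "base x \<in> V0" using base_sub xy(1) by blast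
    thus ?thesis by (rule r0I[OF _ g(1)]) (simp add: act0_base[OF g(1) xy(1)] g(2))
  qed
  note 1 = quotient_card_surj[OF finVS S.equiv_vert_Id subset_refl equiv_r0 base_sub subset_refl resp]
  show fin: "finite (base ` VS // r0)" using 1(1) by blast
  have f: "the_elem (fst (base v)) = v" for v by (simp add: base_def)
  have "VS \<subseteq> (\<lambda>p. the_elem (fst p)) ` base ` VS" using f by (auto simp: image_iff)
  moreover have "(the_elem (fst p), the_elem (fst q)) \<in> rS" if pq: "p \<in> base ` VS" "q \<in> base ` VS" "(p, q) \<in> r0" for p q
  proof -
    obtain x y where xy: "x \<in> VS" "y \<in> VS" "p = base x" "q = base y" using pq by auto
    obtain g where g: "g \<in> carrier \<Gamma>" "act0 g p = q" using r0D[OF pq(3)] by blast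
    hence "aS g x = y" using act0_base[OF g(1) xy(1)] xy base_inj by simp
    thus ?thesis using xy f g S.orb_rel_Id by auto
  qed
  ultimately have "card (VS // rS) \<le> card (base ` VS // r0)"
    using quotient_card_surj(2)[OF fin equiv_r0 base_sub S.equiv_vert_Id subset_refl] by blast
  thus "card (base ` VS // r0) = card (VS // rS)" using 1(2) by simp
qed

lemma finV0: "finite (V0 // r0)"
  unfolding V0_def[of] quotient_Un using fin_base fin_mids by (simp add: V0_def[symmetric])

lemma num_vert_0: "num_vert \<Gamma> act0 V0 R0 = num_vert \<Gamma> aS VS (Id_on VS) + card (mids // r0)"
proof -
  have "(base ` VS // r0) \<inter> (mids // r0) = {}"
  proof (rule quotient_disjoint[OF equiv_r0 base_sub mids_sub])
    fix x y assume x: "x \<in> base ` VS" and y: "y \<in> mids"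
    show "(x, y) \<notin> r0"
    proof
      assume "(x, y) \<in> r0"
      then obtain g where g: "g \<in> carrier \<Gamma>" "act0 g x = y" using r0D by blast
      thus False using x y act0_base[OF g(1)] base_not_mids by auto
    qed
  qed
  moreover have "V0 // r0 = base ` VS // r0 \<union> mids // r0" using quotient_Un[of "base ` VS" mids r0] by (simp add: V0_def)
  ultimately show ?thesis unfolding num_vert_def using fin_base fin_mids card_base by (simp add: card_Un_disjoint)
qed

text \<open>An edge starts at an original vertex or at one of the subdivision points. The former are
  counted by oriented edges of the original tree, and for the latter there are at most two per
  point.\<close>

lemma edges_0:
  shows finE0: "finite (E0 // s0)"
    and num_edge_0: "num_edge \<Gamma> act0 E0 R0 \<le> num_edge \<Gamma> aS ES (Id_on VS) + 2 * card (mids // r0)"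
proof -
  let ?b = "\<lambda>(u, v). (base u, nb u v)"
  let ?Eb = "?b ` ES"
  define Ei where "Ei = {e \<in> E0. fst e \<in> mids}"
  have Eb: "?Eb \<subseteq> E0" using nb(3) by auto
  have cover: "E0 \<subseteq> ?Eb \<union> Ei"
  proof
    fix e assume e: "e \<in> E0"
    show "e \<in> ?Eb \<union> Ei"
    proof (cases "fst e \<in> mids")
      case False
      have "fst e \<in> V0" using E0_V[of "fst e" "snd e"] e by simp
      then obtain w where w: "w \<in> VS" "fst e = base w" using False by (auto simp: V0_def)
      then obtain v where v: "(w, v) \<in> ES" "snd e = nb w v" using base_edge[of w "snd e"] e by (metis prod.collapse)
      have "e = ?b (w, v)" using w v by (simp add: prod_eq_iff)
      thus ?thesis using v by blast
    qed (use e in \<open>simp add: Ei_def\<close>)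
  qed
  hence E0: "E0 = ?Eb \<union> Ei" using Eb by (auto simp: Ei_def)
  have resp: "(?b e, ?b e') \<in> s0" if ee: "e \<in> ES" "(e, e') \<in> sS" for e e'
  proof -
    obtain u v u' v' where e: "e = (u, v)" "e' = (u', v')" by (cases e; cases e')
    then obtain g where g: "g \<in> carrier \<Gamma>" "aS g u = u'" "aS g v = v'" using ee(2) S.edge_orb_Id by blast
    have uv: "(u, v) \<in> ES" using e ee by simp
    show ?thesis using s0I[OF nb(3)[OF uv] g(1)] act0_base[OF g(1)] nb_act[OF uv g(1)] EV[OF uv] g e by simp
  qed
  note 1 = quotient_card_surj[OF finES S.equiv_edge_Id subset_refl equiv_s0 Eb subset_refl resp]
  let ?p = "\<lambda>C. SOME p. p \<in> C \<and> p \<in> mids"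
  let ?Q = "\<lambda>C. (\<lambda>q. s0 `` {(?p C, q)}) ` {q. (?p C, q) \<in> E0}"
  have pC: "?p C \<in> C \<and> ?p C \<in> mids" if C: "C \<in> mids // r0" for C
  proof -
    obtain p where "p \<in> mids" "C = r0 `` {p}" using quotientE[OF C] by metis
    hence "p \<in> C \<and> p \<in> mids" using equiv_class_self[OF equiv_r0] mids_sub by blast
    thus ?thesis by (rule someI)
  qed
  have sub: "Ei // s0 \<subseteq> (\<Union>C\<in>mids // r0. ?Q C)"
  proof
    fix Z assume "Z \<in> Ei // s0"
    then obtain e where e: "e \<in> Ei" "Z = s0 `` {e}" by (meson quotientE)
    obtain p q where pq: "e = (p, q)" by (cases e)
    have p: "p \<in> mids" "(p, q) \<in> E0" using e pq by (auto simp: Ei_def)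
    let ?C = "r0 `` {p}"
    have C: "?C \<in> mids // r0" by (rule quotientI[OF p(1)])
    have "(p, ?p ?C) \<in> r0" using pC[OF C] by blast
    then obtain g where g: "g \<in> carrier \<Gamma>" "act0 g p = ?p ?C" using r0D by blast
    have "(e, (?p ?C, act0 g q)) \<in> s0" using s0I[OF p(2) g refl] pq by simp
    hence "Z = s0 `` {(?p ?C, act0 g q)}" using equiv_class_eq[OF equiv_s0] e by simp
    moreover have "(?p ?C, act0 g q) \<in> E0" using E0_act[OF p(2) g(1)] g(2) by simp
    ultimately have "Z \<in> ?Q ?C" by blast
    thus "Z \<in> (\<Union>C\<in>mids // r0. ?Q C)" using C by blast
  qed
  have Q: "finite (?Q C) \<and> card (?Q C) \<le> 2" if C: "C \<in> mids // r0" for C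
  proof -
    obtain q1 q2 where q: "\<forall>q. (?p C, q) \<in> E0 \<longrightarrow> q = q1 \<or> q = q2" using mids_neighbours pC[OF C] by blast
    hence s: "{q. (?p C, q) \<in> E0} \<subseteq> {q1, q2}" by blast
    hence f: "finite {q. (?p C, q) \<in> E0}" by (rule finite_subset) simp
    have "card {q. (?p C, q) \<in> E0} \<le> card {q1, q2}" by (rule card_mono[OF _ s]) simp
    also have "\<dots> \<le> 2" by (simp add: card_insert_if)
    finally show ?thesis using f card_image_le[OF f, of "\<lambda>q. s0 `` {(?p C, q)}"] by simp
  qed
  have finU: "finite (\<Union>C\<in>mids // r0. ?Q C)" using fin_mids Q by blast
  have "card (\<Union>C\<in>mids // r0. ?Q C) \<le> (\<Sum>C\<in>mids // r0. card (?Q C))" by (rule card_UN_le[OF fin_mids])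
  also have "\<dots> \<le> (\<Sum>C\<in>mids // r0. 2)" by (rule sum_mono) (use Q in blast)
  finally have "card (Ei // s0) \<le> 2 * card (mids // r0)" using card_mono[OF finU sub] by simp
  moreover have fi: "finite (Ei // s0)" using finite_subset[OF sub finU] .
  moreover have eq: "E0 // s0 = ?Eb // s0 \<union> Ei // s0" using quotient_Un[of ?Eb Ei s0] E0 by simp
  moreover have "card (?Eb // s0) \<le> num_edge \<Gamma> aS ES (Id_on VS)" "finite (?Eb // s0)" using 1 unfolding num_edge_def by blast+
  ultimately show "finite (E0 // s0)" "num_edge \<Gamma> act0 E0 R0 \<le> num_edge \<Gamma> aS ES (Id_on VS) + 2 * card (mids // r0)"
    unfolding num_edge_def using card_Un_le[of "?Eb // s0" "Ei // s0"] by auto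
qed

lemma defect_0: "defect \<Gamma> act0 V0 E0 R0 \<le> defect \<Gamma> aS VS ES (Id_on VS)"
  using num_vert_0 num_edge_0 by (simp add: defect_def)

text \<open>An element that fixes a subdivision point fixes the edge that carries it.\<close>

lemma big_0: assumes "p \<in> big_verts \<Gamma> act0 V0 E0 R0" shows "\<exists>v\<in>big_verts \<Gamma> aS VS ES (Id_on VS). p = base v"
proof -
  obtain a b g where *: "p \<in> V0" "g \<in> carrier \<Gamma>" "(a, b) \<in> E0" "(a, p) \<in> R0" "(act0 g p, p) \<in> R0" "(act0 g b, b) \<notin> R0"
    using assms by (rule big_vertsE)
  obtain n where n: "n \<in> N" "act0 n a = p" using R0E[OF *(4)] by metis
  define c where "c = act0 n b"
  have bV: "b \<in> V0" using E0_V[OF *(3)] by blast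
  have c: "(p, c) \<in> E0" using E0_act[OF *(3) N_carrier[OF n(1)]] n by (simp add: c_def)
  have bc: "(b, c) \<in> R0" using R0I[OF bV n(1)] by (simp add: c_def)
  obtain m where m: "m \<in> N" "act0 m (act0 g p) = p" using R0E[OF *(5)] by metis
  define h where "h = m \<otimes>\<^bsub>\<Gamma>\<^esub> g"
  have h: "h \<in> carrier \<Gamma>" "act0 h p = p" using m *(1,2) N_carrier by (simp_all add: h_def X.act_mult)
  have cV: "c \<in> V0" using E0_V[OF c] by blast
  have hc: "act0 h c \<noteq> c"
  proof
    assume "act0 h c = c"
    hence "act0 m (act0 g c) = c" using X.act_mult[OF N_carrier[OF m(1)] *(2) cV] by (simp add: h_def)
    hence "(act0 g c, c) \<in> R0" using R0I[OF X.act_closed[OF *(2) cV] m(1)] by simp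
    hence "(act0 g b, c) \<in> R0" using R0_trans[OF R0_act[OF bc *(2)]] by blast
    thus False using R0_trans[OF _ R0_sym[OF bc]] *(6) by blast
  qed
  have "p \<notin> mids" using mids_fix[OF _ h c] hc by blast
  then obtain v where v: "v \<in> VS" "p = base v" using *(1) by (auto simp: V0_def)
  then obtain w where w: "(v, w) \<in> ES" "c = nb v w" using base_edge c by blast
  have hv: "aS h v = v" using h v act0_base base_inj by metis
  have "aS h w \<noteq> w"
  proof
    assume "aS h w = w"
    hence "act0 h c = c" using nb_act[OF w(1) h(1)] hv w(2) by simp
    thus False using hc by simp
  qed
  hence "v \<in> big_verts \<Gamma> aS VS ES (Id_on VS)" using S.big_iff hv w(1) h(1) by blast
  thus ?thesis using v by blast
qed

lemma num_big_0: "num_big \<Gamma> act0 V0 E0 R0 \<le> num_big \<Gamma> aS VS ES (Id_on VS)"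
proof -
  have bS: "big_verts \<Gamma> aS VS ES (Id_on VS) \<subseteq> VS" and b0: "big_verts \<Gamma> act0 V0 E0 R0 \<subseteq> V0"
    by (rule big_verts_sub)+
  have fin: "finite (big_verts \<Gamma> aS VS ES (Id_on VS) // rS)"
    by (rule finite_subset[OF _ finVS]) (use bS in \<open>auto simp: quotient_def\<close>)
  show ?thesis unfolding num_big_def
  proof (rule quotient_card_surj(2)[OF fin S.equiv_vert_Id bS equiv_r0 b0])
    show "big_verts \<Gamma> act0 V0 E0 R0 \<subseteq> base ` big_verts \<Gamma> aS VS ES (Id_on VS)" using big_0 by blast
    fix x y assume xy: "x \<in> big_verts \<Gamma> aS VS ES (Id_on VS)" "(x, y) \<in> rS"
    then obtain g where g: "g \<in> carrier \<Gamma>" "aS g x = y" using S.orb_rel_Id by blast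
    have x: "x \<in> VS" using xy bS by blast
    have "base x \<in> V0" using base_sub x by blast
    thus "(base x, base y) \<in> r0" by (rule r0I[OF _ g(1)]) (simp add: act0_base[OF g(1) x] g(2))
  qed
qed

end

section \<open>The complexity of the image\<close>

lemma orb_rel_mono: "R \<subseteq> R' \<Longrightarrow> orb_rel \<Gamma> act V R \<subseteq> orb_rel \<Gamma> act V R'"
  unfolding orb_rel_def by blast

lemma edge_orb_rel_mono: assumes "R \<subseteq> R'" shows "edge_orb_rel \<Gamma> act E R \<subseteq> edge_orb_rel \<Gamma> act E R'"
proof -
  have "pair_rel R \<subseteq> pair_rel R'" using assms unfolding pair_rel_def by blast
  thus ?thesis unfolding edge_orb_rel_def by (intro orb_rel_mono) blast
qed

context tree_map
begin

text \<open>The hull of the image is the tree onto which the subdivided tree is folded.\<close>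

definition VI where "VI = snd ` V0"
definition EI where "EI = ET \<inter> VI \<times> VI"

lemma VI_sub: "VI \<subseteq> VT" using V0_snd by (auto simp: VI_def)

lemma F_VI: "v \<in> VS \<Longrightarrow> F v \<in> VI"
  unfolding VI_def using base_sub by (intro image_eqI[of _ _ "base v"]) (auto simp: base_def)

lemma E0_snd: "(p, q) \<in> E0 \<Longrightarrow> (snd p, snd q) \<in> EI \<or> snd p = snd q"
  using E0_types[of p q] E0_V[of p q] unfolding EI_def VI_def by blast

lemma VI_connected: assumes "x \<in> VI" "y \<in> VI" shows "(x, y) \<in> EI\<^sup>*"
proof -
  obtain p q where pq: "p \<in> V0" "q \<in> V0" "x = snd p" "y = snd q" using assms unfolding VI_def by blast
  have "(p, q) \<in> E0\<^sup>*" using E0_connected pq by blast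
  hence "(snd p, snd q) \<in> EI\<^sup>*"
  proof (induction rule: rtrancl_induct)
    case (step a b)
    from E0_snd[OF step(2)] show ?case
      using step(3) by (elim disjE) (simp_all add: rtrancl_into_rtrancl)
  qed simp
  thus ?thesis using pq by simp
qed

lemma VI_act: assumes "h \<in> carrier H" "x \<in> VI" shows "aT h x \<in> VI"
proof -
  obtain p where p: "p \<in> V0" "x = snd p" using assms unfolding VI_def by blast
  have "h \<in> \<phi> ` carrier \<Gamma>" using onto assms(1) by simp
  then obtain g where g: "g \<in> carrier \<Gamma>" "h = \<phi> g" by blast
  have "aT h x = snd (act0 g p)" using p g by (simp add: act0_def)
  thus ?thesis unfolding VI_def using X.act_closed[OF g(1) p(1)] by blast
qed

sublocale I: ctree_act VI EI H aT
proof -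
  interpret ctree VI EI unfolding EI_def
    by (rule T.subtree[OF VI_sub]) (use VI_connected in \<open>simp add: EI_def\<close>)
  interpret gact H VI aT by (rule T.gact_subset[OF VI_sub VI_act])
  show "ctree_act VI EI H aT"
  proof unfold_locales
    show "invariant_rel H aT EI" unfolding invariant_rel_def EI_def using T.E_act VI_act by blast
    show "aT g y \<noteq> x" if "(x, y) \<in> EI" "g \<in> carrier H" "aT g x = y" for x y g
      using T.noinvE that unfolding EI_def by blast
  qed
qed

lemma EI_lift:
  assumes "(t, t') \<in> EI"
  obtains p q where "(p, q) \<in> E0" "snd p = t" "snd q = t'" "\<not> hair p" "\<not> hair q"
proof -
  have e: "(t, t') \<in> ET" "t \<in> VI" "t' \<in> VI" using assms by (auto simp: EI_def)
  obtain x y where xy: "x \<in> V0" "y \<in> V0" "t = snd x" "t' = snd y" using e unfolding VI_def by blast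
  obtain p q where pq: "(p, q) \<in> E0" "\<not> T.beyond t t' (snd p)" "T.beyond t t' (snd q)"
    using rtrancl_crossing[OF E0_connected[OF xy(1,2)], of "\<lambda>r. T.beyond t t' (snd r)"]
      T.not_beyond_start[OF e(1)] T.beyond_cut(2)[OF e(1)] xy by metis
  have n: "snd p \<noteq> snd q" using pq by metis
  hence t: "(snd p, snd q) \<in> ET" "\<not> hair p" "\<not> hair q" using E0_types[OF pq(1)] by blast+
  have "snd p = t \<and> snd q = t'" using T.beyond_edge[OF e(1) t(1)] pq(2,3) T.not_beyond_start[OF e(1)] by metis
  thus ?thesis using that pq(1) t by blast
qed

abbreviation "rI \<equiv> orb_rel H aT VI (Id_on VI)"
abbreviation "sI \<equiv> edge_orb_rel H aT EI (Id_on VI)"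

lemma rmD: assumes "(p, q) \<in> rm"
  shows "p \<in> V0" "q \<in> V0" "hair p = hair q" "(snd p, snd q) \<in> rI"
proof -
  obtain g where g: "p \<in> V0" "q \<in> V0" "g \<in> carrier \<Gamma>" "(act0 g p, q) \<in> Rm" using assms unfolding orb_rel_def by blast
  show "p \<in> V0" "q \<in> V0" using g by auto
  show "hair p = hair q" using RmD[OF g(4)] hair_act[OF g(3,1)] by simp
  have "aT (\<phi> g) (snd p) = snd q" using RmD[OF g(4)] by (simp add: act0_def)
  moreover have "snd p \<in> VI" using g(1) by (simp add: VI_def)
  ultimately show "(snd p, snd q) \<in> rI" using I.orb_rel_Id phi_closed[OF g(3)] by blast
qed

lemma rmI: assumes "p \<in> V0" "q \<in> V0" "\<not> hair p" "\<not> hair q" "(snd p, snd q) \<in> rI" shows "(p, q) \<in> rm"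
proof -
  obtain h where h: "h \<in> carrier H" "aT h (snd p) = snd q" using assms(5) I.orb_rel_Id by blast
  have "h \<in> \<phi> ` carrier \<Gamma>" using onto h(1) by simp
  then obtain g where g: "g \<in> carrier \<Gamma>" "h = \<phi> g" by blast
  have "(act0 g p, q) \<in> Rm"
    using RmI[OF X.act_closed[OF g(1) assms(1)] assms(2)] h g hair_act[OF g(1) assms(1)] assms(3,4) by (simp add: act0_def)
  thus ?thesis using assms(1,2) g(1) unfolding orb_rel_def by blast
qed

lemma smD: assumes "((p, q), (p', q')) \<in> sm" shows "(p, p') \<in> rm" "(q, q') \<in> rm" "((snd p, snd q), (snd p', snd q')) \<in> pair_rel UNIV"
  using assms E0_V[of p q] E0_V[of p' q'] unfolding edge_orb_rel_iff orb_rel_def by auto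

definition Vh where "Vh = {p \<in> V0. hair p}"

lemma finite_rm: "finite (V0 // rm)" "finite (E0 // sm)"
proof -
  have m: "r0 \<subseteq> rm" "s0 \<subseteq> sm" using orb_rel_mono[OF R0_sub_Rm] edge_orb_rel_mono[OF R0_sub_Rm] by blast+
  show "finite (V0 // rm)"
    by (rule quotient_card_surj(1)[OF finV0 equiv_r0 subset_refl equiv_rm subset_refl, of id]) (use m in auto)
  show "finite (E0 // sm)"
    by (rule quotient_card_surj(1)[OF finE0 equiv_s0 subset_refl equiv_sm subset_refl, of id]) (use m in auto)
qed

lemma finite_sub_rm: "A \<subseteq> V0 \<Longrightarrow> finite (A // rm)" "B \<subseteq> E0 \<Longrightarrow> finite (B // sm)"
  by (rule finite_subset[OF _ finite_rm(1)], auto simp: quotient_def, rule finite_subset[OF _ finite_rm(2)], auto simp: quotient_def)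

lemma finVI: "finite (VI // rI)"
  by (rule quotient_card_surj(1)[OF finite_rm(1) equiv_rm subset_refl I.equiv_vert_Id subset_refl, of snd])
    (auto simp: VI_def dest: rmD(4))

lemma num_vert_m: "num_vert \<Gamma> act0 V0 Rm \<le> num_vert H aT VI (Id_on VI) + card (Vh // rm)"
proof -
  let ?n = "V0 - Vh"
  have "?n // rm \<subseteq> (\<lambda>D. {p \<in> ?n. snd p \<in> D}) ` (VI // rI)"
  proof
    fix Z assume "Z \<in> ?n // rm"
    then obtain p where p: "p \<in> ?n" "Z = rm `` {p}" by (meson quotientE)
    have "rm `` {p} = {q \<in> ?n. snd q \<in> rI `` {snd p}}"
    proof (rule Set.set_eqI)
      fix q show "q \<in> rm `` {p} \<longleftrightarrow> q \<in> {q \<in> ?n. snd q \<in> rI `` {snd p}}"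
        using rmD[of p q] rmI[of p q] p(1) unfolding Vh_def by blast
    qed
    moreover have "snd p \<in> VI" using p by (simp add: VI_def)
    hence "rI `` {snd p} \<in> VI // rI" by (rule quotientI)
    ultimately show "Z \<in> (\<lambda>D. {p \<in> ?n. snd p \<in> D}) ` (VI // rI)" using p by blast
  qed
  hence "card (?n // rm) \<le> card (VI // rI)" by (rule surj_card_le[OF finVI])
  moreover have "V0 // rm = ?n // rm \<union> Vh // rm" using quotient_Un[of ?n Vh rm] by (simp add: Vh_def Un_Diff_cancel2 Un_absorb2)
  moreover have "card (?n // rm \<union> Vh // rm) \<le> card (?n // rm) + card (Vh // rm)" by (rule card_Un_le)
  ultimately show ?thesis unfolding num_vert_def by simp
qed

lemma hair_edge: assumes "p \<in> Vh" shows "\<exists>q. (p, q) \<in> E0"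
proof -
  have p: "p \<in> V0" "hair p" using assms by (auto simp: Vh_def)
  then obtain u v where uv: "(u, v) \<in> ES" "F u = F v" "fst p = {u, v}" by (auto simp: hair_def)
  have "p \<in> mids" using hair_mids p by blast
  hence pp: "p \<in> pts u v" using uv(3) by (simp add: pts_def)
  have "{u} \<noteq> {u, v}" using EV[OF uv(1)] by auto
  hence "adj u v p (base u)" using uv by (simp add: adj_def base_def)
  moreover have "base u \<in> pts u v" by (simp add: pts_def)
  ultimately show ?thesis using E0I[OF uv(1) pp] by blast
qed

text \<open>Edges of the quotient by \<open>Rm\<close> come in three kinds: those over the target, and one in each
  orientation for each hair. The hairs thus cancel with the vertices in \<open>num_vert_m\<close>.\<close>

lemma edges_m:
  shows finEI: "finite (EI // sI)"
    and num_edge_m: "num_edge H aT EI (Id_on VI) + 2 * card (Vh // rm) \<le> num_edge \<Gamma> act0 E0 Rm"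
proof -
  define En where "En = {e \<in> E0. \<not> hair (fst e) \<and> \<not> hair (snd e)}"
  define E1 where "E1 = {e \<in> E0. hair (fst e)}"
  define E2 where "E2 = {e \<in> E0. hair (snd e)}"
  have sub: "En \<subseteq> E0" "E1 \<subseteq> E0" "E2 \<subseteq> E0" by (auto simp: En_def E1_def E2_def)
  have smh: "hair (fst e) = hair (fst e')" "hair (snd e) = hair (snd e')" if "(e, e') \<in> sm" for e e'
    using smD[of "fst e" "snd e" "fst e'" "snd e'"] rmD(3) that by auto
  have one: "\<not> (hair (fst e) \<and> hair (snd e))" if "e \<in> E0" for e using E0_types[of "fst e" "snd e"] that by auto
  have d: "En // sm \<inter> E1 // sm = {}" "(En // sm \<union> E1 // sm) \<inter> E2 // sm = {}"
  proof -
    show "En // sm \<inter> E1 // sm = {}"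
      by (rule quotient_disjoint[OF equiv_sm sub(1,2)]) (use smh in \<open>auto simp: En_def E1_def\<close>)
    have "En // sm \<inter> E2 // sm = {}"
      by (rule quotient_disjoint[OF equiv_sm sub(1,3)]) (use smh in \<open>auto simp: En_def E2_def\<close>)
    moreover have "E1 // sm \<inter> E2 // sm = {}"
      by (rule quotient_disjoint[OF equiv_sm sub(2,3)]) (use smh one in \<open>auto simp: E1_def E2_def\<close>)
    ultimately show "(En // sm \<union> E1 // sm) \<inter> E2 // sm = {}" by blast
  qed
  let ?f = "\<lambda>e. (snd (fst e), snd (snd e))"
  have f: "EI \<subseteq> ?f ` En"
  proof
    fix d assume d: "d \<in> EI"
    obtain t t' where t: "d = (t, t')" by (cases d)
    obtain p q where "(p, q) \<in> E0" "snd p = t" "snd q = t'" "\<not> hair p" "\<not> hair q" using EI_lift d t by metis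
    hence "(p, q) \<in> En" "d = ?f (p, q)" using t by (simp_all add: En_def)
    thus "d \<in> ?f ` En" by (rule image_eqI[rotated])
  qed
  have resp: "(?f x, ?f y) \<in> sI" if xy: "(x, y) \<in> sm" "?f x \<in> EI" for x y
  proof -
    obtain p q p' q' where e: "x = (p, q)" "y = (p', q')" by (cases x; cases y)
    obtain g where g: "g \<in> carrier \<Gamma>" "(act0 g p, p') \<in> Rm" "(act0 g q, q') \<in> Rm"
      using xy(1) unfolding e edge_orb_rel_iff by (elim conjE bexE)
    hence "aT (\<phi> g) (snd p) = snd p'" "aT (\<phi> g) (snd q) = snd q'" using RmD[OF g(2)] RmD[OF g(3)] by (simp_all add: act0_def)
    thus ?thesis using I.edge_orb_Id xy(2) e phi_closed[OF g(1)] by auto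
  qed
  note 1 = quotient_card_surj[OF finite_sub_rm(2)[OF sub(1)] equiv_sm sub(1) I.equiv_edge_Id subset_refl f resp]
  show "finite (EI // sI)" using 1(1) by blast
  have c1: "card (EI // sI) \<le> card (En // sm)" using 1(2) by blast
  have Vh: "Vh \<subseteq> V0" by (auto simp: Vh_def)
  have "Vh \<subseteq> fst ` E1"
  proof
    fix p assume p: "p \<in> Vh"
    then obtain q where "(p, q) \<in> E0" using hair_edge by blast
    hence "(p, q) \<in> E1" using p by (simp add: E1_def Vh_def)
    thus "p \<in> fst ` E1" by (metis fst_conv image_eqI)
  qed
  hence c2: "card (Vh // rm) \<le> card (E1 // sm)"
    by (rule quotient_card_surj(2)[OF finite_sub_rm(2)[OF sub(2)] equiv_sm sub(2) equiv_rm Vh]) (metis smD(1) prod.collapse)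
  have "Vh \<subseteq> snd ` E2"
  proof
    fix p assume p: "p \<in> Vh"
    then obtain q where "(p, q) \<in> E0" using hair_edge by blast
    hence "(q, p) \<in> E2" using p E0_sym by (simp add: E2_def Vh_def)
    thus "p \<in> snd ` E2" by (metis snd_conv image_eqI)
  qed
  hence c3: "card (Vh // rm) \<le> card (E2 // sm)"
    by (rule quotient_card_surj(2)[OF finite_sub_rm(2)[OF sub(3)] equiv_sm sub(3) equiv_rm Vh]) (metis smD(2) prod.collapse)
  have "En // sm \<union> E1 // sm \<union> E2 // sm \<subseteq> E0 // sm" using sub by (auto simp: quotient_def)
  hence "card (En // sm \<union> E1 // sm \<union> E2 // sm) \<le> card (E0 // sm)" by (rule card_mono[OF finite_rm(2)])
  moreover have "card (En // sm \<union> E1 // sm \<union> E2 // sm) = card (En // sm) + card (E1 // sm) + card (E2 // sm)"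
    using card_Un_disjoint[OF _ _ d(1)] card_Un_disjoint[OF _ _ d(2)] finite_sub_rm(2)[OF sub(1)] finite_sub_rm(2)[OF sub(2)]
      finite_sub_rm(2)[OF sub(3)] by simp
  ultimately show "num_edge H aT EI (Id_on VI) + 2 * card (Vh // rm) \<le> num_edge \<Gamma> act0 E0 Rm"
    unfolding num_edge_def using c1 c2 c3 by simp
qed

lemma defect_m: "defect H aT VI EI (Id_on VI) \<le> defect \<Gamma> act0 V0 E0 Rm"
  using num_vert_m num_edge_m by (simp add: defect_def)

lemma num_big_m: "num_big H aT VI EI (Id_on VI) \<le> num_big \<Gamma> act0 V0 E0 Rm"
proof -
  let ?B = "big_verts \<Gamma> act0 V0 E0 Rm" and ?C = "big_verts H aT VI EI (Id_on VI)"
  have "?C \<subseteq> snd ` ?B"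
  proof
    fix t assume "t \<in> ?C"
    then obtain t' h where t': "h \<in> carrier H" "(t, t') \<in> EI" "aT h t = t" "aT h t' \<noteq> t'" unfolding I.big_iff by blast
    obtain p q where pq: "(p, q) \<in> E0" "snd p = t" "snd q = t'" "\<not> hair p" "\<not> hair q" using EI_lift t' by metis
    have "h \<in> \<phi> ` carrier \<Gamma>" using onto t'(1) by simp
    then obtain g where g: "g \<in> carrier \<Gamma>" "h = \<phi> g" by blast
    have pV: "p \<in> V0" using E0_V pq by blast
    have "(act0 g p, p) \<in> Rm" using RmI[OF X.act_closed[OF g(1) pV] pV] hair_act[OF g(1) pV] pq t' g by (simp add: act0_def)
    moreover have "(p, p) \<in> Rm" using RmI[OF pV pV] pq by simp
    moreover have "(act0 g q, q) \<notin> Rm" using RmD[of "act0 g q" q] t'(4) pq(3) g(2) by (auto simp: act0_def)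
    ultimately have "p \<in> ?B" using big_vertsI[OF pV g(1) pq(1)] by blast
    thus "t \<in> snd ` ?B" using pq(2) by blast
  qed
  thus ?thesis unfolding num_big_def
    by (rule quotient_card_surj(2)[OF finite_sub_rm(1)[OF big_verts_sub] equiv_rm big_verts_sub I.equiv_vert_Id big_verts_sub])
      (rule rmD(4))
qed

sublocale Z: graph_over_tree \<Gamma> V0 act0 E0 R0 Rm
proof unfold_locales
  show "E0 \<subseteq> V0 \<times> V0" by (rule E0_sub)
  show "invariant_rel \<Gamma> act0 E0" by (rule inv_E0)
  show "equiv V0 R0" "invariant_rel \<Gamma> act0 R0" "equiv V0 Rm" "invariant_rel \<Gamma> act0 Rm" "R0 \<subseteq> Rm"
    by (rule equiv_R0 inv_R0 equiv_Rm inv_Rm R0_sub_Rm)+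
  show "finite (V0 // orb_rel \<Gamma> act0 V0 R0)" by (rule finV0)
  show "finite (E0 // edge_orb_rel \<Gamma> act0 E0 R0)" by (rule finE0)
  fix p q assume e: "(p, q) \<in> E0"
  show "(q, p) \<in> E0" using E0_sym e .
  show "(p, q) \<notin> Rm" using RmD[of p q] E0_types[OF e] T.irreflE by metis
  show "\<exists>c. is_cut E0 Rm p q c" using cut0 e .
  fix g assume g: "g \<in> carrier \<Gamma>"
  show "(act0 g p, q) \<in> Rm \<Longrightarrow> (act0 g q, p) \<notin> Rm" using noinv0[OF e g] .
  show "(act0 g p, p) \<in> Rm \<Longrightarrow> (act0 g q, q) \<in> Rm \<Longrightarrow> (act0 g p, p) \<in> R0 \<and> (act0 g q, q) \<in> R0" using stab0[OF e g] .
next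
  fix p q assume "p \<in> V0" "q \<in> V0" thus "(p, q) \<in> E0\<^sup>*" by (rule E0_connected)
qed

text \<open>An equivariant map that does not increase edge stabilizers does not increase the complexity,
  and if it preserves the complexity, then the quotient of its source by the kernel is a tree.\<close>

theorem complexity_compare:
  "defect H aT VI EI (Id_on VI) \<le> defect \<Gamma> aS VS ES (Id_on VS)"
  "defect H aT VI EI (Id_on VI) = defect \<Gamma> aS VS ES (Id_on VS) \<Longrightarrow>
     num_big H aT VI EI (Id_on VI) \<le> num_big \<Gamma> aS VS ES (Id_on VS)"
  "defect H aT VI EI (Id_on VI) = defect \<Gamma> aS VS ES (Id_on VS) \<Longrightarrow>
     num_big H aT VI EI (Id_on VI) = num_big \<Gamma> aS VS ES (Id_on VS) \<Longrightarrow>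
     (p, q) \<in> E0 \<Longrightarrow> \<exists>c. is_cut E0 R0 p q c"
  using Z.folding[OF Z.adm_R0] defect_0 defect_m num_big_0 num_big_m by auto

text \<open>The cut at the first edge \<open>(base u, nb u v)\<close> of the subdivision of \<open>(u, v)\<close> is evaluated at
  the original vertices. An edge \<open>(a, b)\<close> whose ends it separates contains a translate of this first
  edge under the kernel. If \<open>nb u v\<close> is a subdivision point, then \<open>(a, b)\<close> is a translate of \<open>(u,
  v)\<close>; if it is \<open>base v\<close>, the two ends may be moved by different kernel elements \<open>n\<close> and \<open>n'\<close>. The
  last two conclusions hold because one kernel element suffices to move an edge, and because edges
  are not inverted.\<close>

lemma edge_cut_mod_N:
  assumes cuts: "\<And>p q. (p, q) \<in> E0 \<Longrightarrow> \<exists>c. is_cut E0 R0 p q c" and uv: "(u, v) \<in> ES"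
    and noloop: "\<And>n. n \<in> N \<Longrightarrow> aS n u \<noteq> v"
  shows "\<exists>c :: 'x \<Rightarrow> bool. (\<forall>n\<in>N. \<forall>x\<in>VS. c (aS n x) = c x) \<and>
      (\<forall>(a, b)\<in>ES. c a \<noteq> c b \<longleftrightarrow>
         (\<exists>n\<in>N. \<exists>n'\<in>N. (a = aS n u \<and> b = aS n' v) \<or> (a = aS n v \<and> b = aS n' u)))"
    and "\<And>g n n'. g \<in> carrier \<Gamma> \<Longrightarrow> n \<in> N \<Longrightarrow> n' \<in> N \<Longrightarrow> aS g u = aS n u \<Longrightarrow> aS g v = aS n' v \<Longrightarrow>
           \<exists>m\<in>N. aS g u = aS m u \<and> aS g v = aS m v"
    and "\<And>g n n'. g \<in> carrier \<Gamma> \<Longrightarrow> n \<in> N \<Longrightarrow> n' \<in> N \<Longrightarrow> aS g u = aS n v \<Longrightarrow> aS g v \<noteq> aS n' u"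
proof -
  let ?q = "nb u v"
  note q = nb[OF uv]
  note E = q(3)
  obtain c where c: "is_cut E0 R0 (base u) ?q c" using cuts[OF E] by blast
  have cR: "c p = c q" if "(p, q) \<in> R0" for p q using c that unfolding is_cut_def by blast
  have cE: "(c p \<noteq> c q) = ((p, base u) \<in> R0 \<and> (q, ?q) \<in> R0 \<or> (p, ?q) \<in> R0 \<and> (q, base u) \<in> R0)" if "(p, q) \<in> E0" for p q
    using c that unfolding is_cut_def by blast
  define d where "d x = c (base x)" for x
  have R0b: "(base x, base (aS n x)) \<in> R0" if "n \<in> N" "x \<in> VS" for n x
    using R0I[OF _ that(1), of "base x" "base (aS n x)"] act0_base[OF N_carrier[OF that(1)] that(2)] base_sub that(2) by blast
  have dN: "d (aS n x) = d x" if "n \<in> N" "x \<in> VS" for n x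
    using cR[OF R0b[OF that]] by (simp add: d_def)
  have uvV: "u \<in> VS" "v \<in> VS" "u \<noteq> v" using EV[OF uv] by auto
  have noloop2: "aS n u \<noteq> aS n' v" if "n \<in> N" "n' \<in> N" for n n'
  proof
    assume "aS n u = aS n' v"
    hence "aS (inv\<^bsub>\<Gamma>\<^esub> n' \<otimes>\<^bsub>\<Gamma>\<^esub> n) u = v"
      using S.act_mult S.act_inv1 N_carrier[OF that(1)] N_carrier[OF that(2)] uvV by simp
    thus False using noloop[OF N_mult[OF N_inv[OF that(2)] that(1)]] by blast
  qed
  have rs: "\<exists>r s n n'. {r, s} = {p, q'} \<and> n \<in> N \<and> n' \<in> N \<and> r = base (aS n u) \<and> s = act0 n' ?q"
    if pq: "(p, q') \<in> E0" "c p \<noteq> c q'" for p q'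
  proof -
    obtain r s where rs: "{r, s} = {p, q'}" "(r, base u) \<in> R0" "(s, ?q) \<in> R0"
    proof (cases "(p, base u) \<in> R0 \<and> (q', ?q) \<in> R0")
      case True thus ?thesis using that[of p q'] by simp
    next
      case False
      hence "(p, ?q) \<in> R0 \<and> (q', base u) \<in> R0" using cE[OF pq(1)] pq(2) by argo
      thus ?thesis using that[of q' p] insert_commute[of p q' "{}"] by simp
    qed
    obtain n where n: "n \<in> N" "act0 n (base u) = r" using R0E[OF R0_sym[OF rs(2)]] by metis
    obtain n' where n': "n' \<in> N" "act0 n' ?q = s" using R0E[OF R0_sym[OF rs(3)]] by metis
    have "r = base (aS n u)" using act0_base[OF N_carrier[OF n(1)] uvV(1)] n by simp
    thus ?thesis using rs(1) n n' by blast
  qed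
  have ends: "x = a \<or> x = b" if "(a, b) \<in> ES" "base x \<in> pts a b" for x a b
    using pts_fst[OF that(2)] EV[OF that(1)] by (auto simp: base_def)
  have qc: "?q = base v \<or> ?q \<in> mids \<and> fst ?q = {u, v}"
  proof -
    have "?q \<noteq> base u" using Z.noloop[OF E] Z.Rm_rules(1) E0_V[OF E] by metis
    thus ?thesis using pts_cases[OF uv q(1)] by blast
  qed
  \<comment> \<open>an edge cut by \<open>d\<close> is a translate of \<open>{u, v}\<close> under the kernel, or both are not subdivided\<close>
  have cut: "(?q = base v \<and> (\<exists>n\<in>N. \<exists>n'\<in>N. (a = aS n u \<and> b = aS n' v) \<or> (a = aS n v \<and> b = aS n' u)))
      \<or> (?q \<in> mids \<and> (\<exists>n\<in>N. {a, b} = {aS n u, aS n v}))"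
    if ab: "(a, b) \<in> ES" and dab: "d a \<noteq> d b" for a b
  proof -
    let ?P = "E0 \<inter> pts a b \<times> pts a b"
    have path: "(base a, base b) \<in> ?P\<^sup>*" using pts_connected_inside[OF ab] by (simp add: pts_def)
    obtain p q' where pq: "(p, q') \<in> ?P" "c p \<noteq> c q'"
    proof (cases "c (base a)")
      case True
      hence "\<not> c (base b)" using dab by (simp add: d_def)
      thus ?thesis using rtrancl_crossing[OF path, of "\<lambda>r. \<not> c r"] True that by metis
    next
      case False
      hence "c (base b)" using dab by (simp add: d_def)
      thus ?thesis using rtrancl_crossing[OF path, of c] False that by metis
    qed
    have mem: "p \<in> pts a b" "q' \<in> pts a b" "(p, q') \<in> E0" using pq by auto
    obtain r s n n' where r: "{r, s} = {p, q'}" "n \<in> N" "n' \<in> N" "r = base (aS n u)" "s = act0 n' ?q"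
      using rs[OF mem(3) pq(2)] by blast
    have rsP: "r \<in> pts a b" "s \<in> pts a b" using r(1) mem by (auto simp: doubleton_eq_iff)
    have ru: "aS n u = a \<or> aS n u = b" using ends[OF ab] rsP(1) r by blast
    from qc show ?thesis
    proof
      assume 2: "?q = base v"
      have s: "s = base (aS n' v)" using act0_base[OF N_carrier[OF r(3)] uvV(2)] r(5) 2 by simp
      have sv: "aS n' v = a \<or> aS n' v = b" using ends[OF ab] rsP(2) s by blast
      have "a = aS n u \<and> b = aS n' v \<or> a = aS n' v \<and> b = aS n u" using ru sv noloop2[OF r(2,3)] by metis
      thus ?thesis using 2 r(2,3) by blast
    next
      assume 3: "?q \<in> mids \<and> fst ?q = {u, v}"
      have "fst s = {aS n' u, aS n' v}" using r(5) 3 by (simp add: act0_def)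
      moreover have "s \<in> mids" using act0_mids[OF N_carrier[OF r(3)]] 3 r(5) by blast
      hence "fst s = {a, b}" using mids_fst[OF _ ab rsP(2)] by blast
      ultimately show ?thesis using r(3) 3 by auto
    qed
  qed
  have duv: "d u \<noteq> d v"
  proof -
    have adjP: "adj u v p q'" if "(p, q') \<in> E0" "p \<in> pts u v" "q' \<in> pts u v" for p q'
      using E0_types[OF that(1)] pts_hair[OF uv that(2)] pts_hair[OF uv that(3)] unfolding adj_def by blast
    let ?P = "E0 \<inter> pts u v \<times> pts u v"
    have flip: "(c p \<noteq> c q') = ((p = base u) \<noteq> (q' = base u))" if "(p, q') \<in> ?P" for p q'
    proof
      have mem: "(p, q') \<in> E0" "p \<in> pts u v" "q' \<in> pts u v" using that by auto
      have ne: "p \<noteq> q'" using Z.noloop[OF mem(1)] Z.Rm_rules(1) E0_V[OF mem(1)] by metis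
      show "(p = base u) \<noteq> (q' = base u)" if cne: "c p \<noteq> c q'"
      proof -
        obtain r s n n' where r: "{r, s} = {p, q'}" "n \<in> N" "r = base (aS n u)"
          using rs[OF mem(1) cne] by blast
        have "r \<in> pts u v" using r(1) mem by (auto simp: doubleton_eq_iff)
        hence "aS n u = u \<or> aS n u = v" using ends[OF uv] r(3) by blast
        hence "r = base u" using noloop[OF r(2)] r(3) by auto
        thus ?thesis using r(1) ne by (auto simp: doubleton_eq_iff)
      qed
      show "c p \<noteq> c q'" if "(p = base u) \<noteq> (q' = base u)"
      proof -
        have fl: "c (base u) \<noteq> c ?q" using cE[OF E] R0_refl E0_V[OF E] by blast
        show ?thesis
        proof (cases "p = base u")
          case True
          hence "?q = q'" using nb_unique[OF uv mem(3)] adjP[OF mem] by simp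
          thus ?thesis using fl True by simp
        next
          case False
          hence q': "q' = base u" using that by blast
          have "?q = p" using nb_unique[OF uv mem(2)] adjP[OF E0_sym[OF mem(1)] mem(3,2)] q' by simp
          thus ?thesis using fl q' by simp
        qed
      qed
    qed
    have "(c (base u) = c p) = (p = base u)" if "(base u, p) \<in> ?P\<^sup>*" for p
      using that
    proof (induction rule: rtrancl_induct)
      case (step y z) thus ?case using flip[OF step(2)] by argo
    qed simp
    from this[OF pts_connected_inside[OF uv]] show ?thesis using uvV base_inj by (simp add: pts_def d_def)
  qed
  have dcut: "d a \<noteq> d b \<longleftrightarrow> (\<exists>n\<in>N. \<exists>n'\<in>N. (a = aS n u \<and> b = aS n' v) \<or> (a = aS n v \<and> b = aS n' u))"
    if ab: "(a, b) \<in> ES" for a b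
  proof
    assume "\<exists>n\<in>N. \<exists>n'\<in>N. (a = aS n u \<and> b = aS n' v) \<or> (a = aS n v \<and> b = aS n' u)"
    thus "d a \<noteq> d b" using dN duv uvV by auto
  next
    assume "d a \<noteq> d b"
    from cut[OF ab this] show "\<exists>n\<in>N. \<exists>n'\<in>N. (a = aS n u \<and> b = aS n' v) \<or> (a = aS n v \<and> b = aS n' u)"
    proof
      assume "?q \<in> mids \<and> (\<exists>n\<in>N. {a, b} = {aS n u, aS n v})"
      then obtain n where "n \<in> N" "a = aS n u \<and> b = aS n v \<or> a = aS n v \<and> b = aS n u" by (auto simp: doubleton_eq_iff)
      thus ?thesis by blast
    qed blast
  qed
  show "\<exists>c :: 'x \<Rightarrow> bool. (\<forall>n\<in>N. \<forall>x\<in>VS. c (aS n x) = c x) \<and>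
      (\<forall>(a, b)\<in>ES. c a \<noteq> c b \<longleftrightarrow>
         (\<exists>n\<in>N. \<exists>n'\<in>N. (a = aS n u \<and> b = aS n' v) \<or> (a = aS n v \<and> b = aS n' u)))"
  proof (intro exI[of _ d] conjI)
    show "\<forall>n\<in>N. \<forall>x\<in>VS. d (aS n x) = d x" using dN by simp
    show "\<forall>(a, b)\<in>ES. d a \<noteq> d b \<longleftrightarrow>
         (\<exists>n\<in>N. \<exists>n'\<in>N. (a = aS n u \<and> b = aS n' v) \<or> (a = aS n v \<and> b = aS n' u))"
      by (intro ballI, clarify, rule dcut)
  qed
  have Rm0: "(base (aS n x), base x) \<in> Rm" if "n \<in> N" "x \<in> VS" for n x
    using R0_sym[OF R0b[OF that]] R0_sub_Rm by blast
  show "\<exists>m\<in>N. aS g u = aS m u \<and> aS g v = aS m v"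
    if g: "g \<in> carrier \<Gamma>" and n: "n \<in> N" "n' \<in> N" and e: "aS g u = aS n u" "aS g v = aS n' v" for g n n'
  proof -
    note b = act0_base[OF g uvV(1)] act0_base[OF g uvV(2)]
    have "d (aS g u) \<noteq> d (aS g v)" using dN n uvV duv e by simp
    from cut[OF ES_act[OF uv g] this] show ?thesis
    proof
      assume "?q = base v \<and> (\<exists>n\<in>N. \<exists>n'\<in>N. (aS g u = aS n u \<and> aS g v = aS n' v) \<or> (aS g u = aS n v \<and> aS g v = aS n' u))"
      hence E': "(base u, base v) \<in> E0" using E by simp
      obtain m where m: "m \<in> N" "act0 m (base u) = act0 g (base u)" "act0 m (base v) = act0 g (base v)"
        using common_kernel_element[OF E' g] Rm0[OF n(1) uvV(1)] Rm0[OF n(2) uvV(2)] b e by auto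
      hence "aS g u = aS m u" "aS g v = aS m v" using act0_base[OF N_carrier[OF m(1)]] uvV b base_inj by simp_all
      thus ?thesis using m(1) by blast
    next
      assume "?q \<in> mids \<and> (\<exists>m\<in>N. {aS g u, aS g v} = {aS m u, aS m v})"
      then obtain m where m: "m \<in> N" "aS g u = aS m u \<and> aS g v = aS m v \<or> aS g u = aS m v \<and> aS g v = aS m u"
        by (auto simp: doubleton_eq_iff)
      moreover have "aS g u \<noteq> aS m v" using e(1) noloop2[OF n(1) m(1)] by simp
      ultimately show ?thesis by blast
    qed
  qed
  show "aS g v \<noteq> aS n' u"
    if g: "g \<in> carrier \<Gamma>" and n: "n \<in> N" "n' \<in> N" and e: "aS g u = aS n v" for g n n'
  proof
    assume e': "aS g v = aS n' u"
    note b = act0_base[OF g uvV(1)] act0_base[OF g uvV(2)]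
    have "d (aS g u) \<noteq> d (aS g v)" using dN n uvV duv e e' by simp
    from cut[OF ES_act[OF uv g] this] show False
    proof
      assume "?q = base v \<and> (\<exists>n\<in>N. \<exists>n'\<in>N. (aS g u = aS n u \<and> aS g v = aS n' v) \<or> (aS g u = aS n v \<and> aS g v = aS n' u))"
      hence E': "(base u, base v) \<in> E0" using E by simp
      show False using noinv0[OF E' g] Rm0[OF n(1) uvV(2)] Rm0[OF n(2) uvV(1)] b e e' by auto
    next
      assume "?q \<in> mids \<and> (\<exists>m\<in>N. {aS g u, aS g v} = {aS m u, aS m v})"
      then obtain m where m: "m \<in> N" "aS g u = aS m u \<and> aS g v = aS m v \<or> aS g u = aS m v \<and> aS g v = aS m u"
        by (auto simp: doubleton_eq_iff)
      show False
      proof (cases "aS g u = aS m u")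
        case True thus ?thesis using e noloop2[OF m(1) n(1)] by simp
      next
        case False
        hence w: "aS g u = aS m v \<and> aS g v = aS m u" using m by blast
        have "aS (inv\<^bsub>\<Gamma>\<^esub> m \<otimes>\<^bsub>\<Gamma>\<^esub> g) u = v" "aS (inv\<^bsub>\<Gamma>\<^esub> m \<otimes>\<^bsub>\<Gamma>\<^esub> g) v = u"
          using w S.act_mult[OF S.inv_closed[OF N_carrier[OF m(1)]] g] S.act_inv1[OF N_carrier[OF m(1)]] uvV by simp_all
        thus ?thesis using S.noinvE[OF uv, of "inv\<^bsub>\<Gamma>\<^esub> m \<otimes>\<^bsub>\<Gamma>\<^esub> g"] g N_carrier[OF m(1)] by simp
      qed
    qed
  qed
qed

end

section \<open>Presentations by words\<close>

text \<open>\<open>word_rel\<close> without the restriction to words over the alphabet.\<close>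

definition word_equiv :: "('x list \<Rightarrow> 'x list \<Rightarrow> bool) \<Rightarrow> 'x list \<Rightarrow> 'x list \<Rightarrow> bool" where
  "word_equiv R = equivclp (word_step R)"

lemma word_equiv_refl [simp]: "word_equiv R x x"
  and word_equiv_sym: "word_equiv R x y \<Longrightarrow> word_equiv R y x"
  and word_equiv_trans: "word_equiv R x y \<Longrightarrow> word_equiv R y z \<Longrightarrow> word_equiv R x z"
  by (simp_all add: word_equiv_def equivclp_sym) (rule equivclp_trans)

lemma word_equiv_relator: "R u v \<Longrightarrow> word_equiv R u v"
  unfolding word_equiv_def word_step_def
  by (rule r_into_equivclp, rule exI[of _ "[]"], rule exI[of _ "[]"], rule exI[of _ u], rule exI[of _ v]) simp

lemma word_equiv_context: "word_equiv R x y \<Longrightarrow> word_equiv R (p @ x @ s) (p @ y @ s)"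
  unfolding word_equiv_def
proof (induction rule: equivclp_induct)
  case (step y z)
  have "word_step R (p @ y @ s) (p @ z @ s) \<or> word_step R (p @ z @ s) (p @ y @ s)"
  proof -
    have "word_step R (p @ a @ s) (p @ b @ s)" if ab: "word_step R a b" for a b
    proof -
      obtain p' s' u v where "R u v" "a = p' @ u @ s'" "b = p' @ v @ s'" using ab unfolding word_step_def by blast
      thus ?thesis unfolding word_step_def by (intro exI[of _ "p @ p'"] exI[of _ "s' @ s"] exI[of _ u] exI[of _ v]) simp
    qed
    thus ?thesis using step(2) by blast
  qed
  thus ?case using step(3) by (meson equivclp_sym equivclp_trans r_into_equivclp)
qed (simp add: word_equiv_refl[unfolded word_equiv_def])

lemma word_equiv_append: "word_equiv R x x' \<Longrightarrow> word_equiv R y y' \<Longrightarrow> word_equiv R (x @ y) (x' @ y')"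
  using word_equiv_context[of R x x' "[]" y] word_equiv_context[of R y y' x' "[]"] word_equiv_trans by fastforce

lemma word_equiv_Cons: "word_equiv R y y' \<Longrightarrow> word_equiv R (x # y) (x # y')"
  using word_equiv_context[of R y y' "[x]" "[]"] by simp

definition eval_word :: "('g, 'b) monoid_scheme \<Rightarrow> ('x \<Rightarrow> 'g) \<Rightarrow> 'x list \<Rightarrow> 'g" where
  "eval_word G val w = foldr (\<lambda>x y. val x \<otimes>\<^bsub>G\<^esub> y) w \<one>\<^bsub>G\<^esub>"

lemma eval_word_simps [simp]:
  "eval_word G val [] = \<one>\<^bsub>G\<^esub>" "eval_word G val (x # w) = val x \<otimes>\<^bsub>G\<^esub> eval_word G val w"
  by (simp_all add: eval_word_def)

text \<open>An evaluation of words in a group that respects the relators and is onto identifies the group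
  with the presented one as soon as every word has a normal form that is trivial if its value is.\<close>

lemma word_group_iso:
  fixes G :: "'g monoid" (structure)
  assumes G: "group G" and val: "\<And>x. x \<in> X \<Longrightarrow> val x \<in> carrier G"
    and RX: "\<And>u v. R u v \<Longrightarrow> u \<in> lists X \<and> v \<in> lists X"
    and Re: "\<And>u v. R u v \<Longrightarrow> eval_word G val u = eval_word G val v"
    and onto: "\<And>g. g \<in> carrier G \<Longrightarrow> \<exists>w\<in>lists X. eval_word G val w = g"
    and normal: "\<And>w. w \<in> lists X \<Longrightarrow> \<exists>w'. word_equiv R w w' \<and> (eval_word G val w' = \<one>\<^bsub>G\<^esub> \<longrightarrow> word_equiv R w' [])"
    and inverse: "\<And>x. x \<in> X \<Longrightarrow> \<exists>y\<in>X. word_equiv R [y, x] []"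
  shows "\<exists>h\<in>iso (word_group X R) G. \<forall>w\<in>lists X. h (word_class X R w) = eval_word G val w"
proof -
  interpret group G by (rule G)
  let ?e = "eval_word G val"
  have ec: "?e w \<in> carrier G" if "w \<in> lists X" for w using that val by (induction w) auto
  have ea: "?e (u @ v) = ?e u \<otimes> ?e v" if "u \<in> lists X" "v \<in> lists X" for u v
    using that val ec by (induction u) (auto simp: m_assoc)
  have inv_step: "y \<in> lists X \<and> ?e x = ?e y" if "word_equiv R x y" "x \<in> lists X" for x y
    using that unfolding word_equiv_def
  proof (induction rule: equivclp_induct)
    case (step y z)
    have "a \<in> lists X \<longleftrightarrow> b \<in> lists X" "a \<in> lists X \<Longrightarrow> ?e a = ?e b" if ab: "word_step R a b" for a b
    proof -
      obtain p s u v where *: "R u v" "a = p @ u @ s" "b = p @ v @ s" using ab unfolding word_step_def by blast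
      show "a \<in> lists X \<longleftrightarrow> b \<in> lists X" using RX[OF *(1)] * by auto
      show "a \<in> lists X \<Longrightarrow> ?e a = ?e b"
      proof -
        assume "a \<in> lists X"
        hence "p \<in> lists X" "s \<in> lists X" "u \<in> lists X" "v \<in> lists X" using RX[OF *(1)] * by auto
        thus ?thesis using * Re[OF *(1)] ea by simp
      qed
    qed
    thus ?case using step by metis
  qed simp
  have triv: "word_equiv R w []" if w: "w \<in> lists X" "?e w = \<one>" for w
  proof -
    obtain w' where w': "word_equiv R w w'" "?e w' = \<one> \<longrightarrow> word_equiv R w' []" using normal[OF w(1)] by blast
    have "?e w' = \<one>" using inv_step[OF w'(1) w(1)] w(2) by simp
    thus ?thesis using w' word_equiv_trans by blast
  qed
  define cl where "cl = word_class X R"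
  have clI: "y \<in> cl x \<longleftrightarrow> x \<in> lists X \<and> y \<in> lists X \<and> word_equiv R x y" for x y
    by (simp add: cl_def word_class_def word_rel_def word_equiv_def)
  have cleq: "cl x = cl y" if "word_equiv R x y" "x \<in> lists X" for x y
  proof (rule Set.set_eqI)
    fix z show "z \<in> cl x \<longleftrightarrow> z \<in> cl y"
      using that inv_step[OF that] word_equiv_trans word_equiv_sym unfolding clI by metis
  qed
  have carr: "carrier (word_group X R) = cl ` lists X"
    by (auto simp: word_group_def quotient_def cl_def word_class_def)
  have mult: "cl u \<otimes>\<^bsub>word_group X R\<^esub> cl v = cl (u @ v)" if uv: "u \<in> lists X" "v \<in> lists X" for u v
  proof -
    have "cl u \<otimes>\<^bsub>word_group X R\<^esub> cl v = (\<Union>u'\<in>cl u. \<Union>v'\<in>cl v. cl (u' @ v'))"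
      by (simp add: word_group_def cl_def)
    also have "\<dots> = (\<Union>u'\<in>cl u. \<Union>v'\<in>cl v. cl (u @ v))"
    proof (intro SUP_cong refl)
      fix u' v' assume "u' \<in> cl u" "v' \<in> cl v"
      hence "word_equiv R (u' @ v') (u @ v)" "u' @ v' \<in> lists X"
        using word_equiv_append word_equiv_sym unfolding clI by (metis, simp)
      thus "cl (u' @ v') = cl (u @ v)" by (rule cleq)
    qed
    also have "\<dots> = cl (u @ v)"
    proof -
      have "u \<in> cl u" "v \<in> cl v" using uv by (simp_all add: clI)
      thus ?thesis by blast
    qed
    finally show ?thesis .
  qed
  define h where "h U = ?e (SOME u. u \<in> U)" for U
  have h: "h (cl w) = ?e w" if "w \<in> lists X" for w
  proof -
    have "w \<in> cl w" using that by (simp add: clI)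
    hence "(SOME u. u \<in> cl w) \<in> cl w" by (rule someI)
    thus ?thesis using inv_step unfolding h_def clI by metis
  qed
  have winv: "\<exists>v'\<in>lists X. word_equiv R (v' @ v) []" if "v \<in> lists X" for v
    using that
  proof (induction v)
    case Nil show ?case by (intro bexI[of _ "[]"]) auto
  next
    case (Cons x v)
    then obtain v' where v': "v' \<in> lists X" "word_equiv R (v' @ v) []" by auto
    obtain y where y: "y \<in> X" "word_equiv R [y, x] []" using inverse Cons.hyps by blast
    have "word_equiv R (v' @ [y, x] @ v) (v' @ [] @ v)" by (rule word_equiv_context[OF y(2)])
    hence "word_equiv R ((v' @ [y]) @ x # v) []" using v'(2) word_equiv_trans by fastforce
    thus ?case using v' y by (intro bexI[of _ "v' @ [y]"]) auto
  qed
  have "h \<in> iso (word_group X R) G"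
    unfolding iso_def
  proof (intro CollectI conjI)
    show "h \<in> hom (word_group X R) G"
    proof -
      have "h (cl w) \<in> carrier G" if "w \<in> lists X" for w using h[OF that] ec[OF that] by simp
      moreover have "h (cl u \<otimes>\<^bsub>word_group X R\<^esub> cl v) = h (cl u) \<otimes> h (cl v)" if "u \<in> lists X" "v \<in> lists X" for u v
        using mult[OF that] h[OF that(1)] h[OF that(2)] h[of "u @ v"] ea[OF that] that append_in_lists_conv by metis
      ultimately show ?thesis unfolding hom_def carr by blast
    qed
    have inj: "inj_on h (cl ` lists X)"
    proof (rule inj_onI)
      fix U V assume "U \<in> cl ` lists X" "V \<in> cl ` lists X" and eq: "h U = h V"
      then obtain u v where uv: "u \<in> lists X" "v \<in> lists X" "U = cl u" "V = cl v" by auto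
      hence e: "?e u = ?e v" using eq h[OF uv(1)] h[OF uv(2)] by simp
      obtain v' where v': "v' \<in> lists X" "word_equiv R (v' @ v) []" using winv uv by blast
      have "v' @ v \<in> lists X" using v'(1) uv(2) by simp
      from inv_step[OF v'(2) this] have "?e (v' @ v) = \<one>" by simp
      hence "?e v' \<otimes> ?e v = \<one>" using ea[OF v'(1) uv(2)] by simp
      hence "?e v \<otimes> ?e v' = \<one>" using inv_comm ec[OF v'(1)] ec[OF uv(2)] by blast
      hence "?e (u @ v') = \<one>" using e ea[OF uv(1) v'(1)] by simp
      moreover have "u @ v' \<in> lists X" using v'(1) uv(1) by simp
      ultimately have 1: "word_equiv R (u @ v') []" using triv by blast
      have "word_equiv R (u @ (v' @ v)) (u @ [])" by (rule word_equiv_append[OF word_equiv_refl v'(2)])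
      hence "word_equiv R u (u @ v' @ v)" using word_equiv_sym by fastforce
      moreover have "word_equiv R ((u @ v') @ v) ([] @ v)" by (rule word_equiv_append[OF 1 word_equiv_refl])
      ultimately have "word_equiv R u v" using word_equiv_trans by fastforce
      thus "U = V" using cleq uv by simp
    qed
    have "h ` cl ` lists X = carrier G"
    proof
      show "h ` cl ` lists X \<subseteq> carrier G"
      proof
        fix x assume "x \<in> h ` cl ` lists X"
        then obtain w where w: "w \<in> lists X" "x = h (cl w)" by blast
        from h[OF w(1)] ec[OF w(1)] w(2) show "x \<in> carrier G" by simp
      qed
      show "carrier G \<subseteq> h ` cl ` lists X"
      proof
        fix g assume "g \<in> carrier G"
        then obtain w where w: "w \<in> lists X" "?e w = g" using onto by blast
        have "g = h (cl w)" using h[OF w(1)] w(2) by simp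
        thus "g \<in> h ` cl ` lists X" using w(1) by blast
      qed
    qed
    thus "bij_betw h (carrier (word_group X R)) (carrier G)" using inj carr by (simp add: bij_betw_def)
  qed
  thus ?thesis using h by (auto simp: cl_def)
qed

section \<open>Groups acting on trees with one orbit of edges\<close>

text \<open>A tree all of whose edges are translates of the edge from \<open>u\<close> to \<open>v\<close>, described by the
  half-tree \<open>c\<close> beyond this edge; its translates are the half-trees of the other edges. Edges do not
  appear otherwise, so \<open>conn\<close> expresses that a set containing \<open>u\<close> and closed under crossing edges is
  everything.\<close>

locale one_edge_orbit = gact G W act for G :: "'g monoid" (structure) and W :: "'x set" and act +
  fixes u v :: 'x and c :: "'x \<Rightarrow> bool"
  assumes uW: "u \<in> W" and vW: "v \<in> W" and cu: "\<not> c u" and cv: "c v"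
    and crossing: "g \<in> carrier G \<Longrightarrow> c (act g u) \<noteq> c (act g v) \<Longrightarrow> act g u = u \<and> act g v = v"
    and conn: "u \<in> Z \<Longrightarrow> (\<And>g. g \<in> carrier G \<Longrightarrow> act g u \<in> Z \<longleftrightarrow> act g v \<in> Z) \<Longrightarrow> W \<subseteq> Z"
begin

lemma reversed: "one_edge_orbit G W act v u (\<lambda>x. \<not> c x)"
proof unfold_locales
  fix Z assume Z: "v \<in> Z" "\<And>g. g \<in> carrier G \<Longrightarrow> act g v \<in> Z \<longleftrightarrow> act g u \<in> Z"
  have "u \<in> Z" using Z(1) Z(2)[OF one_closed] act_one uW vW by simp
  thus "W \<subseteq> Z" using conn Z(2) by blast
qed (use uW vW cu cv crossing in auto)

definition A where "A = {g \<in> carrier G. act g u = u}"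
definition B where "B = {g \<in> carrier G. act g v = v}"
definition C where "C = {g \<in> carrier G. act g u = u \<and> act g v = v}"

lemma stabilizer_subgroup: "x \<in> W \<Longrightarrow> subgroup {g \<in> carrier G. act g x = x} G"
  by (rule subgroupI) (auto simp: act_one act_mult intro: exI[of _ \<one>] dest: act_inv1)

lemma subgroup_A: "subgroup A G" and subgroup_B: "subgroup B G"
  unfolding A_def B_def using stabilizer_subgroup uW vW by blast+

lemma C_eq: "C = A \<inter> B" by (auto simp: A_def B_def C_def)

lemma subgroup_C: "subgroup C G"
  unfolding C_eq using subgroups_Inter_pair[OF subgroup_A subgroup_B] .

lemma u_neq_v: "u \<noteq> v" using cu cv by auto

text \<open>Two branches at \<open>u\<close> that are not entered across the same edge are disjoint, since a path from
  \<open>u\<close>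
  can enter or leave their intersection only across such an edge.\<close>

lemma branches:
  assumes "\<not> k1 u" "\<not> k2 u"
    and f1: "\<And>g. g \<in> carrier G \<Longrightarrow> k1 (act g u) \<noteq> k1 (act g v) \<Longrightarrow> act g u = u \<or> act g v = u"
    and f2: "\<And>g. g \<in> carrier G \<Longrightarrow> k2 (act g u) \<noteq> k2 (act g v) \<Longrightarrow> act g u = u \<or> act g v = u"
    and ne: "\<And>g. g \<in> carrier G \<Longrightarrow> k1 (act g u) \<noteq> k1 (act g v) \<Longrightarrow> k2 (act g u) \<noteq> k2 (act g v) \<Longrightarrow> False"
    and x: "x \<in> W"
  shows "\<not> (k1 x \<and> k2 x)"
proof -
  have "W \<subseteq> {x. \<not> (k1 x \<and> k2 x)}"
  proof (rule conn)
    fix g assume g: "g \<in> carrier G"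
    show "act g u \<in> {x. \<not> (k1 x \<and> k2 x)} \<longleftrightarrow> act g v \<in> {x. \<not> (k1 x \<and> k2 x)}"
      using f1[OF g] f2[OF g] ne[OF g] assms(1,2) by (metis (mono_tags, lifting) mem_Collect_eq)
  qed (use assms in simp)
  thus ?thesis using x by blast
qed

text \<open>The ping-pong step: \<open>a\<close> moves the branch behind \<open>v\<close> to a different branch at \<open>u\<close>.\<close>

lemma act_A_out: assumes a: "a \<in> A" "a \<notin> C" and x: "x \<in> W" "c x" shows "\<not> c (act a x)"
proof -
  have aG: "a \<in> carrier G" "act a u = u" using a by (auto simp: A_def)
  let ?k = "\<lambda>y. c (act (inv a) y)"
  have iu: "act (inv a) u = u" using act_inv1[OF aG(1) uW] aG(2) by simp
  have k: "act g u = u \<and> act g v = act a v" if g: "g \<in> carrier G" and kk: "?k (act g u) \<noteq> ?k (act g v)" for g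
  proof -
    have "act (inv a \<otimes> g) u = u \<and> act (inv a \<otimes> g) v = v"
      using crossing[of "inv a \<otimes> g"] kk g aG(1) uW vW by (simp add: act_mult)
    hence "act (inv a) (act g u) = u" "act (inv a) (act g v) = v" using g aG(1) uW vW by (simp_all add: act_mult)
    thus ?thesis using act_inv2[OF aG(1)] act_closed[OF g] uW vW aG(2) by metis
  qed
  have "\<not> (c (act a x) \<and> ?k (act a x))"
  proof (rule branches[of c ?k "act a x"])
    show "\<not> ?k u" using iu cu by simp
    fix g assume g: "g \<in> carrier G"
    show "c (act g u) \<noteq> c (act g v) \<Longrightarrow> act g u = u \<or> act g v = u" using crossing[OF g] by blast
    show "?k (act g u) \<noteq> ?k (act g v) \<Longrightarrow> act g u = u \<or> act g v = u" using k[OF g] by blast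
    assume "c (act g u) \<noteq> c (act g v)" "?k (act g u) \<noteq> ?k (act g v)"
    hence "act a v = v" using crossing[OF g] k[OF g] by simp
    thus False using a aG by (simp add: C_def)
  qed (use cu act_closed[OF aG(1) x(1)] in auto)
  moreover have "?k (act a x)" using act_inv1[OF aG(1) x(1)] x(2) by simp
  ultimately show ?thesis by blast
qed

lemma act_B_in: assumes "b \<in> B" "b \<notin> C" "x \<in> W" "\<not> c x" shows "c (act b x)"
proof -
  interpret r: one_edge_orbit G W act v u "\<lambda>x. \<not> c x" by (rule reversed)
  have "r.A = B" "r.C = C" by (auto simp: r.A_def r.C_def B_def C_def)
  thus ?thesis using r.act_A_out[of b x] assms by auto
qed

end

lemma (in group) eval_word_closed: "(\<And>x. x \<in> set w \<Longrightarrow> val x \<in> carrier G) \<Longrightarrow> eval_word G val w \<in> carrier G"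
  by (induction w) auto

lemma (in group) eval_word_append:
  "(\<And>x. x \<in> set v \<union> set w \<Longrightarrow> val x \<in> carrier G) \<Longrightarrow> eval_word G val (v @ w) = eval_word G val v \<otimes> eval_word G val w"
  by (induction v) (auto simp: m_assoc eval_word_closed)

lemma (in group) eval_word_subgroup:
  "subgroup S G \<Longrightarrow> (\<And>x. x \<in> set w \<Longrightarrow> val x \<in> S) \<Longrightarrow> eval_word G val w \<in> S"
  by (induction w) (auto simp: subgroup.one_closed subgroup.m_closed)

context one_edge_orbit
begin

subsection \<open>The amalgam\<close>

abbreviation A' where "A' \<equiv> G\<lparr>carrier := A\<rparr>"
abbreviation B' where "B' \<equiv> G\<lparr>carrier := B\<rparr>"
abbreviation aval :: "'g + 'g \<Rightarrow> 'g" where "aval \<equiv> case_sum id id"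
abbreviation aeval where "aeval \<equiv> eval_word G aval"
abbreviation arel where "arel \<equiv> amalgam_relator A' B' C"
abbreviation aeq where "aeq \<equiv> word_equiv arel"

lemmas SA = subgroup.m_closed[OF subgroup_A] subgroup.one_closed[OF subgroup_A] subgroup.m_inv_closed[OF subgroup_A]
lemmas SB = subgroup.m_closed[OF subgroup_B] subgroup.one_closed[OF subgroup_B] subgroup.m_inv_closed[OF subgroup_B]
lemmas SC = subgroup.m_closed[OF subgroup_C] subgroup.one_closed[OF subgroup_C] subgroup.m_inv_closed[OF subgroup_C]

lemma AG: "a \<in> A \<Longrightarrow> a \<in> carrier G" and BG: "b \<in> B \<Longrightarrow> b \<in> carrier G"
  and CA: "z \<in> C \<Longrightarrow> z \<in> A" and CB: "z \<in> C \<Longrightarrow> z \<in> B"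
  by (auto simp: A_def B_def C_def)

lemma coset_notin: "x \<in> carrier G \<Longrightarrow> y \<in> C \<Longrightarrow> x \<notin> C \<Longrightarrow> y \<otimes> x \<notin> C"
proof
  assume x: "x \<in> carrier G" "x \<notin> C" and y: "y \<in> C" "y \<otimes> x \<in> C"
  have yG: "y \<in> carrier G" using y CA AG by blast
  have "inv y \<otimes> (y \<otimes> x) \<in> C" using SC(1)[OF SC(3)[OF y(1)] y(2)] .
  thus False using x yG by (simp add: m_assoc[symmetric])
qed

text \<open>Reduced words: letters outside \<open>C\<close>, taken alternately from the two factors.\<close>

fun reduced :: "('g + 'g) list \<Rightarrow> bool" where
  "reduced [] = True"
| "reduced (Inl a # w) = (a \<in> A - C \<and> (w = [] \<or> \<not> isl (hd w)) \<and> reduced w)"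
| "reduced (Inr b # w) = (b \<in> B - C \<and> (w = [] \<or> isl (hd w)) \<and> reduced w)"

lemma merge_left: "a \<in> A \<Longrightarrow> a' \<in> A \<Longrightarrow> aeq (Inl a # Inl a' # w) (Inl (a \<otimes> a') # w)"
  using word_equiv_context[OF word_equiv_relator, of arel "[Inl a, Inl a']" "[Inl (a \<otimes> a')]" "[]" w]
    amalgam_relator.mult_left[of a A' a' B' C] by simp

lemma merge_right: "b \<in> B \<Longrightarrow> b' \<in> B \<Longrightarrow> aeq (Inr b # Inr b' # w) (Inr (b \<otimes> b') # w)"
  using word_equiv_context[OF word_equiv_relator, of arel "[Inr b, Inr b']" "[Inr (b \<otimes> b')]" "[]" w]
    amalgam_relator.mult_right[of b B' b' A' C] by simp

lemma glue_letter: "x \<in> C \<Longrightarrow> aeq (Inl x # w) (Inr x # w)"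
  using word_equiv_context[OF word_equiv_relator, of arel "[Inl x]" "[Inr x]" "[]" w]
    amalgam_relator.glue[of x C A' B'] by simp

lemma one_letter: "aeq [Inl \<one>] []" "aeq [Inr \<one>] []"
  using word_equiv_relator[of arel "[Inl \<one>]" "[]"] amalgam_relator.one_left[of A' B' C]
    word_equiv_relator[of arel "[Inr \<one>]" "[]"] amalgam_relator.one_right[of A' B' C] by simp_all

lemma reduce_letter:
  assumes red: "reduced w" and x: "x \<in> C"
  shows "\<exists>w'. (w' = [Inl x] \<or> w' \<noteq> [] \<and> reduced w') \<and> aeq (Inl x # w) w'"
proof (cases w)
  case Nil thus ?thesis by auto
next
  case (Cons y w0)
  have xG: "x \<in> carrier G" using x CA AG by blast
  show ?thesis
  proof (cases y)
    case (Inl a)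
    have "aeq (Inl x # w) (Inl (x \<otimes> a) # w0)" using merge_left[OF CA[OF x]] red Cons Inl by auto
    moreover have "reduced (Inl (x \<otimes> a) # w0)" using red Cons Inl SA(1)[OF CA[OF x]] coset_notin[OF AG x] by auto
    ultimately show ?thesis by blast
  next
    case (Inr b)
    have "aeq (Inr x # w) (Inr (x \<otimes> b) # w0)" using merge_right[OF CB[OF x]] red Cons Inr by auto
    hence "aeq (Inl x # w) (Inr (x \<otimes> b) # w0)" using glue_letter[OF x] word_equiv_trans by blast
    moreover have "reduced (Inr (x \<otimes> b) # w0)" using red Cons Inr SB(1)[OF CB[OF x]] coset_notin[OF BG x] by auto
    ultimately show ?thesis by blast
  qed
qed

text \<open>Every word is equivalent to a reduced one or to a letter from \<open>C\<close>: adjacent letters of one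
  factor are multiplied, and a letter in \<open>C\<close> is glued to the neighbouring factor and absorbed
  there.\<close>

lemma reduce_word:
  assumes "w \<in> lists (amalgam_letters A' B')"
  shows "\<exists>w'. ((\<exists>x\<in>C. w' = [Inl x]) \<or> w' \<noteq> [] \<and> reduced w') \<and> aeq w w'"
  using assms
proof (induction w)
  case Nil
  have "aeq [] [Inl \<one>]" using word_equiv_sym[OF one_letter(1)] .
  thus ?case using SC(2) by blast
next
  case (Cons y w)
  then obtain w' where w': "(\<exists>x\<in>C. w' = [Inl x]) \<or> w' \<noteq> [] \<and> reduced w'" "aeq w w'" by blast
  have red: "\<exists>w''. ((\<exists>x\<in>C. w'' = [Inl x]) \<or> w'' \<noteq> [] \<and> reduced w'') \<and> aeq (y # w') w''"
  proof (cases y)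
    case y: (Inl a)
    have a: "a \<in> A" using Cons.hyps y by (auto simp: amalgam_letters_def)
    have merge: "\<exists>w''. ((\<exists>x\<in>C. w'' = [Inl x]) \<or> w'' \<noteq> [] \<and> reduced w'') \<and> aeq (Inl a # Inl a' # w0) w''"
      if a': "a' \<in> A" and w0: "reduced w0" "w0 = [] \<or> \<not> isl (hd w0)" for a' w0
    proof (cases "a \<otimes> a' \<in> C")
      case True
      obtain w'' where "w'' = [Inl (a \<otimes> a')] \<or> w'' \<noteq> [] \<and> reduced w''" "aeq (Inl (a \<otimes> a') # w0) w''"
        using reduce_letter[OF w0(1) True] by blast
      thus ?thesis using True word_equiv_trans[OF merge_left[OF a a']] by blast
    next
      case False
      hence "reduced (Inl (a \<otimes> a') # w0)" using w0 SA(1)[OF a a'] by simp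
      thus ?thesis using merge_left[OF a a'] by blast
    qed
    from w'(1) show ?thesis
    proof
      assume "\<exists>x\<in>C. w' = [Inl x]"
      then obtain x where "x \<in> C" "w' = [Inl x]" by blast
      thus ?thesis using merge[of x "[]"] CA y by auto
    next
      assume r: "w' \<noteq> [] \<and> reduced w'"
      then obtain z w0 where z: "w' = z # w0" by (cases w') auto
      show ?thesis
      proof (cases z)
        case (Inl a') thus ?thesis using merge[of a' w0] r z y by auto
      next
        case (Inr b)
        show ?thesis
        proof (cases "a \<in> C")
          case True
          obtain w'' where "w'' = [Inl a] \<or> w'' \<noteq> [] \<and> reduced w''" "aeq (Inl a # w') w''"
            using reduce_letter[OF _ True] r by blast
          thus ?thesis using True y by blast
        next
          case False
          hence "reduced (y # w')" using r a z Inr y by auto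
          thus ?thesis by (intro exI[of _ "y # w'"]) auto
        qed
      qed
    qed
  next
    case y: (Inr b)
    have b: "b \<in> B" using Cons.hyps y by (auto simp: amalgam_letters_def)
    have merge: "\<exists>w''. ((\<exists>x\<in>C. w'' = [Inl x]) \<or> w'' \<noteq> [] \<and> reduced w'') \<and> aeq (Inr b # Inr b' # w0) w''"
      if b': "b' \<in> B" and w0: "reduced w0" "w0 = [] \<or> isl (hd w0)" for b' w0
    proof (cases "b \<otimes> b' \<in> C")
      case True
      obtain w'' where "w'' = [Inl (b \<otimes> b')] \<or> w'' \<noteq> [] \<and> reduced w''" "aeq (Inl (b \<otimes> b') # w0) w''"
        using reduce_letter[OF w0(1) True] by blast
      moreover have "aeq (Inr b # Inr b' # w0) (Inl (b \<otimes> b') # w0)"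
        using word_equiv_trans[OF merge_right[OF b b'] word_equiv_sym[OF glue_letter[OF True]]] .
      ultimately show ?thesis using True word_equiv_trans by blast
    next
      case False
      hence "reduced (Inr (b \<otimes> b') # w0)" using w0 SB(1)[OF b b'] by simp
      thus ?thesis using merge_right[OF b b'] by blast
    qed
    from w'(1) show ?thesis
    proof
      assume "\<exists>x\<in>C. w' = [Inl x]"
      then obtain x where x: "x \<in> C" "w' = [Inl x]" by blast
      have "aeq (y # w') (Inr b # Inr x # [])" using word_equiv_Cons[OF glue_letter[OF x(1)]] x y by simp
      thus ?thesis using merge[OF CB[OF x(1)], of "[]"] word_equiv_trans by fastforce
    next
      assume r: "w' \<noteq> [] \<and> reduced w'"
      then obtain z w0 where z: "w' = z # w0" by (cases w') auto
      show ?thesis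
      proof (cases z)
        case (Inr b') thus ?thesis using merge[of b' w0] r z y by auto
      next
        case (Inl a)
        show ?thesis
        proof (cases "b \<in> C")
          case True
          obtain w'' where w'': "w'' = [Inl b] \<or> w'' \<noteq> [] \<and> reduced w''" "aeq (Inl b # w') w''"
            using reduce_letter[OF _ True] r by blast
          have "aeq (y # w') w''" using word_equiv_trans[OF word_equiv_sym[OF glue_letter[OF True]] w''(2)] y by simp
          thus ?thesis using True w''(1) by blast
        next
          case False
          hence "reduced (y # w')" using r b z Inl y by auto
          thus ?thesis by (intro exI[of _ "y # w'"]) auto
        qed
      qed
    qed
  qed
  then obtain w'' where "(\<exists>x\<in>C. w'' = [Inl x]) \<or> w'' \<noteq> [] \<and> reduced w''" "aeq (y # w') w''" by blast
  thus ?case using word_equiv_trans[OF word_equiv_Cons[OF w'(2)]] by blast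
qed

lemma reduced_letters: "reduced w \<Longrightarrow> x \<in> set w \<Longrightarrow> aval x \<in> carrier G"
  by (induction w rule: reduced.induct) (auto simp: AG BG)

definition start where "start w = (if isl (last w) then v else u)"

lemma start_W: "start w \<in> W" using uW vW by (simp add: start_def)

text \<open>The end of the edge that the last letter does not fix starts on the right side for the game of
  ping-pong: each further letter moves the point across the edge.\<close>

lemma ping_pong: "reduced w \<Longrightarrow> w \<noteq> [] \<Longrightarrow> c (act (aeval w) (start w)) \<longleftrightarrow> \<not> isl (hd w)"
proof (induction w rule: reduced.induct)
  case (2 a w)
  have a: "a \<in> A" "a \<notin> C" using 2 by auto
  have e: "aeval w \<in> carrier G" by (rule eval_word_closed) (use 2 reduced_letters in auto)
  have "c (act (aeval w) (start (Inl a # w)))"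
  proof (cases "w = []")
    case True thus ?thesis using act_one vW cv by (simp add: start_def)
  next
    case False thus ?thesis using 2 by (auto simp: start_def)
  qed
  moreover have "act (aeval (Inl a # w)) (start (Inl a # w)) = act a (act (aeval w) (start (Inl a # w)))"
    using act_mult[OF AG[OF a(1)] e start_W] by simp
  ultimately show ?case using act_A_out[OF a act_closed[OF e start_W]] by simp
next
  case (3 b w)
  have b: "b \<in> B" "b \<notin> C" using 3 by auto
  have e: "aeval w \<in> carrier G" by (rule eval_word_closed) (use 3 reduced_letters in auto)
  have "\<not> c (act (aeval w) (start (Inr b # w)))"
  proof (cases "w = []")
    case True thus ?thesis using act_one uW cu by (simp add: start_def)
  next
    case False thus ?thesis using 3 by (auto simp: start_def)
  qed
  moreover have "act (aeval (Inr b # w)) (start (Inr b # w)) = act b (act (aeval w) (start (Inr b # w)))"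
    using act_mult[OF BG[OF b(1)] e start_W] by simp
  ultimately show ?case using act_B_in[OF b act_closed[OF e start_W]] by simp
qed simp

text \<open>If the letters at both ends come from the same factor, the starting point has been moved.
  Otherwise the first letter fixes the starting point, and the argument applies to the rest of the
  word.\<close>

lemma reduced_nontrivial: assumes "reduced w" "w \<noteq> []" shows "aeval w \<noteq> \<one>"
proof
  assume 1: "aeval w = \<one>"
  obtain y w0 where w: "w = y # w0" using assms by (cases w) auto
  have e: "aeval w0 \<in> carrier G" by (rule eval_word_closed) (use assms reduced_letters w in auto)
  have st: "act (aeval w) (start w) = start w" using 1 act_one[OF start_W, of w] by simp
  have c1: "c (start w) \<longleftrightarrow> \<not> isl y" using ping_pong[OF assms] st w by simp
  have c2: "c (start w) \<longleftrightarrow> isl (last w)" using cu cv by (simp add: start_def)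
  have "w0 \<noteq> []" using c1 c2 w by auto
  have r0: "reduced w0" "isl (hd w0) \<longleftrightarrow> \<not> isl y"
    using assms(1) w \<open>w0 \<noteq> []\<close> by (cases y; auto)+
  have s0: "start w0 = start w" using w \<open>w0 \<noteq> []\<close> by (simp add: start_def)
  have "c (act (aeval w0) (start w)) \<longleftrightarrow> isl y" using ping_pong[OF r0(1) \<open>w0 \<noteq> []\<close>] r0(2) s0 by simp
  moreover have "act (aeval w0) (start w) = start w"
  proof -
    let ?g = "aval y"
    have g: "?g \<in> carrier G" using reduced_letters[OF assms(1)] w by simp
    have "?g \<otimes> aeval w0 = \<one>" using 1 w by simp
    hence "aeval w0 = inv ?g" using g e by (metis inv_equality inv_inv)
    moreover have "act ?g (start w) = start w"
    proof (cases y)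
      case (Inl a)
      hence "start w = u" using c1 c2 by (simp add: start_def)
      thus ?thesis using assms(1) w Inl by (auto simp: A_def)
    next
      case (Inr b)
      hence "start w = v" using c1 c2 by (simp add: start_def)
      thus ?thesis using assms(1) w Inr by (auto simp: B_def)
    qed
    ultimately show ?thesis using act_inv1[OF g start_W] by metis
  qed
  ultimately show False using c1 by simp
qed

text \<open>The factors generate the group, since otherwise the translates of \<open>u\<close> and \<open>v\<close> by the subgroup
  that they generate would be a proper set closed under crossing edges. The splitting is nontrivial:
  if \<open>A = C\<close>, then \<open>B\<close>
is everything and \<open>v\<close> is fixed.\<close>

theorem amalgam_splitting:
  assumes diff: "\<And>g. g \<in> carrier G \<Longrightarrow> act g u \<noteq> v" and nofix: "\<And>x. x \<in> W \<Longrightarrow> \<exists>g\<in>carrier G. act g x \<noteq> x"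
  shows "nontrivial_splitting_over G C"
proof -
  let ?X = "amalgam_letters A' B'"
  have X: "?X = A <+> B" by (simp add: amalgam_letters_def)
  have gen: "\<exists>w\<in>lists ?X. aeval w = g" if g: "g \<in> carrier G" for g
  proof -
    define K where "K = aeval ` lists ?X"
    have val: "x \<in> ?X \<Longrightarrow> aval x \<in> carrier G" for x using X AG BG by auto
    have KG: "K \<subseteq> carrier G" unfolding K_def
    proof clarify
      fix w assume "\<forall>x\<in>set w. x \<in> ?X" thus "aeval w \<in> carrier G" using val by (intro eval_word_closed) blast
    qed
    have Km: "k \<otimes> aval x \<in> K" if k: "k \<in> K" and x: "x \<in> ?X" for k x
    proof -
      obtain w where w: "w \<in> lists ?X" "k = aeval w" using k unfolding K_def by blast
      have "aeval (w @ [x]) = k \<otimes> aval x" using eval_word_append[of w "[x]" aval] w x val by auto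
      moreover have "w @ [x] \<in> lists ?X" using w x by simp
      ultimately show ?thesis unfolding K_def by (metis image_eqI)
    qed
    have K1: "\<one> \<in> K" unfolding K_def by (intro image_eqI[of _ _ "[]"]) auto
    have KA: "g \<in> K" if "g \<in> carrier G" "k \<in> K" "act g u = act k u" for g k
    proof -
      have kG: "k \<in> carrier G" using that KG by blast
      have "inv k \<otimes> g \<in> A" using that kG uW by (simp add: A_def act_mult act_inv1)
      hence "k \<otimes> aval (Inl (inv k \<otimes> g)) \<in> K" using Km[OF that(2)] X by blast
      thus ?thesis using that(1) kG by (simp add: m_assoc[symmetric])
    qed
    have KB: "g \<in> K" if "g \<in> carrier G" "k \<in> K" "act g v = act k v" for g k
    proof -
      have kG: "k \<in> carrier G" using that KG by blast
      have "inv k \<otimes> g \<in> B" using that kG vW by (simp add: B_def act_mult act_inv1)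
      hence "k \<otimes> aval (Inr (inv k \<otimes> g)) \<in> K" using Km[OF that(2)] X by blast
      thus ?thesis using that(1) kG by (simp add: m_assoc[symmetric])
    qed
    have uv: "act g u \<noteq> act k v" if "g \<in> carrier G" "k \<in> carrier G" for g k
    proof
      assume "act g u = act k v"
      hence "act (inv k \<otimes> g) u = v" using that uW vW by (simp add: act_mult act_inv1)
      thus False using diff that by simp
    qed
    let ?Z = "(\<lambda>k. act k u) ` K \<union> (\<lambda>k. act k v) ` K"
    have "W \<subseteq> ?Z"
    proof (rule conn)
      show "u \<in> ?Z" using K1 act_one uW by (intro UnI1 image_eqI[of _ _ \<one>]) auto
      fix g assume g: "g \<in> carrier G"
      have "act g u \<in> ?Z \<longleftrightarrow> g \<in> K" using KA[OF g] uv[OF g] KG by blast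
      moreover have "act g v \<in> ?Z \<longleftrightarrow> g \<in> K"
      proof
        assume "act g v \<in> ?Z"
        then obtain k where k: "k \<in> K" "act g v = act k u \<or> act g v = act k v" by blast
        have "act g v \<noteq> act k u" using uv[of k g] k(1) KG g by auto
        thus "g \<in> K" using KB[OF g k(1)] k(2) by blast
      qed blast
      ultimately show "act g u \<in> ?Z \<longleftrightarrow> act g v \<in> ?Z" by blast
    qed
    hence "act g u \<in> ?Z" using act_closed[OF g uW] by blast
    hence "g \<in> K" using KA[OF g] uv[OF g] KG by blast
    thus ?thesis unfolding K_def by blast
  qed
  have "\<exists>h\<in>iso (word_group ?X arel) G. \<forall>w\<in>lists ?X. h (word_class ?X arel w) = aeval w"
  proof (rule word_group_iso[OF is_group])
    show "aval x \<in> carrier G" if "x \<in> ?X" for x using that X AG BG by auto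
    show "a \<in> lists ?X \<and> b \<in> lists ?X" if "arel a b" for a b
      using that by cases (auto simp: X SA SB CA CB)
    show "aeval a = aeval b" if "arel a b" for a b
      using that by cases (auto simp: AG BG m_assoc)
    show "\<exists>w\<in>lists ?X. aeval w = g" if "g \<in> carrier G" for g using gen[OF that] .
    show "\<exists>y\<in>?X. aeq [y, x] []" if "x \<in> ?X" for x
    proof (cases x)
      case (Inl a)
      hence a: "a \<in> A" using that X by auto
      have "aeq [Inl (inv a), Inl a] [Inl (inv a \<otimes> a)]" using merge_left[OF SA(3)[OF a] a, of "[]"] .
      hence "aeq [Inl (inv a), Inl a] []" using AG[OF a] word_equiv_trans[OF _ one_letter(1)] by simp
      thus ?thesis using Inl SA(3)[OF a] X by blast
    next
      case (Inr b)
      hence b: "b \<in> B" using that X by auto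
      have "aeq [Inr (inv b), Inr b] [Inr (inv b \<otimes> b)]" using merge_right[OF SB(3)[OF b] b, of "[]"] .
      hence "aeq [Inr (inv b), Inr b] []" using BG[OF b] word_equiv_trans[OF _ one_letter(2)] by simp
      thus ?thesis using Inr SB(3)[OF b] X by blast
    qed
    show "\<exists>w'. aeq w w' \<and> (aeval w' = \<one> \<longrightarrow> aeq w' [])" if w: "w \<in> lists ?X" for w
    proof -
      obtain w' where w': "(\<exists>x\<in>C. w' = [Inl x]) \<or> w' \<noteq> [] \<and> reduced w'" "aeq w w'" using reduce_word[OF w] by blast
      have "aeq w' []" if w1: "aeval w' = \<one>"
        using w'(1)
      proof
        assume "\<exists>x\<in>C. w' = [Inl x]"
        then obtain x where x: "x \<in> C" "w' = [Inl x]" by blast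
        hence "x = \<one>" using w1 CA AG by auto
        thus ?thesis using x one_letter(1) by simp
      next
        assume "w' \<noteq> [] \<and> reduced w'"
        thus ?thesis using reduced_nontrivial w1 by blast
      qed
      thus ?thesis using w'(2) by blast
    qed
  qed
  then obtain h where h: "h \<in> iso (amalgam A' B' C) G" "\<And>w. w \<in> lists ?X \<Longrightarrow> h (amalgam_class A' B' C w) = aeval w"
    unfolding amalgam_def amalgam_class_def by blast
  have ha: "h (amalgam_class A' B' C [Inl a]) = a" if "a \<in> A" for a
    using h(2)[of "[Inl a]"] that X AG by auto
  have hb: "h (amalgam_class A' B' C [Inr b]) = b" if "b \<in> B" for b
    using h(2)[of "[Inr b]"] that X BG by auto
  have sp: "splits_as_amalgam G A B C"
    unfolding splits_as_amalgam_def Let_def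
    using subgroup_A subgroup_B subgroup_C CA CB h(1) ha hb by blast
  have "A \<noteq> C"
  proof
    assume AC: "A = C"
    have "g \<in> B" if gG: "g \<in> carrier G" for g
    proof -
      obtain w where w: "w \<in> lists ?X" "aeval w = g" using gen[OF gG] by blast
      have "aval x \<in> B" if "x \<in> set w" for x using w(1) that X AC CB by auto
      hence "aeval w \<in> B" by (rule eval_word_subgroup[OF subgroup_B])
      thus ?thesis using w by simp
    qed
    thus False using nofix[OF vW] by (auto simp: B_def)
  qed
  moreover have "C \<noteq> B"
  proof
    assume CB': "C = B"
    have "g \<in> A" if gG: "g \<in> carrier G" for g
    proof -
      obtain w where w: "w \<in> lists ?X" "aeval w = g" using gen[OF gG] by blast
      have "aval x \<in> A" if "x \<in> set w" for x using w(1) that X CB' CA by auto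
      hence "aeval w \<in> A" by (rule eval_word_subgroup[OF subgroup_A])
      thus ?thesis using w by simp
    qed
    thus False using nofix[OF uW] by (auto simp: A_def)
  qed
  ultimately show ?thesis unfolding nontrivial_splitting_over_def using sp by blast
qed

end

subsection \<open>The HNN extension\<close>

text \<open>The ends of the edge are in one orbit. The stable letter is \<open>inv \<tau>\<close>, which conjugates the
  stabilizer \<open>C\<close> of the edge from \<open>u\<close> to \<open>\<tau> u\<close> into the stabilizer of \<open>u\<close>.\<close>

locale hnn_orbit = one_edge_orbit +
  fixes \<tau>
  assumes tauG: "\<tau> \<in> carrier G" and tau: "act \<tau> u = v"
begin

definition \<theta> where "\<theta> x = inv \<tau> \<otimes> x \<otimes> \<tau>"

fun hval :: "'a hnn_letter \<Rightarrow> 'a" where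
  "hval (Base a) = a"
| "hval Stable = inv \<tau>"
| "hval StableInv = \<tau>"

abbreviation heval where "heval \<equiv> eval_word G hval"
abbreviation hrel where "hrel \<equiv> hnn_relator A' C \<theta>"
abbreviation heq where "heq \<equiv> word_equiv hrel"
abbreviation HX where "HX \<equiv> hnn_letters A'"

lemma HX: "HX = Base ` A \<union> {Stable, StableInv}" by (simp add: hnn_letters_def)

lemma CG: "x \<in> C \<Longrightarrow> x \<in> carrier G" using CA AG by blast

lemma tau_inv: "act (inv \<tau>) v = u" using act_inv1[OF tauG uW] tau by simp

lemma hvalG: "x \<in> HX \<Longrightarrow> hval x \<in> carrier G" using HX AG tauG by auto

lemma theta_A: "x \<in> C \<Longrightarrow> \<theta> x \<in> A"
  using CG[of x] tauG uW vW tau tau_inv by (auto simp: \<theta>_def A_def act_mult C_def act_closed)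

text \<open>The two stable letters are treated together: \<open>tl True\<close> is \<open>Stable\<close>, and \<open>Cb b\<close> is the subgroup
  of the base that the letter \<open>tl b\<close> conjugates into the base.\<close>

definition tl where "tl b = (if b then Stable else StableInv)"
definition tv where "tv b = (if b then inv \<tau> else \<tau>)"
definition Cb where "Cb b = (if b then C else \<theta> ` C)"

lemma tvG: "tv b \<in> carrier G" using tauG by (simp add: tv_def)

lemma hval_tl: "hval (tl b) = tv b" by (simp add: tl_def tv_def)

lemma base_merge: "a \<in> A \<Longrightarrow> a' \<in> A \<Longrightarrow> heq (Base a # Base a' # w) (Base (a \<otimes> a') # w)"
  using word_equiv_context[OF word_equiv_relator, of hrel "[Base a, Base a']" "[Base (a \<otimes> a')]" "[]" w]
    hnn_relator.mult_base[of a A' a' C \<theta>] by simp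

lemma base_one: "heq (Base \<one> # w) w"
  using word_equiv_context[OF word_equiv_relator, of hrel "[Base \<one>]" "[]" "[]" w] hnn_relator.one_base[of A' C \<theta>] by simp

lemma stable_cancel: "heq (tl b # tl (\<not> b) # w) w"
  using word_equiv_context[OF word_equiv_relator, of hrel "[Stable, StableInv]" "[]" "[]" w] hnn_relator.stable_right[of A' C \<theta>]
    word_equiv_context[OF word_equiv_relator, of hrel "[StableInv, Stable]" "[]" "[]" w] hnn_relator.stable_left[of A' C \<theta>]
  by (cases b) (simp_all add: tl_def)

lemma stable_conj: "x \<in> C \<Longrightarrow> heq (Stable # Base x # StableInv # w) (Base (\<theta> x) # w)"
  using word_equiv_context[OF word_equiv_relator, of hrel "[Stable, Base x, StableInv]" "[Base (\<theta> x)]" "[]" w]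
    hnn_relator.conjugate[of x C A' \<theta>] by simp

lemma pinch: assumes "x \<in> Cb b" shows "\<exists>y\<in>A. heq (tl b # Base x # tl (\<not> b) # w) (Base y # w)"
proof (cases b)
  case True
  thus ?thesis using stable_conj[of x w] theta_A[of x] assms by (auto simp: tl_def Cb_def)
next
  case False
  then obtain y where y: "y \<in> C" "x = \<theta> y" using assms by (auto simp: Cb_def)
  have "heq (StableInv # Base x # Stable # w) (StableInv # Stable # Base y # StableInv # Stable # w)"
    using word_equiv_Cons[OF word_equiv_sym[OF stable_conj[OF y(1), of "Stable # w"]]] y(2) by simp
  moreover have "heq (StableInv # Stable # Base y # StableInv # Stable # w) (Base y # StableInv # Stable # w)"
    using stable_cancel[of False] by (simp add: tl_def)
  moreover have "heq (Base y # StableInv # Stable # w) (Base y # w)"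
    using word_equiv_Cons[OF stable_cancel[of False w]] by (simp add: tl_def)
  ultimately have "heq (StableInv # Base x # Stable # w) (Base y # w)" using word_equiv_trans by blast
  thus ?thesis using CA[OF y(1)] False by (auto simp: tl_def)
qed

text \<open>Words without a pinch.\<close>

fun hword :: "('a \<times> bool) list \<Rightarrow> 'a \<Rightarrow> 'a hnn_letter list" where
  "hword [] z = [Base z]"
| "hword ((a, b) # ps) z = Base a # tl b # hword ps z"

fun hred :: "('a \<times> bool) list \<Rightarrow> bool" where
  "hred [] = True"
| "hred [(a, b)] = (a \<in> A)"
| "hred ((a, b) # (a', b') # ps) = (a \<in> A \<and> \<not> (b' = (\<not> b) \<and> a' \<in> Cb b) \<and> hred ((a', b') # ps))"

lemma hred_base: "hred ((a, b) # ps) \<Longrightarrow> a \<in> A" "hred ((a, b) # ps) \<Longrightarrow> hred ps"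
  "hred ((a, b) # ps) \<Longrightarrow> a' \<in> A \<Longrightarrow> hred ((a', b) # ps)"
  by (cases ps; auto)+

lemma hword_merge:
  assumes "x \<in> A" "hred ps" "z \<in> A"
  shows "\<exists>ps' z'. hred ps' \<and> z' \<in> A \<and> heq (Base x # hword ps z) (hword ps' z')"
proof (cases ps)
  case Nil
  thus ?thesis using base_merge[OF assms(1,3), of "[]"] SA(1)[OF assms(1,3)] by (intro exI[of _ "[]"] exI[of _ "x \<otimes> z"]) simp
next
  case (Cons p ps0)
  obtain a b where p: "p = (a, b)" by (cases p)
  have a: "a \<in> A" using hred_base assms Cons p by blast
  show ?thesis
    using base_merge[OF assms(1) a] hred_base(3)[of a b ps0 "x \<otimes> a"] SA(1)[OF assms(1) a] assms Cons p
    by (intro exI[of _ "(x \<otimes> a, b) # ps0"] exI[of _ z]) simp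
qed

lemma hword_stable:
  assumes "hred ps" "z \<in> A"
  shows "\<exists>ps' z'. hred ps' \<and> z' \<in> A \<and> heq (tl b # hword ps z) (hword ps' z')"
proof (cases "\<exists>a' ps0. ps = (a', \<not> b) # ps0 \<and> a' \<in> Cb b")
  case True
  then obtain a' ps0 where p: "ps = (a', \<not> b) # ps0" "a' \<in> Cb b" by blast
  obtain y where y: "y \<in> A" "heq (tl b # hword ps z) (Base y # hword ps0 z)" using pinch[OF p(2), of "hword ps0 z"] p(1) by auto
  have "hred ps0" using hred_base assms(1) p(1) by blast
  from hword_merge[OF y(1) this assms(2)] show ?thesis using word_equiv_trans[OF y(2)] by blast
next
  case False
  have "hred ((\<one>, b) # ps)" using False assms SA(2) by (cases ps) auto
  moreover have "heq (tl b # hword ps z) (hword ((\<one>, b) # ps) z)" using word_equiv_sym[OF base_one] by simp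
  ultimately show ?thesis using assms(2) by blast
qed

lemma hnn_normal:
  assumes "w \<in> lists HX" shows "\<exists>ps z. hred ps \<and> z \<in> A \<and> heq w (hword ps z)"
  using assms
proof (induction w)
  case Nil
  have "heq [] (hword [] \<one>)" using word_equiv_sym[OF base_one[of "[]"]] by simp
  thus ?case using SA(2) hred.simps(1) by blast
next
  case (Cons x w)
  then obtain ps z where p: "hred ps" "z \<in> A" "heq w (hword ps z)" by blast
  have "\<exists>ps' z'. hred ps' \<and> z' \<in> A \<and> heq (x # hword ps z) (hword ps' z')"
  proof (cases x)
    case (Base a)
    hence "a \<in> A" using Cons.hyps HX by auto
    thus ?thesis using hword_merge p Base by blast
  next
    case Stable thus ?thesis using hword_stable[OF p(1,2), of True] by (simp add: tl_def)
  next
    case StableInv thus ?thesis using hword_stable[OF p(1,2), of False] by (simp add: tl_def)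
  qed
  thus ?case using word_equiv_trans[OF word_equiv_Cons[OF p(3)]] by blast
qed

text \<open>The branch at \<open>u\<close> that contains \<open>inv \<tau> u\<close> if \<open>b\<close>, and \<open>\<tau> u\<close> otherwise.\<close>

definition Bb where "Bb b x = (if b then \<not> c (act \<tau> x) else c x)"

lemma Bb_tv: "y \<in> W \<Longrightarrow> Bb b (act (tv b) y) = (\<not> Bb (\<not> b) y)"
  using act_inv2[OF tauG] by (simp add: Bb_def tv_def)

lemma Bb_u: "\<not> Bb b u" using cu cv tau by (simp add: Bb_def)

lemma Bb_flip:
  assumes g: "g \<in> carrier G" and f: "Bb b (act g u) \<noteq> Bb b (act g v)"
  shows "if b then act g v = u \<and> act g u = act (inv \<tau>) u else act g u = u \<and> act g v = v"
proof (cases b)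
  case True
  have "act (\<tau> \<otimes> g) u = u \<and> act (\<tau> \<otimes> g) v = v"
    using crossing[of "\<tau> \<otimes> g"] f True g tauG uW vW by (simp add: Bb_def act_mult)
  hence "act \<tau> (act g u) = u" "act \<tau> (act g v) = v" using g tauG uW vW by (simp_all add: act_mult)
  thus ?thesis using True act_inv1[OF tauG act_closed[OF g uW]] act_inv1[OF tauG act_closed[OF g vW]] tau_inv by simp
next
  case False thus ?thesis using crossing[OF g] f by (simp add: Bb_def)
qed

lemma Cb_False: assumes a: "a \<in> A" "act a (act (inv \<tau>) u) = act (inv \<tau>) u" shows "a \<in> \<theta> ` C"
proof -
  have aG: "a \<in> carrier G" "act a u = u" using a by (auto simp: A_def)
  let ?x = "\<tau> \<otimes> a \<otimes> inv \<tau>"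
  have xG: "?x \<in> carrier G" using aG tauG by simp
  have "act ?x u = act \<tau> (act a (act (inv \<tau>) u))" using aG tauG uW by (simp add: act_mult act_closed)
  hence "act ?x u = u" using a act_inv2[OF tauG uW] by simp
  moreover have "act ?x v = v" using aG tauG uW vW tau_inv tau by (simp add: act_mult act_closed)
  ultimately have "?x \<in> C" using xG by (simp add: C_def)
  moreover have "a = \<theta> ?x" using aG tauG by (simp add: \<theta>_def m_assoc) (simp add: m_assoc[symmetric])
  ultimately show ?thesis by blast
qed

text \<open>The ping-pong step. The exception is a pinch, in which case \<open>a\<close> fixes the edge at \<open>u\<close> that
  leads into the branch.\<close>

lemma Bb_disjoint:
  assumes a: "a \<in> A" and n: "\<not> (b' = (\<not> b) \<and> a \<in> Cb b)" and y: "y \<in> W" "Bb b' y"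
  shows "\<not> Bb (\<not> b) (act a y)"
proof -
  have aG: "a \<in> carrier G" "act a u = u" using a by (auto simp: A_def)
  let ?k = "\<lambda>x. Bb b' (act (inv a) x)"
  have iu: "act (inv a) u = u" using act_inv1[OF aG(1) uW] aG(2) by simp
  have k: "if b' then act g v = u \<and> act g u = act a (act (inv \<tau>) u) else act g u = u \<and> act g v = act a v"
    if g: "g \<in> carrier G" and kk: "?k (act g u) \<noteq> ?k (act g v)" for g
  proof -
    have "Bb b' (act (inv a \<otimes> g) u) \<noteq> Bb b' (act (inv a \<otimes> g) v)" using kk g aG(1) uW vW by (simp add: act_mult)
    from Bb_flip[OF _ this] have f: "if b' then act (inv a) (act g v) = u \<and> act (inv a) (act g u) = act (inv \<tau>) u
        else act (inv a) (act g u) = u \<and> act (inv a) (act g v) = v"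
      using g aG(1) uW vW by (simp add: act_mult split: if_splits)
    have "act a (act (inv a) (act g u)) = act g u" "act a (act (inv a) (act g v)) = act g v"
      using act_inv2[OF aG(1)] act_closed[OF g] uW vW by auto
    thus ?thesis using f aG(2) by (auto split: if_splits)
  qed
  have "\<not> (Bb (\<not> b) (act a y) \<and> ?k (act a y))"
  proof (rule branches[of "Bb (\<not> b)" ?k "act a y"])
    show "\<not> ?k u" using iu Bb_u by simp
    fix g assume g: "g \<in> carrier G"
    show "Bb (\<not> b) (act g u) \<noteq> Bb (\<not> b) (act g v) \<Longrightarrow> act g u = u \<or> act g v = u" using Bb_flip[OF g, of "\<not> b"] by (auto split: if_splits)
    show "?k (act g u) \<noteq> ?k (act g v) \<Longrightarrow> act g u = u \<or> act g v = u" using k[OF g] by (auto split: if_splits)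
    assume f: "Bb (\<not> b) (act g u) \<noteq> Bb (\<not> b) (act g v)" "?k (act g u) \<noteq> ?k (act g v)"
    have ne: "act g u \<noteq> act g v" using act_inj[OF g uW vW] u_neq_v by simp
    note 1 = Bb_flip[OF g f(1)] and 2 = k[OF g f(2)]
    have b': "b' = (\<not> b)" using 1 2 ne by (auto split: if_splits)
    have "a \<in> Cb b"
    proof (cases b)
      case True
      hence "act a v = v" using 1 2 b' by simp
      thus ?thesis using True aG by (simp add: Cb_def C_def)
    next
      case False
      hence "act a (act (inv \<tau>) u) = act (inv \<tau>) u" using 1 2 b' by simp
      thus ?thesis using Cb_False[OF a] False by (simp add: Cb_def)
    qed
    thus False using n b' by blast
  qed (use Bb_u act_closed[OF aG(1) y(1)] in auto)
  moreover have "?k (act a y)" using act_inv1[OF aG(1) y(1)] y(2) by simp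
  ultimately show ?thesis by blast
qed

lemma heval_closed: "hred ps \<Longrightarrow> z \<in> A \<Longrightarrow> heval (hword ps z) \<in> carrier G"
proof (induction ps)
  case (Cons p ps)
  obtain a b where p: "p = (a, b)" by (cases p)
  thus ?case using Cons hred_base[of a b ps] AG tvG by (simp add: hval_tl)
qed (simp add: AG)

lemma hnn_ping_pong:
  "hred ((a, b) # ps) \<Longrightarrow> z \<in> A \<Longrightarrow> Bb b (act (inv a) (act (heval (hword ((a, b) # ps) z)) u))"
proof (induction ps arbitrary: a b)
  case Nil
  let ?e = "heval (hword [] z)"
  have aG: "a \<in> carrier G" and e: "?e \<in> carrier G" using Nil AG by auto
  have eu: "act ?e u = u" using Nil by (auto simp: A_def)
  have "act (heval (hword [(a, b)] z)) u = act a (act (tv b) u)" using eu aG e tvG uW by (simp add: hval_tl act_mult del: hword.simps(1))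
  hence "act (inv a) (act (heval (hword [(a, b)] z)) u) = act (tv b) u" using act_inv1[OF aG] act_closed[OF tvG uW] by simp
  thus ?case using Bb_tv[OF uW] Bb_u by simp
next
  case (Cons p ps)
  obtain a' b' where p: "p = (a', b')" by (cases p)
  let ?e = "heval (hword (p # ps) z)"
  have r: "hred ((a', b') # ps)" "\<not> (b' = (\<not> b) \<and> a' \<in> Cb b)" "a \<in> A" using Cons.prems p by auto
  have aG: "a \<in> carrier G" and e: "?e \<in> carrier G" and a': "a' \<in> A"
    using AG[OF r(3)] heval_closed[OF r(1) Cons.prems(2)] p hred_base(1)[OF r(1)] by auto
  have yW: "act ?e u \<in> W" using act_closed[OF e uW] .
  have "Bb b' (act (inv a') (act ?e u))" using Cons.IH[OF r(1) Cons.prems(2)] p by simp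
  moreover have "act (inv a') (act ?e u) \<in> W" using act_closed yW AG[OF a'] by simp
  ultimately have "\<not> Bb (\<not> b) (act a' (act (inv a') (act ?e u)))" using Bb_disjoint[OF a' r(2)] by blast
  hence nb: "\<not> Bb (\<not> b) (act ?e u)" using act_inv2[OF AG[OF a'] yW] by simp
  have "heval (hword ((a, b) # p # ps) z) = a \<otimes> (tv b \<otimes> ?e)" by (simp add: hval_tl)
  hence "act (heval (hword ((a, b) # p # ps) z)) u = act a (act (tv b) (act ?e u))" using aG e tvG uW by (simp add: act_mult)
  hence "act (inv a) (act (heval (hword ((a, b) # p # ps) z)) u) = act (tv b) (act ?e u)"
    using act_inv1[OF aG] act_closed[OF tvG yW] by simp
  thus ?case using Bb_tv[OF yW] nb by simp
qed

lemma theta_mon: "\<theta> \<in> mon (G\<lparr>carrier := C\<rparr>) A'"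
proof -
  have cancel: "\<tau> \<otimes> (inv \<tau> \<otimes> z) = z" if "z \<in> carrier G" for z
    using that tauG by (simp add: m_assoc[symmetric])
  have "\<theta> x \<otimes> \<theta> y = \<theta> (x \<otimes> y)" if "x \<in> carrier G" "y \<in> carrier G" for x y
    using that tauG cancel by (simp add: \<theta>_def m_assoc)
  moreover have "inj_on \<theta> C" using CG tauG by (auto simp: inj_on_def \<theta>_def)
  ultimately show ?thesis using theta_A CG by (auto simp: mon_def hom_def)
qed

text \<open>The translates of \<open>u\<close> by the subgroup generated by \<open>A\<close> and \<open>\<tau>\<close> are closed under crossing
  edges, so this subgroup is everything. A word without a pinch that contains a stable letter moves
  \<open>u\<close> into a branch.\<close>

theorem hnn_splitting: "nontrivial_splitting_over G C"
proof -
  have gen: "\<exists>w\<in>lists HX. heval w = g" if g: "g \<in> carrier G" for g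
  proof -
    define K where "K = heval ` lists HX"
    have KG: "K \<subseteq> carrier G" unfolding K_def
    proof clarify
      fix w assume "\<forall>x\<in>set w. x \<in> HX" thus "heval w \<in> carrier G" using hvalG by (intro eval_word_closed) blast
    qed
    have Km: "k \<otimes> hval x \<in> K" if k: "k \<in> K" and x: "x \<in> HX" for k x
    proof -
      obtain w where w: "w \<in> lists HX" "k = heval w" using k unfolding K_def by blast
      have "heval (w @ [x]) = k \<otimes> hval x" using eval_word_append[of w "[x]" hval] w x hvalG by auto
      moreover have "w @ [x] \<in> lists HX" using w x by simp
      ultimately show ?thesis unfolding K_def by (metis image_eqI)
    qed
    have K1: "\<one> \<in> K" unfolding K_def by (intro image_eqI[of _ _ "[]"]) auto
    have KA: "g \<in> K" if "g \<in> carrier G" "k \<in> K" "act g u = act k u" for g k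
    proof -
      have kG: "k \<in> carrier G" using that KG by blast
      have "inv k \<otimes> g \<in> A" using that kG uW by (simp add: A_def act_mult act_inv1)
      hence "k \<otimes> hval (Base (inv k \<otimes> g)) \<in> K" using Km[OF that(2)] HX by blast
      thus ?thesis using that(1) kG by (simp add: m_assoc[symmetric])
    qed
    let ?Z = "(\<lambda>k. act k u) ` K"
    have "W \<subseteq> ?Z"
    proof (rule conn)
      show "u \<in> ?Z" using K1 act_one uW by (intro image_eqI[of _ _ \<one>]) auto
      fix g assume g: "g \<in> carrier G"
      have gv: "act g v = act (g \<otimes> \<tau>) u" using tau g tauG uW by (simp add: act_mult)
      have "act g u \<in> ?Z \<longleftrightarrow> g \<in> K" using KA[OF g] by blast
      moreover have "act g v \<in> ?Z \<longleftrightarrow> g \<otimes> \<tau> \<in> K" using KA[of "g \<otimes> \<tau>"] g tauG gv by auto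
      moreover have "g \<in> K \<longleftrightarrow> g \<otimes> \<tau> \<in> K"
      proof
        show "g \<in> K \<Longrightarrow> g \<otimes> \<tau> \<in> K" using Km[of g StableInv] HX by simp
        assume "g \<otimes> \<tau> \<in> K"
        hence "(g \<otimes> \<tau>) \<otimes> inv \<tau> \<in> K" using Km[of "g \<otimes> \<tau>" Stable] HX by simp
        thus "g \<in> K" using g tauG by (simp add: m_assoc)
      qed
      ultimately show "act g u \<in> ?Z \<longleftrightarrow> act g v \<in> ?Z" by blast
    qed
    hence "act g u \<in> ?Z" using act_closed[OF g uW] by blast
    hence "g \<in> K" using KA[OF g] by blast
    thus ?thesis unfolding K_def by blast
  qed
  have "\<exists>h\<in>iso (word_group HX hrel) G. \<forall>w\<in>lists HX. h (word_class HX hrel w) = heval w"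
  proof (rule word_group_iso[OF is_group])
    show "hval x \<in> carrier G" if "x \<in> HX" for x using hvalG[OF that] .
    show "a \<in> lists HX \<and> b \<in> lists HX" if "hrel a b" for a b
      using that by cases (auto simp: HX SA CA theta_A)
    show "heval a = heval b" if "hrel a b" for a b
      using that by cases (use AG tauG CG in \<open>auto simp: m_assoc \<theta>_def\<close>)
    show "\<exists>w\<in>lists HX. heval w = g" if "g \<in> carrier G" for g using gen[OF that] .
    show "\<exists>y\<in>HX. heq [y, x] []" if "x \<in> HX" for x
    proof (cases x)
      case (Base a)
      hence a: "a \<in> A" using that HX by auto
      have "heq [Base (inv a), Base a] [Base (inv a \<otimes> a)]" using base_merge[OF SA(3)[OF a] a, of "[]"] .
      hence "heq [Base (inv a), Base a] []" using AG[OF a] word_equiv_trans[OF _ base_one] by simp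
      thus ?thesis using Base SA(3)[OF a] HX by blast
    next
      case Stable thus ?thesis using stable_cancel[of False "[]"] HX by (intro bexI[of _ StableInv]) (auto simp: tl_def)
    next
      case StableInv thus ?thesis using stable_cancel[of True "[]"] HX by (intro bexI[of _ Stable]) (auto simp: tl_def)
    qed
    show "\<exists>w'. heq w w' \<and> (heval w' = \<one> \<longrightarrow> heq w' [])" if w: "w \<in> lists HX" for w
    proof -
      obtain ps z where p: "hred ps" "z \<in> A" "heq w (hword ps z)" using hnn_normal[OF w] by blast
      have "heq (hword ps z) []" if e: "heval (hword ps z) = \<one>"
      proof (cases ps)
        case Nil
        hence "z = \<one>" using e AG[OF p(2)] by simp
        thus ?thesis using Nil base_one by simp
      next
        case (Cons q ps0)
        obtain a b where q: "q = (a, b)" by (cases q)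
        have "Bb b (act (inv a) (act \<one> u))" using hnn_ping_pong[of a b ps0 z] p q Cons e by simp
        moreover have "act (inv a) (act \<one> u) = u"
          using hred_base(1)[of a b ps0] p(1) Cons q act_one[OF uW] act_inv1[OF AG uW] by (auto simp: A_def) 
        ultimately show ?thesis using Bb_u by simp
      qed
      thus ?thesis using p(3) by blast
    qed
  qed
  then obtain h where h: "h \<in> iso (hnn_extension A' C \<theta>) G" "\<And>w. w \<in> lists HX \<Longrightarrow> h (hnn_class A' C \<theta> w) = heval w"
    unfolding hnn_extension_def hnn_class_def by blast
  have "h (hnn_class A' C \<theta> [Base a]) = a" if "a \<in> A" for a
    using h(2)[of "[Base a]"] that HX AG by auto
  hence "splits_as_hnn G A C \<theta>"
    unfolding splits_as_hnn_def Let_def using subgroup_A subgroup_C CA h(1) theta_mon by blast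
  thus ?thesis unfolding nontrivial_splitting_over_def by blast
qed

end

theorem (in one_edge_orbit) splitting_over_edge_stabilizer:
  assumes "\<And>x. x \<in> W \<Longrightarrow> \<exists>g\<in>carrier G. act g x \<noteq> x"
  shows "nontrivial_splitting_over G C"
proof (cases "\<exists>g\<in>carrier G. act g u = v")
  case True
  then obtain t where "t \<in> carrier G" "act t u = v" by blast
  then interpret hnn_orbit G W act u v c t by unfold_locales
  show ?thesis by (rule hnn_splitting)
next
  case False thus ?thesis using amalgam_splitting assms by blast
qed

section \<open>Splittings from cofinite actions without fixed vertices\<close>

context ctree_act
begin

text \<open>All edges outside of the orbit of \<open>(u, v)\<close> are collapsed by recording for each vertex only on
  which sides of the translates of \<open>(u, v)\<close> it lies.\<close>

definition sides :: "'x \<Rightarrow> 'x \<Rightarrow> 'x \<Rightarrow> 'g set" where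
  "sides u v x = {g \<in> carrier \<Gamma>. beyond u v (act (inv g) x)}"

definition translate :: "'g \<Rightarrow> 'g set \<Rightarrow> 'g set" where
  "translate g S = (\<lambda>h. g \<otimes> h) ` S"

lemma sides_act:
  assumes "g \<in> carrier \<Gamma>" "x \<in> V" shows "translate g (sides u v x) = sides u v (act g x)"
proof -
  have "sides u v (act g x) \<subseteq> translate g (sides u v x)"
  proof
    fix h assume "h \<in> sides u v (act g x)"
    hence h: "h \<in> carrier \<Gamma>" "beyond u v (act (inv h) (act g x))" by (auto simp: sides_def)
    have "inv (inv g \<otimes> h) = inv h \<otimes> g" using assms h by (simp add: inv_mult_group)
    hence "inv g \<otimes> h \<in> sides u v x" using h assms by (simp add: sides_def act_mult)
    moreover have "h = g \<otimes> (inv g \<otimes> h)" using assms h by (simp add: m_assoc[symmetric])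
    ultimately show "h \<in> translate g (sides u v x)" unfolding translate_def by blast
  qed
  moreover have "translate g (sides u v x) \<subseteq> sides u v (act g x)"
  proof
    fix k assume "k \<in> translate g (sides u v x)"
    then obtain h where h: "h \<in> carrier \<Gamma>" "beyond u v (act (inv h) x)" "k = g \<otimes> h" by (auto simp: translate_def sides_def)
    have "act (inv k) (act g x) = act (inv h) (act (inv g) (act g x))"
      using h assms by (simp add: inv_mult_group act_mult act_closed)
    thus "k \<in> sides u v (act g x)" using h assms act_inv1 by (simp add: sides_def)
  qed
  ultimately show ?thesis by blast
qed

lemma one_mem_sides: "x \<in> V \<Longrightarrow> \<one> \<in> sides u v x \<longleftrightarrow> beyond u v x"
  by (simp add: sides_def act_one)

lemma collapse:
  assumes uv: "(u, v) \<in> E"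
  shows "one_edge_orbit \<Gamma> (sides u v ` V) translate (sides u v u) (sides u v v) (\<lambda>S. \<one> \<in> S)"
proof unfold_locales
  have V: "u \<in> V" "v \<in> V" using EVD[OF uv] by auto
  let ?s = "sides u v"
  show "?s u \<in> ?s ` V" "?s v \<in> ?s ` V" using V by auto
  show "\<one> \<notin> ?s u" "\<one> \<in> ?s v"
    using one_mem_sides[OF V(1)] one_mem_sides[OF V(2)] not_beyond_start[OF uv] beyond_cut(2)[OF uv] by auto
  fix g assume g: "g \<in> carrier \<Gamma>"
  show "translate g x \<in> ?s ` V" if "x \<in> ?s ` V" for x using that sides_act[OF g] act_closed[OF g] by auto
  show "translate (g \<otimes> h) x = translate g (translate h x)" if "h \<in> carrier \<Gamma>" "x \<in> ?s ` V" for h x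
    using that g by (auto simp: sides_act act_mult act_closed)
  show "translate g (?s u) = ?s u \<and> translate g (?s v) = ?s v"
    if "(\<one> \<in> translate g (?s u)) \<noteq> (\<one> \<in> translate g (?s v))"
  proof -
    have "beyond u v (act g u) \<noteq> beyond u v (act g v)"
      using that sides_act[OF g] V one_mem_sides act_closed[OF g] by simp
    hence "act g u = u \<and> act g v = v" using beyond_edge[OF uv E_act[OF uv g]] noinvE[OF uv g] by blast
    thus ?thesis using sides_act[OF g] V by simp
  qed
next
  fix x assume "x \<in> sides u v ` V"
  thus "translate \<one> x = x" using sides_act[OF one_closed] act_one by auto
next
  fix Z assume Z: "sides u v u \<in> Z"
    "\<And>g. g \<in> carrier \<Gamma> \<Longrightarrow> (translate g (sides u v u) \<in> Z) = (translate g (sides u v v) \<in> Z)"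
  have V: "u \<in> V" "v \<in> V" using EVD[OF uv] by auto
  let ?s = "sides u v"
  have "?s x \<in> Z" if "(u, x) \<in> E\<^sup>*" for x
    using that
  proof (induction rule: rtrancl_induct)
    case (step p q)
    have pq: "p \<in> V" "q \<in> V" using EVD[OF step(2)] by auto
    show ?case
    proof (cases "?s p = ?s q")
      case False
      then obtain h where h: "h \<in> carrier \<Gamma>" "beyond u v (act (inv h) p) \<noteq> beyond u v (act (inv h) q)"
        unfolding sides_def by blast
      have "(act (inv h) p, act (inv h) q) \<in> E" using E_act[OF step(2)] h by simp
      hence "act (inv h) p = u \<and> act (inv h) q = v \<or> act (inv h) p = v \<and> act (inv h) q = u"
        using beyond_edge[OF uv] h(2) by blast
      hence "p = act h u \<and> q = act h v \<or> p = act h v \<and> q = act h u"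
        using act_inv2[OF h(1) pq(1)] act_inv2[OF h(1) pq(2)] by metis
      thus ?thesis using Z(2)[OF h(1)] sides_act[OF h(1)] V step(3) by auto
    qed (use step in simp)
  qed (use Z in simp)
  thus "sides u v ` V \<subseteq> Z" using connE[OF V(1)] by blast
qed

lemma collapse_stabilizer:
  assumes uv: "(u, v) \<in> E"
  shows "one_edge_orbit.C \<Gamma> translate (sides u v u) (sides u v v) = {g \<in> carrier \<Gamma>. act g u = u \<and> act g v = v}"
proof -
  interpret c: one_edge_orbit \<Gamma> "sides u v ` V" translate "sides u v u" "sides u v v" "\<lambda>S. \<one> \<in> S"
    by (rule collapse[OF uv])
  have V: "u \<in> V" "v \<in> V" using EVD[OF uv] by auto
  have "act g u = u \<and> act g v = v" if g: "g \<in> carrier \<Gamma>" and e: "sides u v (act g u) = sides u v u" "sides u v (act g v) = sides u v v" for g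
  proof -
    have "beyond u v (act g u) \<noteq> beyond u v (act g v)"
      using e one_mem_sides[of "act g u" u v] one_mem_sides[of "act g v" u v] act_closed[OF g] V c.cu c.cv by metis
    thus ?thesis using beyond_edge[OF uv E_act[OF uv g]] noinvE[OF uv g] by blast
  qed
  thus ?thesis unfolding c.C_def using sides_act V by auto
qed

lemma invariant_subtree:
  assumes "Z \<subseteq> V" "\<And>g x. g \<in> carrier \<Gamma> \<Longrightarrow> x \<in> Z \<Longrightarrow> act g x \<in> Z"
    "\<And>x y. x \<in> Z \<Longrightarrow> y \<in> Z \<Longrightarrow> (x, y) \<in> (E \<inter> Z \<times> Z)\<^sup>*"
  shows "ctree_act Z (E \<inter> Z \<times> Z) \<Gamma> act"
proof -
  interpret Z: ctree Z "E \<inter> Z \<times> Z" by (rule subtree[OF assms(1,3)])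
  interpret Zg: gact \<Gamma> Z act by (rule gact_subset[OF assms(1,2)])
  show ?thesis
  proof unfold_locales
    show "invariant_rel \<Gamma> act (E \<inter> Z \<times> Z)" unfolding invariant_rel_def using E_act assms(2) by blast
    show "act g y \<noteq> x" if "(x, y) \<in> E \<inter> Z \<times> Z" "g \<in> carrier \<Gamma>" "act g x = y" for x y g
      using noinvE that by blast
  qed
qed

text \<open>The preimage of a fixed vertex of the collapsed tree is an invariant subtree that does not
  contain the edge \<open>(u, v)\<close>.\<close>

lemma fixed_side_subtree:
  assumes uv: "(u, v) \<in> E" and x: "x \<in> V" "\<And>g. g \<in> carrier \<Gamma> \<Longrightarrow> sides u v (act g x) = sides u v x"
    and fin: "finite (E // edge_orb_rel \<Gamma> act E (Id_on V))"
  defines "Z \<equiv> {y \<in> V. sides u v y = sides u v x}"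
  shows "ctree_act Z (E \<inter> Z \<times> Z) \<Gamma> act"
    "(E \<inter> Z \<times> Z) // edge_orb_rel \<Gamma> act (E \<inter> Z \<times> Z) (Id_on Z) \<subset> E // edge_orb_rel \<Gamma> act E (Id_on V)"
proof -
  have ZV: "Z \<subseteq> V" by (auto simp: Z_def)
  have Zact: "act g y \<in> Z" if "g \<in> carrier \<Gamma>" "y \<in> Z" for g y
  proof -
    have "sides u v (act g y) = translate g (sides u v x)" using sides_act[OF that(1), of y u v] that(2) by (auto simp: Z_def)
    also have "\<dots> = sides u v x" using sides_act[OF that(1) x(1)] x(2)[OF that(1)] by simp
    finally show ?thesis using that act_closed by (simp add: Z_def)
  qed
  have conv: "interval y z \<subseteq> Z" if yz: "y \<in> Z" "z \<in> Z" for y z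
  proof
    fix p assume p: "p \<in> interval y z"
    have V: "y \<in> V" "z \<in> V" "p \<in> V" using yz interval_V[OF p] by (auto simp: Z_def)
    have "beyond u v (act (inv h) p) = beyond u v (act (inv h) x)" if h: "h \<in> carrier \<Gamma>" for h
    proof -
      have ih: "inv h \<in> carrier \<Gamma>" using h by simp
      have s: "beyond u v (act (inv h) y) = beyond u v (act (inv h) x)" "beyond u v (act (inv h) z) = beyond u v (act (inv h) x)"
        using yz h unfolding Z_def sides_def by blast+
      have i: "act (inv h) p \<in> interval (act (inv h) y) (act (inv h) z)" using interval_act[OF ih V(1,2) p] .
      show ?thesis
      proof (cases "beyond u v (act (inv h) x)")
        case True thus ?thesis using intervalD[OF i uv] s by simp
      next
        case False
        note b = beyond_swap[OF uv act_closed[OF ih V(1)]] beyond_swap[OF uv act_closed[OF ih V(2)]] beyond_swap[OF uv act_closed[OF ih V(3)]]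
        have "beyond v u (act (inv h) p)" using intervalD[OF i symE[OF uv]] s b False by simp
        thus ?thesis using b False by simp
      qed
    qed
    hence "sides u v p = sides u v x" by (auto simp: sides_def)
    thus "p \<in> Z" using V by (simp add: Z_def)
  qed
  have "(y, z) \<in> (E \<inter> Z \<times> Z)\<^sup>*" if yz: "y \<in> Z" "z \<in> Z" for y z
  proof -
    have "E \<inter> interval y z \<times> interval y z \<subseteq> E \<inter> Z \<times> Z" using conv[OF yz] by blast
    thus ?thesis using interval_connected[of y z] yz ZV rtrancl_mono by blast
  qed
  from invariant_subtree[OF ZV Zact this] show Z: "ctree_act Z (E \<inter> Z \<times> Z) \<Gamma> act" .
  interpret Z: ctree_act Z "E \<inter> Z \<times> Z" \<Gamma> act by (rule Z)
  let ?s = "edge_orb_rel \<Gamma> act E (Id_on V)" and ?t = "edge_orb_rel \<Gamma> act (E \<inter> Z \<times> Z) (Id_on Z)"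
  have cls: "?t `` {e} = ?s `` {e}" if e: "e \<in> E \<inter> Z \<times> Z" for e
  proof (rule Set.set_eqI)
    fix f :: "'x \<times> 'x" obtain a b c d where ab: "e = (a, b)" "f = (c, d)" by (cases e; cases f)
    show "f \<in> ?t `` {e} \<longleftrightarrow> f \<in> ?s `` {e}" using e unfolding ab by (simp add: Z.edge_orb_Id edge_orb_Id)
  qed
  have sub: "(E \<inter> Z \<times> Z) // ?t \<subseteq> E // ?s"
  proof
    fix C assume "C \<in> (E \<inter> Z \<times> Z) // ?t"
    then obtain e where "e \<in> E \<inter> Z \<times> Z" "C = ?t `` {e}" by (meson quotientE)
    thus "C \<in> E // ?s" using cls by (metis IntD1 quotientI)
  qed
  moreover have "?s `` {(u, v)} \<in> E // ?s" by (rule quotientI[OF uv])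
  moreover have "?s `` {(u, v)} \<notin> (E \<inter> Z \<times> Z) // ?t"
  proof
    assume "?s `` {(u, v)} \<in> (E \<inter> Z \<times> Z) // ?t"
    then obtain e where e: "e \<in> E \<inter> Z \<times> Z" "?s `` {(u, v)} = ?t `` {e}" by (meson quotientE)
    obtain a b where ab: "e = (a, b)" by (cases e)
    have "((u, v), (a, b)) \<in> ?s" using e cls[OF e(1)] equiv_class_self[OF Z.equiv_edge_Id e(1)] ab by blast
    then obtain g where g: "g \<in> carrier \<Gamma>" "act g u = a" "act g v = b" unfolding edge_orb_Id by blast
    have "sides u v a = sides u v b" using e(1) ab by (auto simp: Z_def)
    hence "translate g (sides u v u) = translate g (sides u v v)" using sides_act[OF g(1)] EVD[OF uv] g(2,3) by simp
    hence "sides u v u = sides u v v" using act_inv1[OF g(1)] sides_act[OF inv_closed[OF g(1)]] sides_act[OF g(1)] act_closed[OF g(1)] EVD[OF uv] by metis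
    thus False using one_mem_sides[of u u v] one_mem_sides[of v u v] EVD[OF uv] not_beyond_start[OF uv] beyond_cut(2)[OF uv] by simp
  qed
  ultimately show "(E \<inter> Z \<times> Z) // ?t \<subset> E // ?s" by blast
qed

end

text \<open>Induction on the number of edge orbits: either the collapse onto the orbit of some edge has no
  fixed vertex and Bass-Serre theory applies, or it has one, and its preimage is a smaller invariant
  subtree.\<close>

theorem splitting_of_tree_action:
  assumes "ctree_act V E G act" "V \<noteq> {}" "finite (E // edge_orb_rel G act E (Id_on V))"
    and "\<And>x. x \<in> V \<Longrightarrow> \<exists>g\<in>carrier G. act g x \<noteq> x"
  shows "\<exists>(u, v)\<in>E. nontrivial_splitting_over G {g \<in> carrier G. act g u = u \<and> act g v = v}"
  using assms
proof (induction "card (E // edge_orb_rel G act E (Id_on V))" arbitrary: V E rule: less_induct)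
  case less
  interpret ctree_act V E G act by (rule less.prems(1))
  obtain x where x: "x \<in> V" using less.prems(2) by blast
  obtain g where g: "g \<in> carrier G" "act g x \<noteq> x" using less.prems(4)[OF x] by blast
  obtain u v where uv: "(u, v) \<in> E" using first_edge[OF x act_closed[OF g(1) x]] g(2) by metis
  interpret c: one_edge_orbit G "sides u v ` V" translate "sides u v u" "sides u v v" "\<lambda>S. \<one>\<^bsub>G\<^esub> \<in> S"
    by (rule collapse[OF uv])
  show ?case
  proof (cases "\<exists>S\<in>sides u v ` V. \<forall>g\<in>carrier G. translate g S = S")
    case False
    hence "nontrivial_splitting_over G c.C" by (intro c.splitting_over_edge_stabilizer) blast
    thus ?thesis using collapse_stabilizer[OF uv] uv by auto
  next
    case True
    then obtain y where y: "y \<in> V" "\<And>g. g \<in> carrier G \<Longrightarrow> sides u v (act g y) = sides u v y" using sides_act by force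
    define Z where "Z = {z \<in> V. sides u v z = sides u v y}"
    note Z = fixed_side_subtree[OF uv y less.prems(3), folded Z_def]
    have "card ((E \<inter> Z \<times> Z) // edge_orb_rel G act (E \<inter> Z \<times> Z) (Id_on Z)) < card (E // edge_orb_rel G act E (Id_on V))"
      using psubset_card_mono[OF less.prems(3) Z(2)] .
    from less.hyps[OF this Z(1)] have "\<exists>(u, v)\<in>E \<inter> Z \<times> Z. nontrivial_splitting_over G {g \<in> carrier G. act g u = u \<and> act g v = v}"
      using finite_subset[OF psubset_imp_subset[OF Z(2)] less.prems(3)] less.prems(4) y(1) unfolding Z_def by blast
    thus ?thesis by blast
  qed
qed

section \<open>The quotient tree in the limit\<close>

text \<open>If the quotients of a tree by an increasing sequence of normal subgroups are trees, then so is
  the quotient by the union: whether a given edge path crosses a given edge is decided at a finite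
  stage. Edges that become loops are dropped.\<close>

locale limit_tree = S: ctree_act VS ES \<Gamma> aS + h: group_hom \<Gamma> D \<pi>
  for VS :: "'x set" and ES and \<Gamma> :: "'g monoid" and aS and D :: "'d monoid" and \<pi> +
  fixes N :: "nat \<Rightarrow> 'g set"
  assumes onto: "\<pi> ` carrier \<Gamma> = carrier D"
    and NK: "(\<Union>i. N i) = {g \<in> carrier \<Gamma>. \<pi> g = \<one>\<^bsub>D\<^esub>}" and incN: "i \<le> j \<Longrightarrow> N i \<subseteq> N j"
    and finES: "finite (ES // edge_orb_rel \<Gamma> aS ES (Id_on VS))"
    and cutN: "(u, v) \<in> ES \<Longrightarrow> \<forall>n\<in>N i. aS n u \<noteq> v \<Longrightarrow>
      \<exists>c :: 'x \<Rightarrow> bool. (\<forall>n\<in>N i. \<forall>x\<in>VS. c (aS n x) = c x) \<and>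
      (\<forall>(a, b)\<in>ES. c a \<noteq> c b \<longleftrightarrow>
         (\<exists>n\<in>N i. \<exists>n'\<in>N i. (a = aS n u \<and> b = aS n' v) \<or> (a = aS n v \<and> b = aS n' u)))"
    and parN: "(u, v) \<in> ES \<Longrightarrow> \<forall>n\<in>N i. aS n u \<noteq> v \<Longrightarrow> g \<in> carrier \<Gamma> \<Longrightarrow> n \<in> N i \<Longrightarrow> n' \<in> N i \<Longrightarrow>
      aS g u = aS n u \<Longrightarrow> aS g v = aS n' v \<Longrightarrow> \<exists>m\<in>N i. aS g u = aS m u \<and> aS g v = aS m v"
    and flipN: "(u, v) \<in> ES \<Longrightarrow> \<forall>n\<in>N i. aS n u \<noteq> v \<Longrightarrow> g \<in> carrier \<Gamma> \<Longrightarrow> n \<in> N i \<Longrightarrow> n' \<in> N i \<Longrightarrow>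
      aS g u = aS n v \<Longrightarrow> aS g v \<noteq> aS n' u"
begin

definition K where "K = {g \<in> carrier \<Gamma>. \<pi> g = \<one>\<^bsub>D\<^esub>}"
definition cls where "cls x = (\<lambda>n. aS n x) ` K"
definition Q where "Q = cls ` VS"
definition EQ where "EQ = {(X, Y). \<exists>u v. (u, v) \<in> ES \<and> X = cls u \<and> Y = cls v \<and> X \<noteq> Y}"
definition aQ where "aQ z X = {aS g x |g x. g \<in> carrier \<Gamma> \<and> \<pi> g = z \<and> x \<in> X}"

lemma KG: "n \<in> K \<Longrightarrow> n \<in> carrier \<Gamma>" and Kpi: "n \<in> K \<Longrightarrow> \<pi> n = \<one>\<^bsub>D\<^esub>" by (auto simp: K_def)

lemma K_one: "\<one>\<^bsub>\<Gamma>\<^esub> \<in> K" and K_inv: "n \<in> K \<Longrightarrow> inv\<^bsub>\<Gamma>\<^esub> n \<in> K"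
  and K_mult: "n \<in> K \<Longrightarrow> n' \<in> K \<Longrightarrow> n \<otimes>\<^bsub>\<Gamma>\<^esub> n' \<in> K"
  by (auto simp: K_def)

lemma K_N: "n \<in> K \<longleftrightarrow> (\<exists>i. n \<in> N i)"
  using NK unfolding K_def by blast

lemma K_common: assumes "n \<in> K" "n' \<in> K" shows "\<exists>i. n \<in> N i \<and> n' \<in> N i"
proof -
  obtain i j where "n \<in> N i" "n' \<in> N j" using assms K_N by blast
  hence "n \<in> N (max i j)" "n' \<in> N (max i j)" using incN[of i "max i j"] incN[of j "max i j"] by auto
  thus ?thesis by blast
qed

lemma cls_self: "x \<in> VS \<Longrightarrow> x \<in> cls x"
  unfolding cls_def using K_one S.act_one by (metis image_eqI)

lemma cls_eq_iff: assumes "x \<in> VS" "y \<in> VS" shows "cls x = cls y \<longleftrightarrow> (\<exists>n\<in>K. aS n x = y)"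
proof
  assume "cls x = cls y"
  hence "y \<in> cls x" using cls_self[OF assms(2)] by simp
  thus "\<exists>n\<in>K. aS n x = y" unfolding cls_def by auto
next
  assume "\<exists>n\<in>K. aS n x = y"
  then obtain n where n: "n \<in> K" "aS n x = y" by blast
  show "cls x = cls y"
  proof
    show "cls y \<subseteq> cls x"
    proof
      fix z assume "z \<in> cls y"
      then obtain m where m: "m \<in> K" "z = aS m y" unfolding cls_def by blast
      hence "z = aS (m \<otimes>\<^bsub>\<Gamma>\<^esub> n) x" using n S.act_mult[OF KG[OF m(1)] KG[OF n(1)] assms(1)] by simp
      thus "z \<in> cls x" unfolding cls_def using K_mult[OF m(1) n(1)] by blast
    qed
    show "cls x \<subseteq> cls y"
    proof
      fix z assume "z \<in> cls x"
      then obtain m where m: "m \<in> K" "z = aS m x" unfolding cls_def by blast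
      have "x = aS (inv\<^bsub>\<Gamma>\<^esub> n) y" using S.act_inv1[OF KG[OF n(1)] assms(1)] n(2) by simp
      hence "z = aS (m \<otimes>\<^bsub>\<Gamma>\<^esub> inv\<^bsub>\<Gamma>\<^esub> n) y" using m S.act_mult[OF KG[OF m(1)] KG[OF K_inv[OF n(1)]] assms(2)] by simp
      thus "z \<in> cls y" unfolding cls_def using K_mult[OF m(1) K_inv[OF n(1)]] by blast
    qed
  qed
qed

lemma aQ_cls: assumes g: "g \<in> carrier \<Gamma>" and x: "x \<in> VS" shows "aQ (\<pi> g) (cls x) = cls (aS g x)"
proof
  show "aQ (\<pi> g) (cls x) \<subseteq> cls (aS g x)"
  proof
    fix z assume "z \<in> aQ (\<pi> g) (cls x)"
    then obtain h n where h: "h \<in> carrier \<Gamma>" "\<pi> h = \<pi> g" "n \<in> K" "z = aS h (aS n x)" unfolding aQ_def cls_def by blast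
    define m where "m = h \<otimes>\<^bsub>\<Gamma>\<^esub> n \<otimes>\<^bsub>\<Gamma>\<^esub> inv\<^bsub>\<Gamma>\<^esub> g"
    have n: "n \<in> carrier \<Gamma>" "\<pi> n = \<one>\<^bsub>D\<^esub>" using KG[OF h(3)] Kpi[OF h(3)] by auto
    have "m \<in> K" using h(1,2) n g by (simp add: m_def K_def)
    moreover have "aS m (aS g x) = z"
      using h(1,4) n(1) g x by (simp add: m_def S.act_mult S.act_closed S.act_inv1)
    ultimately show "z \<in> cls (aS g x)" unfolding cls_def by blast
  qed
  show "cls (aS g x) \<subseteq> aQ (\<pi> g) (cls x)"
  proof
    fix z assume "z \<in> cls (aS g x)"
    then obtain n where n: "n \<in> K" "z = aS n (aS g x)" unfolding cls_def by blast
    hence "z = aS (n \<otimes>\<^bsub>\<Gamma>\<^esub> g) x" using S.act_mult[OF KG[OF n(1)] g x] by simp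
    moreover have "\<pi> (n \<otimes>\<^bsub>\<Gamma>\<^esub> g) = \<pi> g" "n \<otimes>\<^bsub>\<Gamma>\<^esub> g \<in> carrier \<Gamma>" using KG[OF n(1)] Kpi[OF n(1)] g by simp_all
    ultimately show "z \<in> aQ (\<pi> g) (cls x)" unfolding aQ_def using cls_self[OF x] by blast
  qed
qed

lemma lift: "z \<in> carrier D \<Longrightarrow> \<exists>g\<in>carrier \<Gamma>. \<pi> g = z"
  using onto by (metis imageE)

lemma Q_cases: "X \<in> Q \<Longrightarrow> \<exists>x\<in>VS. X = cls x" by (auto simp: Q_def)

lemma gact_Q: "gact D Q aQ"
proof
  fix z X assume z: "z \<in> carrier D" "X \<in> Q"
  obtain g x where g: "g \<in> carrier \<Gamma>" "\<pi> g = z" "x \<in> VS" "X = cls x" using lift z Q_cases by blast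
  thus "aQ z X \<in> Q" using aQ_cls S.act_closed unfolding Q_def by blast
next
  fix X assume "X \<in> Q"
  then obtain x where x: "x \<in> VS" "X = cls x" using Q_cases by blast
  have "aQ (\<pi> \<one>\<^bsub>\<Gamma>\<^esub>) (cls x) = cls x" using aQ_cls[OF S.one_closed x(1)] S.act_one[OF x(1)] by simp
  thus "aQ \<one>\<^bsub>D\<^esub> X = X" using x by simp
next
  fix z w X assume z: "z \<in> carrier D" "w \<in> carrier D" "X \<in> Q"
  obtain g where g: "g \<in> carrier \<Gamma>" "\<pi> g = z" using lift[OF z(1)] by blast
  obtain k where k: "k \<in> carrier \<Gamma>" "\<pi> k = w" using lift[OF z(2)] by blast
  obtain x where x: "x \<in> VS" "X = cls x" using Q_cases[OF z(3)] by blast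
  have "aQ (z \<otimes>\<^bsub>D\<^esub> w) X = aQ (\<pi> (g \<otimes>\<^bsub>\<Gamma>\<^esub> k)) (cls x)" using g k x by simp
  also have "\<dots> = cls (aS g (aS k x))"
    using aQ_cls[OF S.m_closed[OF g(1) k(1)] x(1)] S.act_mult[OF g(1) k(1) x(1)] by simp
  also have "\<dots> = aQ z (aQ w X)"
    using aQ_cls[OF g(1) S.act_closed[OF k(1) x(1)]] aQ_cls[OF k(1) x(1)] g(2) k(2) x(2) by simp
  finally show "aQ (z \<otimes>\<^bsub>D\<^esub> w) X = aQ z (aQ w X)" .
qed

lemma EQ_E: assumes "(X, Y) \<in> EQ"
  obtains u v where "(u, v) \<in> ES" "X = cls u" "Y = cls v" "\<forall>i. \<forall>n\<in>N i. aS n u \<noteq> v"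
proof -
  obtain u v where uv: "(u, v) \<in> ES" "X = cls u" "Y = cls v" "X \<noteq> Y" using assms unfolding EQ_def by blast
  have "aS n u \<noteq> v" if "n \<in> N i" for i n
    using uv cls_eq_iff[OF S.EVD[OF uv(1)]] K_N that by blast
  thus ?thesis using that uv by blast
qed

text \<open>The edges \<open>(a, b)\<close> and \<open>(u, v)\<close> have the same image in the quotient by \<open>N i\<close>, up to
  orientation.\<close>

definition par where
  "par i u v a b \<longleftrightarrow> (\<exists>n\<in>N i. \<exists>n'\<in>N i. (a = aS n u \<and> b = aS n' v) \<or> (a = aS n v \<and> b = aS n' u))"

lemma par_mono: "i \<le> j \<Longrightarrow> par i u v a b \<Longrightarrow> par j u v a b"
  using incN unfolding par_def by blast

lemma par_eventually: "\<forall>\<^sub>F i in sequentially. par i u v a b = (\<exists>j. par j u v a b)"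
proof (cases "\<exists>j. par j u v a b")
  case True
  then obtain j where "par j u v a b" by blast
  hence "par i u v a b" if "i \<ge> j" for i using par_mono that by blast
  thus ?thesis using True unfolding eventually_sequentially by blast
qed simp

text \<open>The cuts at the stages are normalized to be false at \<open>u\<close>. Along a fixed path from \<open>u\<close> to \<open>x\<close>
  the set of edges that are crossed stabilizes, so that the values at \<open>x\<close> stabilize.\<close>

lemma limit_cut:
  assumes uv: "(u, v) \<in> ES" and nl: "\<forall>i. \<forall>n\<in>N i. aS n u \<noteq> v"
  shows "\<exists>c :: 'x \<Rightarrow> bool. (\<forall>n\<in>K. \<forall>x\<in>VS. c (aS n x) = c x) \<and> (\<forall>(a, b)\<in>ES. c a \<noteq> c b \<longleftrightarrow> (\<exists>i. par i u v a b))"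
proof -
  have V: "u \<in> VS" using S.EVD[OF uv] by blast
  define P where "P i c \<longleftrightarrow> \<not> c u \<and> (\<forall>n\<in>N i. \<forall>x\<in>VS. c (aS n x) = c x) \<and> (\<forall>(a, b)\<in>ES. c a \<noteq> c b \<longleftrightarrow> par i u v a b)"
    for i and c :: "'x \<Rightarrow> bool"
  have "\<exists>c. P i c" for i
  proof -
    have "\<exists>c :: 'x \<Rightarrow> bool. (\<forall>n\<in>N i. \<forall>x\<in>VS. c (aS n x) = c x) \<and> (\<forall>(a, b)\<in>ES. c a \<noteq> c b \<longleftrightarrow> par i u v a b)"
      unfolding par_def by (rule cutN[OF uv spec[OF nl]])
    then obtain c :: "'x \<Rightarrow> bool" where c: "\<forall>n\<in>N i. \<forall>x\<in>VS. c (aS n x) = c x" "\<forall>(a, b)\<in>ES. c a \<noteq> c b \<longleftrightarrow> par i u v a b"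
      by (elim exE conjE)
    show ?thesis
    proof (cases "c u")
      case True
      hence "P i (\<lambda>x. \<not> c x)" using c unfolding P_def by auto
      thus ?thesis by blast
    next
      case False
      hence "P i c" using c unfolding P_def by simp
      thus ?thesis by blast
    qed
  qed
  hence "\<forall>i. \<exists>c. P i c" by simp
  then obtain c where cP: "\<forall>i. P i (c i)" using choice[of P] by blast
  have c: "\<not> c i u" "n \<in> N i \<Longrightarrow> x \<in> VS \<Longrightarrow> c i (aS n x) = c i x"
    "(a, b) \<in> ES \<Longrightarrow> (c i a \<noteq> c i b) = par i u v a b" for i n x a b
    using cP[rule_format, of i] unfolding P_def by auto
  define d where "d x = (\<forall>\<^sub>F i in sequentially. c i x)" for x
  have "\<exists>b. \<forall>\<^sub>F i in sequentially. c i x = b" if "(u, x) \<in> ES\<^sup>*" for x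
    using that
  proof (induction rule: rtrancl_induct)
    case base show ?case using c(1) by auto
  next
    case (step y z)
    then obtain b where b: "\<forall>\<^sub>F i in sequentially. c i y = b" by blast
    have "\<forall>\<^sub>F i in sequentially. c i z = (b \<noteq> (\<exists>j. par j u v y z))"
      using b par_eventually[of u v y z] by eventually_elim (use c(3)[OF step(2)] in blast)
    thus ?case by blast
  qed
  hence ex: "\<exists>b. \<forall>\<^sub>F i in sequentially. c i x = b" if "x \<in> VS" for x using S.connE[OF V that] by blast
  have ev: "\<forall>\<^sub>F i in sequentially. c i x = d x" if x: "x \<in> VS" for x
  proof -
    obtain b where b: "\<forall>\<^sub>F i in sequentially. c i x = b" using ex[OF x] by blast
    have "d x = b"
    proof
      assume b': b
      show "d x" unfolding d_def using b by eventually_elim (use b' in simp)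
    next
      assume "d x"
      hence "\<forall>\<^sub>F i in sequentially. b" unfolding d_def using b by eventually_elim simp
      thus b by simp
    qed
    thus ?thesis using b by simp
  qed
  have "d (aS n x) = d x" if n: "n \<in> K" and x: "x \<in> VS" for n x
  proof -
    obtain j where "n \<in> N j" using n K_N by blast
    hence "\<forall>\<^sub>F i in sequentially. c i (aS n x) = c i x" using c(2) incN x unfolding eventually_sequentially by (meson subsetD)
    hence "\<forall>\<^sub>F i in sequentially. d (aS n x) = d x"
      using ev[OF x] ev[OF S.act_closed[OF KG[OF n] x]] by eventually_elim simp
    thus ?thesis by simp
  qed
  moreover have "(d a \<noteq> d b) = (\<exists>i. par i u v a b)" if ab: "(a, b) \<in> ES" for a b
  proof -
    have "\<forall>\<^sub>F i in sequentially. (d a \<noteq> d b) = (\<exists>i. par i u v a b)"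
      using ev[OF S.EVD(1)[OF ab]] ev[OF S.EVD(2)[OF ab]] par_eventually[of u v a b]
      by eventually_elim (use c(3)[OF ab] in blast)
    thus ?thesis by simp
  qed
  ultimately show ?thesis by (intro exI[of _ d] conjI ballI; (clarify)?) simp_all
qed

lemma par_cls: assumes uv: "(u, v) \<in> ES" and ab: "(a, b) \<in> ES"
  shows "(\<exists>i. par i u v a b) \<longleftrightarrow> cls a = cls u \<and> cls b = cls v \<or> cls a = cls v \<and> cls b = cls u"
proof -
  have V: "u \<in> VS" "v \<in> VS" "a \<in> VS" "b \<in> VS" using S.EVD uv ab by auto
  have "(\<exists>i. par i u v a b) \<longleftrightarrow> (\<exists>n\<in>K. \<exists>n'\<in>K. (a = aS n u \<and> b = aS n' v) \<or> (a = aS n v \<and> b = aS n' u))" (is "?l = ?r")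
  proof
    assume ?l
    then obtain i n n' where "n \<in> N i" "n' \<in> N i" "(a = aS n u \<and> b = aS n' v) \<or> (a = aS n v \<and> b = aS n' u)"
      unfolding par_def by (elim exE bexE) rule
    thus ?r using K_N by blast
  next
    assume ?r
    then obtain n n' where n: "n \<in> K" "n' \<in> K" "(a = aS n u \<and> b = aS n' v) \<or> (a = aS n v \<and> b = aS n' u)"
      by (elim bexE) rule
    thus ?l using K_common[OF n(1,2)] unfolding par_def by blast
  qed
  also have "\<dots> \<longleftrightarrow> cls u = cls a \<and> cls v = cls b \<or> cls v = cls a \<and> cls u = cls b"
    unfolding cls_eq_iff[OF V(1,3)] cls_eq_iff[OF V(1,4)] cls_eq_iff[OF V(2,3)] cls_eq_iff[OF V(2,4)]
      eq_commute[of _ a] eq_commute[of _ b] by fast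
  finally show ?thesis unfolding eq_commute[of "cls u"] eq_commute[of "cls v"] by fast
qed

lemma Q_cut: assumes "(X, Y) \<in> EQ" shows "\<exists>C. is_cut EQ Id X Y C"
proof -
  obtain u v where uv: "(u, v) \<in> ES" "X = cls u" "Y = cls v" "\<forall>i. \<forall>n\<in>N i. aS n u \<noteq> v" using assms by (rule EQ_E)
  have nl: "\<forall>n\<in>N i. aS n u \<noteq> v" for i using uv(4) by blast
  obtain c :: "'x \<Rightarrow> bool" where c0: "\<forall>n\<in>K. \<forall>x\<in>VS. c (aS n x) = c x"
    "\<forall>(a, b)\<in>ES. c a \<noteq> c b \<longleftrightarrow> (\<exists>i. par i u v a b)" using limit_cut[OF uv(1,4)] by (elim exE conjE)
  have c: "(c a \<noteq> c b) = (\<exists>i. par i u v a b)" if "(a, b) \<in> ES" for a b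
    using bspec[OF c0(2) that] unfolding prod.case .
  let ?C = "\<lambda>Z. \<exists>x\<in>Z. c x"
  have C: "?C (cls x) = c x" if x: "x \<in> VS" for x
  proof
    assume "?C (cls x)"
    then obtain n where "n \<in> K" "c (aS n x)" unfolding cls_def by blast
    thus "c x" using c0(1) x by simp
  qed (use cls_self[OF x] in blast)
  have "is_cut EQ Id X Y ?C"
    unfolding is_cut_def
  proof (intro conjI ballI; clarify)
    fix A B assume "(A, B) \<in> EQ"
    then obtain a b where ab: "(a, b) \<in> ES" "A = cls a" "B = cls b" unfolding EQ_def by blast
    have "(?C A \<noteq> ?C B) = (\<exists>i. par i u v a b)" using C c[OF ab(1)] S.EVD[OF ab(1)] ab(2,3) by simp
    also have "\<dots> = (A = X \<and> B = Y \<or> A = Y \<and> B = X)" using par_cls[OF uv(1) ab(1)] ab uv by simp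
    finally show "(?C A \<noteq> ?C B) = ((A, X) \<in> Id \<and> (B, Y) \<in> Id \<or> (A, Y) \<in> Id \<and> (B, X) \<in> Id)" by simp
  qed
  thus ?thesis by blast
qed

theorem quotient_tree: "ctree_act Q EQ D aQ"
proof -
  interpret gact D Q aQ by (rule gact_Q)
  show ?thesis
  proof unfold_locales
    show "EQ \<subseteq> Q \<times> Q" using S.EVD unfolding EQ_def Q_def by blast
    show "(Y, X) \<in> EQ" if "(X, Y) \<in> EQ" for X Y using that S.symE unfolding EQ_def by blast
    show "(X, X) \<notin> EQ" for X unfolding EQ_def by blast
    show "(X, Y) \<in> EQ\<^sup>*" if XY: "X \<in> Q" "Y \<in> Q" for X Y
    proof -
      obtain x y where xy: "x \<in> VS" "y \<in> VS" "X = cls x" "Y = cls y" using XY Q_cases by blast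
      have "(cls x, cls z) \<in> EQ\<^sup>*" if "(x, z) \<in> ES\<^sup>*" for z
        using that
      proof (induction rule: rtrancl_induct)
        case (step a b)
        have "cls a = cls b \<or> (cls a, cls b) \<in> EQ" using step(2) unfolding EQ_def by blast
        thus ?case using step(3) by (metis rtrancl.rtrancl_into_rtrancl)
      qed simp
      thus ?thesis using S.connE[OF xy(1,2)] xy by blast
    qed
    show "\<exists>c. is_cut EQ Id X Y c" if "(X, Y) \<in> EQ" for X Y using Q_cut[OF that] .
    show "invariant_rel D aQ EQ"
    proof -
      have "(aQ z X, aQ z Y) \<in> EQ" if z: "z \<in> carrier D" and XY: "(X, Y) \<in> EQ" for z X Y
      proof -
        obtain u v where uv: "(u, v) \<in> ES" "X = cls u" "Y = cls v" "X \<noteq> Y" using XY unfolding EQ_def by blast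
        obtain g where g: "g \<in> carrier \<Gamma>" "\<pi> g = z" using lift z by blast
        have V: "u \<in> VS" "v \<in> VS" using S.EVD[OF uv(1)] by auto
        have "aQ z X \<noteq> aQ z Y" using act_inj[OF z] uv V unfolding Q_def by blast
        moreover have "aQ z X = cls (aS g u)" "aQ z Y = cls (aS g v)" using aQ_cls[OF g(1)] V uv g by auto
        ultimately show ?thesis using S.E_act[OF uv(1) g(1)] unfolding EQ_def by blast
      qed
      thus ?thesis unfolding invariant_rel_def by blast
    qed
    show "aQ z Y \<noteq> X" if XY: "(X, Y) \<in> EQ" and z: "z \<in> carrier D" "aQ z X = Y" for z X Y
    proof
      assume w: "aQ z Y = X"
      obtain u v where uv: "(u, v) \<in> ES" "X = cls u" "Y = cls v" "\<forall>i. \<forall>n\<in>N i. aS n u \<noteq> v" using XY by (rule EQ_E)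
      have nl: "\<forall>n\<in>N i. aS n u \<noteq> v" for i using uv(4) by blast
      obtain g where g: "g \<in> carrier \<Gamma>" "\<pi> g = z" using lift z by blast
      have V: "u \<in> VS" "v \<in> VS" using S.EVD[OF uv(1)] by auto
      have "cls v = cls (aS g u)" "cls u = cls (aS g v)" using aQ_cls[OF g(1)] V uv g z w by auto
      then obtain n n' where n: "n \<in> K" "n' \<in> K" "aS n v = aS g u" "aS n' u = aS g v"
        using cls_eq_iff V S.act_closed[OF g(1)] by metis
      obtain i where "n \<in> N i" "n' \<in> N i" using K_common n by blast
      thus False using flipN[OF uv(1) nl g(1)] n by metis
    qed
  qed
qed

text \<open>An element that stabilizes the image of an edge moves both its ends as a single kernel element
  does, by \<open>parN\<close>. Dividing by this element yields one that stabilizes the edge itself.\<close>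

lemma quotient_stabilizer:
  assumes uv: "(u, v) \<in> ES" and ne: "cls u \<noteq> cls v"
  shows "{z \<in> carrier D. aQ z (cls u) = cls u \<and> aQ z (cls v) = cls v} = \<pi> ` {g \<in> carrier \<Gamma>. aS g u = u \<and> aS g v = v}"
proof
  have V: "u \<in> VS" "v \<in> VS" using S.EVD[OF uv] by auto
  have nl: "\<forall>n\<in>N i. aS n u \<noteq> v" for i using ne cls_eq_iff[OF V] K_N by blast
  show "{z \<in> carrier D. aQ z (cls u) = cls u \<and> aQ z (cls v) = cls v} \<subseteq> \<pi> ` {g \<in> carrier \<Gamma>. aS g u = u \<and> aS g v = v}"
  proof
    fix z assume "z \<in> {z \<in> carrier D. aQ z (cls u) = cls u \<and> aQ z (cls v) = cls v}"
    hence z: "z \<in> carrier D" "aQ z (cls u) = cls u" "aQ z (cls v) = cls v" by auto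
    obtain g where g: "g \<in> carrier \<Gamma>" "\<pi> g = z" using lift z by blast
    have "cls u = cls (aS g u)" "cls v = cls (aS g v)" using aQ_cls[OF g(1)] V g z by auto
    then obtain n n' where n: "n \<in> K" "n' \<in> K" "aS n u = aS g u" "aS n' v = aS g v"
      using cls_eq_iff V S.act_closed[OF g(1)] by metis
    obtain i where i: "n \<in> N i" "n' \<in> N i" using K_common n by blast
    obtain m where m: "m \<in> N i" "aS g u = aS m u" "aS g v = aS m v" using parN[OF uv nl g(1) i] n by metis
    have mK: "m \<in> K" using m K_N by blast
    have "aS (inv\<^bsub>\<Gamma>\<^esub> m \<otimes>\<^bsub>\<Gamma>\<^esub> g) u = u" "aS (inv\<^bsub>\<Gamma>\<^esub> m \<otimes>\<^bsub>\<Gamma>\<^esub> g) v = v"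
      using m S.act_mult[OF KG[OF K_inv[OF mK]] g(1)] S.act_inv1[OF KG[OF mK]] V by simp_all
    moreover have "\<pi> (inv\<^bsub>\<Gamma>\<^esub> m \<otimes>\<^bsub>\<Gamma>\<^esub> g) = z" using g KG[OF mK] Kpi[OF mK] z(1) by simp
    ultimately show "z \<in> \<pi> ` {g \<in> carrier \<Gamma>. aS g u = u \<and> aS g v = v}" using g KG[OF mK] by (intro image_eqI[of _ _ "inv\<^bsub>\<Gamma>\<^esub> m \<otimes>\<^bsub>\<Gamma>\<^esub> g"]) auto
  qed
  show "\<pi> ` {g \<in> carrier \<Gamma>. aS g u = u \<and> aS g v = v} \<subseteq> {z \<in> carrier D. aQ z (cls u) = cls u \<and> aQ z (cls v) = cls v}"
  proof
    fix z assume "z \<in> \<pi> ` {g \<in> carrier \<Gamma>. aS g u = u \<and> aS g v = v}"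
    then obtain g where "g \<in> carrier \<Gamma>" "aS g u = u" "aS g v = v" "z = \<pi> g" by blast
    thus "z \<in> {z \<in> carrier D. aQ z (cls u) = cls u \<and> aQ z (cls v) = cls v}" using aQ_cls V by simp
  qed
qed

lemma quotient_finite: "finite (EQ // edge_orb_rel D aQ EQ (Id_on Q))"
proof -
  interpret q: ctree_act Q EQ D aQ by (rule quotient_tree)
  let ?f = "\<lambda>e. (cls (fst e), cls (snd e))"
  show ?thesis
  proof (rule quotient_card_surj(1)[OF finES S.equiv_edge_Id subset_refl q.equiv_edge_Id subset_refl, of ?f])
    show "EQ \<subseteq> ?f ` ES"
    proof
      fix e assume "e \<in> EQ"
      then obtain u v where "(u, v) \<in> ES" "e = (cls u, cls v)" unfolding EQ_def by blast
      thus "e \<in> ?f ` ES" by (intro image_eqI[of _ _ "(u, v)"]) auto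
    qed
    fix x y assume xy: "(x, y) \<in> edge_orb_rel \<Gamma> aS ES (Id_on VS)" "?f x \<in> EQ"
    obtain a b a' b' where ab: "x = (a, b)" "y = (a', b')" by (cases x; cases y)
    then obtain g where g: "g \<in> carrier \<Gamma>" "aS g a = a'" "aS g b = b'" "(a, b) \<in> ES" using xy(1) S.edge_orb_Id by blast
    have "aQ (\<pi> g) (cls a) = cls a'" "aQ (\<pi> g) (cls b) = cls b'" using aQ_cls[OF g(1)] S.EVD[OF g(4)] g by auto
    thus "(?f x, ?f y) \<in> edge_orb_rel D aQ EQ (Id_on Q)" using q.edge_orb_Id xy(2) ab g(1) by auto
  qed
qed

text \<open>Hence the limit group splits over the image of an edge stabilizer, unless it fixes a vertex.\<close>

theorem limit_splitting:
  assumes ne: "VS \<noteq> {}" and nofix: "\<And>x. x \<in> VS \<Longrightarrow> \<exists>g\<in>carrier \<Gamma>. \<forall>n\<in>K. aS g x \<noteq> aS n x"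
  shows "\<exists>(u, v)\<in>ES. nontrivial_splitting_over D (\<pi> ` {g \<in> carrier \<Gamma>. aS g u = u \<and> aS g v = v})"
proof -
  have nf: "\<exists>z\<in>carrier D. aQ z X \<noteq> X" if "X \<in> Q" for X
  proof -
    obtain x where x: "x \<in> VS" "X = cls x" using Q_cases \<open>X \<in> Q\<close> by blast
    obtain g where g: "g \<in> carrier \<Gamma>" "\<And>n. n \<in> K \<Longrightarrow> aS g x \<noteq> aS n x" using nofix[OF x(1)] by blast
    have "cls x \<noteq> cls (aS g x)" using cls_eq_iff[OF x(1) S.act_closed[OF g(1) x(1)]] g(2) by metis
    hence "aQ (\<pi> g) X \<noteq> X" using aQ_cls[OF g(1) x(1)] x(2) by simp
    thus ?thesis using h.hom_closed[OF g(1)] by (rule bexI[of _ "\<pi> g"])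
  qed
  have "Q \<noteq> {}" using ne by (simp add: Q_def)
  hence "\<exists>(X, Y)\<in>EQ. nontrivial_splitting_over D {z \<in> carrier D. aQ z X = X \<and> aQ z Y = Y}"
    by (rule splitting_of_tree_action[OF quotient_tree _ quotient_finite]) (rule nf)
  then obtain e where e: "e \<in> EQ" "case e of (X, Y) \<Rightarrow> nontrivial_splitting_over D {z \<in> carrier D. aQ z X = X \<and> aQ z Y = Y}"
    by (rule bexE)
  obtain X Y where "e = (X, Y)" by (cases e)
  hence XY: "(X, Y) \<in> EQ" "nontrivial_splitting_over D {z \<in> carrier D. aQ z X = X \<and> aQ z Y = Y}" using e by simp_all
  then obtain u v where uv: "(u, v) \<in> ES" "X = cls u" "Y = cls v" "X \<noteq> Y" unfolding EQ_def by blast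
  have "cls u \<noteq> cls v" using uv by simp
  hence "nontrivial_splitting_over D (\<pi> ` {g \<in> carrier \<Gamma>. aS g u = u \<and> aS g v = v})"
    using XY(2) quotient_stabilizer[OF uv(1)] uv(2,3) by simp
  thus ?thesis using uv(1) by (intro bexI[of _ "(u, v)"]) simp_all
qed

end

section \<open>The direct limit of a sequence of epimorphisms\<close>

lemma transition_refl: "transition \<phi> k k = id"
  by (simp add: transition_def)

lemma transition_Suc: "k \<le> m \<Longrightarrow> transition \<phi> k (Suc m) g = \<phi> m (transition \<phi> k m g)"
  by (simp add: transition_def Suc_diff_le)

locale epi_sequence =
  fixes G :: "nat \<Rightarrow> 'a monoid" and \<phi> :: "nat \<Rightarrow> 'a \<Rightarrow> 'a"
  assumes grp: "group (G k)" and step_hom: "\<phi> k \<in> hom (G k) (G (Suc k))"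
    and step_onto: "\<phi> k ` carrier (G k) = carrier (G (Suc k))"
begin

lemma transition_trans:
  assumes "k \<le> l" "l \<le> m" shows "transition \<phi> l m (transition \<phi> k l g) = transition \<phi> k m g"
  using assms(2,1) by (induction m rule: dec_induct) (simp_all add: transition_refl transition_Suc)

lemma transition_hom: "k \<le> m \<Longrightarrow> transition \<phi> k m \<in> hom (G k) (G m)"
proof (induction m rule: dec_induct)
  case base show ?case by (simp add: transition_refl hom_def)
next
  case (step m)
  have "transition \<phi> k (Suc m) = \<phi> m \<circ> transition \<phi> k m" by (simp add: transition_Suc[OF step(1)] fun_eq_iff)
  thus ?case using Group.hom_compose[OF step(3) step_hom[of m]] by (simp only:)
qed

lemma transition_closed: "k \<le> m \<Longrightarrow> g \<in> carrier (G k) \<Longrightarrow> transition \<phi> k m g \<in> carrier (G m)"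
  using transition_hom[of k m] by (auto simp: hom_def)

lemma transition_mult: "k \<le> m \<Longrightarrow> g \<in> carrier (G k) \<Longrightarrow> h \<in> carrier (G k) \<Longrightarrow>
    transition \<phi> k m (g \<otimes>\<^bsub>G k\<^esub> h) = transition \<phi> k m g \<otimes>\<^bsub>G m\<^esub> transition \<phi> k m h"
  using hom_mult[OF transition_hom] .

lemma transition_one: "k \<le> m \<Longrightarrow> transition \<phi> k m \<one>\<^bsub>G k\<^esub> = \<one>\<^bsub>G m\<^esub>"
  using hom_one[OF transition_hom grp grp] .

lemma transition_onto: "k \<le> m \<Longrightarrow> transition \<phi> k m ` carrier (G k) = carrier (G m)"
proof (induction m rule: dec_induct)
  case base show ?case by (simp add: transition_refl)
next
  case (step m)
  have "transition \<phi> k (Suc m) ` carrier (G k) = \<phi> m ` transition \<phi> k m ` carrier (G k)"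
    by (simp add: transition_Suc[OF step(1)] image_image)
  thus ?case using step(3) step_onto by simp
qed

lemma mem_limit_map: "g \<in> carrier (G k) \<Longrightarrow> (l, h) \<in> limit_map G \<phi> k g \<longleftrightarrow>
    h \<in> carrier (G l) \<and> (\<exists>m. k \<le> m \<and> l \<le> m \<and> transition \<phi> k m g = transition \<phi> l m h)"
  by (auto simp: limit_map_def limit_rel_def)

lemma transition_eq_mono:
  "transition \<phi> k m g = transition \<phi> l m h \<Longrightarrow> k \<le> m \<Longrightarrow> l \<le> m \<Longrightarrow> m \<le> p \<Longrightarrow> transition \<phi> k p g = transition \<phi> l p h"
  using transition_trans[of k m p g] transition_trans[of l m p h] by simp

lemma limit_map_eq_iff:
  assumes g: "g \<in> carrier (G k)" and h: "h \<in> carrier (G l)"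
  shows "limit_map G \<phi> k g = limit_map G \<phi> l h \<longleftrightarrow> (\<exists>m. k \<le> m \<and> l \<le> m \<and> transition \<phi> k m g = transition \<phi> l m h)"
proof
  assume "limit_map G \<phi> k g = limit_map G \<phi> l h"
  moreover have "(l, h) \<in> limit_map G \<phi> l h" using mem_limit_map[OF h, of l h] h by auto
  ultimately have "(l, h) \<in> limit_map G \<phi> k g" by simp
  thus "\<exists>m. k \<le> m \<and> l \<le> m \<and> transition \<phi> k m g = transition \<phi> l m h" using mem_limit_map[OF g] by simp
next
  assume "\<exists>m. k \<le> m \<and> l \<le> m \<and> transition \<phi> k m g = transition \<phi> l m h"
  then obtain m where m: "k \<le> m" "l \<le> m" "transition \<phi> k m g = transition \<phi> l m h" by (elim exE conjE)
  have "(\<exists>p. k \<le> p \<and> r \<le> p \<and> transition \<phi> k p g = transition \<phi> r p x) \<longleftrightarrow>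
        (\<exists>p. l \<le> p \<and> r \<le> p \<and> transition \<phi> l p h = transition \<phi> r p x)" for r x
  proof
    assume "\<exists>p. k \<le> p \<and> r \<le> p \<and> transition \<phi> k p g = transition \<phi> r p x"
    then obtain p where p: "k \<le> p" "r \<le> p" "transition \<phi> k p g = transition \<phi> r p x" by (elim exE conjE)
    have "transition \<phi> l (max m p) h = transition \<phi> r (max m p) x"
      using transition_eq_mono[OF p(3,1,2), of "max m p"] transition_eq_mono[OF m(3,1,2), of "max m p"] by simp
    thus "\<exists>p. l \<le> p \<and> r \<le> p \<and> transition \<phi> l p h = transition \<phi> r p x" using m p by (intro exI[of _ "max m p"]) auto
  next
    assume "\<exists>p. l \<le> p \<and> r \<le> p \<and> transition \<phi> l p h = transition \<phi> r p x"
    then obtain p where p: "l \<le> p" "r \<le> p" "transition \<phi> l p h = transition \<phi> r p x" by (elim exE conjE)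
    have "transition \<phi> k (max m p) g = transition \<phi> r (max m p) x"
      using transition_eq_mono[OF p(3,1,2), of "max m p"] transition_eq_mono[OF m(3,1,2), of "max m p"] by simp
    thus "\<exists>p. k \<le> p \<and> r \<le> p \<and> transition \<phi> k p g = transition \<phi> r p x" using m p by (intro exI[of _ "max m p"]) auto
  qed
  thus "limit_map G \<phi> k g = limit_map G \<phi> l h"
    by (intro Set.set_eqI) (simp add: mem_limit_map[OF g] mem_limit_map[OF h] split_paired_all)
qed

lemma limit_map_transition:
  assumes "k \<le> m" "g \<in> carrier (G k)" shows "limit_map G \<phi> m (transition \<phi> k m g) = limit_map G \<phi> k g"
  unfolding limit_map_eq_iff[OF transition_closed[OF assms] assms(2)]
  using assms by (intro exI[of _ m]) (simp add: transition_refl)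

lemma carrier_direct_limit: "carrier (direct_limit G \<phi>) = limit_map G \<phi> k ` carrier (G k)"
proof
  have 0: "limit_map G \<phi> l h \<in> limit_map G \<phi> k ` carrier (G k)" if h: "h \<in> carrier (G l)" for l h
  proof -
    obtain g where g: "g \<in> carrier (G 0)" "transition \<phi> 0 l g = h" using transition_onto[of 0 l] h by (metis imageE le0)
    have "limit_map G \<phi> l h = limit_map G \<phi> k (transition \<phi> 0 k g)"
      using limit_map_transition[of 0 l g] limit_map_transition[of 0 k g] g by simp
    thus ?thesis using transition_closed[of 0 k g] g by simp
  qed
  show "carrier (direct_limit G \<phi>) \<subseteq> limit_map G \<phi> k ` carrier (G k)"
  proof
    fix X assume "X \<in> carrier (direct_limit G \<phi>)"
    then obtain p where p: "p \<in> (SIGMA k:UNIV. carrier (G k))" "X = limit_rel G \<phi> `` {p}"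
      unfolding direct_limit_def by (auto elim: quotientE)
    obtain l h where "p = (l, h)" by (cases p)
    thus "X \<in> limit_map G \<phi> k ` carrier (G k)" using p 0[of h l] by (simp add: limit_map_def)
  qed
  show "limit_map G \<phi> k ` carrier (G k) \<subseteq> carrier (direct_limit G \<phi>)"
    unfolding direct_limit_def limit_map_def by (auto intro!: quotientI)
qed

lemma limit_map_mult:
  assumes g: "g \<in> carrier (G k)" and h: "h \<in> carrier (G k)"
  shows "limit_map G \<phi> k g \<otimes>\<^bsub>direct_limit G \<phi>\<^esub> limit_map G \<phi> k h = limit_map G \<phi> k (g \<otimes>\<^bsub>G k\<^esub> h)"
proof -
  have gh: "g \<otimes>\<^bsub>G k\<^esub> h \<in> carrier (G k)" using g h grp[of k] by (simp add: group.is_monoid monoid.m_closed)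
  let ?F = "\<lambda>p q. limit_map G \<phi> (max (fst p) (fst q)) (transition \<phi> (fst p) (max (fst p) (fst q)) (snd p)
       \<otimes>\<^bsub>G (max (fst p) (fst q))\<^esub> transition \<phi> (fst q) (max (fst p) (fst q)) (snd q))"
  have F: "?F p q = limit_map G \<phi> k (g \<otimes>\<^bsub>G k\<^esub> h)"
    if pq: "p \<in> limit_map G \<phi> k g" "q \<in> limit_map G \<phi> k h" for p q
  proof -
    obtain i g' where p: "p = (i, g')" by (cases p)
    obtain j h' where q: "q = (j, h')" by (cases q)
    have g': "g' \<in> carrier (G i)" and h': "h' \<in> carrier (G j)" using pq p q mem_limit_map[OF g] mem_limit_map[OF h] by auto
    obtain m where m: "k \<le> m" "i \<le> m" "transition \<phi> k m g = transition \<phi> i m g'" using pq p mem_limit_map[OF g] by auto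
    obtain m' where m': "k \<le> m'" "j \<le> m'" "transition \<phi> k m' h = transition \<phi> j m' h'" using pq q mem_limit_map[OF h] by auto
    define n where "n = max m m'"
    define r where "r = max i j"
    have r: "i \<le> r" "j \<le> r" "r \<le> n" "k \<le> n" using m m' by (auto simp: n_def r_def)
    have e: "transition \<phi> k n g = transition \<phi> i n g'" "transition \<phi> k n h = transition \<phi> j n h'"
      using transition_eq_mono[OF m(3,1,2), of n] transition_eq_mono[OF m'(3,1,2), of n] by (auto simp: n_def)
    have c: "transition \<phi> i r g' \<in> carrier (G r)" "transition \<phi> j r h' \<in> carrier (G r)"
      using transition_closed g' h' r by auto
    have c': "transition \<phi> i r g' \<otimes>\<^bsub>G r\<^esub> transition \<phi> j r h' \<in> carrier (G r)"
      using c grp[of r] by (simp add: group.is_monoid monoid.m_closed)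
    have "transition \<phi> r n (transition \<phi> i r g' \<otimes>\<^bsub>G r\<^esub> transition \<phi> j r h') = transition \<phi> k n (g \<otimes>\<^bsub>G k\<^esub> h)"
      unfolding transition_mult[OF r(3) c] transition_mult[OF r(4) g h] transition_trans[OF r(1,3)] transition_trans[OF r(2,3)] e ..
    hence "limit_map G \<phi> r (transition \<phi> i r g' \<otimes>\<^bsub>G r\<^esub> transition \<phi> j r h') = limit_map G \<phi> k (g \<otimes>\<^bsub>G k\<^esub> h)"
      unfolding limit_map_eq_iff[OF c' gh] using r by blast
    thus ?thesis by (simp add: p q r_def)
  qed
  have ne: "(k, g) \<in> limit_map G \<phi> k g" "(k, h) \<in> limit_map G \<phi> k h" using mem_limit_map[OF g, of k g] mem_limit_map[OF h, of k h] g h by auto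
  have "limit_map G \<phi> k g \<otimes>\<^bsub>direct_limit G \<phi>\<^esub> limit_map G \<phi> k h
      = (\<Union>p\<in>limit_map G \<phi> k g. \<Union>q\<in>limit_map G \<phi> k h. ?F p q)"
    unfolding direct_limit_def by (simp add: case_prod_unfold)
  also have "\<dots> = (\<Union>p\<in>limit_map G \<phi> k g. \<Union>q\<in>limit_map G \<phi> k h. limit_map G \<phi> k (g \<otimes>\<^bsub>G k\<^esub> h))"
    by (intro SUP_cong refl F)
  also have "\<dots> = limit_map G \<phi> k (g \<otimes>\<^bsub>G k\<^esub> h)" using ne by auto
  finally show ?thesis .
qed

lemma limit_map_hom: "limit_map G \<phi> k \<in> hom (G k) (direct_limit G \<phi>)"
  using limit_map_mult carrier_direct_limit[of k] unfolding hom_def by auto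

lemma one_direct_limit: "\<one>\<^bsub>direct_limit G \<phi>\<^esub> = limit_map G \<phi> k \<one>\<^bsub>G k\<^esub>"
  using limit_map_transition[of 0 k "\<one>\<^bsub>G 0\<^esub>"] transition_one[of 0 k] grp[of 0]
  by (simp add: direct_limit_def group.is_monoid monoid.one_closed)

text \<open>As the maps are onto, the limit is the image of \<open>G 0\<close>.\<close>

lemma group_direct_limit: "group (direct_limit G \<phi>)"
proof -
  have "group (direct_limit G \<phi> \<lparr>carrier := limit_map G \<phi> 0 ` carrier (G 0), one := limit_map G \<phi> 0 \<one>\<^bsub>G 0\<^esub>\<rparr>)"
    by (rule group.hom_imp_img_group[OF grp limit_map_hom])
  moreover have "direct_limit G \<phi> \<lparr>carrier := limit_map G \<phi> 0 ` carrier (G 0), one := limit_map G \<phi> 0 \<one>\<^bsub>G 0\<^esub>\<rparr> = direct_limit G \<phi>"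
    unfolding carrier_direct_limit[of 0, symmetric] one_direct_limit[of 0, symmetric] by simp
  ultimately show ?thesis by simp
qed

lemma limit_map_group_hom: "group_hom (G k) (direct_limit G \<phi>) (limit_map G \<phi> k)"
  using grp group_direct_limit limit_map_hom by (simp add: group_hom_def group_hom_axioms_def)

lemma limit_map_kernel:
  "{g \<in> carrier (G k). limit_map G \<phi> k g = \<one>\<^bsub>direct_limit G \<phi>\<^esub>}
    = (\<Union>i. {g \<in> carrier (G k). transition \<phi> k (k + i) g = \<one>\<^bsub>G (k + i)\<^esub>})"
proof -
  have o: "\<one>\<^bsub>G k\<^esub> \<in> carrier (G k)" using grp[of k] by (simp add: group.is_monoid monoid.one_closed)
  have "limit_map G \<phi> k g = \<one>\<^bsub>direct_limit G \<phi>\<^esub> \<longleftrightarrow> (\<exists>i. transition \<phi> k (k + i) g = \<one>\<^bsub>G (k + i)\<^esub>)"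
    if g: "g \<in> carrier (G k)" for g
    unfolding one_direct_limit[of k] limit_map_eq_iff[OF g o]
    by (metis le_add1 le_iff_add transition_one)
  thus ?thesis by auto
qed

lemma transition_kernel_mono:
  assumes "i \<le> j"
  shows "{g \<in> carrier (G k). transition \<phi> k (k + i) g = \<one>\<^bsub>G (k + i)\<^esub>} \<subseteq> {g \<in> carrier (G k). transition \<phi> k (k + j) g = \<one>\<^bsub>G (k + j)\<^esub>}"
proof (intro subsetI CollectI conjI; clarify)
  fix g assume g: "transition \<phi> k (k + i) g = \<one>\<^bsub>G (k + i)\<^esub>"
  show "transition \<phi> k (k + j) g = \<one>\<^bsub>G (k + j)\<^esub>"
    using transition_trans[of k "k + i" "k + j" g] transition_one[of "k + i" "k + j"] assms g by simp
qed

end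

section \<open>From maps of realizations to maps of vertices\<close>

definition arcs :: "'v graph \<Rightarrow> ('v \<times> 'v) set" where
  "arcs T = {(u, v). {u, v} \<in> edges T}"

lemma walk_rtrancl:
  assumes "ws \<noteq> []" "successively (\<lambda>u v. (u, v) \<in> R) ws" shows "(hd ws, last ws) \<in> R\<^sup>*"
  using assms
proof (induction ws rule: induct_list012)
  case (3 x y zs)
  hence "(x, y) \<in> R" "(y, last (y # zs)) \<in> R\<^sup>*" by simp_all
  thus ?case using converse_rtrancl_into_rtrancl[of x y R] by simp
qed simp_all

text \<open>A walk that returns to one of its vertices is shortened there.\<close>

lemma rtrancl_distinct_walk:
  assumes "(x, y) \<in> R\<^sup>*"
  shows "\<exists>ws. ws \<noteq> [] \<and> hd ws = x \<and> last ws = y \<and> distinct ws \<and> successively (\<lambda>u v. (u, v) \<in> R) ws"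
  using assms
proof (induction rule: rtrancl_induct)
  case base
  show ?case by (intro exI[of _ "[x]"]) simp
next
  case (step y z)
  then obtain ws where ws: "ws \<noteq> []" "hd ws = x" "last ws = y" "distinct ws" "successively (\<lambda>u v. (u, v) \<in> R) ws"
    by (elim exE conjE)
  show ?case
  proof (cases "z \<in> set ws")
    case True
    then obtain as bs where s: "ws = as @ z # bs" by (auto simp: in_set_conv_decomp)
    hence "successively (\<lambda>u v. (u, v) \<in> R) ((as @ [z]) @ bs)" using ws(5) by simp
    hence "successively (\<lambda>u v. (u, v) \<in> R) (as @ [z])" unfolding successively_append_iff by simp
    moreover have "hd (as @ [z]) = x" using ws(2) s by (cases as) auto
    ultimately show ?thesis using ws(4) s by (intro exI[of _ "as @ [z]"]) simp
  next
    case False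
    thus ?thesis using ws step(2) by (intro exI[of _ "ws @ [z]"]) (simp add: successively_append_iff)
  qed
qed

context
  fixes T :: "'v graph" assumes T: "simplicial_tree T"
begin

lemma arcsD: assumes "(u, v) \<in> arcs T" shows "u \<in> verts T" "v \<in> verts T" "u \<noteq> v" "(v, u) \<in> arcs T"
proof -
  have "{u, v} \<in> {{u, v} | u v. u \<in> verts T \<and> v \<in> verts T \<and> u \<noteq> v}"
    using assms T unfolding arcs_def simplicial_tree_def by blast
  then obtain a b where "{u, v} = {a, b}" "a \<in> verts T" "b \<in> verts T" "a \<noteq> b" by blast
  thus "u \<in> verts T" "v \<in> verts T" "u \<noteq> v" by (auto simp: doubleton_eq_iff)
  show "(v, u) \<in> arcs T" using assms by (simp add: arcs_def insert_commute)
qed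

text \<open>The side of \<open>y\<close> consists of what can be reached from \<open>y\<close> without crossing the edge from \<open>x\<close>
  to \<open>y\<close>; it does not contain \<open>x\<close>, since there are no circuits.\<close>

lemma ctree_of_tree: "ctree (verts T) (arcs T)"
proof
  show "arcs T \<subseteq> verts T \<times> verts T" using arcsD by auto
  show "(y, x) \<in> arcs T" if "(x, y) \<in> arcs T" for x y using arcsD(4)[OF that] .
  show "(x, x) \<notin> arcs T" for x using arcsD(3)[of x x] by auto
  show "(x, y) \<in> (arcs T)\<^sup>*" if xy: "x \<in> verts T" "y \<in> verts T" for x y
  proof -
    have "\<forall>u\<in>verts T. \<forall>v\<in>verts T. \<exists>ws. walk T ws \<and> hd ws = u \<and> last ws = v"
      using T unfolding simplicial_tree_def by (elim conjE)
    then obtain ws where ws: "walk T ws" "hd ws = x" "last ws = y" using xy by fast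
    have "ws \<noteq> []" "successively (\<lambda>u v. (u, v) \<in> arcs T) ws" using ws(1) unfolding walk_def arcs_def by simp_all
    from walk_rtrancl[OF this] ws show ?thesis by simp
  qed
next
  fix x y assume xy: "(x, y) \<in> arcs T"
  define R where "R = arcs T - {(x, y), (y, x)}"
  have symR: "(b, a) \<in> R" if "(a, b) \<in> R" for a b using that arcsD(4)[of a b] unfolding R_def by blast
  define c where "c z \<longleftrightarrow> (y, z) \<in> R\<^sup>*" for z
  have cR: "c a = c b" if "(a, b) \<in> R" for a b
    using rtrancl_into_rtrancl[OF _ that, of y] rtrancl_into_rtrancl[OF _ symR[OF that], of y] unfolding c_def by fast
  have "\<not> c x"
  proof
    assume "c x"
    then obtain ws where ws: "ws \<noteq> []" "hd ws = y" "last ws = x" "distinct ws" "successively (\<lambda>u v. (u, v) \<in> R) ws"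
      using rtrancl_distinct_walk[of y x R] unfolding c_def by blast
    obtain z zs where z: "ws = y # z # zs"
    proof (cases ws)
      case (Cons p us)
      thus ?thesis using ws(1,2,3) arcsD(3)[OF xy] that by (cases us) auto
    qed (use ws(1) in simp)
    have "zs \<noteq> []"
    proof
      assume "zs = []"
      hence "(y, x) \<in> R" using ws z by simp
      thus False by (simp add: R_def)
    qed
    hence "3 \<le> length ws" unfolding z by (cases zs) simp_all
    moreover have "successively (\<lambda>u v. {u, v} \<in> edges T) ws"
      by (rule successively_mono[OF ws(5)]) (auto simp: R_def arcs_def)
    moreover have "set ws \<subseteq> verts T"
    proof
      fix p assume "p \<in> set ws"
      have "\<forall>q\<in>set (y # us). q \<in> verts T" if "successively (\<lambda>u v. (u, v) \<in> R) (y # us)" "y \<in> verts T" for y us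
        using that
      proof (induction us arbitrary: y)
        case (Cons u us)
        hence "u \<in> verts T" using arcsD(2)[of y u] by (simp add: R_def)
        thus ?case using Cons.IH[of u] Cons.prems by simp
      qed simp
      from this[of y "z # zs"] show "p \<in> verts T" using \<open>p \<in> set ws\<close> ws(5) arcsD(2)[OF xy] unfolding z by fast
    qed
    ultimately have "circuit T ws"
      using ws xy unfolding circuit_def walk_def arcs_def by simp
    moreover have "\<nexists>ws. circuit T ws" using T unfolding simplicial_tree_def by (elim conjE)
    ultimately show False by fast
  qed
  moreover have "c y" by (simp add: c_def)
  ultimately have "(c a \<noteq> c b) = (a = x \<and> b = y \<or> a = y \<and> b = x)" if "(a, b) \<in> arcs T" for a b
    using cR[of a b] that unfolding R_def by auto
  hence "is_cut (arcs T) Id x y c" unfolding is_cut_def by auto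
  thus "\<exists>c. is_cut (arcs T) Id x y c" by blast
qed

end

definition vertex_point :: "'w \<Rightarrow> 'w \<Rightarrow> real" where "vertex_point v = (\<lambda>w. of_bool (w = v))"

lemma vertex_point_inj: "vertex_point v = vertex_point w \<longleftrightarrow> v = w"
proof
  assume "vertex_point v = vertex_point w"
  from fun_cong[OF this, of v] show "v = w" by (simp add: vertex_point_def split: if_splits)
qed simp

context
  fixes G :: "'a monoid" and T :: "'v graph" and \<alpha>
  assumes G: "group G" and A: "tree_action G T \<alpha>"
begin

lemma tree: "simplicial_tree T" and act: "group_action G (verts T) \<alpha>"
  using A by (auto simp: tree_action_def)

lemma ctree_act_of_tree_action: "ctree_act (verts T) (arcs T) G \<alpha>"
proof -
  interpret ctree "verts T" "arcs T" by (rule ctree_of_tree[OF tree])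
  interpret group_action G "verts T" \<alpha> by (rule act)
  interpret group G by (rule G)
  show ?thesis
  proof unfold_locales
    show "\<alpha> g x \<in> verts T" if "g \<in> carrier G" "x \<in> verts T" for g x using element_image[OF that(1,2) refl] .
    show "\<alpha> \<one>\<^bsub>G\<^esub> x = x" if "x \<in> verts T" for x using id_eq_one that by (metis restrict_apply')
    show "\<alpha> (g \<otimes>\<^bsub>G\<^esub> h) x = \<alpha> g (\<alpha> h x)" if "g \<in> carrier G" "h \<in> carrier G" "x \<in> verts T" for g h x
      using composition_rule[OF that(3,1,2)] .
    show "invariant_rel G \<alpha> (arcs T)"
    proof -
      have "{\<alpha> g u, \<alpha> g v} \<in> edges T" if "g \<in> carrier G" "{u, v} \<in> edges T" for g u v
      proof -
        have "\<alpha> g ` {u, v} \<in> edges T" using A that unfolding tree_action_def by blast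
        thus ?thesis by simp
      qed
      thus ?thesis unfolding invariant_rel_def arcs_def by blast
    qed
    show "\<alpha> g y \<noteq> x" if "(x, y) \<in> arcs T" "g \<in> carrier G" "\<alpha> g x = y" for x y g
      using A that unfolding tree_action_def arcs_def by blast
  qed
qed

text \<open>There are no inversions.\<close>

lemma edge_stabilizer_pointwise:
  assumes "(u, v) \<in> arcs T"
  shows "edge_stabilizer G \<alpha> {u, v} = {g \<in> carrier G. \<alpha> g u = u \<and> \<alpha> g v = v}"
proof -
  have "\<not> (\<alpha> g u = v \<and> \<alpha> g v = u)" if "g \<in> carrier G" for g
    using A that assms unfolding tree_action_def arcs_def by blast
  thus ?thesis unfolding edge_stabilizer_def stabilizer_def by (auto simp: doubleton_eq_iff)
qed

lemma vertex_point_realization: "v \<in> verts T \<Longrightarrow> vertex_point v \<in> realization T"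
  unfolding realization_def simplices_def
  by (rule UN_I[of "{v}"]) (auto simp: closed_simplex_def vertex_point_def)

lemma point_action_vertex:
  assumes g: "g \<in> carrier G" and v: "v \<in> verts T"
  shows "point_action G T \<alpha> g (vertex_point v) = vertex_point (\<alpha> g v)"
proof
  interpret ctree_act "verts T" "arcs T" G \<alpha> by (rule ctree_act_of_tree_action)
  fix w
  show "point_action G T \<alpha> g (vertex_point v) w = vertex_point (\<alpha> g v) w"
  proof (cases "w \<in> verts T")
    case True
    have "\<alpha> (inv\<^bsub>G\<^esub> g) w = v \<longleftrightarrow> w = \<alpha> g v" using act_inv1[OF g v] act_inv2[OF g True] by auto
    thus ?thesis using True by (simp add: point_action_def vertex_point_def)
  next
    case False
    thus ?thesis using act_closed[OF g v] by (auto simp: point_action_def vertex_point_def)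
  qed
qed

lemma no_fixed_vertex:
  assumes "\<not> trivial_action G T \<alpha>" "v \<in> verts T" shows "\<exists>g\<in>carrier G. \<alpha> g v \<noteq> v"
proof (rule ccontr)
  assume "\<not> (\<exists>g\<in>carrier G. \<alpha> g v \<noteq> v)"
  hence "\<forall>g\<in>carrier G. point_action G T \<alpha> g (vertex_point v) = vertex_point v"
    using point_action_vertex[OF _ assms(2)] by auto
  thus False using assms(1) vertex_point_realization[OF assms(2)] unfolding trivial_action_def by blast
qed

text \<open>The edge path condition says nothing about vertices that lie in no edge; nontrivial actions
  have none.\<close>

lemma incident_arc:
  assumes "\<not> trivial_action G T \<alpha>" "v \<in> verts T" shows "\<exists>w. (v, w) \<in> arcs T"
proof -
  interpret ctree_act "verts T" "arcs T" G \<alpha> by (rule ctree_act_of_tree_action)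
  obtain g where g: "g \<in> carrier G" "\<alpha> g v \<noteq> v" using no_fixed_vertex[OF assms] by blast
  thus ?thesis using first_edge[OF assms(2) act_closed[OF g(1) assms(2)]] by metis
qed

end

lemma edge_point_ends: "edge_point u v 0 = vertex_point u" "edge_point u v 1 = vertex_point v"
  by (auto simp: edge_point_def vertex_point_def)

lemma closed_simplex_edge:
  assumes "u \<noteq> v" shows "closed_simplex {u, v} = edge_point u v ` {0..1}"
proof
  show "closed_simplex {u, v} \<subseteq> edge_point u v ` {0..1}"
  proof
    fix x assume x: "x \<in> closed_simplex {u, v}"
    have s: "x u + x v = 1" "0 \<le> x u" "0 \<le> x v" "\<And>w. w \<notin> {u, v} \<Longrightarrow> x w = 0"
      using x assms unfolding closed_simplex_def by auto
    have "x w = edge_point u v (x v) w" for w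
      using s(1) s(4)[of w] assms unfolding edge_point_def by auto
    moreover have "x v \<in> {0..1}" using s by simp
    ultimately show "x \<in> edge_point u v ` {0..1}" by blast
  qed
  show "edge_point u v ` {0..1} \<subseteq> closed_simplex {u, v}"
    using assms by (auto simp: closed_simplex_def edge_point_def)
qed

lemma walk_point_at:
  assumes "0 \<le> s" "s \<le> 1"
  shows "walk_point ws (real i + s) = (if s = 1 then vertex_point (ws ! Suc i) else edge_point (ws ! i) (ws ! Suc i) s)"
proof (cases "s = 1")
  case True
  have "real i + 1 = of_nat (Suc i)" by simp
  hence "nat \<lfloor>real i + 1\<rfloor> = Suc i" "frac (real i + 1) = 0" by (simp_all only: floor_of_nat nat_int frac_eq_0_iff Ints_of_nat)
  thus ?thesis using True edge_point_ends(1) unfolding walk_point_def by (simp only: refl if_True)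
next
  case False
  hence "\<lfloor>real i + s\<rfloor> = int i" using assms by (intro floor_unique) auto
  thus ?thesis using False by (simp add: walk_point_def frac_def)
qed

lemma walk_point_nat: "walk_point ws (real i) = vertex_point (ws ! i)"
  by (simp add: walk_point_def edge_point_ends frac_eq_0_iff[THEN iffD2, OF Ints_of_nat])

text \<open>By the intermediate value theorem, the image of an edge contains every edge of its edge path.\<close>

lemma edge_path:
  assumes T: "simplicial_tree T" and uv: "(u, v) \<in> arcs T" and f: "sends_to_edge_path T' f {u, v}"
  obtains ws where "walk T' ws" "f (vertex_point u) = vertex_point (hd ws)" "f (vertex_point v) = vertex_point (last ws)"
    "\<And>i. Suc i < length ws \<Longrightarrow> ws ! i \<noteq> ws ! Suc i \<Longrightarrow> closed_simplex {ws ! i, ws ! Suc i} \<subseteq> f ` closed_simplex {u, v}"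
proof -
  have main: thesis if ab: "{u, v} = {a, b}" "walk T' ws" and cont: "continuous_on {0..1} h"
      and h: "h 0 = 0" "h 1 = real (length ws - 1)" "\<forall>t\<in>{0..1}. f (edge_point a b t) = walk_point ws (h t)"
      and that': "\<And>ws. walk T' ws \<Longrightarrow> f (vertex_point a) = vertex_point (hd ws) \<Longrightarrow> f (vertex_point b) = vertex_point (last ws) \<Longrightarrow>
        (\<And>i. Suc i < length ws \<Longrightarrow> ws ! i \<noteq> ws ! Suc i \<Longrightarrow> closed_simplex {ws ! i, ws ! Suc i} \<subseteq> f ` closed_simplex {u, v}) \<Longrightarrow> thesis"
    for a b ws h thesis
  proof (rule that'[OF ab(2)])
    have ne: "ws \<noteq> []" using ab(2) by (simp add: walk_def)
    show "f (vertex_point a) = vertex_point (hd ws)"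
      using h(1) h(3)[rule_format, of 0] walk_point_nat[of ws 0] ne by (simp add: edge_point_ends hd_conv_nth)
    show "f (vertex_point b) = vertex_point (last ws)"
      using h(2) h(3)[rule_format, of 1] walk_point_nat[of ws "length ws - 1"] ne by (simp add: edge_point_ends last_conv_nth)
    fix i assume i: "Suc i < length ws" "ws ! i \<noteq> ws ! Suc i"
    show "closed_simplex {ws ! i, ws ! Suc i} \<subseteq> f ` closed_simplex {u, v}"
    proof
      fix x assume "x \<in> closed_simplex {ws ! i, ws ! Suc i}"
      then obtain s where s: "0 \<le> s" "s \<le> 1" "x = edge_point (ws ! i) (ws ! Suc i) s"
        unfolding closed_simplex_edge[OF i(2)] by auto
      have x: "x = walk_point ws (real i + s)"
        unfolding walk_point_at[OF s(1,2)] using s(3) edge_point_ends by auto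
      have "real i + s \<le> h 1" "h 0 \<le> real i + s" using h(1,2) i s by auto
      then obtain t where t: "0 \<le> t" "t \<le> 1" "h t = real i + s"
        using IVT'[of h 0 "real i + s" 1] cont by auto
      have "x = f (edge_point a b t)" using h(3) t x by auto
      moreover have "edge_point a b t \<in> closed_simplex {u, v}"
      proof -
        have "a \<noteq> b" using ab(1) arcsD(3)[OF T uv] by auto
        thus ?thesis unfolding ab(1) using closed_simplex_edge[of a b] t by simp
      qed
      ultimately show "x \<in> f ` closed_simplex {u, v}" by blast
    qed
  qed
  obtain a b ws h where h: "{u, v} = {a, b}" "walk T' ws" "continuous_on {0..1} h"
      "h 0 = 0" "h 1 = real (length ws - 1)" "\<forall>t\<in>{0..1}. f (edge_point a b t) = walk_point ws (h t)"
    using f unfolding sends_to_edge_path_def by blast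
  show thesis
  proof (rule main[OF h])
    fix ws assume ws: "walk T' ws" "f (vertex_point a) = vertex_point (hd ws)" "f (vertex_point b) = vertex_point (last ws)"
      "\<And>i. Suc i < length ws \<Longrightarrow> ws ! i \<noteq> ws ! Suc i \<Longrightarrow> closed_simplex {ws ! i, ws ! Suc i} \<subseteq> f ` closed_simplex {u, v}"
    consider "a = u" "b = v" | "a = v" "b = u" using h(1) by (auto simp: doubleton_eq_iff)
    thus thesis
    proof cases
      case 1
      thus thesis using that[of ws] ws by blast
    next
      case 2
      have ne: "ws \<noteq> []" and vs: "set ws \<subseteq> verts T'" and suc: "successively (\<lambda>u v. {u, v} \<in> edges T') ws"
        using ws(1) by (auto simp: walk_def)
      have "successively (\<lambda>u v. {u, v} \<in> edges T') (rev ws)"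
        unfolding successively_rev by (rule successively_mono[OF suc]) (simp_all add: insert_commute)
      hence w: "walk T' (rev ws)" using ne vs by (simp add: walk_def)
      have "closed_simplex {rev ws ! i, rev ws ! Suc i} \<subseteq> f ` closed_simplex {u, v}"
        if i: "Suc i < length (rev ws)" "rev ws ! i \<noteq> rev ws ! Suc i" for i
      proof -
        define j where "j = length ws - Suc (Suc i)"
        have j: "rev ws ! i = ws ! Suc j" "rev ws ! Suc i = ws ! j" "Suc j < length ws"
          using i(1) by (auto simp: j_def rev_nth Suc_diff_Suc)
        show ?thesis using ws(4)[OF j(3)] i(2) unfolding j(1,2) by (simp add: insert_commute)
      qed
      thus thesis using that[OF w] ws(2,3) 2 ne by (simp add: hd_rev last_rev)
    qed
  qed
qed

text \<open>The vertex map induced by an epimorphism of actions. An edge separating the images of the ends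
  of \<open>e\<close> lies on the edge path \<open>f e\<close>.\<close>

lemma vertex_map:
  fixes G :: "'a monoid" and G' :: "'b monoid"
  assumes G: "group G" "group G'" and A: "tree_action G T \<alpha>" "tree_action G' T' \<alpha>'"
    and nt: "\<not> trivial_action G T \<alpha>" and ep: "action_epimorphism G T \<alpha> G' T' \<alpha>' \<phi> f"
  obtains F where "\<And>v. v \<in> verts T \<Longrightarrow> F v \<in> verts T'"
    "\<And>g v. g \<in> carrier G \<Longrightarrow> v \<in> verts T \<Longrightarrow> F (\<alpha> g v) = \<alpha>' (\<phi> g) (F v)"
    "\<And>u v p q. (u, v) \<in> arcs T \<Longrightarrow> (p, q) \<in> arcs T' \<Longrightarrow>
       ctree.beyond (arcs T') p q (F u) \<noteq> ctree.beyond (arcs T') p q (F v) \<Longrightarrow>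
       closed_simplex {p, q} \<subseteq> f ` closed_simplex {u, v}"
proof -
  note tr = tree[OF G(1) A(1)] tree[OF G(2) A(2)]
  interpret S: ctree_act "verts T" "arcs T" G \<alpha> by (rule ctree_act_of_tree_action[OF G(1) A(1)])
  interpret T: ctree_act "verts T'" "arcs T'" G' \<alpha>' by (rule ctree_act_of_tree_action[OF G(2) A(2)])
  have path: "sends_to_edge_path T' f {u, v}" if "(u, v) \<in> arcs T" for u v
    using ep that unfolding action_epimorphism_def arcs_def by blast
  have "\<exists>w. w \<in> verts T' \<and> f (vertex_point v) = vertex_point w" if v: "v \<in> verts T" for v
  proof -
    obtain w where w: "(v, w) \<in> arcs T" using incident_arc[OF G(1) A(1) nt v] by blast
    obtain ws where ws: "walk T' ws" "f (vertex_point v) = vertex_point (hd ws)"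
      using edge_path[OF tr(1) w path[OF w]] by metis
    have "hd ws \<in> verts T'" using ws(1) unfolding walk_def by auto
    thus ?thesis using ws by blast
  qed
  then obtain F where F: "\<And>v. v \<in> verts T \<Longrightarrow> F v \<in> verts T'" "\<And>v. v \<in> verts T \<Longrightarrow> f (vertex_point v) = vertex_point (F v)"
    by metis
  show thesis
  proof (rule that[of F])
    show "F v \<in> verts T'" if "v \<in> verts T" for v using F(1)[OF that] .
    show "F (\<alpha> g v) = \<alpha>' (\<phi> g) (F v)" if g: "g \<in> carrier G" and v: "v \<in> verts T" for g v
    proof -
      have \<phi>g: "\<phi> g \<in> carrier G'" using ep g unfolding action_epimorphism_def epi_def hom_def by auto
      have "f (point_action G T \<alpha> g (vertex_point v)) = point_action G' T' \<alpha>' (\<phi> g) (f (vertex_point v))"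
        using ep g vertex_point_realization[OF G(1) A(1) v] unfolding action_epimorphism_def by blast
      hence "vertex_point (F (\<alpha> g v)) = vertex_point (\<alpha>' (\<phi> g) (F v))"
        using point_action_vertex[OF G(1) A(1) g v] point_action_vertex[OF G(2) A(2) \<phi>g F(1)[OF v]]
          F(2)[OF v] F(2)[OF S.act_closed[OF g v]] by simp
      thus ?thesis by (simp add: vertex_point_inj)
    qed
    show "closed_simplex {p, q} \<subseteq> f ` closed_simplex {u, v}"
      if uv: "(u, v) \<in> arcs T" and pq: "(p, q) \<in> arcs T'" and sep: "T.beyond p q (F u) \<noteq> T.beyond p q (F v)" for u v p q
    proof -
      obtain ws where ws: "walk T' ws" "f (vertex_point u) = vertex_point (hd ws)" "f (vertex_point v) = vertex_point (last ws)"
        "\<And>i. Suc i < length ws \<Longrightarrow> ws ! i \<noteq> ws ! Suc i \<Longrightarrow> closed_simplex {ws ! i, ws ! Suc i} \<subseteq> f ` closed_simplex {u, v}"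
        using edge_path[OF tr(1) uv path[OF uv]] by blast
      have ne: "ws \<noteq> []" using ws(1) by (simp add: walk_def)
      have ends: "ws ! 0 = F u" "ws ! (length ws - 1) = F v"
        using ws(2,3) F(2) S.EVD[OF uv] ne by (simp_all add: vertex_point_inj hd_conv_nth last_conv_nth)
      have "\<exists>i. Suc i < length ws \<and> T.beyond p q (ws ! i) \<noteq> T.beyond p q (ws ! Suc i)"
      proof (rule ccontr)
        assume no: "\<not> ?thesis"
        have "i < length ws \<Longrightarrow> T.beyond p q (ws ! i) = T.beyond p q (ws ! 0)" for i
          by (induction i) (use no in auto)
        from this[of "length ws - 1"] show False using sep ends ne by simp
      qed
      then obtain i where i: "Suc i < length ws" "T.beyond p q (ws ! i) \<noteq> T.beyond p q (ws ! Suc i)" by blast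
      have "(ws ! i, ws ! Suc i) \<in> arcs T'"
        using ws(1) i(1) unfolding walk_def arcs_def by (simp add: successively_conv_nth)
      hence "{ws ! i, ws ! Suc i} = {p, q}" using T.beyond_edge[OF pq] i(2) by blast
      moreover have "ws ! i \<noteq> ws ! Suc i" using i(2) by auto
      ultimately show ?thesis using ws(4)[OF i(1)] by simp
    qed
  qed
qed

section \<open>Minimizing the complexity along the sequence\<close>

text \<open>The whole tree \<open>S k\<close> may have infinitely many orbits of edges, but the complexity is defined
  for these subtrees.\<close>

definition cofinite_subtree :: "'g monoid \<Rightarrow> ('g \<Rightarrow> 'x \<Rightarrow> 'x) \<Rightarrow> 'x set \<Rightarrow> ('x \<times> 'x) set \<Rightarrow> 'x set \<Rightarrow> bool" where
  "cofinite_subtree \<Gamma> act V E Y \<longleftrightarrow> Y \<noteq> {} \<and> Y \<subseteq> V \<and> (\<forall>g\<in>carrier \<Gamma>. \<forall>x\<in>Y. act g x \<in> Y) \<and>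
     (\<forall>x\<in>Y. \<forall>y\<in>Y. (x, y) \<in> (E \<inter> Y \<times> Y)\<^sup>*) \<and> finite (Y // orb_rel \<Gamma> act Y (Id_on Y)) \<and>
     finite ((E \<inter> Y \<times> Y) // edge_orb_rel \<Gamma> act (E \<inter> Y \<times> Y) (Id_on Y))"

lemma cofinite_subtreeD:
  assumes "cofinite_subtree \<Gamma> act V E Y"
  shows "Y \<noteq> {}" "Y \<subseteq> V" "\<And>g x. g \<in> carrier \<Gamma> \<Longrightarrow> x \<in> Y \<Longrightarrow> act g x \<in> Y"
    "\<And>x y. x \<in> Y \<Longrightarrow> y \<in> Y \<Longrightarrow> (x, y) \<in> (E \<inter> Y \<times> Y)\<^sup>*" "finite (Y // orb_rel \<Gamma> act Y (Id_on Y))"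
    "finite ((E \<inter> Y \<times> Y) // edge_orb_rel \<Gamma> act (E \<inter> Y \<times> Y) (Id_on Y))"
  using assms unfolding cofinite_subtree_def by blast+

context ctree_act
begin

lemma cofinite_subtree_ctree_act:
  assumes "cofinite_subtree \<Gamma> act V E Y" shows "ctree_act Y (E \<inter> Y \<times> Y) \<Gamma> act"
  by (rule invariant_subtree) (use cofinite_subtreeD[OF assms] in simp_all)

lemma cofinite_subtree_defect:
  assumes "cofinite_subtree \<Gamma> act V E Y" shows "- 2 \<le> defect \<Gamma> act Y (E \<inter> Y \<times> Y) (Id_on Y)"
proof -
  interpret Y: ctree_act Y "E \<inter> Y \<times> Y" \<Gamma> act by (rule cofinite_subtree_ctree_act[OF assms])
  show ?thesis
    by (rule Y.defect_lower_bound[OF cofinite_subtreeD(1)[OF assms] Y.EV Y.symE Y.invE Y.connE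
      Y.equiv_Id_on Y.invariant_Id_on cofinite_subtreeD(5,6)[OF assms]])
qed

text \<open>If \<open>\<Gamma>\<close> is generated by a finite set \<open>X\<close>, the translates of the geodesics from \<open>v\<close> to \<open>s v\<close> for
  \<open>s\<close> in \<open>X\<close> form a cofinite subtree.\<close>

lemma cofinite_subtree_exists:
  assumes fg: "finitely_generated \<Gamma>" and v: "v \<in> V"
  shows "\<exists>Y. cofinite_subtree \<Gamma> act V E Y"
proof -
  obtain X where X: "finite X" "X \<subseteq> carrier \<Gamma>" "generate \<Gamma> X = carrier \<Gamma>"
    using fg unfolding finitely_generated_def by blast
  define B where "B = insert v (\<Union>s\<in>X. interval v (act s v))"
  have XV: "act s v \<in> V" if "s \<in> X" for s using X(2) that act_closed v by blast
  have finB: "finite B" unfolding B_def using X(1) finite_interval[OF v XV] by simp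
  have BV: "B \<subseteq> V" unfolding B_def using v interval_V by blast
  define Y where "Y = (\<Union>g\<in>carrier \<Gamma>. act g ` B)"
  define EB where "EB = {(act g a, act g b) |g a b. g \<in> carrier \<Gamma> \<and> (a, b) \<in> E \<and> a \<in> B \<and> b \<in> B}"
  have YV: "Y \<subseteq> V" unfolding Y_def using act_closed BV by blast
  have vB: "v \<in> B" by (simp add: B_def)
  have BY: "b \<in> Y" if "b \<in> B" for b
    unfolding Y_def using that act_one[of b] BV by (intro UN_I[OF one_closed]) (auto simp: image_iff intro!: bexI[of _ b])
  have Yact: "act g x \<in> Y" if g: "g \<in> carrier \<Gamma>" and x: "x \<in> Y" for g x
  proof -
    obtain h b where h: "h \<in> carrier \<Gamma>" "b \<in> B" "x = act h b" using x unfolding Y_def by blast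
    hence "act g x = act (g \<otimes> h) b" using act_mult[OF g h(1)] BV by auto
    thus ?thesis unfolding Y_def using h g by blast
  qed
  have EBact: "(act g x, act g y) \<in> EB" if g: "g \<in> carrier \<Gamma>" and xy: "(x, y) \<in> EB" for g x y
  proof -
    obtain h a b where h: "h \<in> carrier \<Gamma>" "x = act h a" "y = act h b" "(a, b) \<in> E" "a \<in> B" "b \<in> B" using xy unfolding EB_def by blast
    hence "act g x = act (g \<otimes> h) a" "act g y = act (g \<otimes> h) b" using act_mult[OF g h(1)] BV by auto
    thus ?thesis unfolding EB_def using h g m_closed[OF g h(1)] by blast
  qed
  have EBact': "(act g x, act g y) \<in> EB\<^sup>*" if g: "g \<in> carrier \<Gamma>" and xy: "(x, y) \<in> EB\<^sup>*" for g x y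
    using xy by (induction rule: rtrancl_induct) (auto intro: rtrancl_into_rtrancl EBact[OF g])
  have symEB: "(y, x) \<in> EB" if "(x, y) \<in> EB" for x y using that symE unfolding EB_def by blast
  have symEB': "(y, x) \<in> EB\<^sup>*" if "(x, y) \<in> EB\<^sup>*" for x y
    using that by (induction rule: rtrancl_induct) (auto intro: converse_rtrancl_into_rtrancl symEB)
  have BB: "E \<inter> B \<times> B \<subseteq> EB"
  proof
    fix p assume p: "p \<in> E \<inter> B \<times> B"
    obtain a b where ab: "p = (a, b)" by (cases p)
    have "act \<one> a = a" "act \<one> b = b" using p ab act_one BV by auto
    hence "p = (act \<one> a, act \<one> b) \<and> \<one> \<in> carrier \<Gamma> \<and> (a, b) \<in> E \<and> a \<in> B \<and> b \<in> B" using p ab by simp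
    thus "p \<in> EB" unfolding EB_def by blast
  qed
  have to_B: "(v, b) \<in> EB\<^sup>*" if b: "b \<in> B" for b
  proof (cases "b = v")
    case False
    then obtain s where s: "s \<in> X" "b \<in> interval v (act s v)" using b unfolding B_def by blast
    have "E \<inter> interval v (act s v) \<times> interval v (act s v) \<subseteq> EB" using s(1) BB unfolding B_def by blast
    thus ?thesis using interval_connected_mono[OF s(2) v] rtrancl_mono by blast
  qed simp
  have "g \<in> carrier \<Gamma> \<and> (v, act g v) \<in> EB\<^sup>*" if "g \<in> generate \<Gamma> X" for g
    using that
  proof (induction rule: generate.induct)
    case one show ?case using act_one[OF v] by simp
  next
    case (incl s)
    have "act s v \<in> interval v (act s v)" using interval_ends(2) XV incl by blast
    hence "act s v \<in> B" using incl unfolding B_def by blast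
    thus ?case using to_B X(2) incl by blast
  next
    case (inv s)
    have "act s v \<in> interval v (act s v)" using interval_ends(2) XV inv by blast
    hence "act s v \<in> B" using inv unfolding B_def by blast
    moreover have s: "s \<in> carrier \<Gamma>" using X(2) inv by blast
    ultimately have "(act (inv s) v, act (inv s) (act s v)) \<in> EB\<^sup>*" using EBact' to_B by simp
    thus ?case using symEB' act_inv1[OF s v] s by simp
  next
    case (eng g h)
    hence "(act g v, act g (act h v)) \<in> EB\<^sup>*" using EBact' by blast
    thus ?case using eng act_mult[of g h v] v by (auto intro: rtrancl_trans)
  qed
  hence from_v: "(v, act g v) \<in> EB\<^sup>*" if "g \<in> carrier \<Gamma>" for g using X(3) that by blast
  have vY: "(v, y) \<in> EB\<^sup>*" if yY: "y \<in> Y" for y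
  proof -
    obtain g b where g: "g \<in> carrier \<Gamma>" "b \<in> B" "y = act g b" using yY unfolding Y_def by blast
    thus ?thesis using rtrancl_trans[OF from_v[OF g(1)] EBact'[OF g(1) to_B[OF g(2)]]] by simp
  qed
  have conB: "(x, y) \<in> EB\<^sup>*" if "x \<in> Y" "y \<in> Y" for x y
    using rtrancl_trans[OF symEB'[OF vY[OF that(1)]] vY[OF that(2)]] .
  have EBE: "(x, y) \<in> E" if "(x, y) \<in> EB" for x y using that E_act unfolding EB_def by blast
  have EBY: "EB \<subseteq> E \<inter> Y \<times> Y"
  proof
    fix p assume p: "p \<in> EB"
    then obtain g a b where g: "p = (act g a, act g b)" "g \<in> carrier \<Gamma>" "a \<in> B" "b \<in> B" unfolding EB_def by blast
    thus "p \<in> E \<inter> Y \<times> Y" using EBE[of "act g a" "act g b"] Yact[OF g(2)] BY p by simp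
  qed
  \<comment> \<open>A path in the translates that joins the ends of an edge crosses this edge.\<close>
  have YEB: "(x, y) \<in> EB" if xy: "(x, y) \<in> E" "x \<in> Y" "y \<in> Y" for x y
  proof (rule ccontr)
    assume no: "(x, y) \<notin> EB"
    have "beyond x y z = beyond x y x" if "(x, z) \<in> EB\<^sup>*" for z
      using that
    proof (induction rule: rtrancl_induct)
      case (step p q)
      have "(p, q) \<noteq> (x, y)" "(q, p) \<noteq> (x, y)" using step(2) symEB[OF step(2)] no by auto
      thus ?case using beyond_edge[OF xy(1) EBE[OF step(2)]] step(3) by auto
    qed simp
    from this[OF conB[OF xy(2,3)]] show False using not_beyond_start[OF xy(1)] beyond_cut(2)[OF xy(1)] by simp
  qed
  have con: "(x, y) \<in> (E \<inter> Y \<times> Y)\<^sup>*" if "x \<in> Y" "y \<in> Y" for x y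
    using conB[OF that] rtrancl_mono[OF EBY] by blast
  interpret Y: ctree_act Y "E \<inter> Y \<times> Y" \<Gamma> act by (rule invariant_subtree[OF YV Yact con])
  let ?r = "orb_rel \<Gamma> act Y (Id_on Y)" and ?s = "edge_orb_rel \<Gamma> act (E \<inter> Y \<times> Y) (Id_on Y)"
  have "Y // ?r \<subseteq> (\<lambda>b. ?r `` {b}) ` B"
  proof
    fix C assume "C \<in> Y // ?r"
    then obtain y where y: "y \<in> Y" "C = ?r `` {y}" by (rule quotientE)
    obtain g b where g: "g \<in> carrier \<Gamma>" "b \<in> B" "y = act g b" using y(1) unfolding Y_def by blast
    hence "(b, y) \<in> ?r" using BY by (auto simp: Y.orb_rel_Id)
    hence "?r `` {b} = C" using equiv_class_eq[OF Y.equiv_vert_Id] y(2) by blast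
    thus "C \<in> (\<lambda>b. ?r `` {b}) ` B" using g(2) by blast
  qed
  hence finv: "finite (Y // ?r)" using finB finite_surj by blast
  have "(E \<inter> Y \<times> Y) // ?s \<subseteq> (\<lambda>e. ?s `` {e}) ` (B \<times> B)"
  proof
    fix C assume "C \<in> (E \<inter> Y \<times> Y) // ?s"
    then obtain e where e: "e \<in> E \<inter> Y \<times> Y" "C = ?s `` {e}" by (rule quotientE)
    obtain x y where xy: "e = (x, y)" by (cases e)
    have "(x, y) \<in> EB" using YEB[of x y] e xy by blast
    then obtain g a b where g: "g \<in> carrier \<Gamma>" "x = act g a" "y = act g b" "(a, b) \<in> E" "a \<in> B" "b \<in> B" unfolding EB_def by blast
    hence "((a, b), e) \<in> ?s" using BY xy by (auto simp: Y.edge_orb_Id)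
    hence "?s `` {(a, b)} = C" using equiv_class_eq[OF Y.equiv_edge_Id] e(2) by blast
    thus "C \<in> (\<lambda>e. ?s `` {e}) ` (B \<times> B)" using g(5,6) by blast
  qed
  hence "finite ((E \<inter> Y \<times> Y) // ?s)" using finB finite_surj[of "B \<times> B"] by blast
  moreover have "Y \<noteq> {}" using BY[OF vB] by blast
  ultimately have "cofinite_subtree \<Gamma> act V E Y"
    unfolding cofinite_subtree_def using YV Yact con finv by simp
  thus ?thesis by blast
qed

end

text \<open>The hull of the image competes with the source in the minimization below.\<close>

lemma (in tree_map) image_cofinite: "cofinite_subtree H aT VT ET VI"
proof -
  obtain v where "v \<in> VS" using neS by blast
  hence "VI \<noteq> {}" using F_VI by blast
  thus ?thesis
    unfolding cofinite_subtree_def EI_def[symmetric] using VI_sub VI_act VI_connected finVI finEI by simp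
qed

text \<open>The combinatorial content of a sequence of epimorphisms of actions.\<close>

locale tree_sequence = epi_sequence G \<phi> for G :: "nat \<Rightarrow> 'a monoid" and \<phi> +
  fixes V :: "nat \<Rightarrow> 'v set" and E and \<alpha> :: "nat \<Rightarrow> 'a \<Rightarrow> 'v \<Rightarrow> 'v" and F
  assumes tree: "ctree_act (V k) (E k) (G k) (\<alpha> k)"
    and neV: "V k \<noteq> {}"
    and F_closed: "v \<in> V k \<Longrightarrow> F k v \<in> V (Suc k)"
    and F_equiv: "g \<in> carrier (G k) \<Longrightarrow> v \<in> V k \<Longrightarrow> F k (\<alpha> k g v) = \<alpha> (Suc k) (\<phi> k g) (F k v)"
    and F_stab: "(u, v) \<in> E k \<Longrightarrow> (p, q) \<in> E (Suc k) \<Longrightarrow>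
      ctree.beyond (E (Suc k)) p q (F k u) \<noteq> ctree.beyond (E (Suc k)) p q (F k v) \<Longrightarrow>
      h \<in> carrier (G (Suc k)) \<Longrightarrow> \<alpha> (Suc k) h p = p \<Longrightarrow> \<alpha> (Suc k) h q = q \<Longrightarrow>
      \<exists>g\<in>carrier (G k). \<phi> k g = h \<and> \<alpha> k g u = u \<and> \<alpha> k g v = v"
    and fg: "finitely_generated (G k)"
    and no_fix: "v \<in> V k \<Longrightarrow> \<exists>g\<in>carrier (G k). \<alpha> k g v \<noteq> v"
begin

lemma F_trans_closed: "k \<le> m \<Longrightarrow> v \<in> V k \<Longrightarrow> transition F k m v \<in> V m"
  by (induction m rule: dec_induct) (simp_all add: transition_refl transition_Suc F_closed)

lemma F_trans_equiv:
  assumes "k \<le> m" "g \<in> carrier (G k)" "v \<in> V k"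
  shows "transition F k m (\<alpha> k g v) = \<alpha> m (transition \<phi> k m g) (transition F k m v)"
  using assms(1)
proof (induction m rule: dec_induct)
  case (step m)
  thus ?case using F_equiv[OF transition_closed[OF step(1) assms(2)] F_trans_closed[OF step(1) assms(3)]]
    by (simp add: transition_Suc)
qed (simp add: transition_refl)

text \<open>An edge between the images of \<open>u\<close> and \<open>v\<close> at level \<open>m + 1\<close> lies on the image of some edge of
  the geodesic at level \<open>m\<close>, to which the induction hypothesis applies.\<close>

lemma F_trans_stab:
  assumes "k \<le> m" and uv: "(u, v) \<in> E k" and "(p, q) \<in> E m"
    "ctree.beyond (E m) p q (transition F k m u) \<noteq> ctree.beyond (E m) p q (transition F k m v)"
    "h \<in> carrier (G m)" "\<alpha> m h p = p" "\<alpha> m h q = q"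
  shows "\<exists>g\<in>carrier (G k). transition \<phi> k m g = h \<and> \<alpha> k g u = u \<and> \<alpha> k g v = v"
  using assms(1,3-)
proof (induction m arbitrary: p q h rule: dec_induct)
  case base
  interpret ctree_act "V k" "E k" "G k" "\<alpha> k" by (rule tree)
  have "p = u \<and> q = v \<or> p = v \<and> q = u" using beyond_edge[OF base(1) uv] base(2) by (auto simp: transition_refl)
  thus ?case using base(3-5) by (auto simp: transition_refl)
next
  case (step m)
  interpret S: ctree_act "V m" "E m" "G m" "\<alpha> m" by (rule tree)
  let ?F = "transition F k m" and ?c = "\<lambda>x. ctree.beyond (E (Suc m)) p q (F m x)"
  have uvV: "u \<in> V k" "v \<in> V k" using ctree.EVD[OF ctree_act.axioms(1)[OF tree] uv] by auto
  have FV: "?F u \<in> V m" "?F v \<in> V m" using F_trans_closed[OF step(1)] uvV by auto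
  have sep: "?c (?F u) \<noteq> ?c (?F v)" using step(5) step(1) by (simp add: transition_Suc)
  have "\<exists>(a, b)\<in>E m \<inter> S.interval (?F u) (?F v) \<times> S.interval (?F u) (?F v). ?c a \<noteq> ?c b"
  proof (rule ccontr)
    assume no: "\<not> ?thesis"
    have "?c (?F u) = ?c x" if "(?F u, x) \<in> (E m \<inter> S.interval (?F u) (?F v) \<times> S.interval (?F u) (?F v))\<^sup>*" for x
      using that by (induction rule: rtrancl_induct) (use no in auto)
    thus False using S.interval_connected[OF FV] sep by simp
  qed
  then obtain a b where ab: "(a, b) \<in> E m" "a \<in> S.interval (?F u) (?F v)" "b \<in> S.interval (?F u) (?F v)" "?c a \<noteq> ?c b" by blast
  obtain g' where g': "g' \<in> carrier (G m)" "\<phi> m g' = h" "\<alpha> m g' a = a" "\<alpha> m g' b = b"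
    using F_stab[OF ab(1) step(4) ab(4) step(6-8)] by blast
  obtain g where g: "g \<in> carrier (G k)" "transition \<phi> k m g = g'" "\<alpha> k g u = u" "\<alpha> k g v = v"
    using step(3)[OF ab(1) S.interval_edge_separates[OF ab(2,3,1) FV] g'(1,3,4)] by blast
  have "transition \<phi> k (Suc m) g = h" using g(2) g'(2) step(1) by (simp add: transition_Suc)
  thus ?case using g by blast
qed

abbreviation cofinite :: "nat \<Rightarrow> 'v set \<Rightarrow> bool" where
  "cofinite k Y \<equiv> cofinite_subtree (G k) (\<alpha> k) (V k) (E k) Y"

abbreviation dfc :: "nat \<Rightarrow> 'v set \<Rightarrow> int" where
  "dfc k Y \<equiv> defect (G k) (\<alpha> k) Y (E k \<inter> Y \<times> Y) (Id_on Y)"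

abbreviation big :: "nat \<Rightarrow> 'v set \<Rightarrow> nat" where
  "big k Y \<equiv> num_big (G k) (\<alpha> k) Y (E k \<inter> Y \<times> Y) (Id_on Y)"

lemma tree_map_transition:
  assumes "k \<le> m" "cofinite k Y"
  shows "tree_map Y (E k \<inter> Y \<times> Y) (G k) (\<alpha> k) (V m) (E m) (G m) (\<alpha> m) (transition \<phi> k m) (transition F k m)"
proof -
  note Y = cofinite_subtreeD[OF assms(2)]
  interpret S: ctree_act Y "E k \<inter> Y \<times> Y" "G k" "\<alpha> k" by (rule ctree_act.cofinite_subtree_ctree_act[OF tree assms(2)])
  interpret T: ctree_act "V m" "E m" "G m" "\<alpha> m" by (rule tree)
  show ?thesis
  proof unfold_locales
    show "transition \<phi> k m \<in> hom (G k) (G m)" using transition_hom[OF assms(1)] .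
    show "transition \<phi> k m ` carrier (G k) = carrier (G m)" using transition_onto[OF assms(1)] .
    show "Y \<noteq> {}" using Y(1) .
    show "transition F k m v \<in> V m" if "v \<in> Y" for v using F_trans_closed[OF assms(1)] Y(2) that by blast
    show "transition F k m (\<alpha> k g v) = \<alpha> m (transition \<phi> k m g) (transition F k m v)" if "g \<in> carrier (G k)" "v \<in> Y" for g v
      using F_trans_equiv[OF assms(1) that(1)] Y(2) that by blast
    show "\<exists>g\<in>carrier (G k). transition \<phi> k m g = h \<and> \<alpha> k g u = u \<and> \<alpha> k g v = v"
      if "(u, v) \<in> E k \<inter> Y \<times> Y" "(t, t') \<in> E m"
        "T.beyond t t' (transition F k m u) \<noteq> T.beyond t t' (transition F k m v)"
        "h \<in> carrier (G m)" "\<alpha> m h t = t" "\<alpha> m h t' = t'" for u v t t' h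
      by (rule F_trans_stab[OF assms(1) _ that(2-)]) (use that(1) in blast)
    show "finite (Y // orb_rel (G k) (\<alpha> k) Y (Id_on Y))" using Y(5) .
    show "finite ((E k \<inter> Y \<times> Y) // edge_orb_rel (G k) (\<alpha> k) (E k \<inter> Y \<times> Y) (Id_on Y))" using Y(6) .
  qed
qed

text \<open>Minimizing over all levels at once makes every image of the chosen subtree have the same
  complexity.\<close>

lemma minimal_cofinite:
  obtains k Y where "cofinite k Y"
    "\<forall>m Z. cofinite m Z \<longrightarrow> dfc m Z \<le> dfc k Y \<longrightarrow> dfc m Z = dfc k Y"
    "\<forall>m Z. cofinite m Z \<longrightarrow> dfc m Z = dfc k Y \<longrightarrow> big k Y \<le> big m Z"
proof -
  define P where "P = (\<lambda>(k, Y). cofinite k Y)"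
  define d where "d = (\<lambda>(k, Y). nat (dfc k Y + 2))"
  obtain v where "v \<in> V 0" using neV by blast
  then obtain Y0 where "cofinite 0 Y0" using ctree_act.cofinite_subtree_exists[OF tree fg] by blast
  hence "P (0, Y0)" by (simp add: P_def)
  from ex_has_least_nat[of P, OF this, of d] obtain x where x: "P x" "\<And>y. P y \<Longrightarrow> d x \<le> d y" by blast
  have "P x \<and> d x = d x" using x by simp
  from ex_has_least_nat[of "\<lambda>y. P y \<and> d y = d x", OF this, of "\<lambda>(k, Y). big k Y"]
  obtain z where z: "P z" "d z = d x" "\<And>y. P y \<Longrightarrow> d y = d x \<Longrightarrow> (case z of (k, Y) \<Rightarrow> big k Y) \<le> (case y of (k, Y) \<Rightarrow> big k Y)"
    by blast
  obtain k Y where kY: "z = (k, Y)" by (cases z)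
  show thesis
  proof (rule that; (intro allI impI)?)
    show c: "cofinite k Y" using z(1) by (simp add: P_def kY)
    show "dfc m Z = dfc k Y" if "cofinite m Z" "dfc m Z \<le> dfc k Y" for m Z
    proof -
      have "d z \<le> d (m, Z)" using x(2)[of "(m, Z)"] z(2) that by (simp add: P_def)
      hence "nat (dfc k Y + 2) \<le> nat (dfc m Z + 2)" by (simp add: d_def kY)
      thus ?thesis
        using ctree_act.cofinite_subtree_defect[OF tree c] ctree_act.cofinite_subtree_defect[OF tree that(1)] that(2) by linarith
    qed
    show "big k Y \<le> big m Z" if "cofinite m Z" "dfc m Z = dfc k Y" for m Z
      using z(3)[of "(m, Z)"] z(2) that by (simp add: P_def d_def kY)
  qed
qed

text \<open>If the direct limit fixed a vertex of the limit tree, then for each of finitely many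
  generators this would be witnessed by a relation at a finite level, and the action at a common
  level would be trivial.\<close>

lemma no_fix_limit:
  assumes "x \<in> V k"
  shows "\<exists>g\<in>carrier (G k). \<forall>n. n \<in> carrier (G k) \<and> (\<exists>i. transition \<phi> k (k + i) n = \<one>\<^bsub>G (k + i)\<^esub>) \<longrightarrow> \<alpha> k g x \<noteq> \<alpha> k n x"
proof (rule ccontr)
  assume no: "\<not> ?thesis"
  define Q where "Q i s \<longleftrightarrow> (\<exists>n\<in>carrier (G k). transition \<phi> k (k + i) n = \<one>\<^bsub>G (k + i)\<^esub> \<and> \<alpha> k s x = \<alpha> k n x)" for i s
  obtain X where X: "finite X" "X \<subseteq> carrier (G k)" "generate (G k) X = carrier (G k)"
    using fg[of k] unfolding finitely_generated_def by blast
  have Q_mono: "Q j s" if ij: "i \<le> j" and Qi: "Q i s" for i j s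
    using Qi transition_kernel_mono[OF ij, of k] unfolding Q_def by blast
  have "\<forall>s\<in>X. \<exists>i. Q i s" using no X(2) unfolding Q_def by blast
  hence "\<forall>s\<in>X. \<forall>\<^sub>F i in sequentially. Q i s" unfolding eventually_sequentially using Q_mono by blast
  hence "\<forall>\<^sub>F i in sequentially. \<forall>s\<in>X. Q i s" using X(1) by (simp add: eventually_ball_finite_distrib)
  then obtain i where i: "\<And>s. s \<in> X \<Longrightarrow> Q i s" unfolding eventually_sequentially by blast
  define m where "m = k + i"
  have km: "k \<le> m" by (simp add: m_def)
  interpret S: ctree_act "V k" "E k" "G k" "\<alpha> k" by (rule tree)
  interpret T: ctree_act "V m" "E m" "G m" "\<alpha> m" by (rule tree)
  let ?t = "transition \<phi> k m" and ?y = "transition F k m x"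
  have y: "?y \<in> V m" using F_trans_closed[OF km assms] .
  have fixX: "\<alpha> m (?t s) ?y = ?y" if sX: "s \<in> X" for s
  proof -
    obtain n where n: "n \<in> carrier (G k)" "?t n = \<one>\<^bsub>G m\<^esub>" "\<alpha> k s x = \<alpha> k n x" using i[OF sX] unfolding Q_def m_def by blast
    have "\<alpha> m (?t s) ?y = transition F k m (\<alpha> k n x)" using F_trans_equiv[OF km _ assms, of s] sX X(2) n(3) by auto
    also have "\<dots> = ?y" using F_trans_equiv[OF km n(1) assms] n(2) T.act_one[OF y] by simp
    finally show ?thesis .
  qed
  have "g \<in> carrier (G k) \<and> \<alpha> m (?t g) ?y = ?y" if "g \<in> generate (G k) X" for g
    using that
  proof (induction rule: generate.induct)
    case one show ?case using T.act_one[OF y] transition_one[OF km] by simp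
  next
    case (incl s) thus ?case using fixX X(2) by blast
  next
    case (inv s)
    have s: "s \<in> carrier (G k)" using inv X(2) by blast
    have "?t (inv\<^bsub>G k\<^esub> s) \<otimes>\<^bsub>G m\<^esub> ?t s = \<one>\<^bsub>G m\<^esub>"
      using transition_mult[OF km S.inv_closed[OF s] s] transition_one[OF km] s by simp
    hence "\<alpha> m (?t (inv\<^bsub>G k\<^esub> s)) (\<alpha> m (?t s) ?y) = ?y"
      using T.act_mult[OF transition_closed[OF km S.inv_closed[OF s]] transition_closed[OF km s] y] T.act_one[OF y] by simp
    thus ?case using fixX[OF inv] s by simp
  next
    case (eng g h)
    thus ?case using transition_mult[OF km, of g h] T.act_mult[OF transition_closed[OF km, of g] transition_closed[OF km, of h] y] by simp
  qed
  hence "\<alpha> m (?t g) ?y = ?y" if "g \<in> carrier (G k)" for g using X(3) that by blast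
  hence "\<alpha> m h ?y = ?y" if "h \<in> carrier (G m)" for h using transition_onto[OF km] that by (metis imageE)
  thus False using no_fix[OF y] by blast
qed

text \<open>For a subtree \<open>Y\<close> of minimal complexity, no fold of a composite map can lower the complexity.
  So the quotient of \<open>Y\<close> by the kernel of each transition map is a tree, and these trees converge.\<close>

theorem limit_splits:
  "\<exists>k. \<exists>(u, v)\<in>E k. nontrivial_splitting_over (direct_limit G \<phi>)
     (limit_map G \<phi> k ` {g \<in> carrier (G k). \<alpha> k g u = u \<and> \<alpha> k g v = v})"
proof -
  obtain k Y where Y: "cofinite k Y"
    and min1: "\<forall>m Z. cofinite m Z \<longrightarrow> dfc m Z \<le> dfc k Y \<longrightarrow> dfc m Z = dfc k Y"
    and min2: "\<forall>m Z. cofinite m Z \<longrightarrow> dfc m Z = dfc k Y \<longrightarrow> big k Y \<le> big m Z" by (rule minimal_cofinite)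
  define N where "N i = {g \<in> carrier (G k). transition \<phi> k (k + i) g = \<one>\<^bsub>G (k + i)\<^esub>}" for i
  let ?E = "E k \<inter> Y \<times> Y"
  interpret S: ctree_act Y ?E "G k" "\<alpha> k" by (rule ctree_act.cofinite_subtree_ctree_act[OF tree Y])
  have cuts: "(\<exists>c :: 'v \<Rightarrow> bool. (\<forall>n\<in>N i. \<forall>x\<in>Y. c (\<alpha> k n x) = c x) \<and>
      (\<forall>(a, b)\<in>?E. c a \<noteq> c b \<longleftrightarrow>
         (\<exists>n\<in>N i. \<exists>n'\<in>N i. (a = \<alpha> k n u \<and> b = \<alpha> k n' v) \<or> (a = \<alpha> k n v \<and> b = \<alpha> k n' u)))) \<and>
      (\<forall>g n n'. g \<in> carrier (G k) \<longrightarrow> n \<in> N i \<longrightarrow> n' \<in> N i \<longrightarrow> \<alpha> k g u = \<alpha> k n u \<longrightarrow> \<alpha> k g v = \<alpha> k n' v \<longrightarrow>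
           (\<exists>m\<in>N i. \<alpha> k g u = \<alpha> k m u \<and> \<alpha> k g v = \<alpha> k m v)) \<and>
      (\<forall>g n n'. g \<in> carrier (G k) \<longrightarrow> n \<in> N i \<longrightarrow> n' \<in> N i \<longrightarrow> \<alpha> k g u = \<alpha> k n v \<longrightarrow> \<alpha> k g v \<noteq> \<alpha> k n' u)"
    if uv: "(u, v) \<in> ?E" and nl: "\<forall>n\<in>N i. \<alpha> k n u \<noteq> v" for u v i
  proof -
    interpret M: tree_map Y ?E "G k" "\<alpha> k" "V (k + i)" "E (k + i)" "G (k + i)" "\<alpha> (k + i)" "transition \<phi> k (k + i)" "transition F k (k + i)"
      by (rule tree_map_transition[OF le_add1 Y])
    have N: "M.N = N i" by (simp add: M.N_def N_def)
    have EI: "M.EI = E (k + i) \<inter> M.VI \<times> M.VI" by (rule M.EI_def)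
    have eq1: "dfc (k + i) M.VI = dfc k Y" using min1[rule_format, OF M.image_cofinite] M.complexity_compare(1) unfolding EI by blast
    have eq2: "big (k + i) M.VI = big k Y"
      using min2[rule_format, OF M.image_cofinite eq1] M.complexity_compare(2) eq1 unfolding EI by simp
    have c: "\<exists>c. is_cut M.E0 M.R0 p q c" if pq: "(p, q) \<in> M.E0" for p q
      using M.complexity_compare(3)[OF _ _ pq] eq1 eq2 unfolding EI by blast
    have nl': "\<alpha> k n u \<noteq> v" if n: "n \<in> M.N" for n using nl n unfolding N by blast
    note r = M.edge_cut_mod_N[OF c uv nl', unfolded N]
    show ?thesis
    proof (intro conjI allI impI)
      show "\<exists>c :: 'v \<Rightarrow> bool. (\<forall>n\<in>N i. \<forall>x\<in>Y. c (\<alpha> k n x) = c x) \<and>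
      (\<forall>(a, b)\<in>?E. c a \<noteq> c b \<longleftrightarrow>
         (\<exists>n\<in>N i. \<exists>n'\<in>N i. (a = \<alpha> k n u \<and> b = \<alpha> k n' v) \<or> (a = \<alpha> k n v \<and> b = \<alpha> k n' u)))" by (rule r(1))
    next
      fix g n n' assume a: "g \<in> carrier (G k)" "n \<in> N i" "n' \<in> N i"
      show "\<exists>m\<in>N i. \<alpha> k g u = \<alpha> k m u \<and> \<alpha> k g v = \<alpha> k m v" if b: "\<alpha> k g u = \<alpha> k n u" "\<alpha> k g v = \<alpha> k n' v"
        by (rule r(2)[OF _ _ a b])
      show "\<alpha> k g v \<noteq> \<alpha> k n' u" if b: "\<alpha> k g u = \<alpha> k n v"
        by (rule r(3)[OF _ _ a b])
    qed
  qed
  interpret h: group_hom "G k" "direct_limit G \<phi>" "limit_map G \<phi> k" by (rule limit_map_group_hom)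
  interpret L: limit_tree Y ?E "G k" "\<alpha> k" "direct_limit G \<phi>" "limit_map G \<phi> k" N
  proof unfold_locales
    show "limit_map G \<phi> k ` carrier (G k) = carrier (direct_limit G \<phi>)" using carrier_direct_limit[of k] by simp
    show "(\<Union>i. N i) = {g \<in> carrier (G k). limit_map G \<phi> k g = \<one>\<^bsub>direct_limit G \<phi>\<^esub>}"
      unfolding N_def limit_map_kernel ..
    show "N i \<subseteq> N j" if "i \<le> j" for i j unfolding N_def by (rule transition_kernel_mono[OF that])
    show "finite (?E // edge_orb_rel (G k) (\<alpha> k) ?E (Id_on Y))" using cofinite_subtreeD(6)[OF Y] .
    fix u v i assume uv: "(u, v) \<in> ?E" "\<forall>n\<in>N i. \<alpha> k n u \<noteq> v"
    show "\<exists>c :: 'v \<Rightarrow> bool. (\<forall>n\<in>N i. \<forall>x\<in>Y. c (\<alpha> k n x) = c x) \<and>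
      (\<forall>(a, b)\<in>?E. c a \<noteq> c b \<longleftrightarrow>
         (\<exists>n\<in>N i. \<exists>n'\<in>N i. (a = \<alpha> k n u \<and> b = \<alpha> k n' v) \<or> (a = \<alpha> k n v \<and> b = \<alpha> k n' u)))"
      using cuts[OF uv] by (elim conjE)
    fix g n n' assume a: "g \<in> carrier (G k)" "n \<in> N i" "n' \<in> N i"
    show "\<exists>m\<in>N i. \<alpha> k g u = \<alpha> k m u \<and> \<alpha> k g v = \<alpha> k m v" if b: "\<alpha> k g u = \<alpha> k n u" "\<alpha> k g v = \<alpha> k n' v"
      using conjunct1[OF conjunct2[OF cuts[OF uv]], rule_format, OF a b] .
    show "\<alpha> k g v \<noteq> \<alpha> k n' u" if b: "\<alpha> k g u = \<alpha> k n v"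
      using conjunct2[OF conjunct2[OF cuts[OF uv]], rule_format, OF a b] .
  qed
  have "\<exists>g\<in>carrier (G k). \<forall>n\<in>L.K. \<alpha> k g x \<noteq> \<alpha> k n x" if x: "x \<in> Y" for x
  proof -
    have "x \<in> V k" using cofinite_subtreeD(2)[OF Y] x by blast
    from no_fix_limit[OF this] obtain g where g: "g \<in> carrier (G k)"
      "\<And>n. n \<in> carrier (G k) \<Longrightarrow> (\<exists>i. transition \<phi> k (k + i) n = \<one>\<^bsub>G (k + i)\<^esub>) \<Longrightarrow> \<alpha> k g x \<noteq> \<alpha> k n x" by blast
    have "\<alpha> k g x \<noteq> \<alpha> k n x" if "n \<in> L.K" for n
      using g(2)[OF L.KG[OF that]] L.K_N[of n] that unfolding N_def by blast
    thus ?thesis using g(1) by blast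
  qed
  from L.limit_splitting[OF cofinite_subtreeD(1)[OF Y] this]
  obtain e where e: "e \<in> ?E" "case e of (u, v) \<Rightarrow> nontrivial_splitting_over (direct_limit G \<phi>)
     (limit_map G \<phi> k ` {g \<in> carrier (G k). \<alpha> k g u = u \<and> \<alpha> k g v = v})" by fast
  show ?thesis by (intro exI[of _ k] bexI[of _ e]) (use e in simp_all)
qed

end

theorem theorem2p1:
  fixes G :: "nat \<Rightarrow> 'a monoid"
    and S :: "nat \<Rightarrow> 'v graph"
    and \<alpha> :: "nat \<Rightarrow> 'a \<Rightarrow> 'v \<Rightarrow> 'v"
    and \<phi> :: "nat \<Rightarrow> 'a \<Rightarrow> 'a"
    and f :: "nat \<Rightarrow> ('v \<Rightarrow> real) \<Rightarrow> ('v \<Rightarrow> real)"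
  assumes "\<And>k. group (G k)"
    and "\<And>k. finitely_generated (G k)"
    and "\<And>k. tree_action (G k) (S k) (\<alpha> k)"
    and "\<And>k. \<not> trivial_action (G k) (S k) (\<alpha> k)"
    and "\<And>k. action_epimorphism (G k) (S k) (\<alpha> k) (G (Suc k)) (S (Suc k)) (\<alpha> (Suc k)) (\<phi> k) (f k)"
    and "\<And>k e e'. e \<in> edges (S k) \<Longrightarrow> e' \<in> edges (S (Suc k)) \<Longrightarrow>
           closed_simplex e' \<subseteq> f k ` closed_simplex e \<Longrightarrow>
           edge_stabilizer (G (Suc k)) (\<alpha> (Suc k)) e' = \<phi> k ` edge_stabilizer (G k) (\<alpha> k) e"
  shows "\<exists>k. \<exists>e\<in>edges (S k).
           nontrivial_splitting_over (direct_limit G \<phi>)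
             (limit_map G \<phi> k ` edge_stabilizer (G k) (\<alpha> k) e)"
proof -
  define P where "P k F \<longleftrightarrow> (\<forall>v\<in>verts (S k). F v \<in> verts (S (Suc k))) \<and>
      (\<forall>g\<in>carrier (G k). \<forall>v\<in>verts (S k). F (\<alpha> k g v) = \<alpha> (Suc k) (\<phi> k g) (F v)) \<and>
      (\<forall>u v p q. (u, v) \<in> arcs (S k) \<longrightarrow> (p, q) \<in> arcs (S (Suc k)) \<longrightarrow>
         ctree.beyond (arcs (S (Suc k))) p q (F u) \<noteq> ctree.beyond (arcs (S (Suc k))) p q (F v) \<longrightarrow>
         closed_simplex {p, q} \<subseteq> f k ` closed_simplex {u, v})" for k F
  have "\<exists>F. P k F" for k
    by (rule vertex_map[OF assms(1)[of k] assms(1)[of "Suc k"] assms(3)[of k] assms(3)[of "Suc k"] assms(4)[of k] assms(5)[of k]]) (unfold P_def, blast)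
  then obtain F where F: "\<And>k. P k (F k)" by metis
  interpret tree_sequence G \<phi> "\<lambda>k. verts (S k)" "\<lambda>k. arcs (S k)" \<alpha> F
  proof (intro tree_sequence.intro tree_sequence_axioms.intro epi_sequence.intro)
    fix k
    show "group (G k)" by (rule assms(1))
    show "\<phi> k \<in> hom (G k) (G (Suc k))" "\<phi> k ` carrier (G k) = carrier (G (Suc k))"
      using assms(5)[of k] unfolding action_epimorphism_def epi_def by blast+
    show "ctree_act (verts (S k)) (arcs (S k)) (G k) (\<alpha> k)" by (rule ctree_act_of_tree_action[OF assms(1,3)])
    show "verts (S k) \<noteq> {}" using assms(3)[of k] unfolding tree_action_def simplicial_tree_def by blast
    show "finitely_generated (G k)" by (rule assms(2))
    show "\<exists>g\<in>carrier (G k). \<alpha> k g v \<noteq> v" if "v \<in> verts (S k)" for v by (rule no_fixed_vertex[OF assms(1,3,4) that])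
    show "F k v \<in> verts (S (Suc k))" if "v \<in> verts (S k)" for v using F[of k] that unfolding P_def by blast
    show "F k (\<alpha> k g v) = \<alpha> (Suc k) (\<phi> k g) (F k v)" if "g \<in> carrier (G k)" "v \<in> verts (S k)" for g v
      using F[of k] that unfolding P_def by blast
    show "\<exists>g\<in>carrier (G k). \<phi> k g = h \<and> \<alpha> k g u = u \<and> \<alpha> k g v = v"
      if uv: "(u, v) \<in> arcs (S k)" and pq: "(p, q) \<in> arcs (S (Suc k))"
        and sep: "ctree.beyond (arcs (S (Suc k))) p q (F k u) \<noteq> ctree.beyond (arcs (S (Suc k))) p q (F k v)"
        and h: "h \<in> carrier (G (Suc k))" "\<alpha> (Suc k) h p = p" "\<alpha> (Suc k) h q = q" for u v p q h
    proof -
      have "closed_simplex {p, q} \<subseteq> f k ` closed_simplex {u, v}" using F[of k] uv pq sep unfolding P_def by blast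
      from assms(6)[OF _ _ this] have "edge_stabilizer (G (Suc k)) (\<alpha> (Suc k)) {p, q} = \<phi> k ` edge_stabilizer (G k) (\<alpha> k) {u, v}"
        using uv pq by (simp add: arcs_def)
      moreover have "h \<in> edge_stabilizer (G (Suc k)) (\<alpha> (Suc k)) {p, q}"
        using edge_stabilizer_pointwise[OF assms(1,3) pq] h by simp
      ultimately show ?thesis using edge_stabilizer_pointwise[OF assms(1,3) uv] by auto
    qed
  qed
  obtain k e where e: "e \<in> arcs (S k)" "case e of (u, v) \<Rightarrow> nontrivial_splitting_over (direct_limit G \<phi>)
     (limit_map G \<phi> k ` {g \<in> carrier (G k). \<alpha> k g u = u \<and> \<alpha> k g v = v})" using limit_splits by fast
  obtain u v where uv: "e = (u, v)" by (cases e)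
  have "nontrivial_splitting_over (direct_limit G \<phi>) (limit_map G \<phi> k ` edge_stabilizer (G k) (\<alpha> k) {u, v})"
    using e(2) edge_stabilizer_pointwise[OF assms(1,3), of u v k] e(1) by (simp add: uv)
  moreover have "{u, v} \<in> edges (S k)" using e(1) by (simp add: uv arcs_def)
  ultimately show ?thesis by blast
qed

end
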